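(* Assume $\mathcal{D}$ is local. Let $(K,\partial)$ be a $\mathcal{D}$-field with $K$ a large field. The following are equivalent: (1) $(K,\partial)\models\mathrm{UC}_{\mathcal{D}}$; (2) whenever $(V,s)$ is an affine, $K$-irreducible D-variety such that $V$ has a smooth $K$-rational point, the set of $K$-rational sharp points of $(V,s)$ is Zariski dense in $V$; (3) whenever $(V,s)$ is an affine, $K$-irreducible D-variety such that $V$ has a smooth $K$-rational point, $(V,s)$ has a $K$-rational sharp point; (4) whenever $(V,s)$ is a smooth, affine, $K$-irreducible D-variety such that $V$ has a $K$-rational point, $(V,s)$ has a $K$-rational sharp point; (5) whenever $(L,\delta)$ is a $\mathcal{D}$-field extension of $(K,\partial)$ such that $K$ is existentially closed in $L$ as a field, $(K,\partial)$ is existentially closed in $(L,\delta)$ as a $\mathcal{D}$-field.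
   Context: All fields have characteristic $0$. Fix a field $k$ of characteristic $0$ and a finite-dimensional local $k$-algebra $\mathcal{D}$ with $k$-basis $\varepsilon_0,\dots,\varepsilon_l$ and the residue map $\pi:\mathcal{D}\to k$, $\pi(\varepsilon_0)=1$, $\pi(\varepsilon_i)=0$ for $i\ge1$. A $\mathcal{D}$-ring is a $k$-algebra $R$ with a $k$-algebra homomorphism $\partial:R\to R\otimes_k\mathcal{D}$, $(\mathrm{id}_R\otimes\pi)\circ\partial=\mathrm{id}_R$; $\partial(r)=r\otimes\varepsilon_0+\sum_{i\ge1}\partial_i(r)\otimes\varepsilon_i$ defines operators $\partial_1,\dots,\partial_l$; language $\mathcal{L}_{\mathrm{ring}}(\partial)=\{+,-,\cdot,0,1,(c_a)_{a\in k},\partial_1,\dots,\partial_l\}$. A field $K$ is large if every $K$-irreducible variety with a smooth $K$-rational point has a Zariski dense set of $K$-rational points. Prolongation: for a $\mathcal{D}$-field $(K,\partial)$ and affine $X=\mathrm{Spec}\,K[x]/I$, $\tau X=\mathrm{Spec}\,K[x^0,\dots,x^l]/I'$ with $I'$ generated by all $f^{(j)}$, where for $f\in I$, $f^\partial$ is $f$ with $\partial$ applied to its coefficients and $f^\partial(\sum_jx^j\varepsilon_j)=\sum_jf^{(j)}(x^0,\dots,x^l)\varepsilon_j$; $\hat\pi:\tau X\to X$ is the projection to $x^0$; for a $\mathcal{D}$-field extension $(L,\delta)$, $\nabla:X(L)\to\tau X(L)$, $a\mapsto(a,\delta_1(a),\dots,\delta_l(a))$. $\mathrm{UC}_{\mathcal{D}}$: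 the theory of $\mathcal{D}$-fields $(K,\partial)$ such that whenever $X$ is a $K$-irreducible affine variety, $Y\subseteq\tau X$ is a $K$-irreducible affine variety with $\hat\pi(Y)$ Zariski dense in $X$ and $Y$ having a smooth $K$-rational point, every nonempty Zariski open $U\subseteq Y$ over $K$ contains $\nabla(a)$ for some $a\in X(K)$. A D-variety over $(K,\partial)$ is a pair $(V,s)$ with $V$ a $K$-variety and $s:V\to\tau V$ a morphism over $K$ with $\hat\pi\circ s=\mathrm{id}_V$; it is affine, $K$-irreducible, smooth if $V$ is. For a $\mathcal{D}$-field extension $(L,\delta)$, the $L$-rational sharp points are $\{a\in V(L):\nabla a=s(a)\}$. *)

theory Defs
  imports
    "HOL-Algebra.Algebraic_Closure_Type"
    "HOL-Library.Poly_Mapping"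
    "HOL-Library.Function_Algebras"
    "HOL-Analysis.Abstract_Topology"
begin

section \<open>Multivariate polynomials\<close>

type_synonym ('v, 'a) mpol = "('v \<Rightarrow>\<^sub>0 nat) \<Rightarrow>\<^sub>0 'a"

definition mconst :: "'a::zero \<Rightarrow> ('v, 'a) mpol" where
  "mconst c = Poly_Mapping.single 0 c"

definition mvar :: "'v \<Rightarrow> ('v, 'a::zero_neq_one) mpol" where
  "mvar v = Poly_Mapping.single (Poly_Mapping.single v 1) 1"

text \<open>Evaluation at \<open>x\<close>, the coefficients being transported by \<open>c\<close>. With \<open>c = mconst\<close> this is
  substitution of polynomials for the variables.\<close>

definition mp_eval :: "('a::zero \<Rightarrow> 'b::comm_ring_1) \<Rightarrow> ('v \<Rightarrow> 'b) \<Rightarrow> ('v, 'a) mpol \<Rightarrow> 'b" where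
  "mp_eval c x p = (\<Sum>m\<in>Poly_Mapping.keys p. c (Poly_Mapping.lookup p m) *
      (\<Prod>v\<in>Poly_Mapping.keys m. x v ^ Poly_Mapping.lookup m v))"

definition mp_deriv :: "'v \<Rightarrow> ('v, 'a::comm_ring_1) mpol \<Rightarrow> ('v, 'a) mpol" where
  "mp_deriv v p = (\<Sum>m\<in>Poly_Mapping.keys p.
      Poly_Mapping.single (m - Poly_Mapping.single v 1)
        (of_nat (Poly_Mapping.lookup m v) * Poly_Mapping.lookup p m))"

definition mpols :: "'v set \<Rightarrow> ('v, 'a::zero) mpol set" where
  "mpols N = {p. \<forall>m\<in>Poly_Mapping.keys p. Poly_Mapping.keys m \<subseteq> N}"

text \<open>The ring \<open>K[x\<^sub>v : v \<in> N]\<close>.\<close>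

definition mpol_ring :: "'v set \<Rightarrow> ('v, 'a::comm_ring_1) mpol ring" where
  "mpol_ring N = \<lparr>carrier = mpols N, monoid.mult = (*), one = 1, ring.zero = 0, add = (+)\<rparr>"

lemma mpols_0 [simp]: "0 \<in> mpols N"
  by (simp add: mpols_def)

lemma mpols_1 [simp]: "(1 :: ('v, 'a::comm_ring_1) mpol) \<in> mpols N"
  by (simp add: mpols_def)

lemma mpols_add: "p \<in> mpols N \<Longrightarrow> q \<in> mpols N \<Longrightarrow> p + q \<in> mpols N"
  using Poly_Mapping.keys_add[of p q] by (auto simp: mpols_def)

lemma mpols_uminus: "(p :: ('v, 'a::comm_ring_1) mpol) \<in> mpols N \<Longrightarrow> - p \<in> mpols N"
  by (auto simp: mpols_def in_keys_iff)

lemma mpols_mult: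
  fixes p q :: "('v, 'a::comm_ring_1) mpol"
  assumes "p \<in> mpols N" "q \<in> mpols N"
  shows "p * q \<in> mpols N"
proof -
  have "Poly_Mapping.keys m \<subseteq> N" if "m \<in> Poly_Mapping.keys (p * q)" for m
  proof -
    from that Poly_Mapping.keys_mult[of p q] obtain a b
      where "m = a + b" "a \<in> Poly_Mapping.keys p" "b \<in> Poly_Mapping.keys q"
      by blast
    with assms Poly_Mapping.keys_add[of a b] show ?thesis
      unfolding mpols_def by blast
  qed
  then show ?thesis by (auto simp: mpols_def)
qed

lemma cring_mpol_ring: "cring (mpol_ring N :: ('v, 'a::comm_ring_1) mpol ring)"
proof (rule cringI)
  show "abelian_group (mpol_ring N :: ('v, 'a) mpol ring)"
  proof (rule abelian_groupI)
    fix x :: "('v, 'a) mpol" assume "x \<in> carrier (mpol_ring N)"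
    then show "\<exists>y\<in>carrier (mpol_ring N). y \<oplus>\<^bsub>mpol_ring N\<^esub> x = \<zero>\<^bsub>mpol_ring N\<^esub>"
      by (intro bexI[of _ "- x"]) (auto simp: mpol_ring_def mpols_uminus)
  qed (auto simp: mpol_ring_def mpols_add algebra_simps)
  show "Group.comm_monoid (mpol_ring N :: ('v, 'a) mpol ring)"
    by (rule comm_monoidI) (auto simp: mpol_ring_def mpols_mult algebra_simps)
qed (auto simp: mpol_ring_def algebra_simps)


section \<open>Affine varieties\<close>

text \<open>A set \<open>N\<close> of variables and an ideal \<open>I\<close> of \<open>K[N]\<close> represent \<open>Spec K[N]/I\<close>, whose
  points are taken to be the primes of \<open>K[N]\<close> containing \<open>I\<close>.\<close>

definition zariski :: "'v set \<Rightarrow> ('v, 'a::comm_ring_1) mpol set \<Rightarrow> ('v, 'a) mpol set topology" where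
  "zariski N I = topology (\<lambda>U. \<exists>S \<subseteq> mpols N.
      U = {p. primeideal p (mpol_ring N) \<and> I \<subseteq> p \<and> \<not> S \<subseteq> p})"

lemma openin_zariski:
  fixes I :: "('v, 'a::comm_ring_1) mpol set"
  shows "openin (zariski N I) U \<longleftrightarrow>
    (\<exists>S \<subseteq> mpols N. U = {p. primeideal p (mpol_ring N) \<and> I \<subseteq> p \<and> \<not> S \<subseteq> p})"
proof -
  define D where "D S = {p. primeideal p (mpol_ring N) \<and> I \<subseteq> p \<and> \<not> S \<subseteq> p}" for S
  have "istopology (\<lambda>U. \<exists>S \<subseteq> mpols N. U = D S)"
    unfolding istopology_def
  proof (intro conjI allI impI)
    fix U V assume "\<exists>S\<subseteq>mpols N. U = D S" "\<exists>S\<subseteq>mpols N. V = D S"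
    then obtain S T where S: "S \<subseteq> mpols N" "U = D S" and T: "T \<subseteq> mpols N" "V = D T"
      by blast
    have "U \<inter> V = D {s * t | s t. s \<in> S \<and> t \<in> T}"
    proof (intro equalityI subsetI)
      fix p assume "p \<in> U \<inter> V"
      then obtain s t where st: "s \<in> S" "s \<notin> p" "t \<in> T" "t \<notin> p"
        and p: "primeideal p (mpol_ring N)" "I \<subseteq> p"
        using S T by (auto simp: D_def)
      with primeideal.I_prime[OF p(1), of s t] S(1) T(1) have "s * t \<notin> p"
        by (auto simp: mpol_ring_def)
      with st p show "p \<in> D {s * t | s t. s \<in> S \<and> t \<in> T}"
        by (auto simp: D_def)
    next
      fix p assume "p \<in> D {s * t | s t. s \<in> S \<and> t \<in> T}"
      then obtain s t where st: "s \<in> S" "t \<in> T" "s * t \<notin> p"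
        and p: "primeideal p (mpol_ring N)" "I \<subseteq> p"
        by (auto simp: D_def)
      have i: "ideal p (mpol_ring N)"
        using p(1) by (rule primeideal.axioms(1))
      from ideal.I_l_closed[OF i, of t s] ideal.I_r_closed[OF i, of s t] st S(1) T(1)
      have "s \<notin> p" "t \<notin> p"
        by (auto simp: mpol_ring_def)
      with st p show "p \<in> U \<inter> V"
        using S T by (auto simp: D_def)
    qed
    moreover have "{s * t | s t. s \<in> S \<and> t \<in> T} \<subseteq> mpols N"
      using S T by (auto intro: mpols_mult)
    ultimately show "\<exists>S\<subseteq>mpols N. U \<inter> V = D S"
      by blast
  next
    fix \<K> assume "\<forall>K\<in>\<K>. \<exists>S\<subseteq>mpols N. K = D S"
    then obtain f where f: "\<And>K. K \<in> \<K> \<Longrightarrow> f K \<subseteq> mpols N \<and> K = D (f K)"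
      by metis
    have "\<Union>\<K> = D (\<Union>K\<in>\<K>. f K)"
    proof (intro equalityI subsetI)
      fix p assume "p \<in> \<Union>\<K>"
      then obtain K where K: "K \<in> \<K>" "p \<in> K" by blast
      then have "p \<in> D (f K)" using f by blast
      with K(1) show "p \<in> D (\<Union>K\<in>\<K>. f K)"
        by (auto simp: D_def)
    next
      fix p assume "p \<in> D (\<Union>K\<in>\<K>. f K)"
      then obtain K where "K \<in> \<K>" "p \<in> D (f K)"
        by (auto simp: D_def)
      then show "p \<in> \<Union>\<K>" using f by blast
    qed
    moreover have "(\<Union>K\<in>\<K>. f K) \<subseteq> mpols N"
      using f by blast
    ultimately show "\<exists>S\<subseteq>mpols N. \<Union>\<K> = D S"
      by blast
  qed
  then show ?thesis
    by (simp add: zariski_def topology_inverse' D_def)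
qed

definition irreducible_space :: "'a topology \<Rightarrow> bool" where
  "irreducible_space T \<longleftrightarrow> topspace T \<noteq> {} \<and>
     (\<forall>A B. closedin T A \<and> closedin T B \<and> A \<union> B = topspace T \<longrightarrow>
        A = topspace T \<or> B = topspace T)"

text \<open>Varieties are reduced, hence the radicality condition.\<close>

definition affine_variety :: "'v set \<Rightarrow> ('v, 'a::field) mpol set \<Rightarrow> bool" where
  "affine_variety N I \<longleftrightarrow> finite N \<and> ideal I (mpol_ring N) \<and>
     (\<forall>f\<in>mpols N. \<forall>r::nat. f ^ r \<in> I \<longrightarrow> f \<in> I)"

definition irreducible_variety :: "'v set \<Rightarrow> ('v, 'a::field) mpol set \<Rightarrow> bool" where
  "irreducible_variety N I \<longleftrightarrow> affine_variety N I \<and> irreducible_space (zariski N I)"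

text \<open>The points with coordinates in an extension \<open>c : K \<rightarrow> F\<close>; \<open>c = id\<close> gives \<open>X(K)\<close> and
  \<open>c = to_ac\<close> gives the points over the algebraic closure.\<close>

definition points :: "('a::field \<Rightarrow> 'b::field) \<Rightarrow> 'v set \<Rightarrow> ('v, 'a) mpol set \<Rightarrow> ('v \<Rightarrow> 'b) set" where
  "points c N I = {x \<in> N \<rightarrow>\<^sub>E UNIV. \<forall>f\<in>I. mp_eval c x f = 0}"

definition rational_points :: "'v set \<Rightarrow> ('v, 'a::field) mpol set \<Rightarrow> ('v \<Rightarrow> 'a) set" where
  "rational_points N I = points id N I"

definition point_ideal :: "'v set \<Rightarrow> ('v \<Rightarrow> 'a::field) \<Rightarrow> ('v, 'a) mpol set" where
  "point_ideal N x = {f \<in> mpols N. mp_eval id x f = 0}"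

definition zariski_dense_in ::
    "'v set \<Rightarrow> ('v, 'a::field) mpol set \<Rightarrow> ('v, 'a) mpol set set \<Rightarrow> bool" where
  "zariski_dense_in N I P \<longleftrightarrow> zariski N I closure_of P = topspace (zariski N I)"

text \<open>The dimension of an irreducible variety is the transcendence degree over \<open>K\<close> of its
  coordinate ring.\<close>

definition alg_independent_mod ::
    "('v, 'a::field) mpol set \<Rightarrow> nat \<Rightarrow> (nat \<Rightarrow> ('v, 'a) mpol) \<Rightarrow> bool" where
  "alg_independent_mod I d g \<longleftrightarrow> (\<forall>F\<in>mpols {..<d}. F \<noteq> 0 \<longrightarrow> mp_eval mconst g F \<notin> I)"

definition variety_dim :: "'v set \<Rightarrow> ('v, 'a::field) mpol set \<Rightarrow> nat" where
  "variety_dim N I = Max {d. \<exists>g. g ` {..<d} \<subseteq> mpols N \<and> alg_independent_mod I d g}"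

text \<open>Smoothness of an irreducible variety at a point: the Jacobian matrix of (the equations in)
  \<open>I\<close> has rank \<open>card N - dim\<close>.\<close>

definition smooth_at ::
    "('a::field \<Rightarrow> 'b::field) \<Rightarrow> 'v set \<Rightarrow> ('v, 'a) mpol set \<Rightarrow> ('v \<Rightarrow> 'b) \<Rightarrow> bool" where
  "smooth_at c N I x \<longleftrightarrow>
     vector_space.dim (\<lambda>(a::'b) (u :: 'v \<Rightarrow> 'b). (\<lambda>v. a * u v))
       ((\<lambda>f v. mp_eval c x (mp_deriv v f)) ` I) + variety_dim N I = card N"

definition has_smooth_rational_point :: "'v set \<Rightarrow> ('v, 'a::field) mpol set \<Rightarrow> bool" where
  "has_smooth_rational_point N I \<longleftrightarrow> (\<exists>x\<in>rational_points N I. smooth_at id N I x)"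

definition smooth_variety :: "'v set \<Rightarrow> ('v, 'a::field) mpol set \<Rightarrow> bool" where
  "smooth_variety N I \<longleftrightarrow> (\<forall>x\<in>points to_ac N I. smooth_at to_ac N I x)"

text \<open>Affine varieties suffice here: a smooth rational point of an arbitrary irreducible variety
  has an affine open neighbourhood, which is dense.\<close>

definition large_field :: "'a::field itself \<Rightarrow> bool" where
  "large_field _ \<longleftrightarrow> (\<forall>n (I :: (nat, 'a) mpol set).
     irreducible_variety {..<n} I \<and> has_smooth_rational_point {..<n} I \<longrightarrow>
     zariski_dense_in {..<n} I (point_ideal {..<n} ` rational_points {..<n} I))"


section \<open>The algebra \<open>\<D>\<close> and \<open>\<D>\<close>-rings\<close>

record ('k, 'd) based_algebra =
  smul :: "'k \<Rightarrow> 'd \<Rightarrow> 'd"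
  eps :: "nat \<Rightarrow> 'd"
  len :: nat
  resid :: "'d \<Rightarrow> 'k"

definition finite_local_algebra :: "('k::field_char_0, 'd::comm_ring_1) based_algebra \<Rightarrow> bool" where
  "finite_local_algebra \<D> \<longleftrightarrow>
     vector_space (smul \<D>) \<and>
     (\<forall>a x y. smul \<D> a (x * y) = smul \<D> a x * y) \<and>
     inj_on (eps \<D>) {..len \<D>} \<and>
     \<not> Modules.module.dependent (smul \<D>) (eps \<D> ` {..len \<D>}) \<and>
     Modules.module.span (smul \<D>) (eps \<D> ` {..len \<D>}) = UNIV \<and>
     (\<exists>!M. maximalideal M (ring_of_type_algebra :: 'd ring)) \<and>
     resid \<D> \<in> ring_hom ring_of_type_algebra ring_of_type_algebra \<and>
     (\<forall>a x. resid \<D> (smul \<D> a x) = a * resid \<D> x) \<and>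
     resid \<D> (eps \<D> 0) = 1 \<and>
     (\<forall>i\<in>{1..len \<D>}. resid \<D> (eps \<D> i) = 0)"

definition coord :: "('k::field, 'd::comm_ring_1) based_algebra \<Rightarrow> 'd \<Rightarrow> nat \<Rightarrow> 'k" where
  "coord \<D> x m = Modules.module.representation (smul \<D>) (eps \<D> ` {..len \<D>}) x (eps \<D> m)"

text \<open>\<open>R \<otimes>\<^sub>k \<D>\<close> for a \<open>k\<close>-algebra \<open>R\<close> with structure map \<open>\<iota>\<close>: the function \<open>u\<close> stands for
  \<open>\<Sum>\<^sub>j u j \<otimes> \<epsilon>\<^sub>j\<close>.\<close>

definition base_change ::
    "('k::field, 'd::comm_ring_1) based_algebra \<Rightarrow> 'r ring \<Rightarrow> ('k \<Rightarrow> 'r) \<Rightarrow> (nat \<Rightarrow> 'r) ring" where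
  "base_change \<D> R \<iota> = \<lparr>
     carrier = {..len \<D>} \<rightarrow>\<^sub>E carrier R,
     monoid.mult = (\<lambda>u v. \<lambda>m\<in>{..len \<D>}. \<Oplus>\<^bsub>R\<^esub>i\<in>{..len \<D>}. \<Oplus>\<^bsub>R\<^esub>j\<in>{..len \<D>}.
        \<iota> (coord \<D> (eps \<D> i * eps \<D> j) m) \<otimes>\<^bsub>R\<^esub> (u i \<otimes>\<^bsub>R\<^esub> v j)),
     one = (\<lambda>m\<in>{..len \<D>}. \<iota> (coord \<D> 1 m)),
     ring.zero = (\<lambda>m\<in>{..len \<D>}. \<zero>\<^bsub>R\<^esub>),
     add = (\<lambda>u v. \<lambda>m\<in>{..len \<D>}. u m \<oplus>\<^bsub>R\<^esub> v m)\<rparr>"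

text \<open>\<open>\<Delta> r j\<close> is \<open>\<partial>\<^sub>j(r)\<close>, the coefficient of \<open>\<epsilon>\<^sub>j\<close> in \<open>\<partial>(r)\<close>. The last condition is
  \<open>(id \<otimes> \<pi>) \<circ> \<partial> = id\<close>, that is, \<open>\<partial>\<^sub>0 = id\<close>.\<close>

definition D_ring ::
    "('k::field, 'd::comm_ring_1) based_algebra \<Rightarrow> 'r ring \<Rightarrow> ('k \<Rightarrow> 'r) \<Rightarrow> ('r \<Rightarrow> nat \<Rightarrow> 'r) \<Rightarrow> bool" where
  "D_ring \<D> R \<iota> \<Delta> \<longleftrightarrow>
     cring R \<and>
     \<iota> \<in> ring_hom ring_of_type_algebra R \<and>
     \<Delta> \<in> ring_hom R (base_change \<D> R \<iota>) \<and>
     (\<forall>a. \<forall>r\<in>carrier R. \<Delta> (\<iota> a \<otimes>\<^bsub>R\<^esub> r) = (\<lambda>j\<in>{..len \<D>}. \<iota> a \<otimes>\<^bsub>R\<^esub> \<Delta> r j)) \<and>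
     (\<forall>r\<in>carrier R. (\<Oplus>\<^bsub>R\<^esub>j\<in>{..len \<D>}. \<Delta> r j \<otimes>\<^bsub>R\<^esub> \<iota> (resid \<D> (eps \<D> j))) = r)"

definition D_field ::
    "('k::field, 'd::comm_ring_1) based_algebra \<Rightarrow> 'r ring \<Rightarrow> ('k \<Rightarrow> 'r) \<Rightarrow> ('r \<Rightarrow> nat \<Rightarrow> 'r) \<Rightarrow> bool" where
  "D_field \<D> R \<iota> \<Delta> \<longleftrightarrow> field R \<and> D_ring \<D> R \<iota> \<Delta>"

definition D_field_extension ::
    "('k::field, 'd::comm_ring_1) based_algebra \<Rightarrow> 'r ring \<Rightarrow> ('k \<Rightarrow> 'r) \<Rightarrow> ('r \<Rightarrow> nat \<Rightarrow> 'r)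
      \<Rightarrow> 's ring \<Rightarrow> ('s \<Rightarrow> nat \<Rightarrow> 's) \<Rightarrow> ('r \<Rightarrow> 's) \<Rightarrow> bool" where
  "D_field_extension \<D> R \<iota> \<Delta> S \<delta> e \<longleftrightarrow>
     D_field \<D> R \<iota> \<Delta> \<and> D_field \<D> S (e \<circ> \<iota>) \<delta> \<and> e \<in> ring_hom R S \<and>
     (\<forall>r\<in>carrier R. \<forall>j\<in>{..len \<D>}. \<delta> (e r) j = e (\<Delta> r j))"


section \<open>Prolongations, \<open>UC\<^sub>\<D>\<close> and D-varieties\<close>

text \<open>The variable \<open>(j, i)\<close> is the coordinate \<open>x\<^sup>j\<^sub>i\<close> on the prolongation.\<close>

definition prol_vars :: "('k, 'd) based_algebra \<Rightarrow> nat \<Rightarrow> (nat \<times> nat) set" where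
  "prol_vars \<D> n = {..len \<D>} \<times> {..<n}"

text \<open>\<open>f\<^sup>\<partial>(\<Sum>\<^sub>j x\<^sup>j \<epsilon>\<^sub>j)\<close>, computed in \<open>K[x\<^sup>0,\<dots>,x\<^sup>l] \<otimes>\<^sub>k \<D>\<close>; its coefficient at \<open>j\<close> is \<open>f\<^sup>(\<^sup>j\<^sup>)\<close>.\<close>

definition prol_poly ::
    "('k::field, 'd::comm_ring_1) based_algebra \<Rightarrow> ('k \<Rightarrow> 'a::field) \<Rightarrow> ('a \<Rightarrow> nat \<Rightarrow> 'a) \<Rightarrow> nat
      \<Rightarrow> (nat, 'a) mpol \<Rightarrow> nat \<Rightarrow> (nat \<times> nat, 'a) mpol" where
  "prol_poly \<D> \<iota> \<Delta> n f =
     (let T = base_change \<D> (mpol_ring (prol_vars \<D> n)) (mconst \<circ> \<iota>) in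
      \<Oplus>\<^bsub>T\<^esub>m\<in>Poly_Mapping.keys f.
        (\<lambda>j\<in>{..len \<D>}. mconst (\<Delta> (Poly_Mapping.lookup f m) j)) \<otimes>\<^bsub>T\<^esub>
        (\<Otimes>\<^bsub>T\<^esub>i\<in>Poly_Mapping.keys m. (\<lambda>j\<in>{..len \<D>}. mvar (j, i)) [^]\<^bsub>T\<^esub> Poly_Mapping.lookup m i))"

definition prol_ideal ::
    "('k::field, 'd::comm_ring_1) based_algebra \<Rightarrow> ('k \<Rightarrow> 'a::field) \<Rightarrow> ('a \<Rightarrow> nat \<Rightarrow> 'a) \<Rightarrow> nat
      \<Rightarrow> (nat, 'a) mpol set \<Rightarrow> (nat \<times> nat, 'a) mpol set" where
  "prol_ideal \<D> \<iota> \<Delta> n I =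
     Idl\<^bsub>mpol_ring (prol_vars \<D> n)\<^esub> {prol_poly \<D> \<iota> \<Delta> n f j | f j. f \<in> I \<and> j \<in> {..len \<D>}}"

text \<open>\<open>\<pi>\<close>-hat on points: contraction of primes along \<open>x\<^sub>i \<mapsto> x\<^sup>0\<^sub>i\<close>.\<close>

definition prol_proj :: "nat \<Rightarrow> (nat \<times> nat, 'a::field) mpol set \<Rightarrow> (nat, 'a) mpol set" where
  "prol_proj n p = {f \<in> mpols {..<n}. mp_eval mconst (\<lambda>i. mvar (0, i)) f \<in> p}"

definition nabla ::
    "('k, 'd) based_algebra \<Rightarrow> ('a \<Rightarrow> nat \<Rightarrow> 'a) \<Rightarrow> nat \<Rightarrow> (nat \<Rightarrow> 'a) \<Rightarrow> nat \<times> nat \<Rightarrow> 'a" where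
  "nabla \<D> \<Delta> n a = (\<lambda>(j, i)\<in>prol_vars \<D> n. if j = 0 then a i else \<Delta> (a i) j)"

definition UC ::
    "('k::field, 'd::comm_ring_1) based_algebra \<Rightarrow> ('k \<Rightarrow> 'a::field) \<Rightarrow> ('a \<Rightarrow> nat \<Rightarrow> 'a) \<Rightarrow> bool" where
  "UC \<D> \<iota> \<Delta> \<longleftrightarrow> D_field \<D> ring_of_type_algebra \<iota> \<Delta> \<and>
     (\<forall>n I J.
        irreducible_variety {..<n} I \<and>
        irreducible_variety (prol_vars \<D> n) J \<and>
        prol_ideal \<D> \<iota> \<Delta> n I \<subseteq> J \<and>
        zariski_dense_in {..<n} I (prol_proj n ` topspace (zariski (prol_vars \<D> n) J)) \<and>
        has_smooth_rational_point (prol_vars \<D> n) J \<longrightarrow>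
        (\<forall>U. openin (zariski (prol_vars \<D> n) J) U \<and> U \<noteq> {} \<longrightarrow>
           (\<exists>a\<in>rational_points {..<n} I. point_ideal (prol_vars \<D> n) (nabla \<D> \<Delta> n a) \<in> U)))"

text \<open>A morphism \<open>s : V \<rightarrow> \<tau>V\<close> is given by polynomials \<open>s (j, i)\<close>, the images of the coordinates
  \<open>x\<^sup>j\<^sub>i\<close> under the comorphism; the last condition says that it is a section of the projection.\<close>

definition affine_D_variety ::
    "('k::field, 'd::comm_ring_1) based_algebra \<Rightarrow> ('k \<Rightarrow> 'a::field) \<Rightarrow> ('a \<Rightarrow> nat \<Rightarrow> 'a) \<Rightarrow> nat
      \<Rightarrow> (nat, 'a) mpol set \<Rightarrow> (nat \<times> nat \<Rightarrow> (nat, 'a) mpol) \<Rightarrow> bool" where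
  "affine_D_variety \<D> \<iota> \<Delta> n I s \<longleftrightarrow>
     affine_variety {..<n} I \<and>
     s ` prol_vars \<D> n \<subseteq> mpols {..<n} \<and>
     (\<forall>g\<in>prol_ideal \<D> \<iota> \<Delta> n I. mp_eval mconst s g \<in> I) \<and>
     (\<forall>i<n. s (0, i) - mvar i \<in> I)"

definition irreducible_D_variety ::
    "('k::field, 'd::comm_ring_1) based_algebra \<Rightarrow> ('k \<Rightarrow> 'a::field) \<Rightarrow> ('a \<Rightarrow> nat \<Rightarrow> 'a) \<Rightarrow> nat
      \<Rightarrow> (nat, 'a) mpol set \<Rightarrow> (nat \<times> nat \<Rightarrow> (nat, 'a) mpol) \<Rightarrow> bool" where
  "irreducible_D_variety \<D> \<iota> \<Delta> n I s \<longleftrightarrow>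
     affine_D_variety \<D> \<iota> \<Delta> n I s \<and> irreducible_variety {..<n} I"

definition sharp_points ::
    "('k, 'd) based_algebra \<Rightarrow> ('a::field \<Rightarrow> nat \<Rightarrow> 'a) \<Rightarrow> nat
      \<Rightarrow> (nat, 'a) mpol set \<Rightarrow> (nat \<times> nat \<Rightarrow> (nat, 'a) mpol) \<Rightarrow> (nat \<Rightarrow> 'a) set" where
  "sharp_points \<D> \<Delta> n I s =
     {a \<in> rational_points {..<n} I. nabla \<D> \<Delta> n a = (\<lambda>v\<in>prol_vars \<D> n. mp_eval id a (s v))}"


section \<open>Existential closedness\<close>

text \<open>Terms and quantifier-free formulas in the ring operations, constants \<open>c\<^sub>a\<close> and unary
  operators.\<close>

datatype ('k, 'o) rterm =
    TVar nat
  | TZero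
  | TOne
  | TConst 'k
  | TPlus "('k, 'o) rterm" "('k, 'o) rterm"
  | TMinus "('k, 'o) rterm" "('k, 'o) rterm"
  | TTimes "('k, 'o) rterm" "('k, 'o) rterm"
  | TOp 'o "('k, 'o) rterm"

datatype (qf_consts: 'k, qf_ops: 'o) qf_formula =
    QEq "('k, 'o) rterm" "('k, 'o) rterm"
  | QNot "('k, 'o) qf_formula"
  | QAnd "('k, 'o) qf_formula" "('k, 'o) qf_formula"

primrec term_val ::
    "'r ring \<Rightarrow> ('k \<Rightarrow> 'r) \<Rightarrow> ('o \<Rightarrow> 'r \<Rightarrow> 'r) \<Rightarrow> (nat \<Rightarrow> 'r) \<Rightarrow> ('k, 'o) rterm \<Rightarrow> 'r" where
  "term_val R \<iota> F \<rho> (TVar v) = \<rho> v"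
| "term_val R \<iota> F \<rho> TZero = \<zero>\<^bsub>R\<^esub>"
| "term_val R \<iota> F \<rho> TOne = \<one>\<^bsub>R\<^esub>"
| "term_val R \<iota> F \<rho> (TConst a) = \<iota> a"
| "term_val R \<iota> F \<rho> (TPlus s t) = term_val R \<iota> F \<rho> s \<oplus>\<^bsub>R\<^esub> term_val R \<iota> F \<rho> t"
| "term_val R \<iota> F \<rho> (TMinus s t) = term_val R \<iota> F \<rho> s \<ominus>\<^bsub>R\<^esub> term_val R \<iota> F \<rho> t"
| "term_val R \<iota> F \<rho> (TTimes s t) = term_val R \<iota> F \<rho> s \<otimes>\<^bsub>R\<^esub> term_val R \<iota> F \<rho> t"
| "term_val R \<iota> F \<rho> (TOp f t) = F f (term_val R \<iota> F \<rho> t)"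

primrec qf_sat ::
    "'r ring \<Rightarrow> ('k \<Rightarrow> 'r) \<Rightarrow> ('o \<Rightarrow> 'r \<Rightarrow> 'r) \<Rightarrow> (nat \<Rightarrow> 'r) \<Rightarrow> ('k, 'o) qf_formula \<Rightarrow> bool" where
  "qf_sat R \<iota> F \<rho> (QEq s t) \<longleftrightarrow> term_val R \<iota> F \<rho> s = term_val R \<iota> F \<rho> t"
| "qf_sat R \<iota> F \<rho> (QNot \<phi>) \<longleftrightarrow> \<not> qf_sat R \<iota> F \<rho> \<phi>"
| "qf_sat R \<iota> F \<rho> (QAnd \<phi> \<psi>) \<longleftrightarrow> qf_sat R \<iota> F \<rho> \<phi> \<and> qf_sat R \<iota> F \<rho> \<psi>"

text \<open>\<open>R\<close> is existentially closed in \<open>S\<close> along \<open>e\<close>, for the language with constants in \<open>A\<close> and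
  operators in \<open>Q\<close>: an existential formula \<open>\<exists>(x\<^sub>v)\<^bsub>v\<in>V\<^esub>. \<phi>\<close>, with parameters from \<open>R\<close> (the values
  \<open>\<rho> v\<close>, \<open>v \<notin> V\<close>), that holds in \<open>S\<close> holds in \<open>R\<close>.\<close>

definition ex_closed ::
    "'k set \<Rightarrow> 'o set \<Rightarrow> 'r ring \<Rightarrow> ('k \<Rightarrow> 'r) \<Rightarrow> ('o \<Rightarrow> 'r \<Rightarrow> 'r)
      \<Rightarrow> 's ring \<Rightarrow> ('k \<Rightarrow> 's) \<Rightarrow> ('o \<Rightarrow> 's \<Rightarrow> 's) \<Rightarrow> ('r \<Rightarrow> 's) \<Rightarrow> bool" where
  "ex_closed A Q R \<iota> F S \<kappa> G e \<longleftrightarrow>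
     (\<forall>\<phi> V \<rho>. qf_consts \<phi> \<subseteq> A \<and> qf_ops \<phi> \<subseteq> Q \<and> finite V \<and> range \<rho> \<subseteq> carrier R \<and>
        (\<exists>\<sigma>. range \<sigma> \<subseteq> carrier S \<and> (\<forall>v. v \<notin> V \<longrightarrow> \<sigma> v = e (\<rho> v)) \<and> qf_sat S \<kappa> G \<sigma> \<phi>) \<longrightarrow>
        (\<exists>\<tau>. range \<tau> \<subseteq> carrier R \<and> (\<forall>v. v \<notin> V \<longrightarrow> \<tau> v = \<rho> v) \<and> qf_sat R \<iota> F \<tau> \<phi>))"

text \<open>The language of rings has no constants \<open>c\<^sub>a\<close> and no operators, so that their
  interpretations are irrelevant.\<close>

definition ex_closed_field :: "'r ring \<Rightarrow> 's ring \<Rightarrow> ('r \<Rightarrow> 's) \<Rightarrow> bool" where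
  "ex_closed_field R S e \<longleftrightarrow>
     ex_closed ({} :: unit set) ({} :: unit set) R (\<lambda>_. \<zero>\<^bsub>R\<^esub>) (\<lambda>_ r. r) S (\<lambda>_. \<zero>\<^bsub>S\<^esub>) (\<lambda>_ r. r) e"

definition ex_closed_D_field ::
    "('k, 'd) based_algebra \<Rightarrow> 'r ring \<Rightarrow> ('k \<Rightarrow> 'r) \<Rightarrow> ('r \<Rightarrow> nat \<Rightarrow> 'r)
      \<Rightarrow> 's ring \<Rightarrow> ('s \<Rightarrow> nat \<Rightarrow> 's) \<Rightarrow> ('r \<Rightarrow> 's) \<Rightarrow> bool" where
  "ex_closed_D_field \<D> R \<iota> \<Delta> S \<delta> e \<longleftrightarrow>
     ex_closed UNIV {1..len \<D>} R \<iota> (\<lambda>j r. \<Delta> r j) S (e \<circ> \<iota>) (\<lambda>j r. \<delta> r j) e"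

end

theory Submission
  imports
    Defs
    "HOL-Algebra.Weak_Morphisms"
    "HOL-Computational_Algebra.Polynomial"
    "HOL-Computational_Algebra.Fraction_Field"
begin

text \<open>Every prime of \<open>K[x]\<close> has a triangular presentation: after inverting one polynomial \<open>h\<close> it is
  generated by polynomials \<open>P\<^sub>v\<close>, each separable in its own variable \<open>v\<close>. Points with \<open>h \<noteq> 0\<close> and
  \<open>P\<^sub>v = 0\<close> are therefore smooth, and being such a point is a quantifier-free condition.

  (4) implies (1): a generic point of \<open>Y \<subseteq> \<tau>X\<close> is a homomorphism from \<open>K[X]\<close> to \<open>K[Y] \<otimes> \<D>\<close>. Since the
  kernel of the residue map is nilpotent, Hensel's lemma, applied to the \<open>P\<^sub>v\<close> one after the other,
  extends it to a \<open>\<D>\<close>-structure on \<open>K[Y][1/h]\<close>, which is thus a smooth D-variety; it has a rational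
  point because \<open>K\<close> is large, and a sharp point of it gives \<open>\<nabla>(a) \<in> U\<close>. (1) implies (2): apply \<open>UC\<^sub>\<D>\<close>
  to the graph of \<open>s\<close>. (3) implies (4), because Jacobian ranks do not change under field extension.
  (1) implies (5): apply \<open>UC\<^sub>\<D>\<close> to the loci over \<open>K\<close> of the tuple of values of all subterms of the given
  formula and of its image under \<open>\<nabla>\<close>. (5) implies (3): the section \<open>s\<close> makes \<open>K(V)\<close> a \<open>\<D>\<close>-field whose
  generic point is sharp, and largeness makes \<open>K\<close> existentially closed in \<open>K(V)\<close>; as \<open>K(V)\<close> has the
  cardinality of \<open>K\<close>, it can be moved into the type \<open>'a + 'l\<close> over which (5) quantifies.\<close>

section \<open>Polynomials\<close>

text \<open>A smooth rational point is never turned into equations here. Smoothness is transported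
  along changes of generators, serves as the hypothesis under which largeness or \<open>UC\<close>
  acts, and is concluded at points where a triangular presentation has \<open>h\<close> nonzero. The
  smooth point given on Y may well have \<open>h\<close> = 0; largeness provides another one with
  \<open>h\<close> nonzero, and adjoining 1/h as a coordinate makes the variety smooth everywhere.
  Hensel's lemma leaves the given data alone because of the order of the variables: the coordinates
  of X come first with lifts prescribed by the point of the prolongation, and only later coordinates
  are corrected. Characteristic 0 makes each \<open>P v\<close> separable. The Jacobian rank is the
  number of the \<open>P v\<close>. That the dimension, defined by algebraically independent
  polynomials, is the complementary number rests on invariance of the codimension under change of
  generators, applied at generic points. A generic point in a universal domain also turns coordinate
  rings, their localisations and function fields into subrings of one field, so that no quotient
  ring has to be formed.\<close>

lemma ring_of_type_sel [simp]:
  "carrier (ring_of_type_algebra :: 'a::ring_1 ring) = UNIV"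
  "x \<otimes>\<^bsub>ring_of_type_algebra\<^esub> y = (x * y :: 'a)"
  "x \<oplus>\<^bsub>ring_of_type_algebra\<^esub> y = (x + y :: 'a)"
  "\<one>\<^bsub>ring_of_type_algebra\<^esub> = (1 :: 'a)"
  "\<zero>\<^bsub>ring_of_type_algebra\<^esub> = (0 :: 'a)"
  by (simp_all add: ring_of_type_algebra_def)

lemma mpol_ring_sel [simp]:
  "carrier (mpol_ring N :: ('v, 'a::comm_ring_1) mpol ring) = mpols N"
  "f \<otimes>\<^bsub>mpol_ring N\<^esub> g = (f * g :: ('v, 'a) mpol)"
  "f \<oplus>\<^bsub>mpol_ring N\<^esub> g = (f + g :: ('v, 'a) mpol)"
  "\<one>\<^bsub>mpol_ring N\<^esub> = (1 :: ('v, 'a) mpol)"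
  "\<zero>\<^bsub>mpol_ring N\<^esub> = (0 :: ('v, 'a) mpol)"
  by (simp_all add: mpol_ring_def)

lemma mpols_UNIV [simp]: "mpols UNIV = UNIV"
  by (simp add: mpols_def)

lemma mpols_mono: "A \<subseteq> B \<Longrightarrow> mpols A \<subseteq> mpols B"
  by (auto simp: mpols_def)

lemma mpols_minus: "(p :: ('v, 'a::comm_ring_1) mpol) \<in> mpols N \<Longrightarrow> q \<in> mpols N \<Longrightarrow> p - q \<in> mpols N"
  using mpols_add[of p N "- q"] mpols_uminus[of q N] by simp

lemma mpols_single: "Poly_Mapping.keys m \<subseteq> N \<Longrightarrow> Poly_Mapping.single m c \<in> mpols N"
  by (simp add: mpols_def)

lemma mpols_const [simp]: "mconst c \<in> mpols N"
  by (simp add: mconst_def mpols_single)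

lemma mpols_var: "v \<in> N \<Longrightarrow> mvar v \<in> mpols N"
  by (simp add: mvar_def mpols_single)

lemma mpols_sum: "(\<And>i. i \<in> A \<Longrightarrow> f i \<in> mpols N) \<Longrightarrow> (\<Sum>i\<in>A. f i) \<in> mpols N"
  by (induction A rule: infinite_finite_induct) (auto intro: mpols_add)

lemma mpols_prod:
  "(\<And>i. i \<in> A \<Longrightarrow> f i \<in> mpols N) \<Longrightarrow> (\<Prod>i\<in>A. f i) \<in> (mpols N :: ('v, 'a::comm_ring_1) mpol set)"
  by (induction A rule: infinite_finite_induct) (auto intro: mpols_mult)

lemma mpols_power: "f \<in> mpols N \<Longrightarrow> f ^ k \<in> (mpols N :: ('v, 'a::comm_ring_1) mpol set)"
  by (induction k) (auto intro: mpols_mult)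

lemma mconst_simps [simp]:
  "mconst 0 = 0" "mconst 1 = (1 :: ('v, 'a::comm_ring_1) mpol)"
  "mconst (a + b) = (mconst a + mconst b :: ('v, 'a) mpol)"
  "mconst (a * b) = (mconst a * mconst b :: ('v, 'a) mpol)"
  "mconst (- a) = (- mconst a :: ('v, 'a) mpol)"
  by (simp_all add: mconst_def single_add mult_single single_uminus)

lemma mconst_hom [simp]: "mconst \<in> ring_hom ring_of_type_algebra (mpol_ring N)"
  by (simp add: ring_hom_def)

lemma mconst_of_nat: "mconst (of_nat n) = (of_nat n :: ('v, 'a::comm_ring_1) mpol)"
  by (induction n) auto

lemma poly_mapping_sum_singles:
  "f = (\<Sum>m\<in>Poly_Mapping.keys f. Poly_Mapping.single m (Poly_Mapping.lookup f m))"
proof (rule poly_mapping_eqI)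
  fix k
  have "(\<Sum>x\<in>Poly_Mapping.keys f. Poly_Mapping.lookup f x when x = k) = Poly_Mapping.lookup f k"
  proof (cases "k \<in> Poly_Mapping.keys f")
    case True
    then show ?thesis
      by (subst sum.remove[of _ k]) (auto simp: when_def intro!: sum.neutral)
  qed (auto simp: when_def in_keys_iff intro!: sum.neutral)
  then show "Poly_Mapping.lookup f k =
    Poly_Mapping.lookup (\<Sum>m\<in>Poly_Mapping.keys f. Poly_Mapping.single m (Poly_Mapping.lookup f m)) k"
    by (simp add: lookup_sum lookup_single)
qed

lemma mvar_power:
  "mvar v ^ e = (Poly_Mapping.single (Poly_Mapping.single v e) 1 :: ('v, 'a::comm_ring_1) mpol)"
  by (induction e) (auto simp: mvar_def mult_single simp flip: single_add)

lemma single_eq_prod: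
  "(Poly_Mapping.single m c :: ('v, 'a::comm_ring_1) mpol) =
     mconst c * (\<Prod>v\<in>Poly_Mapping.keys m. mvar v ^ Poly_Mapping.lookup m v)"
proof -
  have "finite A \<Longrightarrow> (\<Prod>v\<in>A. mvar v ^ Poly_Mapping.lookup m v) =
    (Poly_Mapping.single (\<Sum>v\<in>A. Poly_Mapping.single v (Poly_Mapping.lookup m v)) 1 :: ('v, 'a) mpol)" for A
    by (induction A rule: finite_induct) (auto simp: mvar_power mult_single)
  then show ?thesis
    using poly_mapping_sum_singles[of m] by (simp add: mconst_def mult_single)
qed

lemma mpol_induct_single [consumes 1, case_names zero single add]:
  fixes f :: "('v, 'a::comm_ring_1) mpol"
  assumes "f \<in> mpols N"
    and "P 0"
    and "\<And>m c. Poly_Mapping.keys m \<subseteq> N \<Longrightarrow> P (Poly_Mapping.single m c)"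
    and "\<And>f g. f \<in> mpols N \<Longrightarrow> g \<in> mpols N \<Longrightarrow> P f \<Longrightarrow> P g \<Longrightarrow> P (f + g)"
  shows "P f"
proof -
  have "A \<subseteq> Poly_Mapping.keys f \<Longrightarrow> (\<Sum>m\<in>A. Poly_Mapping.single m (Poly_Mapping.lookup f m)) \<in> mpols N \<and>
      P (\<Sum>m\<in>A. Poly_Mapping.single m (Poly_Mapping.lookup f m))" if "finite A" for A
    using that
  proof (induction A rule: finite_induct)
    case (insert m A)
    then have "Poly_Mapping.keys m \<subseteq> N"
      using assms(1) by (auto simp: mpols_def)
    with insert assms(3) show ?case
      by (auto intro!: assms(4) mpols_single mpols_add)
  qed (use assms in auto)
  from this[of "Poly_Mapping.keys f"] show ?thesis
    using poly_mapping_sum_singles[of f] by simp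
qed

lemma mpol_induct [consumes 1, case_names const var add mult]:
  fixes f :: "('v, 'a::comm_ring_1) mpol"
  assumes "f \<in> mpols N"
    and const: "\<And>c. P (mconst c)"
    and var: "\<And>v. v \<in> N \<Longrightarrow> P (mvar v)"
    and add: "\<And>f g. f \<in> mpols N \<Longrightarrow> g \<in> mpols N \<Longrightarrow> P f \<Longrightarrow> P g \<Longrightarrow> P (f + g)"
    and mult: "\<And>f g. f \<in> mpols N \<Longrightarrow> g \<in> mpols N \<Longrightarrow> P f \<Longrightarrow> P g \<Longrightarrow> P (f * g)"
  shows "P f"
  using assms(1)
proof (induction rule: mpol_induct_single)
  case zero
  then show ?case using const[of 0] by simp
next
  case (single m c)
  have pw: "P (mvar v ^ e)" if "v \<in> N" for v e
  proof (induction e)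
    case 0
    then show ?case using const[of 1] by simp
  next
    case (Suc e)
    then show ?case
      using mult[of "mvar v" "mvar v ^ e"] var that by (auto intro: mpols_var mpols_power)
  qed
  have "P (\<Prod>v\<in>A. mvar v ^ Poly_Mapping.lookup m v)" if "finite A" "A \<subseteq> N" for A
    using that
  proof (induction A rule: finite_induct)
    case empty
    then show ?case using const[of 1] by simp
  next
    case (insert v A)
    then show ?case
      using pw by (auto intro!: mult mpols_power mpols_var mpols_prod)
  qed
  with single have "P (mconst c * (\<Prod>v\<in>Poly_Mapping.keys m. mvar v ^ Poly_Mapping.lookup m v))"
    by (auto intro!: mult const mpols_prod mpols_power mpols_var)
  then show ?case by (simp add: single_eq_prod)
qed (rule add)

section \<open>Evaluation in a commutative ring\<close>

text \<open>Base changes to \<open>\<D>\<close> and localisations are rings given by a carrier, so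
  evaluation has to be available there; \<open>mp_eval\<close> is the case of a whole type, see
  \<open>mp_eval_eq_in\<close>.\<close>

definition mp_eval_in :: "('r, 'm) ring_scheme \<Rightarrow> ('a::zero \<Rightarrow> 'r) \<Rightarrow> ('v \<Rightarrow> 'r) \<Rightarrow> ('v, 'a) mpol \<Rightarrow> 'r" where
  "mp_eval_in R c x f = (\<Oplus>\<^bsub>R\<^esub>m\<in>Poly_Mapping.keys f. c (Poly_Mapping.lookup f m) \<otimes>\<^bsub>R\<^esub>
      (\<Otimes>\<^bsub>R\<^esub>v\<in>Poly_Mapping.keys m. x v [^]\<^bsub>R\<^esub> Poly_Mapping.lookup m v))"

lemma ring_hom_zero_of_type:
  fixes c :: "'a::comm_ring_1 \<Rightarrow> 'r"
  assumes "ring R" "c \<in> ring_hom ring_of_type_algebra R"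
  shows "c 0 = \<zero>\<^bsub>R\<^esub>"
  using Ring.ring_hom_zero[OF assms(2) ring_from_type_algebra assms(1)] by simp

locale mp_evaluation = cring R for R :: "('b, 'm) ring_scheme" (structure) +
  fixes c :: "'a::comm_ring_1 \<Rightarrow> 'b" and x :: "'v \<Rightarrow> 'b" and N :: "'v set"
  assumes c_hom: "c \<in> ring_hom ring_of_type_algebra R"
    and x_closed: "x \<in> N \<rightarrow> carrier R"
begin

lemma c_closed [simp]: "c a \<in> carrier R"
  using c_hom by (auto simp: ring_hom_def)

lemma c_zero [simp]: "c 0 = \<zero>"
  using c_hom ring_axioms by (rule ring_hom_zero_of_type[rotated])

lemma c_simps [simp]: "c 1 = \<one>" "c (a + b) = c a \<oplus> c b" "c (a * b) = c a \<otimes> c b"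
  using c_hom by (auto simp: ring_hom_def)

abbreviation mon :: "('v \<Rightarrow>\<^sub>0 nat) \<Rightarrow> 'b" where
  "mon m \<equiv> (\<Otimes>v\<in>Poly_Mapping.keys m. x v [^] Poly_Mapping.lookup m v)"

lemma pow_closed: "v \<in> N \<Longrightarrow> x v [^] (e::nat) \<in> carrier R"
  using x_closed by auto

lemma mon_closed [simp]: "Poly_Mapping.keys m \<subseteq> N \<Longrightarrow> mon m \<in> carrier R"
  by (auto intro!: finprod_closed pow_closed)

lemma mon_superset:
  assumes "finite A" "Poly_Mapping.keys m \<subseteq> A" "A \<subseteq> N"
  shows "mon m = (\<Otimes>v\<in>A. x v [^] Poly_Mapping.lookup m v)"
  using assms
  by (intro finprod_mono_neutral_cong_left) (auto intro!: pow_closed simp: in_keys_iff)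

lemma mon_add:
  assumes "Poly_Mapping.keys m \<subseteq> N" "Poly_Mapping.keys m' \<subseteq> N"
  shows "mon (m + m') = mon m \<otimes> mon m'"
proof -
  let ?A = "Poly_Mapping.keys m \<union> Poly_Mapping.keys m'"
  have A: "?A \<subseteq> N" using assms by auto
  have "mon (m + m') = (\<Otimes>v\<in>?A. x v [^] Poly_Mapping.lookup (m + m') v)"
    using A Poly_Mapping.keys_add[of m m'] by (intro mon_superset) auto
  also have "\<dots> = (\<Otimes>v\<in>?A. x v [^] Poly_Mapping.lookup m v \<otimes> x v [^] Poly_Mapping.lookup m' v)"
    using A pow_closed x_closed
    by (intro finprod_cong') (auto simp: lookup_add nat_pow_mult Pi_iff subset_iff)
  also have "\<dots> = (\<Otimes>v\<in>?A. x v [^] Poly_Mapping.lookup m v) \<otimes> (\<Otimes>v\<in>?A. x v [^] Poly_Mapping.lookup m' v)"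
    using A pow_closed by (intro finprod_multf) auto
  also have "\<dots> = mon m \<otimes> mon m'"
    using A by (simp add: mon_superset[of ?A])
  finally show ?thesis .
qed

abbreviation ev :: "('v, 'a) mpol \<Rightarrow> 'b" where "ev \<equiv> mp_eval_in R c x"

lemma ev_superset:
  assumes "finite A" "Poly_Mapping.keys f \<subseteq> A" "\<And>m. m \<in> A \<Longrightarrow> Poly_Mapping.keys m \<subseteq> N"
  shows "ev f = (\<Oplus>m\<in>A. c (Poly_Mapping.lookup f m) \<otimes> mon m)"
  unfolding mp_eval_in_def using assms
  by (intro add.finprod_mono_neutral_cong_left) (auto intro!: mon_closed simp: in_keys_iff)

lemma ev_closed: "f \<in> mpols N \<Longrightarrow> ev f \<in> carrier R"
  unfolding mp_eval_in_def by (auto intro!: finsum_closed mon_closed simp: mpols_def)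

lemma ev_single: "Poly_Mapping.keys m \<subseteq> N \<Longrightarrow> ev (Poly_Mapping.single m a) = c a \<otimes> mon m"
  using mon_closed[of m] by (subst ev_superset[of "{m}"]) auto

lemma ev_zero [simp]: "ev 0 = \<zero>"
  by (simp add: mp_eval_in_def)

lemma ev_add:
  assumes "f \<in> mpols N" "g \<in> mpols N"
  shows "ev (f + g) = ev f \<oplus> ev g"
proof -
  let ?A = "Poly_Mapping.keys f \<union> Poly_Mapping.keys g"
  have A: "\<And>m. m \<in> ?A \<Longrightarrow> Poly_Mapping.keys m \<subseteq> N" using assms by (auto simp: mpols_def)
  have "ev (f + g) = (\<Oplus>m\<in>?A. c (Poly_Mapping.lookup (f + g) m) \<otimes> mon m)"
    using A Poly_Mapping.keys_add[of f g] by (intro ev_superset) auto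
  also have "\<dots> = (\<Oplus>m\<in>?A. c (Poly_Mapping.lookup f m) \<otimes> mon m \<oplus> c (Poly_Mapping.lookup g m) \<otimes> mon m)"
    using A by (intro finsum_cong') (auto simp: lookup_add l_distr mon_closed)
  also have "\<dots> = (\<Oplus>m\<in>?A. c (Poly_Mapping.lookup f m) \<otimes> mon m) \<oplus> (\<Oplus>m\<in>?A. c (Poly_Mapping.lookup g m) \<otimes> mon m)"
    using A by (intro finsum_addf) (auto simp: mon_closed)
  also have "(\<Oplus>m\<in>?A. c (Poly_Mapping.lookup f m) \<otimes> mon m) = ev f"
    by (rule ev_superset[symmetric]) (use A in auto)
  also have "(\<Oplus>m\<in>?A. c (Poly_Mapping.lookup g m) \<otimes> mon m) = ev g"
    by (rule ev_superset[symmetric]) (use A in auto)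
  finally show ?thesis .
qed

lemma ev_mult:
  assumes "f \<in> mpols N" "g \<in> mpols N"
  shows "ev (f * g) = ev f \<otimes> ev g"
  using assms(1)
proof (induction rule: mpol_induct_single)
  case zero
  then show ?case using assms ev_closed by simp
next
  case (single m a)
  show ?case using assms(2)
  proof (induction rule: mpol_induct_single)
    case zero
    then show ?case using single ev_closed[OF mpols_single] by simp
  next
    case s2: (single m' b)
    have "Poly_Mapping.keys (m + m') \<subseteq> N"
      using Poly_Mapping.keys_add[of m m'] single s2 by auto
    then show ?case
      using single s2 mon_closed[of m] mon_closed[of m']
      by (simp add: mult_single ev_single mon_add m_ac)
  next
    case (add f g)
    then show ?case using single ev_closed[OF mpols_single]
      by (simp add: distrib_left ev_add mpols_mult mpols_single ev_closed r_distr)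
  qed
next
  case (add f f')
  then show ?case using assms
    by (simp add: distrib_right ev_add mpols_mult ev_closed l_distr)
qed

lemma ev_const [simp]: "ev (mconst a) = c a"
  unfolding mconst_def by (subst ev_single) auto

lemma ev_one [simp]: "ev 1 = \<one>"
  using ev_const[of 1] by simp

lemma ev_var [simp]: "v \<in> N \<Longrightarrow> ev (mvar v) = x v"
  unfolding mvar_def using x_closed funcset_mem[OF x_closed, of v]
  by (subst ev_single) (auto simp: finprod_insert)

lemma ev_hom: "ev \<in> ring_hom (mpol_ring N) R"
  by (simp add: ring_hom_def ev_closed ev_add ev_mult)

text \<open>The universal property of the polynomial ring. Compatibility with ring homomorphisms and
  independence of the values outside \<open>N\<close> are deduced from it without expanding the
  defining sum.\<close>

lemma ev_unique:
  assumes \<phi>: "\<phi> \<in> ring_hom (mpol_ring N) R" and "\<And>a. \<phi> (mconst a) = c a"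
    and "\<And>v. v \<in> N \<Longrightarrow> \<phi> (mvar v) = x v" and "f \<in> mpols N"
  shows "\<phi> f = ev f"
  using assms(4)
proof (induction rule: mpol_induct)
  case (add f g)
  then show ?case using \<phi> by (simp add: ring_hom_def ev_add)
next
  case (mult f g)
  then show ?case using \<phi> by (simp add: ring_hom_def ev_mult)
qed (use assms in auto)

end

lemma mp_evaluationI:
  assumes "cring R" "c \<in> ring_hom ring_of_type_algebra R" "x \<in> N \<rightarrow> carrier R"
  shows "mp_evaluation R c x N"
  using assms by (intro mp_evaluation.intro mp_evaluation_axioms.intro)

lemma mp_eval_in_compose_hom:
  assumes "mp_evaluation R c x N" and S: "cring S" and h: "h \<in> ring_hom R S" and f: "f \<in> mpols N"
  shows "h (mp_eval_in R c x f) = mp_eval_in S (h \<circ> c) (h \<circ> x) f"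
proof -
  interpret e: mp_evaluation R c x N by fact
  interpret S: mp_evaluation S "h \<circ> c" "h \<circ> x" N
    using e.c_hom e.x_closed h S by (intro mp_evaluationI) (auto simp: ring_hom_def)
  have "(h \<circ> mp_eval_in R c x) f = S.ev f"
  proof (rule S.ev_unique)
    show "h \<circ> mp_eval_in R c x \<in> ring_hom (mpol_ring N) S"
      using e.ev_hom h by (auto simp: ring_hom_def Pi_def)
  qed (use f in auto)
  then show ?thesis by simp
qed

lemma mp_eval_in_cong:
  fixes c :: "'a::comm_ring_1 \<Rightarrow> 'r"
  assumes "\<And>v. v \<in> N \<Longrightarrow> x v = y v" "f \<in> mpols N" "cring R" "x \<in> N \<rightarrow> carrier R"
    and "c \<in> ring_hom ring_of_type_algebra R"
  shows "mp_eval_in R c x f = mp_eval_in R c y f"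
proof -
  interpret e: mp_evaluation R c x N by (intro mp_evaluationI) (use assms in auto)
  have "y \<in> N \<rightarrow> carrier R"
    using assms(1,4) unfolding Pi_iff by metis
  then interpret e': mp_evaluation R c y N by (intro mp_evaluationI) (use assms in auto)
  show ?thesis
    by (rule e'.ev_unique[OF e.ev_hom]) (use assms in auto)
qed

section \<open>Evaluation in a ring that is a whole type\<close>

lemma finsum_of_type: "finsum (ring_of_type_algebra :: 'a::comm_ring_1 ring) f A = sum f A"
proof (induction A rule: infinite_finite_induct)
  case (infinite A)
  then show ?case by (simp add: finsum_def finprod_def)
next
  case empty
  interpret cring "ring_of_type_algebra :: 'a ring" by (rule cring_from_type_algebra)
  show ?case by simp
next
  case (insert a A)
  interpret cring "ring_of_type_algebra :: 'a ring" by (rule cring_from_type_algebra)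
  from insert show ?case by simp
qed

lemma finprod_of_type: "finprod (ring_of_type_algebra :: 'a::comm_ring_1 ring) f A = prod f A"
proof (induction A rule: infinite_finite_induct)
  case (infinite A)
  then show ?case by (simp add: finprod_def)
next
  case empty
  interpret cring "ring_of_type_algebra :: 'a ring" by (rule cring_from_type_algebra)
  show ?case by simp
next
  case (insert a A)
  interpret cring "ring_of_type_algebra :: 'a ring" by (rule cring_from_type_algebra)
  from insert show ?case by simp
qed

lemma pow_of_type: "(a :: 'a::comm_ring_1) [^]\<^bsub>ring_of_type_algebra\<^esub> (n::nat) = a ^ n"
proof (induction n)
  interpret cring "ring_of_type_algebra :: 'a ring" by (rule cring_from_type_algebra)
  case 0
  show ?case by simp
next
  interpret cring "ring_of_type_algebra :: 'a ring" by (rule cring_from_type_algebra)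
  case (Suc n)
  then show ?case by (simp add: mult.commute)
qed

lemma mp_eval_eq_in: "mp_eval c x f = mp_eval_in ring_of_type_algebra c x f"
  by (simp add: mp_eval_def mp_eval_in_def finsum_of_type finprod_of_type pow_of_type)

abbreviation type_hom :: "('a::comm_ring_1 \<Rightarrow> 'b::comm_ring_1) \<Rightarrow> bool" where
  "type_hom c \<equiv> c \<in> ring_hom ring_of_type_algebra ring_of_type_algebra"

lemma type_homD:
  assumes "type_hom c"
  shows "c 0 = 0" "c 1 = 1" "c (a + b) = c a + c b" "c (a * b) = c a * c b" "c (- a) = - c a"
    "c (a - b) = c a - c b" "c (of_nat n) = of_nat n" "c (a ^ n) = c a ^ n"
proof -
  have *: "c 1 = 1" "\<And>a b. c (a + b) = c a + c b" "\<And>a b. c (a * b) = c a * c b"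
    using assms by (auto simp: ring_hom_def)
  then have 0: "c 0 = 0"
    by (metis add_cancel_right_left)
  have m: "c (- a) = - c a" for a
    using *(2)[of a "- a"] 0 by (metis add.right_inverse add_eq_0_iff2 minus_unique)
  show "c 0 = 0" "c 1 = 1" "c (a + b) = c a + c b" "c (a * b) = c a * c b" "c (- a) = - c a"
    by (fact 0 * m)+
  show "c (a - b) = c a - c b"
    using *(2)[of a "- b"] m by simp
  show "c (of_nat n) = of_nat n"
    by (induction n) (auto simp: * 0)
  show "c (a ^ n) = c a ^ n"
    by (induction n) (auto simp: *)
qed

lemma type_hom_sum: "type_hom c \<Longrightarrow> c (sum f A) = (\<Sum>a\<in>A. c (f a))"
  by (induction A rule: infinite_finite_induct) (auto simp: type_homD)

lemma type_hom_id [simp]: "type_hom id" "type_hom (\<lambda>x. x)"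
  by (auto simp: ring_hom_def)

lemma type_hom_to_ac [simp]: "type_hom to_ac"
  by (auto simp: ring_hom_def)

lemma type_hom_mconst [simp]: "type_hom mconst"
  by (auto simp: ring_hom_def)

lemma mp_evaluation_type: "type_hom c \<Longrightarrow> mp_evaluation ring_of_type_algebra c x N"
  by (intro mp_evaluationI) auto

context
  fixes c :: "'a::comm_ring_1 \<Rightarrow> 'b::comm_ring_1"
  assumes c: "type_hom c"
begin

interpretation mp_evaluation ring_of_type_algebra c x UNIV for x
  by (rule mp_evaluation_type[OF c])

lemma mp_eval_add: "mp_eval c x (f + g) = mp_eval c x f + mp_eval c x g"
  by (simp add: mp_eval_eq_in ev_add)

lemma mp_eval_mult: "mp_eval c x (f * g) = mp_eval c x f * mp_eval c x g"
  by (simp add: mp_eval_eq_in ev_mult)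

lemma mp_eval_const: "mp_eval c x (mconst a) = c a"
  by (simp add: mp_eval_eq_in)

lemma mp_eval_var: "mp_eval c x (mvar v) = x v"
  by (simp add: mp_eval_eq_in)

lemma mp_eval_hom: "type_hom (mp_eval c x)"
  using mp_eval_add mp_eval_mult mp_eval_const[of x 1] by (auto simp: ring_hom_def)

lemmas mp_eval_ring_simps = type_homD[OF mp_eval_hom] mp_eval_const mp_eval_var

lemma mp_eval_sum: "mp_eval c x (sum f A) = (\<Sum>a\<in>A. mp_eval c x (f a))"
  by (rule type_hom_sum[OF mp_eval_hom])

lemma mp_eval_prod: "mp_eval c x (prod f A) = (\<Prod>a\<in>A. mp_eval c x (f a))"
  by (induction A rule: infinite_finite_induct) (auto simp: mp_eval_ring_simps)

lemma mp_eval_compose: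
  fixes d :: "'b \<Rightarrow> 'e::comm_ring_1"
  assumes "type_hom d"
  shows "d (mp_eval c x f) = mp_eval (d \<circ> c) (d \<circ> x) f"
  unfolding mp_eval_eq_in
  using mp_eval_in_compose_hom[OF mp_evaluation_axioms cring_from_type_algebra assms] by simp

end

lemma mp_eval_cong:
  "type_hom c \<Longrightarrow> f \<in> mpols N \<Longrightarrow> (\<And>v. v \<in> N \<Longrightarrow> x v = y v) \<Longrightarrow> mp_eval c x f = mp_eval c y f"
  unfolding mp_eval_eq_in by (rule mp_eval_in_cong[of N]) auto

lemma mp_eval_subst:
  assumes "type_hom c"
  shows "mp_eval c x (mp_eval mconst s f) = mp_eval c (\<lambda>v. mp_eval c x (s v)) f"
  using mp_eval_compose[OF type_hom_mconst mp_eval_hom[OF assms], of x s f]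
  by (simp add: comp_def mp_eval_const[OF assms])

lemma mp_eval_mconst_mvar: "mp_eval mconst mvar f = (f :: ('v, 'a::comm_ring_1) mpol)"
proof -
  interpret mp_evaluation "mpol_ring UNIV :: ('v, 'a) mpol ring" mconst mvar UNIV
    by (intro mp_evaluationI cring_mpol_ring) auto
  have "f \<in> mpols UNIV" by simp
  then show ?thesis
    by (induction rule: mpol_induct) (simp_all add: mp_eval_ring_simps)
qed

lemma mp_eval_mpol_ring:
  fixes s :: "'v \<Rightarrow> ('w, 'a::comm_ring_1) mpol"
  assumes f: "f \<in> mpols N" and s: "s \<in> N \<rightarrow> mpols M"
  shows "mp_eval_in (mpol_ring M) mconst s f = mp_eval mconst s f"
proof -
  interpret mp_evaluation "mpol_ring M" mconst s N
    by (intro mp_evaluationI cring_mpol_ring) (use s in auto)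
  show ?thesis using f
    by (induction rule: mpol_induct) (simp_all add: mp_eval_ring_simps ev_add ev_mult)
qed

lemma mpols_subst:
  fixes s :: "'v \<Rightarrow> ('w, 'a::comm_ring_1) mpol"
  assumes f: "f \<in> mpols N" and s: "\<And>v. v \<in> N \<Longrightarrow> s v \<in> mpols M"
  shows "mp_eval mconst s f \<in> mpols M"
  using f by (induction rule: mpol_induct) (auto simp: mp_eval_ring_simps mpols_add mpols_mult s)

section \<open>Derivatives\<close>

lemma mp_deriv_superset:
  assumes "finite A" "Poly_Mapping.keys f \<subseteq> A"
  shows "mp_deriv v f = (\<Sum>m\<in>A. Poly_Mapping.single (m - Poly_Mapping.single v 1)
        (of_nat (Poly_Mapping.lookup m v) * Poly_Mapping.lookup f m))"
  unfolding mp_deriv_def by (rule sum.mono_neutral_left) (use assms in \<open>auto simp: in_keys_iff\<close>)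

lemma mp_deriv_add: "mp_deriv v (f + g) = mp_deriv v f + mp_deriv v g"
proof -
  let ?A = "Poly_Mapping.keys f \<union> Poly_Mapping.keys g"
  show ?thesis
    using Poly_Mapping.keys_add[of f g]
    by (simp add: mp_deriv_superset[of ?A] lookup_add distrib_left single_add sum.distrib)
qed

lemma mp_deriv_zero [simp]: "mp_deriv v 0 = 0"
  by (simp add: mp_deriv_def)

lemma mp_deriv_single:
  "mp_deriv v (Poly_Mapping.single m a) =
     Poly_Mapping.single (m - Poly_Mapping.single v 1) (of_nat (Poly_Mapping.lookup m v) * a)"
  by (subst mp_deriv_superset[of "{m}"]) auto

lemma mp_deriv_mult:
  fixes f g :: "('v, 'a::comm_ring_1) mpol"
  shows "mp_deriv v (f * g) = mp_deriv v f * g + f * mp_deriv v g"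
proof -
  \<comment> \<open>Subtraction of exponents is truncated, so this fails when \<open>v\<close> does
    not occur in \<open>m\<close>; in that case the coefficient of the derivative is 0.\<close>
  have minus: "Poly_Mapping.lookup m v \<noteq> 0 \<Longrightarrow>
      m - Poly_Mapping.single v 1 + m' = m + m' - Poly_Mapping.single v 1" for m m' :: "'v \<Rightarrow>\<^sub>0 nat"
    by (rule poly_mapping_eqI) (auto simp: lookup_add lookup_minus lookup_single when_def)
  have s: "mp_deriv v (Poly_Mapping.single m a * Poly_Mapping.single m' b) =
    mp_deriv v (Poly_Mapping.single m a) * Poly_Mapping.single m' b +
    Poly_Mapping.single m a * mp_deriv v (Poly_Mapping.single m' b)" for m m' and a b :: 'a
  proof -
    have "mp_deriv v (Poly_Mapping.single m a) * Poly_Mapping.single m' b =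
      Poly_Mapping.single (m + m' - Poly_Mapping.single v 1) (of_nat (Poly_Mapping.lookup m v) * a * b)"
      using minus[of m m'] by (cases "Poly_Mapping.lookup m v = 0") (auto simp: mp_deriv_single mult_single)
    moreover have "Poly_Mapping.single m a * mp_deriv v (Poly_Mapping.single m' b) =
      Poly_Mapping.single (m + m' - Poly_Mapping.single v 1) (of_nat (Poly_Mapping.lookup m' v) * a * b)"
      using minus[of m' m]
      by (cases "Poly_Mapping.lookup m' v = 0") (auto simp: mp_deriv_single mult_single add.commute mult_ac)
    ultimately show ?thesis
      by (simp add: mp_deriv_single mult_single lookup_add algebra_simps single_add)
  qed
  have "f \<in> mpols UNIV" "g \<in> mpols UNIV" by simp_all
  then show ?thesis
  proof (induction rule: mpol_induct_single)
    case (single m c)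
    show ?case using \<open>g \<in> mpols UNIV\<close>
      by (induction rule: mpol_induct_single) (simp_all add: s distrib_left mp_deriv_add algebra_simps)
  qed (simp_all add: distrib_right mp_deriv_add algebra_simps)
qed

lemma mp_deriv_const [simp]: "mp_deriv v (mconst a) = 0"
  by (simp add: mconst_def mp_deriv_single)

lemma mp_deriv_var: "mp_deriv v (mvar w :: ('v, 'a::comm_ring_1) mpol) = (if v = w then 1 else 0)"
  by (auto simp: mvar_def mp_deriv_single lookup_single)

lemma mp_deriv_one [simp]: "mp_deriv v 1 = 0"
  using mp_deriv_const[of v 1] by simp

lemma mp_deriv_uminus: "mp_deriv v (- f) = - mp_deriv v (f :: ('v, 'a::comm_ring_1) mpol)"
  using mp_deriv_add[of v f "- f"] by (simp add: eq_neg_iff_add_eq_0 add.commute)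

lemma mp_deriv_minus: "mp_deriv v (f - g) = mp_deriv v f - mp_deriv v (g :: ('v, 'a::comm_ring_1) mpol)"
  using mp_deriv_add[of v f "- g"] by (simp add: mp_deriv_uminus)

lemma mp_deriv_sum: "mp_deriv v (sum f A) = (\<Sum>a\<in>A. mp_deriv v (f a))"
  by (induction A rule: infinite_finite_induct) (auto simp: mp_deriv_add)

lemma mpols_deriv: "f \<in> mpols N \<Longrightarrow> mp_deriv v f \<in> (mpols N :: ('v, 'a::comm_ring_1) mpol set)"
  by (induction rule: mpol_induct) (auto simp: mp_deriv_add mp_deriv_mult mp_deriv_var mpols_add mpols_mult)

lemma mp_deriv_outside: "f \<in> mpols N \<Longrightarrow> v \<notin> N \<Longrightarrow> mp_deriv v (f :: ('v, 'a::comm_ring_1) mpol) = 0"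
  by (induction rule: mpol_induct) (auto simp: mp_deriv_add mp_deriv_mult mp_deriv_var)

text \<open>The chain rule. It turns a change of generators into a linear map between spaces of
  gradients.\<close>

lemma mp_deriv_subst:
  fixes s :: "'v \<Rightarrow> ('w, 'a::comm_ring_1) mpol"
  assumes "finite N" "f \<in> mpols N"
  shows "mp_deriv w (mp_eval mconst s f) =
    (\<Sum>v\<in>N. mp_eval mconst s (mp_deriv v f) * mp_deriv w (s v))"
  using assms(2)
proof (induction rule: mpol_induct)
  case (var u)
  have "(\<Sum>v\<in>N. mp_eval mconst s (mp_deriv v (mvar u)) * mp_deriv w (s v)) =
      (\<Sum>v\<in>N. if v = u then mp_deriv w (s v) else 0)"
    by (intro sum.cong) (auto simp: mp_deriv_var mp_eval_ring_simps)
  with var assms(1) show ?case by (simp add: mp_eval_ring_simps)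
next
  case (mult f g)
  then show ?case
    by (simp add: mp_eval_ring_simps mp_deriv_mult mp_deriv_add sum.distrib sum_distrib_left
        sum_distrib_right algebra_simps)
qed (simp_all add: mp_eval_ring_simps mp_deriv_add sum.distrib algebra_simps)

lemma (in cring) taylor_add:
  assumes "F \<in> carrier R" "F' \<in> carrier R" "G \<in> carrier R" "G' \<in> carrier R"
    "z \<in> carrier R" "r \<in> carrier R" "s \<in> carrier R"
  shows "(F \<oplus> z \<otimes> F' \<oplus> z \<otimes> z \<otimes> r) \<oplus> (G \<oplus> z \<otimes> G' \<oplus> z \<otimes> z \<otimes> s) =
    (F \<oplus> G) \<oplus> z \<otimes> (F' \<oplus> G') \<oplus> z \<otimes> z \<otimes> (r \<oplus> s)"
  using assms by (simp add: r_distr a_ac)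

lemma (in cring) taylor_mult:
  assumes "F \<in> carrier R" "F' \<in> carrier R" "G \<in> carrier R" "G' \<in> carrier R"
    "z \<in> carrier R" "r \<in> carrier R" "s \<in> carrier R"
  shows "(F \<oplus> z \<otimes> F' \<oplus> z \<otimes> z \<otimes> r) \<otimes> (G \<oplus> z \<otimes> G' \<oplus> z \<otimes> z \<otimes> s) =
    F \<otimes> G \<oplus> z \<otimes> (F' \<otimes> G \<oplus> F \<otimes> G') \<oplus> z \<otimes> z \<otimes>
      (F' \<otimes> G' \<oplus> F \<otimes> s \<oplus> r \<otimes> G \<oplus> z \<otimes> (F' \<otimes> s \<oplus> r \<otimes> G') \<oplus> z \<otimes> z \<otimes> r \<otimes> s)"
  using assms by (simp add: r_distr l_distr a_ac m_ac)

text \<open>First-order expansions in \<open>z\<close> with an error divisible by the square of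
  \<open>z\<close> are closed under sums and products, so induction over the polynomial suffices.
  The ring is arbitrary because the expansion is used for Newton's method in
  \<open>R \<otimes> \<D>\<close>.\<close>

lemma mp_taylor:
  fixes f :: "('v, 'a::comm_ring_1) mpol"
  assumes R: "cring R" and c: "c \<in> ring_hom ring_of_type_algebra R" and x: "x \<in> N \<rightarrow> carrier R"
    and z: "z \<in> carrier R" and v: "v \<in> N" and f: "f \<in> mpols N"
  shows "\<exists>r\<in>carrier R. mp_eval_in R c (x(v := x v \<oplus>\<^bsub>R\<^esub> z)) f =
    mp_eval_in R c x f \<oplus>\<^bsub>R\<^esub> z \<otimes>\<^bsub>R\<^esub> mp_eval_in R c x (mp_deriv v f) \<oplus>\<^bsub>R\<^esub> z \<otimes>\<^bsub>R\<^esub> z \<otimes>\<^bsub>R\<^esub> r"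
proof -
  interpret cring R by (rule R)
  define y where "y = x(v := x v \<oplus>\<^bsub>R\<^esub> z)"
  interpret X: mp_evaluation R c x N by (intro mp_evaluationI R c x)
  interpret Y: mp_evaluation R c y N
    by (intro mp_evaluationI R c) (use x v z in \<open>auto simp: Pi_iff y_def\<close>)
  show ?thesis using f unfolding y_def[symmetric]
  proof (induction rule: mpol_induct)
    case (const a)
    show ?case by (rule bexI[of _ "\<zero>\<^bsub>R\<^esub>"]) (use z in simp_all)
  next
    case (var u)
    show ?case
      unfolding X.ev_var[OF var] Y.ev_var[OF var]
      by (rule bexI[of _ "\<zero>\<^bsub>R\<^esub>"])
        (use z v funcset_mem[OF x var] in \<open>auto simp: mp_deriv_var y_def\<close>)
  next
    case (add f g)
    then obtain r s where r: "r \<in> carrier R" "Y.ev f = X.ev f \<oplus>\<^bsub>R\<^esub> z \<otimes>\<^bsub>R\<^esub> X.ev (mp_deriv v f) \<oplus>\<^bsub>R\<^esub> z \<otimes>\<^bsub>R\<^esub> z \<otimes>\<^bsub>R\<^esub> r"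
      and s: "s \<in> carrier R" "Y.ev g = X.ev g \<oplus>\<^bsub>R\<^esub> z \<otimes>\<^bsub>R\<^esub> X.ev (mp_deriv v g) \<oplus>\<^bsub>R\<^esub> z \<otimes>\<^bsub>R\<^esub> z \<otimes>\<^bsub>R\<^esub> s"
      by blast
    have cl: "X.ev f \<in> carrier R" "X.ev g \<in> carrier R"
      "X.ev (mp_deriv v f) \<in> carrier R" "X.ev (mp_deriv v g) \<in> carrier R"
      using add.hyps by (auto intro!: X.ev_closed mpols_deriv)
    have "Y.ev (f + g) = X.ev f \<oplus>\<^bsub>R\<^esub> z \<otimes>\<^bsub>R\<^esub> X.ev (mp_deriv v f) \<oplus>\<^bsub>R\<^esub> z \<otimes>\<^bsub>R\<^esub> z \<otimes>\<^bsub>R\<^esub> r \<oplus>\<^bsub>R\<^esub>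
       (X.ev g \<oplus>\<^bsub>R\<^esub> z \<otimes>\<^bsub>R\<^esub> X.ev (mp_deriv v g) \<oplus>\<^bsub>R\<^esub> z \<otimes>\<^bsub>R\<^esub> z \<otimes>\<^bsub>R\<^esub> s)"
      using add.hyps r s by (simp add: Y.ev_add)
    also have "\<dots> = X.ev f \<oplus>\<^bsub>R\<^esub> X.ev g \<oplus>\<^bsub>R\<^esub> z \<otimes>\<^bsub>R\<^esub> (X.ev (mp_deriv v f) \<oplus>\<^bsub>R\<^esub> X.ev (mp_deriv v g)) \<oplus>\<^bsub>R\<^esub>
       z \<otimes>\<^bsub>R\<^esub> z \<otimes>\<^bsub>R\<^esub> (r \<oplus>\<^bsub>R\<^esub> s)"
      by (rule taylor_add) (use cl r(1) s(1) z in auto)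
    finally show ?case
      using add.hyps r(1) s(1)
      by (intro bexI[of _ "r \<oplus>\<^bsub>R\<^esub> s"]) (simp_all add: X.ev_add mp_deriv_add mpols_deriv)
  next
    case (mult f g)
    then obtain r s where r: "r \<in> carrier R" "Y.ev f = X.ev f \<oplus>\<^bsub>R\<^esub> z \<otimes>\<^bsub>R\<^esub> X.ev (mp_deriv v f) \<oplus>\<^bsub>R\<^esub> z \<otimes>\<^bsub>R\<^esub> z \<otimes>\<^bsub>R\<^esub> r"
      and s: "s \<in> carrier R" "Y.ev g = X.ev g \<oplus>\<^bsub>R\<^esub> z \<otimes>\<^bsub>R\<^esub> X.ev (mp_deriv v g) \<oplus>\<^bsub>R\<^esub> z \<otimes>\<^bsub>R\<^esub> z \<otimes>\<^bsub>R\<^esub> s"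
      by blast
    define F where "F = X.ev f" 
    define F' where "F' = X.ev (mp_deriv v f)" 
    define G where "G = X.ev g" 
    define G' where "G' = X.ev (mp_deriv v g)" 
    have cl: "F \<in> carrier R" "G \<in> carrier R" "F' \<in> carrier R" "G' \<in> carrier R"
      using mult.hyps by (auto simp: F_def F'_def G_def G'_def intro!: X.ev_closed mpols_deriv)
    \<comment> \<open>The part of the product of the two expansions that is divisible by
      \<open>z\<close> twice, with these two factors taken out.\<close>
    let ?r = "F' \<otimes>\<^bsub>R\<^esub> G' \<oplus>\<^bsub>R\<^esub> F \<otimes>\<^bsub>R\<^esub> s \<oplus>\<^bsub>R\<^esub> r \<otimes>\<^bsub>R\<^esub> G \<oplus>\<^bsub>R\<^esub> z \<otimes>\<^bsub>R\<^esub> (F' \<otimes>\<^bsub>R\<^esub> s \<oplus>\<^bsub>R\<^esub> r \<otimes>\<^bsub>R\<^esub> G') \<oplus>\<^bsub>R\<^esub> z \<otimes>\<^bsub>R\<^esub> z \<otimes>\<^bsub>R\<^esub> r \<otimes>\<^bsub>R\<^esub> s"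
    have e: "X.ev (mp_deriv v (f * g)) = F' \<otimes>\<^bsub>R\<^esub> G \<oplus>\<^bsub>R\<^esub> F \<otimes>\<^bsub>R\<^esub> G'"
      using mult.hyps by (simp add: mp_deriv_mult X.ev_add X.ev_mult mpols_mult mpols_deriv F_def F'_def G_def G'_def)
    have "Y.ev (f * g) = (F \<oplus>\<^bsub>R\<^esub> z \<otimes>\<^bsub>R\<^esub> F' \<oplus>\<^bsub>R\<^esub> z \<otimes>\<^bsub>R\<^esub> z \<otimes>\<^bsub>R\<^esub> r) \<otimes>\<^bsub>R\<^esub> (G \<oplus>\<^bsub>R\<^esub> z \<otimes>\<^bsub>R\<^esub> G' \<oplus>\<^bsub>R\<^esub> z \<otimes>\<^bsub>R\<^esub> z \<otimes>\<^bsub>R\<^esub> s)"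
      using mult.hyps r(2) s(2) by (simp add: Y.ev_mult F_def F'_def G_def G'_def)
    also have "\<dots> = F \<otimes>\<^bsub>R\<^esub> G \<oplus>\<^bsub>R\<^esub> z \<otimes>\<^bsub>R\<^esub> (F' \<otimes>\<^bsub>R\<^esub> G \<oplus>\<^bsub>R\<^esub> F \<otimes>\<^bsub>R\<^esub> G') \<oplus>\<^bsub>R\<^esub> z \<otimes>\<^bsub>R\<^esub> z \<otimes>\<^bsub>R\<^esub> ?r"
      by (rule taylor_mult) (use cl r(1) s(1) z in auto)
    finally show ?case
      using cl r(1) s(1) z mult.hyps
      by (intro bexI[of _ ?r]) (simp_all add: e X.ev_mult F_def G_def)
  qed
qed

section \<open>Primes and irreducible varieties\<close>

text \<open>Zorn's lemma, kept apart from the statement on primes because \<open>f = 1\<close>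
  yields a maximal ideal above a proper one, which the local algebra \<open>\<D>\<close>
  requires.\<close>

lemma (in cring) exists_ideal_maximal_avoiding_powers:
  assumes I: "ideal I R" and f: "f \<in> carrier R" and avoid: "\<And>n::nat. f [^] n \<notin> I"
  obtains P where "ideal P R" "I \<subseteq> P" "\<And>n::nat. f [^] n \<notin> P"
    "\<And>Q. ideal Q R \<Longrightarrow> P \<subset> Q \<Longrightarrow> \<exists>n::nat. f [^] n \<in> Q"
proof -
  define A where "A = {Q. ideal Q R \<and> I \<subseteq> Q \<and> (\<forall>n::nat. f [^] n \<notin> Q)}"
  have "\<exists>M\<in>A. \<forall>Q\<in>A. M \<subseteq> Q \<longrightarrow> Q = M"
  proof (rule subset_Zorn_nonempty)
    show "A \<noteq> {}" using I avoid by (auto simp: A_def)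
    fix C assume C: "C \<noteq> {}" "subset.chain A C"
    then have "subset.chain {I. ideal I R} C"
      by (auto simp: subset.chain_def A_def)
    from chain_Union_is_ideal[OF this] C have "ideal (\<Union>C) R" by simp
    moreover have "I \<subseteq> \<Union>C" using C by (fastforce simp: subset.chain_def A_def)
    ultimately show "\<Union>C \<in> A"
      using C by (auto simp: subset.chain_def A_def)
  qed
  then obtain M where M: "M \<in> A" "\<And>Q. Q \<in> A \<Longrightarrow> M \<subseteq> Q \<Longrightarrow> Q = M" by blast
  show ?thesis
  proof (rule that[of M])
    fix Q assume Q: "ideal Q R" "M \<subset> Q"
    then have "Q \<notin> A" using M(2)[of Q] by blast
    then show "\<exists>n::nat. f [^] n \<in> Q"
      using Q M(1) by (auto simp: A_def)
  qed (use M(1) in \<open>auto simp: A_def\<close>)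
qed

lemma (in cring) ideal_add_principal:
  assumes "ideal P R" "a \<in> carrier R"
  shows "ideal (P <+>\<^bsub>R\<^esub> PIdl a) R" "P \<subseteq> P <+>\<^bsub>R\<^esub> PIdl a" "a \<in> P <+>\<^bsub>R\<^esub> PIdl a"
    "\<And>z. z \<in> P <+>\<^bsub>R\<^esub> PIdl a \<Longrightarrow> \<exists>p\<in>P. \<exists>x\<in>carrier R. z = p \<oplus> x \<otimes> a"
proof -
  interpret P: ideal P R by fact
  show "ideal (P <+>\<^bsub>R\<^esub> PIdl a) R"
    using assms by (intro add_ideals cgenideal_ideal)
  show "P \<subseteq> P <+>\<^bsub>R\<^esub> PIdl a"
  proof
    fix p assume p: "p \<in> P"
    then have "p = p \<oplus> \<zero> \<otimes> a" using assms P.a_Hcarr by auto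
    with p show "p \<in> P <+>\<^bsub>R\<^esub> PIdl a"
      unfolding set_add_def' cgenideal_def by blast
  qed
  have "a = \<zero> \<oplus> \<one> \<otimes> a" using assms by auto
  then show "a \<in> P <+>\<^bsub>R\<^esub> PIdl a"
    unfolding set_add_def' cgenideal_def using P.zero_closed by blast
qed (auto simp: set_add_def' cgenideal_def)

text \<open>An ideal maximal among those missing the powers of \<open>f\<close> is prime: were
  neither \<open>a\<close> nor \<open>b\<close> in it, both enlarged ideals would contain a power of
  \<open>f\<close>, and the product of these powers would lie in the ideal as soon as
  \<open>a \<otimes> b\<close> does. This is the common source of the descriptions of radical
  ideals, nilpotents and units by primes.\<close>

lemma (in cring) exists_prime_avoiding:
  assumes I: "ideal I R" and f: "f \<in> carrier R" and avoid: "\<And>n::nat. f [^] n \<notin> I"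
  obtains P where "primeideal P R" "I \<subseteq> P" "f \<notin> P"
proof -
  obtain P where P: "ideal P R" "I \<subseteq> P" "\<And>n::nat. f [^] n \<notin> P"
    and max: "\<And>Q. ideal Q R \<Longrightarrow> P \<subset> Q \<Longrightarrow> \<exists>n::nat. f [^] n \<in> Q"
    using exists_ideal_maximal_avoiding_powers[OF assms] by metis
  interpret P: ideal P R by fact
  have "primeideal P R"
  proof (rule primeidealI)
    show "ideal P R" "cring R" by fact (rule cring_axioms)
    show "carrier R \<noteq> P" using P(3)[of 0] by auto
    fix a b assume ab: "a \<in> carrier R" "b \<in> carrier R" "a \<otimes> b \<in> P"
    show "a \<in> P \<or> b \<in> P"
    proof (rule ccontr)
      assume *: "\<not> (a \<in> P \<or> b \<in> P)"
      have "\<exists>n::nat. f [^] n \<in> P <+>\<^bsub>R\<^esub> PIdl a"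
        using ideal_add_principal[OF P(1) ab(1)] * by (intro max) auto
      moreover have "\<exists>n::nat. f [^] n \<in> P <+>\<^bsub>R\<^esub> PIdl b"
        using ideal_add_principal[OF P(1) ab(2)] * by (intro max) auto
      ultimately obtain n m :: nat and p q x y where
        n: "f [^] n = p \<oplus> x \<otimes> a" "p \<in> P" "x \<in> carrier R" and
        m: "f [^] m = q \<oplus> y \<otimes> b" "q \<in> P" "y \<in> carrier R"
        using ideal_add_principal(4)[OF P(1) ab(1)] ideal_add_principal(4)[OF P(1) ab(2)] by metis
      have pq: "p \<in> carrier R" "q \<in> carrier R"
        using n m P.a_Hcarr by auto
      have "f [^] (n + m) = f [^] n \<otimes> f [^] m"
        using f by (simp add: nat_pow_mult)
      also have "\<dots> = (q \<oplus> y \<otimes> b) \<otimes> p \<oplus> (x \<otimes> a \<otimes> q \<oplus> x \<otimes> y \<otimes> (a \<otimes> b))"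
        unfolding n m using n(3) m(3) ab pq by (simp add: r_distr l_distr a_ac m_ac)
      also have "\<dots> \<in> P"
        using n m ab pq
        by (intro P.a_closed P.I_l_closed[of p] P.I_l_closed[of q] P.I_l_closed[of "a \<otimes> b"]) auto
      finally show False using P(3) by blast
    qed
  qed
  then show ?thesis using that P(2) P(3)[of 1] f by auto
qed

section \<open>Ideals and primes of a polynomial ring\<close>

lemma ideal_mpolD:
  fixes J :: "('v, 'a::comm_ring_1) mpol set"
  assumes "ideal J (mpol_ring N)"
  shows "J \<subseteq> mpols N" "0 \<in> J" "f \<in> J \<Longrightarrow> g \<in> J \<Longrightarrow> f + g \<in> J"
    "f \<in> J \<Longrightarrow> p \<in> mpols N \<Longrightarrow> p * f \<in> J" "f \<in> J \<Longrightarrow> p \<in> mpols N \<Longrightarrow> f * p \<in> J"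
    "f \<in> J \<Longrightarrow> - f \<in> J" "f \<in> J \<Longrightarrow> g \<in> J \<Longrightarrow> f - g \<in> J"
proof -
  interpret ideal J "mpol_ring N" by fact
  show "J \<subseteq> mpols N" using a_subset by simp
  show "0 \<in> J" using additive_subgroup.zero_closed[OF is_additive_subgroup] by simp
  have add: "f + g \<in> J" if "f \<in> J" "g \<in> J" for f g
    using that additive_subgroup.a_closed[OF is_additive_subgroup, of f g] by simp
  then show "f \<in> J \<Longrightarrow> g \<in> J \<Longrightarrow> f + g \<in> J" .
  have l: "p * f \<in> J" if "f \<in> J" "p \<in> mpols N" for f p using that I_l_closed by simp
  then show "f \<in> J \<Longrightarrow> p \<in> mpols N \<Longrightarrow> p * f \<in> J" .
  show "f * p \<in> J" if "f \<in> J" "p \<in> mpols N" using that I_r_closed by simp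
  have m: "- f \<in> J" if "f \<in> J" for f using l[OF that, of "- 1"] by (simp add: mpols_uminus)
  then show "f \<in> J \<Longrightarrow> - f \<in> J" .
  show "f - g \<in> J" if "f \<in> J" "g \<in> J"
    using add[OF that(1) m[OF that(2)]] by simp
qed

lemma ideal_mpolI:
  fixes J :: "('v, 'a::comm_ring_1) mpol set"
  assumes "J \<subseteq> mpols N" "0 \<in> J" "\<And>f g. f \<in> J \<Longrightarrow> g \<in> J \<Longrightarrow> f + g \<in> J"
    "\<And>f p. f \<in> J \<Longrightarrow> p \<in> mpols N \<Longrightarrow> p * f \<in> J"
  shows "ideal J (mpol_ring N)"
proof -
  interpret R: cring "mpol_ring N :: ('v, 'a) mpol ring" by (rule cring_mpol_ring)
  have neg: "\<ominus>\<^bsub>mpol_ring N\<^esub> f = - f" if "f \<in> mpols N" for f :: "('v, 'a) mpol"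
    by (rule R.minus_equality) (use that in \<open>auto simp: mpols_uminus\<close>)
  have m: "- f \<in> J" if "f \<in> J" for f
    using assms(4)[OF that, of "- 1"] by (simp add: mpols_uminus)
  show ?thesis
  proof (rule idealI)
    show "ring (mpol_ring N :: ('v, 'a) mpol ring)" by (rule R.ring_axioms)
    show "subgroup J (add_monoid (mpol_ring N))"
    proof (rule R.add.subgroupI)
      fix f assume "f \<in> J"
      then show "\<ominus>\<^bsub>mpol_ring N\<^esub> f \<in> J"
        using m neg assms(1) by auto
    qed (use assms in auto)
  qed (use assms(4) in \<open>auto simp: mult.commute\<close>)
qed

lemma primeideal_mpolD:
  fixes J :: "('v, 'a::comm_ring_1) mpol set"
  assumes "primeideal J (mpol_ring N)"
  shows "ideal J (mpol_ring N)" "1 \<notin> J"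
    "f \<in> mpols N \<Longrightarrow> g \<in> mpols N \<Longrightarrow> f * g \<in> J \<Longrightarrow> f \<in> J \<or> g \<in> J"
    "f \<in> mpols N \<Longrightarrow> f ^ k \<in> J \<Longrightarrow> f \<in> J"
proof -
  interpret primeideal J "mpol_ring N" by fact
  show i: "ideal J (mpol_ring N)" by (rule is_ideal)
  show 1: "1 \<notin> J"
    using I_notcarr one_imp_carrier by auto
  have p: "f \<in> J \<or> g \<in> J" if "f \<in> mpols N" "g \<in> mpols N" "f * g \<in> J" for f g
    using I_prime that by simp
  then show "f \<in> mpols N \<Longrightarrow> g \<in> mpols N \<Longrightarrow> f * g \<in> J \<Longrightarrow> f \<in> J \<or> g \<in> J" .
  show "f \<in> J" if "f \<in> mpols N" "f ^ k \<in> J"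
    using that(2)
  proof (induction k)
    case (Suc k)
    then show ?case using p[of f "f ^ k"] that(1) mpols_power by auto
  qed (use 1 in auto)
qed

lemma primeideal_mpolI:
  fixes J :: "('v, 'a::comm_ring_1) mpol set"
  assumes "ideal J (mpol_ring N)" "1 \<notin> J"
    "\<And>f g. f \<in> mpols N \<Longrightarrow> g \<in> mpols N \<Longrightarrow> f * g \<in> J \<Longrightarrow> f \<in> J \<or> g \<in> J"
  shows "primeideal J (mpol_ring N)"
proof (rule primeidealI)
  show "carrier (mpol_ring N) \<noteq> J" using assms(2) by auto
qed (use assms cring_mpol_ring in auto)

section \<open>The Zariski topology through primes\<close>

lemma topspace_zariski:
  fixes I :: "('v, 'a::comm_ring_1) mpol set"
  shows "topspace (zariski N I) = {p. primeideal p (mpol_ring N) \<and> I \<subseteq> p}"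
proof
  let ?V = "{p. primeideal p (mpol_ring N) \<and> I \<subseteq> p}"
  have "1 \<notin> p" if "primeideal p (mpol_ring N)" for p :: "('v, 'a) mpol set"
    using primeideal_mpolD(2)[OF that] .
  then have "?V = {p. primeideal p (mpol_ring N) \<and> I \<subseteq> p \<and> \<not> {1} \<subseteq> p}"
    by auto
  moreover have "{1 :: ('v, 'a) mpol} \<subseteq> mpols N" by simp
  ultimately have "openin (zariski N I) ?V"
    unfolding openin_zariski by (intro exI[of _ "{1}"] conjI)
  then show "?V \<subseteq> topspace (zariski N I)"
    by (rule openin_subset)
  show "topspace (zariski N I) \<subseteq> ?V"
  proof
    fix p assume "p \<in> topspace (zariski N I)"
    then obtain U where U: "p \<in> U" "openin (zariski N I) U"
      unfolding topspace_def by auto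
    from U(2)[unfolded openin_zariski]
    obtain S where "U = {p. primeideal p (mpol_ring N) \<and> I \<subseteq> p \<and> \<not> S \<subseteq> p}"
      by (elim exE conjE)
    with U(1) show "p \<in> ?V" by simp
  qed
qed

lemma closedin_zariski_hypersurface:
  fixes I :: "('v, 'a::comm_ring_1) mpol set"
  assumes "f \<in> mpols N"
  shows "closedin (zariski N I) {p. primeideal p (mpol_ring N) \<and> I \<subseteq> p \<and> f \<in> p}"
proof -
  have "topspace (zariski N I) - {p. primeideal p (mpol_ring N) \<and> I \<subseteq> p \<and> f \<in> p} =
      {p. primeideal p (mpol_ring N) \<and> I \<subseteq> p \<and> \<not> {f} \<subseteq> p}"
    by (auto simp: topspace_zariski)
  then show ?thesis
    unfolding closedin_def openin_zariski using assms
    by (auto simp: topspace_zariski intro!: exI[of _ "{f}"])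
qed

lemma pow_mpol_ring: "f [^]\<^bsub>mpol_ring N\<^esub> (k::nat) = (f ^ k :: ('v, 'a::comm_ring_1) mpol)"
proof -
  interpret cring "mpol_ring N :: ('v, 'a) mpol ring" by (rule cring_mpol_ring)
  show ?thesis by (induction k) (auto simp: mult.commute)
qed

text \<open>If \<open>f * g\<close> is in \<open>I\<close>, the hypersurfaces of \<open>f\<close>
  and \<open>g\<close> cover the space, so one of them is everything; radicality then puts the
  polynomial into \<open>I\<close>, since a polynomial outside \<open>I\<close> is missed by some
  prime above \<open>I\<close>. Conversely a prime \<open>I\<close> is a point of its own space, and
  the only closed set containing this point is the whole space.\<close>

lemma irreducible_variety_iff_prime:
  fixes I :: "('v, 'a::field) mpol set"
  shows "irreducible_variety N I \<longleftrightarrow> finite N \<and> primeideal I (mpol_ring N)"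
proof
  assume irr: "irreducible_variety N I"
  then have fin: "finite N" and I: "ideal I (mpol_ring N)"
    and rad: "\<And>f r. f \<in> mpols N \<Longrightarrow> f ^ r \<in> I \<Longrightarrow> f \<in> I"
    and sp: "irreducible_space (zariski N I)"
    by (auto simp: irreducible_variety_def affine_variety_def)
  interpret R: cring "mpol_ring N :: ('v, 'a) mpol ring" by (rule cring_mpol_ring)
  let ?V = "\<lambda>f. {p. primeideal p (mpol_ring N) \<and> I \<subseteq> p \<and> f \<in> p}"
  have sep: "\<exists>p. primeideal p (mpol_ring N) \<and> I \<subseteq> p \<and> f \<notin> p" if "f \<in> mpols N" "f \<notin> I" for f
    using R.exists_prime_avoiding[OF I, of f] rad that by (simp add: pow_mpol_ring) metis
  have "primeideal I (mpol_ring N)"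
  proof (rule primeideal_mpolI[OF I])
    obtain p where "primeideal p (mpol_ring N)" "I \<subseteq> p"
      using sp by (auto simp: irreducible_space_def topspace_zariski)
    then show "1 \<notin> I" using primeideal_mpolD(2) by blast
    fix f g assume fg: "f \<in> mpols N" "g \<in> mpols N" "f * g \<in> I"
    have "?V f \<union> ?V g = topspace (zariski N I)"
      unfolding topspace_zariski using fg primeideal_mpolD(3)[of _ N f g] by blast
    then have "?V f = topspace (zariski N I) \<or> ?V g = topspace (zariski N I)"
      using sp closedin_zariski_hypersurface[of f N I] closedin_zariski_hypersurface[of g N I] fg
      unfolding irreducible_space_def by blast
    then show "f \<in> I \<or> g \<in> I"
      using sep[of f] sep[of g] fg unfolding topspace_zariski by blast
  qed
  with fin show "finite N \<and> primeideal I (mpol_ring N)" by simp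
next
  assume "finite N \<and> primeideal I (mpol_ring N)"
  then have fin: "finite N" and I: "primeideal I (mpol_ring N)" by auto
  have gen: "A = topspace (zariski N I)" if A: "closedin (zariski N I) A" "I \<in> A" for A
  proof -
    obtain S where S: "topspace (zariski N I) - A =
        {p. primeideal p (mpol_ring N) \<and> I \<subseteq> p \<and> \<not> S \<subseteq> p}"
      using A(1) by (auto simp: closedin_def openin_zariski)
    with A(2) I have "S \<subseteq> I" by auto
    with S have "topspace (zariski N I) - A = {}" by auto
    with A(1) show ?thesis by (auto dest: closedin_subset)
  qed
  have I_in: "I \<in> topspace (zariski N I)"
    using I by (simp add: topspace_zariski)
  have "irreducible_space (zariski N I)"
    unfolding irreducible_space_def
  proof (intro conjI allI impI)
    show "topspace (zariski N I) \<noteq> {}" using I_in by blast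
    fix A B assume AB: "closedin (zariski N I) A \<and> closedin (zariski N I) B \<and> A \<union> B = topspace (zariski N I)"
    then have "I \<in> A \<or> I \<in> B" using I_in by blast
    then show "A = topspace (zariski N I) \<or> B = topspace (zariski N I)"
      using gen AB by blast
  qed
  then show "irreducible_variety N I"
    unfolding irreducible_variety_def affine_variety_def
    by (intro conjI ballI allI impI fin primeideal_mpolD(1)[OF I]) (rule primeideal_mpolD(4)[OF I])
qed

text \<open>Basic open sets suffice, and the one given by \<open>f\<close> is nonempty for
  \<open>f\<close> outside \<open>I\<close> because the prime \<open>I\<close> is itself a point of
  it.\<close>

lemma zariski_dense_in_iff:
  fixes I :: "('v, 'a::field) mpol set"
  assumes I: "primeideal I (mpol_ring N)"
  shows "zariski_dense_in N I P \<longleftrightarrow>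
    (\<forall>f\<in>mpols N. f \<notin> I \<longrightarrow> (\<exists>p\<in>P. primeideal p (mpol_ring N) \<and> I \<subseteq> p \<and> f \<notin> p))"
proof
  assume *: "zariski_dense_in N I P"
  show "\<forall>f\<in>mpols N. f \<notin> I \<longrightarrow> (\<exists>p\<in>P. primeideal p (mpol_ring N) \<and> I \<subseteq> p \<and> f \<notin> p)"
  proof (intro ballI impI)
    fix f assume f: "f \<in> mpols N" "f \<notin> I"
    let ?U = "{p. primeideal p (mpol_ring N) \<and> I \<subseteq> p \<and> \<not> {f} \<subseteq> p}"
    have op: "openin (zariski N I) ?U"
      unfolding openin_zariski using f by (intro exI[of _ "{f}"]) auto
    have IU: "I \<in> ?U" using f I by auto
    have "I \<in> zariski N I closure_of P"
      using * I by (simp add: zariski_dense_in_def topspace_zariski)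
    then have "\<forall>T. I \<in> T \<and> openin (zariski N I) T \<longrightarrow> (\<exists>y. y \<in> P \<and> y \<in> T)"
      by (simp add: in_closure_of)
    from spec[OF this, of ?U] op IU show "\<exists>p\<in>P. primeideal p (mpol_ring N) \<and> I \<subseteq> p \<and> f \<notin> p" by auto
  qed
next
  assume *: "\<forall>f\<in>mpols N. f \<notin> I \<longrightarrow> (\<exists>p\<in>P. primeideal p (mpol_ring N) \<and> I \<subseteq> p \<and> f \<notin> p)"
  have "x \<in> zariski N I closure_of P" if x: "x \<in> topspace (zariski N I)" for x
    unfolding in_closure_of
  proof (intro conjI allI impI x)
    fix U assume U: "x \<in> U \<and> openin (zariski N I) U"
    then obtain S where S: "S \<subseteq> mpols N" "U = {p. primeideal p (mpol_ring N) \<and> I \<subseteq> p \<and> \<not> S \<subseteq> p}"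
      by (auto simp: openin_zariski)
    with U obtain f where "f \<in> S" "f \<notin> x" "I \<subseteq> x" by auto
    with S(1) * obtain p where "p \<in> P" "primeideal p (mpol_ring N)" "I \<subseteq> p" "f \<notin> p"
      by blast
    with S(2) \<open>f \<in> S\<close> show "\<exists>y. y \<in> P \<and> y \<in> U" by auto
  qed
  then show "zariski_dense_in N I P"
    unfolding zariski_dense_in_def by (auto simp: in_closure_of)
qed

text \<open>The ideal of the locus of \<open>b\<close> over \<open>K\<close>. By
  \<open>generic_point\<close> every prime in finitely many variables has this form for a tuple
  \<open>b\<close> of the universal domain, and most arguments below pass through such a
  tuple.\<close>

definition vanishing_ideal :: "('a::field \<Rightarrow> 'b::field) \<Rightarrow> 'v set \<Rightarrow> ('v \<Rightarrow> 'b) \<Rightarrow> ('v, 'a) mpol set" where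
  "vanishing_ideal c N b = {f \<in> mpols N. mp_eval c b f = 0}"

lemma point_ideal_eq: "point_ideal N x = vanishing_ideal id N x"
  by (simp add: point_ideal_def vanishing_ideal_def)

lemma primeideal_vanishing_ideal:
  assumes c: "type_hom c"
  shows "primeideal (vanishing_ideal c N b) (mpol_ring N)"
proof (rule primeideal_mpolI)
  show "ideal (vanishing_ideal c N b) (mpol_ring N)"
    by (rule ideal_mpolI)
      (auto simp: vanishing_ideal_def mp_eval_ring_simps[OF c] mpols_add mpols_mult)
qed (auto simp: vanishing_ideal_def mp_eval_ring_simps[OF c])

lemma rational_points_alt:
  fixes I :: "('v, 'a::field) mpol set"
  assumes "I \<subseteq> mpols N"
  shows "x \<in> rational_points N I \<longleftrightarrow> x \<in> N \<rightarrow>\<^sub>E UNIV \<and> I \<subseteq> point_ideal N x"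
  using assms by (auto simp: rational_points_def points_def point_ideal_def)

lemma rational_points_dense_iff:
  fixes I :: "('v, 'a::field) mpol set"
  assumes I: "primeideal I (mpol_ring N)" and A: "A \<subseteq> rational_points N I"
  shows "zariski_dense_in N I (point_ideal N ` A) \<longleftrightarrow>
    (\<forall>f\<in>mpols N. f \<notin> I \<longrightarrow> (\<exists>x\<in>A. mp_eval id x f \<noteq> 0))"
proof -
  have "I \<subseteq> mpols N"
    using ideal_mpolD(1) primeideal_mpolD(1)[OF I] by blast
  then have "I \<subseteq> point_ideal N x" if "x \<in> A" for x
    using A that rational_points_alt by blast
  moreover have "primeideal (point_ideal N x) (mpol_ring N)" for x :: "'v \<Rightarrow> 'a"
    unfolding point_ideal_eq by (rule primeideal_vanishing_ideal) simp
  ultimately show ?thesis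
    unfolding zariski_dense_in_iff[OF I] by (auto simp: point_ideal_def)
qed

section \<open>Jacobian ranks\<close>

interpretation fun_vs: vector_space "\<lambda>(a::'b::field) (u :: 'v \<Rightarrow> 'b). (\<lambda>v. a * u v)"
  by unfold_locales (auto simp: fun_eq_iff algebra_simps)

lemma sum_fun_apply: "(\<Sum>a\<in>A. f a) x = (\<Sum>a\<in>A. f a x)"
  by (induction A rule: infinite_finite_induct) auto

text \<open>Stated for families so that coincidences need no separate treatment: two equal members
  satisfy the relation with coefficients 1 and -1.\<close>

lemma fun_vs_independent_family:
  fixes g :: "'i \<Rightarrow> 'v \<Rightarrow> 'b::field"
  assumes fin: "finite S"
    and ind: "\<And>a. (\<And>v. (\<Sum>i\<in>S. a i * g i v) = 0) \<Longrightarrow> \<forall>i\<in>S. a i = 0"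
  shows "inj_on g S" "fun_vs.independent (g ` S)"
proof -
  show inj: "inj_on g S"
  proof (rule inj_onI, rule ccontr)
    fix i j assume ij: "i \<in> S" "j \<in> S" "g i = g j" "i \<noteq> j"
    define a where "a = (\<lambda>k. if k = i then 1 else if k = j then - 1 else (0::'b))"
    have "(\<Sum>k\<in>S. a k * g k v) = 0" for v
    proof -
      have "(\<Sum>k\<in>S. a k * g k v) = (\<Sum>k\<in>{i, j}. a k * g k v)"
        by (rule sum.mono_neutral_right) (use ij fin in \<open>auto simp: a_def\<close>)
      also have "\<dots> = 0" using ij by (simp add: a_def)
      finally show ?thesis .
    qed
    then have "a i = 0" using ind[of a] ij by blast
    then show False by (simp add: a_def)
  qed
  show "fun_vs.independent (g ` S)"
  proof
    assume "fun_vs.dependent (g ` S)"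
    then obtain u where u: "\<exists>v\<in>g ` S. u v \<noteq> 0" "(\<Sum>v\<in>g ` S. (\<lambda>x. u v * v x)) = 0"
      using fun_vs.dependent_finite[of "g ` S"] fin by auto
    have "(\<Sum>i\<in>S. u (g i) * g i v) = 0" for v
    proof -
      have "(\<Sum>i\<in>S. u (g i) * g i v) = (\<Sum>w\<in>g ` S. u w * w v)"
        by (subst sum.reindex[OF inj]) (simp add: comp_def)
      also have "\<dots> = (\<Sum>w\<in>g ` S. (\<lambda>x. u w * w x)) v"
        by (simp add: sum_fun_apply)
      finally show ?thesis using u(2) by simp
    qed
    from ind[of "\<lambda>i. u (g i)", OF this] u(1) show False by auto
  qed
qed

lemma fun_vs_span_family:
  fixes g :: "'i \<Rightarrow> 'v \<Rightarrow> 'b::field"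
  shows "(\<lambda>v. \<Sum>i\<in>S. a i * g i v) \<in> fun_vs.span (g ` S)"
proof -
  have "(\<Sum>i\<in>S. (\<lambda>v. a i * g i v)) \<in> fun_vs.span (g ` S)"
    by (intro fun_vs.span_sum fun_vs.span_scale fun_vs.span_base) auto
  moreover have "(\<Sum>i\<in>S. (\<lambda>v. a i * g i v)) = (\<lambda>v. \<Sum>i\<in>S. a i * g i v)"
    by (rule ext) (simp add: sum_fun_apply)
  ultimately show ?thesis by simp
qed

text \<open>In a vanishing linear combination take the index of highest order with nonzero
  coefficient. At that coordinate all other summands are 0, and only the nonzero diagonal entry
  remains.\<close>

lemma fun_vs_dim_triangular:
  fixes g :: "'v \<Rightarrow> 'v \<Rightarrow> 'b::field" and ord :: "'v \<Rightarrow> nat"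
  assumes fin: "finite S" and inj: "inj_on ord S"
    and diag: "\<And>v. v \<in> S \<Longrightarrow> g v v \<noteq> 0"
    and upper: "\<And>v w. v \<in> S \<Longrightarrow> w \<in> S \<Longrightarrow> ord v < ord w \<Longrightarrow> g v w = 0"
    and "g ` S \<subseteq> W" and "W \<subseteq> fun_vs.span (g ` S)"
  shows "fun_vs.dim W = card S"
proof -
  have ind: "\<forall>i\<in>S. a i = 0" if a: "\<And>v. (\<Sum>i\<in>S. a i * g i v) = 0" for a
  proof (rule ccontr)
    assume "\<not> (\<forall>i\<in>S. a i = 0)"
    then have ne: "ord ` {i \<in> S. a i \<noteq> 0} \<noteq> {}" "finite (ord ` {i \<in> S. a i \<noteq> 0})" using fin by auto
    from Max_in[OF ne(2,1)] obtain v where v: "v \<in> S" "a v \<noteq> 0" "ord v = Max (ord ` {i \<in> S. a i \<noteq> 0})"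
      by force
    have "a i * g i v = 0" if i: "i \<in> S" "i \<noteq> v" for i
    proof (cases "a i = 0")
      case False
      then have "ord i \<le> ord v" using v(3) ne(2) i by auto
      with i v(1) inj have "ord i < ord v" by (metis inj_onD le_neq_implies_less)
      then show ?thesis using upper[of i v] i v by simp
    qed simp
    then have "(\<Sum>i\<in>S - {v}. a i * g i v) = 0"
      by (intro sum.neutral) auto
    then have "(\<Sum>i\<in>S. a i * g i v) = a v * g v v"
      using fin v(1) by (subst sum.remove[of _ v]) auto
    then show False using a[of v] diag v by simp
  qed
  note fam = fun_vs_independent_family[where g = g, OF fin ind]
  show ?thesis
    by (rule fun_vs.dim_unique[of "g ` S"]) (use assms fam in \<open>auto simp: card_image\<close>)
qed

text \<open>The coordinate space on \<open>N\<close>, realised inside the functions on all variables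
  because \<open>smooth_at\<close> takes its rank there.\<close>

definition supported :: "'v set \<Rightarrow> ('v \<Rightarrow> 'b::field) set" where
  "supported N = {u. \<forall>v. v \<notin> N \<longrightarrow> u v = 0}"

lemma supported_span:
  fixes N :: "'v set"
  assumes "finite N"
  shows "supported N = fun_vs.span ((\<lambda>w v. if v = w then 1 else (0::'b::field)) ` N)"
    and "fun_vs.independent ((\<lambda>w v. if v = w then 1 else (0::'b)) ` N)"
    and "card ((\<lambda>w v. if v = w then 1 else (0::'b)) ` N) = card N"
proof -
  let ?e = "\<lambda>w v. if v = w then 1 else (0::'b)"
  have sub: "fun_vs.subspace (supported N :: ('v \<Rightarrow> 'b) set)"
    by (auto simp: supported_def intro!: fun_vs.subspaceI)
  show "supported N = fun_vs.span (?e ` N)"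
  proof
    show "supported N \<subseteq> fun_vs.span (?e ` N)"
    proof
      fix u :: "'v \<Rightarrow> 'b" assume "u \<in> supported N"
      have "u = (\<lambda>v. \<Sum>w\<in>N. u w * ?e w v)"
      proof (intro ext)
        fix v
        have "(\<Sum>w\<in>N. u w * ?e w v) = (\<Sum>w\<in>N. if w = v then u w else 0)"
          by (intro sum.cong) auto
        with \<open>u \<in> supported N\<close> assms show "u v = (\<Sum>w\<in>N. u w * ?e w v)"
          by (auto simp: supported_def)
      qed
      then show "u \<in> fun_vs.span (?e ` N)"
        using fun_vs_span_family[where S = N and a = u and g = ?e] by simp
    qed
    show "fun_vs.span (?e ` N) \<subseteq> supported N"
      by (rule fun_vs.span_minimal[OF _ sub]) (auto simp: supported_def)
  qed
  have ind: "\<forall>i\<in>N. a i = 0" if "\<And>v. (\<Sum>i\<in>N. a i * ?e i v) = 0" for a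
  proof
    fix i assume i: "i \<in> N"
    have "(\<Sum>j\<in>N. a j * ?e j i) = (\<Sum>j\<in>N. if j = i then a j else 0)"
      by (intro sum.cong) auto
    with that[of i] i assms show "a i = 0" by simp
  qed
  note fam = fun_vs_independent_family[where g = ?e, OF assms ind]
  show "fun_vs.independent (?e ` N)" "card (?e ` N) = card N"
    using fam by (auto simp: card_image)
qed

text \<open>\<open>A\<close> maps \<open>W'\<close> into the span of \<open>W\<close>, and
  \<open>B\<close> is a right inverse of \<open>A\<close> modulo \<open>W\<close>. Hence
  \<open>B\<close> embeds a complement of \<open>W\<close> into a complement of \<open>W'\<close>: a
  relation between the image and \<open>W'\<close> is carried by \<open>A\<close> into the span of
  \<open>W\<close>, where the complement admits none. Two opposite instances give equality of
  codimensions.\<close>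

lemma fun_vs_codim_le:
  fixes W :: "('v \<Rightarrow> 'b::field) set" and W' :: "('w \<Rightarrow> 'b) set"
    and A :: "('w \<Rightarrow> 'b) \<Rightarrow> 'v \<Rightarrow> 'b" and B :: "('v \<Rightarrow> 'b) \<Rightarrow> 'w \<Rightarrow> 'b"
  assumes N: "finite N" and N': "finite N'"
    and W: "W \<subseteq> supported N" and W': "W' \<subseteq> supported N'"
    and A: "\<And>u u' v. A (\<lambda>x. u x + u' x) v = A u v + A u' v" "\<And>a u v. A (\<lambda>x. a * u x) v = a * A u v"
    and AW: "\<And>u. u \<in> W' \<Longrightarrow> A u \<in> fun_vs.span W"
    and B: "\<And>u. u \<in> supported N \<Longrightarrow> B u \<in> supported N'"
    and AB: "\<And>u. u \<in> supported N \<Longrightarrow> (\<lambda>v. A (B u) v - u v) \<in> fun_vs.span W"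
  shows "card N + fun_vs.dim W' \<le> card N' + fun_vs.dim W"
proof -
  note sp = supported_span[OF N, where 'b='b] and sp' = supported_span[OF N', where 'b='b]
  have A0: "A 0 = 0" using A(2)[of 0] by (auto simp: fun_eq_iff zero_fun_def)
  have Asum: "A (\<lambda>x. \<Sum>i\<in>I. a i * g i x) = (\<lambda>v. \<Sum>i\<in>I. a i * A (g i) v)" if "finite I"
    for I :: "('v \<Rightarrow> 'b) set" and a g
    using that by (induction I rule: finite_induct) (use A0 A in \<open>auto simp: zero_fun_def fun_eq_iff\<close>)
  have AspanW: "A u \<in> fun_vs.span W" if "u \<in> fun_vs.span W'" for u
    using that
  proof (induction rule: fun_vs.span_induct_alt)
    case base
    then show ?case using A0 fun_vs.span_zero[of W] by (simp add: zero_fun_def)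
  next
    case (step a x y)
    have eq: "A ((\<lambda>v. a * x v) + y) = (\<lambda>v. a * A x v) + A y"
      by (rule ext) (use A in \<open>simp add: plus_fun_def\<close>)
    show ?case unfolding eq by (intro fun_vs.span_add fun_vs.span_scale AW step)
  qed
  obtain B0 where B0: "B0 \<subseteq> W" "fun_vs.independent B0" "W \<subseteq> fun_vs.span B0" "card B0 = fun_vs.dim W"
    using fun_vs.basis_exists[of W] by metis
  obtain B0' where B0': "B0' \<subseteq> W'" "fun_vs.independent B0'" "W' \<subseteq> fun_vs.span B0'" "card B0' = fun_vs.dim W'"
    using fun_vs.basis_exists[of W'] by metis
  obtain B1 where B1: "B0 \<subseteq> B1" "B1 \<subseteq> supported N" "fun_vs.independent B1" "supported N \<subseteq> fun_vs.span B1"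
    using fun_vs.maximal_independent_subset_extend[of B0 "supported N"] B0 W by blast
  let ?E = "(\<lambda>w v. if v = w then 1 else (0::'b)) ` N"
  let ?E' = "(\<lambda>w v. if v = w then 1 else (0::'b)) ` N'"
  have "B1 \<subseteq> fun_vs.span ?E" using B1(2) sp(1) by simp
  then have finB1: "finite B1"
    using fun_vs.independent_span_bound[OF finite_imageI[OF N] B1(3)] by blast
  have "B0' \<subseteq> fun_vs.span ?E'" using B0'(1) W' sp'(1) by simp
  then have finB0': "finite B0'"
    using fun_vs.independent_span_bound[OF finite_imageI[OF N'] B0'(2)] by blast
  have "card B1 = card N"
  proof -
    have "fun_vs.dim (supported N :: ('v \<Rightarrow> 'b) set) = card B1"
      by (rule fun_vs.dim_unique[OF B1(2,4,3) refl])
    moreover have "fun_vs.dim (supported N :: ('v \<Rightarrow> 'b) set) = card N"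
      by (rule fun_vs.dim_unique[of ?E]) (use sp fun_vs.span_superset[of ?E] in simp_all)
    ultimately show ?thesis by simp
  qed
  have finB0: "finite B0" using finB1 B1 finite_subset by blast
  define C where "C = B1 - B0"
  have cardC: "card C + fun_vs.dim W = card N"
    using \<open>card B1 = card N\<close> B1(1) finB1 finB0 B0(4) card_mono[of B1 B0]
    by (simp add: C_def card_Diff_subset)
  have finC: "finite C" using finB1 by (simp add: C_def)
  have spanW: "fun_vs.span W = fun_vs.span B0"
    by (intro equalityI fun_vs.span_minimal fun_vs.span_mono fun_vs.subspace_span B0)
  have spanW': "fun_vs.span B0' \<subseteq> fun_vs.span W'"
    using B0' by (intro fun_vs.span_mono)
  \<comment> \<open>A basis of \<open>W'\<close> together with the images under \<open>B\<close> of
    the basis \<open>C\<close> of a complement of \<open>W\<close>. The index set is a disjoint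
    union because members might coincide; that they do not is part of the independence to be
    shown.\<close>
  define g where "g = case_sum (\<lambda>b. b) B"
  let ?S = "Inl ` B0' \<union> Inr ` C"
  have finS: "finite ?S" using finB0' finC by auto
  have sumS: "(\<Sum>i\<in>?S. h i) = (\<Sum>b\<in>B0'. h (Inl b)) + (\<Sum>x\<in>C. h (Inr x))" for h :: "_ \<Rightarrow> 'b"
    using finB0' finC by (subst sum.union_disjoint) (auto simp: sum.reindex)
  have ind: "\<forall>i\<in>?S. a i = 0" if a: "\<And>v. (\<Sum>i\<in>?S. a i * g i v) = 0" for a
  proof -
    have e: "(\<Sum>b\<in>B0'. a (Inl b) * b v) + (\<Sum>x\<in>C. a (Inr x) * B x v) = 0" for v
      using a[of v] by (simp add: sumS g_def)
    let ?u = "\<lambda>v. \<Sum>x\<in>C. a (Inr x) * B x v"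
    have "?u = (\<lambda>v. \<Sum>b\<in>B0'. (- a (Inl b)) * b v)"
      using e by (auto simp: fun_eq_iff sum_negf add_eq_0_iff)
    then have "?u \<in> fun_vs.span W'"
      using fun_vs_span_family[where S = B0' and a = "\<lambda>b. - a (Inl b)" and g = "\<lambda>b. b"] spanW' by auto
    then have "A ?u \<in> fun_vs.span W" by (rule AspanW)
    then have 1: "(\<lambda>v. \<Sum>x\<in>C. a (Inr x) * A (B x) v) \<in> fun_vs.span W"
      using Asum[OF finC] by simp
    have 2: "(\<Sum>x\<in>C. (\<lambda>v. a (Inr x) * (A (B x) v - x v))) \<in> fun_vs.span W"
      using B1(2) by (intro fun_vs.span_sum fun_vs.span_scale AB) (auto simp: C_def)
    have 3: "(\<Sum>x\<in>C. (\<lambda>v. a (Inr x) * (A (B x) v - x v))) =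
       (\<lambda>v. \<Sum>x\<in>C. a (Inr x) * A (B x) v) - (\<lambda>v. \<Sum>x\<in>C. a (Inr x) * x v)"
      by (rule ext) (simp add: sum_fun_apply
          right_diff_distrib sum_subtractf)
    \<comment> \<open>\<open>A\<close> undoes \<open>B\<close> modulo \<open>W\<close>, so the
      combination of \<open>C\<close> itself falls into the span of \<open>W\<close>.\<close>
    have "(\<lambda>v. \<Sum>x\<in>C. a (Inr x) * x v) \<in> fun_vs.span W"
      using fun_vs.span_diff[OF 1 2] unfolding 3 by (simp only: diff_diff_eq2 add_diff_cancel_left')
    then have "(\<lambda>v. \<Sum>x\<in>C. a (Inr x) * x v) \<in> fun_vs.span B0" using spanW by simp
    then obtain t where t: "(\<lambda>v. \<Sum>x\<in>C. a (Inr x) * x v) = (\<Sum>b\<in>B0. (\<lambda>v. t b * b v))"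
      unfolding fun_vs.span_finite[OF finB0] by auto
    define r where "r = (\<lambda>b. if b \<in> B0 then - t b else a (Inr b))"
    have "(\<Sum>b\<in>B1. (\<lambda>v. r b * b v)) = 0"
    proof (rule ext)
      fix v
      have "(\<Sum>b\<in>B1. (\<lambda>v. r b * b v)) v = (\<Sum>b\<in>C. r b * b v) + (\<Sum>b\<in>B0. r b * b v)"
        using B1(1) finB1 by (simp add: sum_fun_apply C_def sum.subset_diff)
      also have "(\<Sum>b\<in>C. r b * b v) = (\<Sum>b\<in>C. a (Inr b) * b v)"
        by (intro sum.cong) (auto simp: r_def C_def)
      also have "\<dots> = (\<Sum>b\<in>B0. t b * b v)"
        using fun_cong[OF t, of v] by (simp add: sum_fun_apply)
      also have "(\<Sum>b\<in>B0. r b * b v) = - (\<Sum>b\<in>B0. t b * b v)"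
        by (simp add: r_def sum_negf)
      finally show "(\<Sum>b\<in>B1. (\<lambda>v. r b * b v)) v = 0 v" by simp
    qed
    then have "r b = 0" if b: "b \<in> B1" for b
      using fun_vs.dependent_finite[OF finB1] B1(3) b by blast
    then have aC: "a (Inr x) = 0" if "x \<in> C" for x
    proof -
      have "x \<in> B1" "x \<notin> B0" using that by (auto simp: C_def)
      then show ?thesis using \<open>\<And>b. b \<in> B1 \<Longrightarrow> r b = 0\<close>[of x] by (simp add: r_def)
    qed
    then have z: "(\<Sum>b\<in>B0'. (\<lambda>v. a (Inl b) * b v)) = 0"
      using e by (auto simp: fun_eq_iff sum_fun_apply)
    have "a (Inl b) = 0" if b: "b \<in> B0'" for b
    proof (rule ccontr)
      assume "a (Inl b) \<noteq> 0"
      with b z have "fun_vs.dependent B0'"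
        unfolding fun_vs.dependent_finite[OF finB0']
        by (intro exI[of _ "\<lambda>b. a (Inl b)"] conjI bexI[of _ b])
      with B0'(2) show False by simp
    qed
    with aC show ?thesis by auto
  qed
  note fam = fun_vs_independent_family[where g = g, OF finS ind]
  have "g ` ?S \<subseteq> supported N'"
    using B0'(1) W' B1(2) B by (auto simp: g_def C_def)
  then have "card (g ` ?S) \<le> card N'"
    using fun_vs.independent_span_bound[of ?E', OF finite_imageI[OF N'] fam(2)] sp'(1,3) by simp
  moreover have "card (g ` ?S) = card B0' + card C"
  proof -
    have "card (g ` ?S) = card ?S" using fam(1) by (rule card_image)
    also have "\<dots> = card (Inl ` B0' :: (('w \<Rightarrow> 'b) + ('v \<Rightarrow> 'b)) set) + card (Inr ` C :: (('w \<Rightarrow> 'b) + ('v \<Rightarrow> 'b)) set)"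
      by (rule card_Un_disjoint) (use finB0' finC in auto)
    finally show ?thesis by (simp add: card_image)
  qed
  ultimately show ?thesis
    using B0'(4) cardC by linarith
qed

section \<open>Gradients and smoothness under a change of generators\<close>

definition grad :: "('a::field \<Rightarrow> 'b::field) \<Rightarrow> ('v \<Rightarrow> 'b) \<Rightarrow> ('v, 'a) mpol \<Rightarrow> 'v \<Rightarrow> 'b" where
  "grad c x f = (\<lambda>v. mp_eval c x (mp_deriv v f))"

lemma smooth_at_iff: "smooth_at c N I x \<longleftrightarrow> fun_vs.dim (grad c x ` I) + variety_dim N I = card N"
  by (simp add: smooth_at_def grad_def[abs_def])

lemma grad_supported: "type_hom c \<Longrightarrow> f \<in> mpols N \<Longrightarrow> grad c x f \<in> supported N"
  by (auto simp: grad_def supported_def mp_deriv_outside mp_eval_ring_simps)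

lemma grad_subst:
  fixes s :: "'v \<Rightarrow> ('w, 'a::field) mpol"
  assumes c: "type_hom c" and N: "finite N" and f: "f \<in> mpols N"
    and y: "\<And>v. v \<in> N \<Longrightarrow> y v = mp_eval c x (s v)"
  shows "grad c x (mp_eval mconst s f) w = (\<Sum>v\<in>N. grad c y f v * grad c x (s v) w)"
proof -
  have "mp_eval c x (mp_eval mconst s (mp_deriv v f)) = mp_eval c y (mp_deriv v f)" for v
    unfolding mp_eval_subst[OF c] using y by (intro mp_eval_cong[OF c, of _ N] mpols_deriv f) auto
  then show ?thesis
    unfolding grad_def mp_deriv_subst[OF N f] by (simp add: mp_eval_sum[OF c] mp_eval_mult[OF c])
qed

text \<open>Two tuples generating the same \<open>K\<close>-algebra: \<open>b' = \<phi>(b)\<close> and \<open>b = \<psi>(b')\<close>.\<close>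

locale interdefinable =
  fixes c :: "'a::field \<Rightarrow> 'f::field" and N :: "'v set" and N' :: "'w set"
    and b :: "'v \<Rightarrow> 'f" and b' :: "'w \<Rightarrow> 'f"
    and \<phi> :: "'w \<Rightarrow> ('v, 'a) mpol" and \<psi> :: "'v \<Rightarrow> ('w, 'a) mpol"
  assumes c: "type_hom c" and N: "finite N" and N': "finite N'"
    and \<phi>: "\<And>v. v \<in> N' \<Longrightarrow> \<phi> v \<in> mpols N" and \<psi>: "\<And>v. v \<in> N \<Longrightarrow> \<psi> v \<in> mpols N'"
    and b': "\<And>v. v \<in> N' \<Longrightarrow> b' v = mp_eval c b (\<phi> v)"
    and b: "\<And>v. v \<in> N \<Longrightarrow> b v = mp_eval c b' (\<psi> v)"
begin

abbreviation "I \<equiv> vanishing_ideal c N b"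
abbreviation "I' \<equiv> vanishing_ideal c N' b'"

lemma eval_\<phi>: "f \<in> mpols N' \<Longrightarrow> mp_eval c b (mp_eval mconst \<phi> f) = mp_eval c b' f"
  unfolding mp_eval_subst[OF c] using b' by (intro mp_eval_cong[OF c, of _ N']) auto

lemma pullback_in: "f \<in> I' \<Longrightarrow> mp_eval mconst \<phi> f \<in> I"
  using \<phi> by (auto simp: vanishing_ideal_def eval_\<phi> intro: mpols_subst)

lemma swap: "interdefinable c N' N b' b \<psi> \<phi>"
  by unfold_locales (use c N N' \<phi> \<psi> b b' in auto)

lemma image_point:
  assumes d: "type_hom d" and x: "x \<in> points d N I"
  defines "y \<equiv> \<lambda>v\<in>N'. mp_eval d x (\<phi> v)"
  shows "y \<in> points d N' I'" "\<And>v. v \<in> N \<Longrightarrow> mp_eval d y (\<psi> v) = x v"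
proof -
  have y: "mp_eval d y f = mp_eval d x (mp_eval mconst \<phi> f)" if "f \<in> mpols N'" for f
    unfolding mp_eval_subst[OF d] by (rule mp_eval_cong[OF d that]) (auto simp: y_def)
  have "mp_eval d y f = 0" if "f \<in> I'" for f
    using x pullback_in[OF that] y[of f] that by (auto simp: points_def vanishing_ideal_def)
  then show "y \<in> points d N' I'"
    by (auto simp: points_def y_def)
  fix v assume v: "v \<in> N"
  interpret s: interdefinable c N' N b' b \<psi> \<phi> by (rule swap)
  have "mp_eval mconst \<phi> (\<psi> v) - mvar v \<in> I"
    using v b[OF v] \<phi> \<psi> eval_\<phi>[of "\<psi> v"]
    by (auto simp: vanishing_ideal_def mp_eval_ring_simps[OF c] intro!: mpols_minus mpols_subst[of _ N'] mpols_var)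
  then have "mp_eval d x (mp_eval mconst \<phi> (\<psi> v) - mvar v) = 0"
    using x by (auto simp: points_def)
  then show "mp_eval d y (\<psi> v) = x v"
    using y[OF \<psi>[OF v]] by (simp add: mp_eval_ring_simps[OF d])
qed

text \<open>By the chain rule the Jacobians of \<open>\<phi>\<close> and \<open>\<psi>\<close> act
  on gradients as the maps \<open>A\<close> and \<open>B\<close> of \<open>fun_vs_codim_le\<close>:
  \<open>\<phi>\<close> pulls relations of \<open>b'\<close> back to relations of \<open>b\<close>,
  and substituting \<open>\<phi>\<close> into \<open>\<psi> v\<close> gives \<open>v\<close> up to a
  relation of \<open>b\<close>. Only the values of \<open>y\<close> on \<open>N'\<close> matter,
  which lets the opposite instance return to the given \<open>x\<close>.\<close>

lemma codim_le:
  fixes d :: "'a \<Rightarrow> 'e::field"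
  assumes d: "type_hom d" and x: "x \<in> points d N I"
    and yeq: "\<And>v. v \<in> N' \<Longrightarrow> y v = mp_eval d x (\<phi> v)"
  shows "card N + fun_vs.dim (grad d y ` I') \<le> card N' + fun_vs.dim (grad d x ` I)"
proof -
  let ?A = "\<lambda>u w. \<Sum>v\<in>N'. u v * grad d x (\<phi> v) w"
  let ?B = "\<lambda>u w. \<Sum>v\<in>N. u v * grad d y (\<psi> v) w"
  have sub: "I \<subseteq> mpols N" "I' \<subseteq> mpols N'" by (auto simp: vanishing_ideal_def)
  have \<phi>\<psi>: "mp_eval mconst \<phi> (\<psi> v) - mvar v \<in> I" if v: "v \<in> N" for v
    using v b[OF v] \<phi> \<psi> eval_\<phi>[of "\<psi> v"]
    by (auto simp: vanishing_ideal_def mp_eval_ring_simps[OF c] intro!: mpols_minus mpols_subst[of _ N'] mpols_var)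
  have AB: "?A (?B u) w - u w = (\<Sum>v\<in>N. u v * grad d x (mp_eval mconst \<phi> (\<psi> v) - mvar v) w)"
    if u: "u \<in> supported N" for u w
  proof -
    have "?A (?B u) w = (\<Sum>v'\<in>N'. \<Sum>v\<in>N. u v * (grad d y (\<psi> v) v' * grad d x (\<phi> v') w))"
      by (simp add: sum_distrib_right mult.assoc)
    also have "\<dots> = (\<Sum>v\<in>N. \<Sum>v'\<in>N'. u v * (grad d y (\<psi> v) v' * grad d x (\<phi> v') w))"
      by (rule sum.swap)
    also have "\<dots> = (\<Sum>v\<in>N. u v * grad d x (mp_eval mconst \<phi> (\<psi> v)) w)"
      using grad_subst[OF d N' \<psi> yeq] by (simp add: sum_distrib_left)
    finally have 1: "?A (?B u) w = (\<Sum>v\<in>N. u v * grad d x (mp_eval mconst \<phi> (\<psi> v)) w)" .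
    have "(\<Sum>v\<in>N. u v * grad d x (mvar v) w) = (\<Sum>v\<in>N. if v = w then u v else 0)"
      by (intro sum.cong) (auto simp: grad_def mp_deriv_var mp_eval_ring_simps[OF d])
    also have "\<dots> = u w" using u N by (auto simp: supported_def)
    finally have 2: "(\<Sum>v\<in>N. u v * grad d x (mvar v) w) = u w" .
    show ?thesis
      unfolding 1 by (subst 2[symmetric])
        (simp add: grad_def mp_deriv_minus mp_eval_ring_simps[OF d] right_diff_distrib sum_subtractf)
  qed
  show ?thesis
  proof (rule fun_vs_codim_le[where A = ?A and B = ?B])
    show "grad d x ` I \<subseteq> supported N" "grad d y ` I' \<subseteq> supported N'"
      using grad_supported[OF d] sub by (fastforce)+
    fix u assume "u \<in> grad d y ` I'"
    then obtain f where f: "f \<in> I'" "u = grad d y f" by auto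
    then have "?A u = grad d x (mp_eval mconst \<phi> f)"
      using grad_subst[OF d N' _ yeq] sub by (intro ext) auto
    with pullback_in[OF f(1)] show "?A u \<in> fun_vs.span (grad d x ` I)"
      by (auto intro: fun_vs.span_base)
  next
    fix u :: "'v \<Rightarrow> 'e" assume u: "u \<in> supported N"
    show "?B u \<in> supported N'"
      using grad_supported[OF d \<psi>] by (auto simp: supported_def intro!: sum.neutral)
    have "(\<lambda>w. ?A (?B u) w - u w) \<in>
        fun_vs.span ((\<lambda>v. grad d x (mp_eval mconst \<phi> (\<psi> v) - mvar v)) ` N)"
      unfolding AB[OF u] by (rule fun_vs_span_family)
    also have "\<dots> \<subseteq> fun_vs.span (grad d x ` I)"
      using \<phi>\<psi> by (intro fun_vs.span_mono) auto
    finally show "(\<lambda>w. ?A (?B u) w - u w) \<in> fun_vs.span (grad d x ` I)" .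
  qed (use N N' in \<open>auto simp: sum.distrib sum_distrib_left algebra_simps\<close>)
qed

lemma codim_eq:
  assumes d: "type_hom d" and x: "x \<in> points d N I"
  defines "y \<equiv> \<lambda>v\<in>N'. mp_eval d x (\<phi> v)"
  shows "card N + fun_vs.dim (grad d y ` I') = card N' + fun_vs.dim (grad d x ` I)"
proof -
  interpret s: interdefinable c N' N b' b \<psi> \<phi> by (rule swap)
  note y = image_point[OF d x, folded y_def]
  show ?thesis
    using codim_le[OF d x, of y] s.codim_le[OF d y(1), of x] y(2) by (force simp: y_def)
qed

text \<open>Substituting \<open>\<psi>\<close> preserves algebraic independence because the values
  at the two tuples agree. By symmetry the two sets are equal, and so are their maxima, before
  anything is known about their boundedness.\<close>

lemma dim_set_subset:
  "{d. \<exists>g. g ` {..<d} \<subseteq> mpols N \<and> alg_independent_mod I d g} \<subseteq>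
   {d. \<exists>g. g ` {..<d} \<subseteq> mpols N' \<and> alg_independent_mod I' d g}"
proof safe
  interpret s: interdefinable c N' N b' b \<psi> \<phi> by (rule swap)
  fix d g assume g: "g ` {..<d} \<subseteq> mpols N" "alg_independent_mod I d g"
  let ?g = "\<lambda>i. mp_eval mconst \<psi> (g i)"
  have "?g ` {..<d} \<subseteq> mpols N'"
    using g(1) \<psi> by (auto intro!: mpols_subst[of _ N])
  moreover have "alg_independent_mod I' d ?g"
    unfolding alg_independent_mod_def
  proof (intro ballI impI notI)
    fix F :: "(nat, 'a) mpol" assume F: "F \<in> mpols {..<d}" "F \<noteq> 0" "mp_eval mconst ?g F \<in> I'"
    have "mp_eval c b' (mp_eval mconst ?g F) = mp_eval c b (mp_eval mconst g F)"
      unfolding mp_eval_subst[OF c]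
      using g(1) s.eval_\<phi> by (intro mp_eval_cong[OF c F(1)]) (auto simp: mp_eval_subst[OF c, symmetric])
    moreover have "mp_eval mconst g F \<in> mpols N"
      using F(1) g(1) by (intro mpols_subst[of _ "{..<d}"]) auto
    ultimately have "mp_eval mconst g F \<in> I"
      using F(3) by (auto simp: vanishing_ideal_def)
    with g(2) F show False by (auto simp: alg_independent_mod_def)
  qed
  ultimately show "\<exists>g. g ` {..<d} \<subseteq> mpols N' \<and> alg_independent_mod I' d g" by blast
qed

lemma variety_dim_eq: "variety_dim N I = variety_dim N' I'"
proof -
  interpret s: interdefinable c N' N b' b \<psi> \<phi> by (rule swap)
  show ?thesis
    unfolding variety_dim_def using dim_set_subset s.dim_set_subset by (simp add: subset_antisym)
qed

text \<open>Other generators change the rank of the Jacobian and the number of variables by the same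
  amount and leave the dimension alone.\<close>

lemma smooth_image:
  assumes d: "type_hom d" and x: "x \<in> points d N I" and sm: "smooth_at d N I x"
  shows "smooth_at d N' I' (\<lambda>v\<in>N'. mp_eval d x (\<phi> v))"
  using codim_eq[OF d x] sm variety_dim_eq unfolding smooth_at_iff by linarith

lemma has_smooth_rational_point_image:
  assumes "has_smooth_rational_point N I"
  shows "has_smooth_rational_point N' I'"
proof -
  obtain x where x: "x \<in> points id N I" "smooth_at id N I x"
    using assms by (auto simp: has_smooth_rational_point_def rational_points_def)
  show ?thesis
    unfolding has_smooth_rational_point_def rational_points_def
    using smooth_image[OF _ x] image_point(1)[OF _ x(1)] by auto
qed

end

section \<open>Triangular presentations of primes\<close>

definition coeffs_in :: "'v set \<Rightarrow> ('v, 'a::comm_ring_1) mpol poly \<Rightarrow> bool" where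
  "coeffs_in A p \<longleftrightarrow> (\<forall>i. Polynomial.coeff p i \<in> mpols A)"

lemma coeffs_in_0 [simp]: "coeffs_in A 0"
  by (simp add: coeffs_in_def)

lemma coeffs_in_pCons [simp]: "coeffs_in A (pCons a p) \<longleftrightarrow> a \<in> mpols A \<and> coeffs_in A p"
  unfolding coeffs_in_def by (metis coeff_pCons_0 coeff_pCons_Suc not0_implies_Suc)

lemma coeffs_in_add: "coeffs_in A p \<Longrightarrow> coeffs_in A q \<Longrightarrow> coeffs_in A (p + q)"
  by (simp add: coeffs_in_def mpols_add)

lemma coeffs_in_diff: "coeffs_in A p \<Longrightarrow> coeffs_in A q \<Longrightarrow> coeffs_in A (p - q)"
  by (simp add: coeffs_in_def mpols_minus)

lemma coeffs_in_mult: "coeffs_in A p \<Longrightarrow> coeffs_in A q \<Longrightarrow> coeffs_in A (p * q)"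
  by (simp add: coeffs_in_def coeff_mult mpols_sum mpols_mult)

lemma coeffs_in_smult: "a \<in> mpols A \<Longrightarrow> coeffs_in A p \<Longrightarrow> coeffs_in A (smult a p)"
  by (simp add: coeffs_in_def mpols_mult)

lemma coeffs_in_monom: "a \<in> mpols A \<Longrightarrow> coeffs_in A (Polynomial.monom a n)"
  by (simp add: coeffs_in_def)

lemma mpols_of_nat: "(of_nat n :: ('v, 'a::comm_ring_1) mpol) \<in> mpols A"
  unfolding mconst_of_nat[symmetric] by (rule mpols_const)

text \<open>The library's \<open>pderiv\<close> is only available over rings without zero divisors, hence not over
  \<open>('v, 'a) mpol\<close> for an unordered type \<open>'v\<close>.\<close>

definition formal_deriv :: "'b::comm_ring_1 poly \<Rightarrow> 'b poly" where
  "formal_deriv p = (\<Sum>i<Polynomial.degree p. Polynomial.monom (of_nat (Suc i) * Polynomial.coeff p (Suc i)) i)"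

lemma coeff_formal_deriv:
  "Polynomial.coeff (formal_deriv p) n = of_nat (Suc n) * Polynomial.coeff p (Suc n)"
proof -
  have "Polynomial.coeff (formal_deriv p) n =
      (\<Sum>i<Polynomial.degree p. if i = n then of_nat (Suc n) * Polynomial.coeff p (Suc n) else 0)"
    unfolding formal_deriv_def coeff_sum by (intro sum.cong) (auto simp del: of_nat_Suc)
  then show ?thesis by (auto simp: coeff_eq_0 simp del: of_nat_Suc)
qed

lemma coeffs_in_formal_deriv: "coeffs_in A p \<Longrightarrow> coeffs_in A (formal_deriv p)"
  unfolding coeffs_in_def coeff_formal_deriv by (auto intro!: mpols_mult mpols_of_nat simp del: of_nat_Suc)

lemma mpols_poly: "coeffs_in A p \<Longrightarrow> x \<in> mpols A \<Longrightarrow> poly p x \<in> mpols A"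
  by (induction p) (auto intro: mpols_add mpols_mult)

lemma coeffs_in_mono: "A \<subseteq> B \<Longrightarrow> coeffs_in A p \<Longrightarrow> coeffs_in B p"
  unfolding coeffs_in_def using mpols_mono by blast

lemma mpol_as_poly:
  assumes "f \<in> mpols (insert v A)"
  obtains p where "coeffs_in A p" "f = poly p (mvar v)"
proof -
  have "\<exists>p. coeffs_in A p \<and> f = poly p (mvar v)" using assms
  proof (induction rule: mpol_induct)
    case (const c)
    show ?case by (rule exI[of _ "[:mconst c:]"]) auto
  next
    case (var u)
    show ?case
    proof (cases "u = v")
      case True
      then show ?thesis by (intro exI[of _ "[:0, 1:]"]) auto
    next
      case False
      then show ?thesis using var by (intro exI[of _ "[:mvar u:]"]) (auto intro: mpols_var)
    qed
  next
    case (add f g)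
    then show ?case by (metis coeffs_in_add poly_add)
  next
    case (mult f g)
    then show ?case by (metis coeffs_in_mult poly_mult)
  qed
  then show ?thesis using that by blast
qed

lemma mp_deriv_var_power:
  "mp_deriv v (mvar v ^ Suc n) = of_nat (Suc n) * (mvar v ^ n :: ('v, 'a::comm_ring_1) mpol)"
  by (induction n) (simp_all add: mp_deriv_mult mp_deriv_var algebra_simps)

lemma mp_deriv_poly:
  assumes "coeffs_in A p" "v \<notin> A"
  shows "mp_deriv v (poly p (mvar v)) = poly (formal_deriv p) (mvar v)"
proof -
  have c: "mp_deriv v (Polynomial.coeff p i) = 0" for i
    using assms by (intro mp_deriv_outside) (auto simp: coeffs_in_def)
  have "mp_deriv v (poly p (mvar v)) =
      (\<Sum>i\<le>Polynomial.degree p. Polynomial.coeff p i * mp_deriv v (mvar v ^ i))"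
    unfolding poly_altdef mp_deriv_sum by (simp add: mp_deriv_mult c)
  also have "\<dots> = (\<Sum>i<Polynomial.degree p. Polynomial.coeff p (Suc i) * mp_deriv v (mvar v ^ Suc i))"
    unfolding lessThan_Suc_atMost[symmetric] sum.lessThan_Suc_shift by simp
  also have "\<dots> = poly (formal_deriv p) (mvar v)"
    unfolding formal_deriv_def poly_sum
    by (intro sum.cong) (simp_all add: poly_monom mp_deriv_var_power mult_ac del: of_nat_Suc power_Suc)
  finally show ?thesis .
qed

text \<open>The leading coefficient of \<open>p\<close> is not a unit, so each division step costs
  one factor of it. These factors are absorbed later by inverting \<open>h\<close>.\<close>

lemma pseudo_division:
  assumes p: "coeffs_in A p" "Polynomial.degree p > 0" and q: "coeffs_in A q"
  shows "\<exists>k a r. coeffs_in A a \<and> coeffs_in A r \<and> Polynomial.degree r < Polynomial.degree p \<and>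
    smult (Polynomial.lead_coeff p ^ k) q = a * p + r"
  using q
proof (induction "Polynomial.degree q" arbitrary: q rule: less_induct)
  case less
  define l where "l = Polynomial.lead_coeff p"
  have l: "l \<in> mpols A" using p by (simp add: l_def coeffs_in_def)
  show ?case
  proof (cases "Polynomial.degree q < Polynomial.degree p")
    case True
    then show ?thesis using less.prems by (intro exI[of _ 0] exI[of _ q]) auto
  next
    case False
    define n where "n = Polynomial.degree q - Polynomial.degree p"
    define m where "m = Polynomial.monom (Polynomial.lead_coeff q) n"
    have m: "coeffs_in A m" using less.prems by (simp add: m_def coeffs_in_monom coeffs_in_def)
    let ?q = "smult l q - m * p"
    have cq: "coeffs_in A ?q"
      using less.prems p l m by (intro coeffs_in_diff coeffs_in_smult coeffs_in_mult)
    have "Polynomial.degree (m * p) \<le> Polynomial.degree q"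
      using degree_mult_le[of m p] degree_monom_le[of "Polynomial.lead_coeff q" n] False
      by (simp add: m_def n_def)
    then have le: "Polynomial.degree ?q \<le> Polynomial.degree q"
      using degree_smult_le[of l q] by (intro degree_diff_le)
    have "Polynomial.coeff ?q (Polynomial.degree q) = 0"
      unfolding m_def n_def l_def using False by (simp add: coeff_monom_mult)
    then have "Polynomial.degree ?q < Polynomial.degree q"
      using le False p(2) by (metis (no_types, lifting) degree_0 leading_coeff_0_iff le_neq_implies_less linorder_not_less neq0_conv)
    from less.hyps[OF this cq] obtain k a r where
      r: "coeffs_in A a" "coeffs_in A r" "Polynomial.degree r < Polynomial.degree p"
        "smult (l ^ k) ?q = a * p + r" unfolding l_def by blast
    have "smult (l ^ Suc k) q = smult (l ^ k) ?q + smult (l ^ k) m * p"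
      by (simp add: smult_diff_right mult.commute)
    also have "\<dots> = (a + smult (l ^ k) m) * p + r"
      unfolding r(4) by (simp add: algebra_simps)
    finally show ?thesis
      using r m l by (intro exI[of _ "Suc k"] exI[of _ "a + smult (l ^ k) m"] exI[of _ r])
        (auto simp: l_def intro!: coeffs_in_add coeffs_in_smult mpols_power)
  qed
qed

text \<open>The variable \<open>v\<close> is transcendental modulo \<open>J\<close> over the variables in \<open>A\<close>.\<close>

definition transc :: "('v, 'a::comm_ring_1) mpol set \<Rightarrow> 'v set \<Rightarrow> 'v \<Rightarrow> bool" where
  "transc J A v \<longleftrightarrow>
     (\<forall>p. coeffs_in A p \<and> poly p (mvar v) \<in> J \<longrightarrow> (\<forall>i. Polynomial.coeff p i \<in> J))"

lemma ideal_poly_in: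
  assumes J: "ideal J (mpol_ring N)" and "\<And>i. Polynomial.coeff p i \<in> J" "x \<in> mpols N"
  shows "poly p x \<in> J"
proof -
  note id = ideal_mpolD[OF J]
  have "poly p x = (\<Sum>i\<le>Polynomial.degree p. Polynomial.coeff p i * x ^ i)"
    by (rule poly_altdef)
  also have "\<dots> \<in> J"
  proof -
    have "finite A \<Longrightarrow> (\<Sum>i\<in>A. Polynomial.coeff p i * x ^ i) \<in> J" for A
      by (induction A rule: finite_induct)
        (auto simp: id(2) intro!: id(3) id(5) mpols_power assms(2,3))
    then show ?thesis by simp
  qed
  finally show ?thesis .
qed

text \<open>\<open>p\<close> has least degree among the polynomials over \<open>A\<close> whose
  value at \<open>v\<close> is in \<open>J\<close> although some coefficient is not. If its leading
  coefficient were in \<open>J\<close>, dropping the leading term would give a smaller one. If the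
  value of its derivative were in \<open>J\<close>, so would be the leading coefficient times the
  degree, and the degree is invertible in characteristic 0.\<close>

lemma minimal_poly_mod_prime:
  fixes J :: "('v, 'a::field_char_0) mpol set"
  assumes J: "primeideal J (mpol_ring N)" and A: "A \<subseteq> N" and v: "v \<in> N" and "\<not> transc J A v"
  obtains p where "coeffs_in A p" "poly p (mvar v) \<in> J" "Polynomial.lead_coeff p \<notin> J"
    "Polynomial.degree p > 0" "poly (formal_deriv p) (mvar v) \<notin> J"
    "\<And>q. coeffs_in A q \<Longrightarrow> Polynomial.degree q < Polynomial.degree p \<Longrightarrow>
       poly q (mvar v) \<in> J \<Longrightarrow> (\<forall>i. Polynomial.coeff q i \<in> J)"
proof -
  note id = ideal_mpolD[OF primeideal_mpolD(1)[OF J]] and pr = primeideal_mpolD[OF J]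
  let ?Q = "\<lambda>p. coeffs_in A p \<and> poly p (mvar v) \<in> J \<and> (\<exists>i. Polynomial.coeff p i \<notin> J)"
  obtain p0 where "?Q p0" using assms(4) by (auto simp: transc_def)
  then obtain p where p: "?Q p" and min: "\<And>q. ?Q q \<Longrightarrow> Polynomial.degree p \<le> Polynomial.degree q"
    using ex_has_least_nat[of ?Q p0 Polynomial.degree] by blast
  have AN: "f \<in> mpols N" if "f \<in> mpols A" for f :: "('v, 'a) mpol"
    using that mpols_mono[OF A] by blast
  have cN: "Polynomial.coeff p i \<in> mpols N" for i
    using p AN by (auto simp: coeffs_in_def)
  have small: "\<forall>i. Polynomial.coeff q i \<in> J"
    if "coeffs_in A q" "Polynomial.degree q < Polynomial.degree p" "poly q (mvar v) \<in> J" for q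
    using min[of q] that by force
  have deg: "Polynomial.degree p > 0"
  proof (rule ccontr)
    assume "\<not> Polynomial.degree p > 0"
    then obtain a where a: "p = [:a:]" using degree_eq_zeroE by blast
    with p have "a \<in> J" by simp
    moreover have "Polynomial.coeff p i = (if i = 0 then a else 0)" for i
      using a by (cases i) auto
    ultimately show False using p id(2) by (metis (full_types))
  qed
  have lead: "Polynomial.lead_coeff p \<notin> J"
  proof
    assume l: "Polynomial.lead_coeff p \<in> J"
    let ?m = "Polynomial.monom (Polynomial.lead_coeff p) (Polynomial.degree p)"
    let ?q = "p - ?m"
    have cq: "coeffs_in A ?q" using p by (intro coeffs_in_diff coeffs_in_monom) (auto simp: coeffs_in_def)
    have "poly ?m (mvar v) \<in> J"
      using l v by (auto simp: poly_monom intro!: id(5) mpols_power mpols_var)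
    then have q: "poly ?q (mvar v) \<in> J" using p id(7) by simp
    have "Polynomial.degree ?q \<le> Polynomial.degree p"
      by (intro degree_diff_le degree_monom_le) auto
    moreover have "Polynomial.coeff ?q (Polynomial.degree p) = 0" by simp
    ultimately have "Polynomial.degree ?q < Polynomial.degree p"
      using deg by (metis degree_0 leading_coeff_0_iff le_neq_implies_less)
    from small[OF cq this q] have *: "\<forall>i. Polynomial.coeff ?q i \<in> J" .
    have "Polynomial.coeff p i \<in> J" for i
      using spec[OF *, of i] l by (cases "i = Polynomial.degree p") auto
    with p show False by blast
  qed
  have "poly (formal_deriv p) (mvar v) \<notin> J"
  proof
    assume d: "poly (formal_deriv p) (mvar v) \<in> J"
    have cd: "coeffs_in A (formal_deriv p)" using p coeffs_in_formal_deriv by blast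
    have "Polynomial.degree (formal_deriv p) < Polynomial.degree p"
    proof -
      have "Polynomial.degree (formal_deriv p) \<le> Polynomial.degree p - 1"
      proof (rule degree_le, intro allI impI)
        fix i assume "Polynomial.degree p - 1 < i"
        then have "Polynomial.coeff p (Suc i) = 0" by (intro coeff_eq_0) auto
        then show "Polynomial.coeff (formal_deriv p) i = 0" by (simp add: coeff_formal_deriv)
      qed
      with deg show ?thesis by linarith
    qed
    from small[OF cd this d] have "Polynomial.coeff (formal_deriv p) (Polynomial.degree p - 1) \<in> J" by blast
    then have "of_nat (Polynomial.degree p) * Polynomial.lead_coeff p \<in> J"
      using deg by (simp add: coeff_formal_deriv)
    then have "mconst (inverse (of_nat (Polynomial.degree p))) * (of_nat (Polynomial.degree p) * Polynomial.lead_coeff p) \<in> J"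
      by (rule id(4)) simp
    moreover have "mconst (inverse (of_nat (Polynomial.degree p))) * of_nat (Polynomial.degree p) = (1 :: ('v, 'a) mpol)"
      using deg by (simp flip: mconst_of_nat mconst_simps(4))
    ultimately show False using lead by (simp flip: mult.assoc)
  qed
  then show ?thesis using that p lead deg small by blast
qed

text \<open>Membership of \<open>f\<close> in the saturation with respect to \<open>h\<close> of the ideal generated by the
  \<open>P v\<close>.\<close>

definition in_sat :: "('v, 'a::comm_ring_1) mpol \<Rightarrow> ('v \<Rightarrow> ('v, 'a) mpol) \<Rightarrow> 'v set \<Rightarrow> ('v, 'a) mpol \<Rightarrow> bool" where
  "in_sat h P S f \<longleftrightarrow> (\<exists>k q. h ^ k * f = (\<Sum>v\<in>S. q v * P v))"

lemma in_sat_0: "in_sat h P S 0"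
  unfolding in_sat_def by (intro exI[of _ 0] exI[of _ "\<lambda>_. 0"]) auto

lemma in_sat_add:
  assumes "in_sat h P S f" "in_sat h P S g"
  shows "in_sat h P S (f + g)"
proof -
  obtain k q where 1: "h ^ k * f = (\<Sum>v\<in>S. q v * P v)" using assms by (auto simp: in_sat_def)
  obtain l r where 2: "h ^ l * g = (\<Sum>v\<in>S. r v * P v)" using assms by (auto simp: in_sat_def)
  have "h ^ (k + l) * (f + g) = h ^ l * (h ^ k * f) + h ^ k * (h ^ l * g)"
    by (simp add: power_add algebra_simps)
  also have "\<dots> = (\<Sum>v\<in>S. (h ^ l * q v + h ^ k * r v) * P v)"
    unfolding 1 2 by (simp add: sum_distrib_left sum.distrib algebra_simps)
  finally show ?thesis unfolding in_sat_def
    by (intro exI[of _ "k + l"] exI[of _ "\<lambda>v. h ^ l * q v + h ^ k * r v"])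
qed

lemma in_sat_mult:
  assumes "in_sat h P S f"
  shows "in_sat h P S (g * f)"
proof -
  obtain k q where 1: "h ^ k * f = (\<Sum>v\<in>S. q v * P v)" using assms by (auto simp: in_sat_def)
  have "h ^ k * (g * f) = g * (h ^ k * f)" by (simp add: algebra_simps)
  also have "\<dots> = (\<Sum>v\<in>S. (g * q v) * P v)"
    unfolding 1 by (simp add: sum_distrib_left algebra_simps)
  finally show ?thesis unfolding in_sat_def by (intro exI)
qed

lemma in_sat_base:
  assumes "finite S" "v \<in> S"
  shows "in_sat h P S (P v)"
proof -
  have "(\<Sum>w\<in>S. (if w = v then 1 else 0) * P w) = (\<Sum>w\<in>S. if w = v then P w else 0)"
    by (intro sum.cong) auto
  then have "h ^ 0 * P v = (\<Sum>w\<in>S. (if w = v then 1 else 0) * P w)"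
    using assms by simp
  then show ?thesis unfolding in_sat_def by (intro exI)
qed

lemma in_sat_dvd:
  assumes "in_sat h P S f" "h dvd h'"
  shows "in_sat h' P S f"
proof -
  obtain k q where 1: "h ^ k * f = (\<Sum>v\<in>S. q v * P v)" using assms by (auto simp: in_sat_def)
  obtain g where g: "h' = h * g" using assms by auto
  have "h' ^ k * f = g ^ k * (h ^ k * f)" unfolding g by (simp add: power_mult_distrib algebra_simps)
  also have "\<dots> = (\<Sum>v\<in>S. (g ^ k * q v) * P v)"
    unfolding 1 by (simp add: sum_distrib_left algebra_simps)
  finally show ?thesis unfolding in_sat_def by (intro exI)
qed

text \<open>A divisor of \<open>h\<close> becomes a unit once \<open>h\<close> is inverted.\<close>

lemma in_sat_cancel:
  assumes "in_sat h P S (g ^ l * f)" "g dvd h"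
  shows "in_sat h P S f"
proof -
  obtain k q where 1: "h ^ k * (g ^ l * f) = (\<Sum>v\<in>S. q v * P v)" using assms by (auto simp: in_sat_def)
  obtain g' where g: "h = g * g'" using assms by auto
  have "h ^ (k + l) * f = g' ^ l * (h ^ k * (g ^ l * f))"
    by (simp add: power_add g power_mult_distrib algebra_simps)
  also have "\<dots> = (\<Sum>v\<in>S. (g' ^ l * q v) * P v)"
    unfolding 1 by (simp add: sum_distrib_left algebra_simps)
  finally show ?thesis unfolding in_sat_def by (intro exI)
qed

lemma in_sat_superset:
  assumes "in_sat h P S f" "S \<subseteq> S'" "finite S'" "\<And>v. v \<in> S \<Longrightarrow> P v = P' v"
  shows "in_sat h P' S' f"
proof -
  obtain k q where 1: "h ^ k * f = (\<Sum>v\<in>S. q v * P v)" using assms by (auto simp: in_sat_def)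
  have "(\<Sum>v\<in>S'. (if v \<in> S then q v else 0) * P' v) = (\<Sum>v\<in>S. q v * P v)"
    using assms by (intro sum.mono_neutral_cong_right) auto
  then have "h ^ k * f = (\<Sum>v\<in>S'. (if v \<in> S then q v else 0) * P' v)" using 1 by simp
  then show ?thesis unfolding in_sat_def
    by (intro exI[of _ k] exI[of _ "\<lambda>v. if v \<in> S then q v else 0"])
qed

lemma in_sat_poly:
  assumes "\<And>i. in_sat h P S (Polynomial.coeff p i)"
  shows "in_sat h P S (poly p x)"
  using assms
proof (induction p)
  case 0
  then show ?case by (simp add: in_sat_0)
next
  case (pCons a p)
  have "in_sat h P S a" using pCons.prems[of 0] by simp
  moreover have "in_sat h P S (poly p x)"
    using pCons.prems[of "Suc _"] by (intro pCons.IH) simp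
  ultimately show ?case by (simp add: in_sat_add in_sat_mult)
qed

definition prevs :: "'v list \<Rightarrow> 'v \<Rightarrow> 'v set" where
  "prevs vs v = set (takeWhile (\<lambda>w. w \<noteq> v) vs)"

lemma prevs_append [simp]: "v \<in> set vs \<Longrightarrow> prevs (vs @ ws) v = prevs vs v"
  by (auto simp: prevs_def takeWhile_append)

lemma prevs_last [simp]: "v \<notin> set vs \<Longrightarrow> prevs (vs @ [v]) v = set vs"
  by (auto simp: prevs_def takeWhile_append)

lemma prevs_subset: "prevs vs v \<subseteq> set vs"
  by (auto simp: prevs_def dest: set_takeWhileD)

text \<open>For prime \<open>J\<close> the remaining variables form a transcendence basis of the
  function field, namely the one found greedily along the list.\<close>

definition algebraic_vars :: "('v, 'a::comm_ring_1) mpol set \<Rightarrow> 'v list \<Rightarrow> 'v set" where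
  "algebraic_vars J vs = {v \<in> set vs. \<not> transc J (prevs vs v) v}"

lemma algebraic_vars_append1:
  assumes "v \<notin> set vs"
  shows "algebraic_vars J (vs @ [v]) = algebraic_vars J vs \<union> (if transc J (set vs) v then {} else {v})"
  using assms by (auto simp: algebraic_vars_def)

lemma mpols_empty: "f \<in> mpols {} \<Longrightarrow> \<exists>c. f = mconst c"
proof -
  assume "f \<in> mpols {}"
  then have "Poly_Mapping.keys f \<subseteq> {0}" by (auto simp: mpols_def)
  then have "f = mconst (Poly_Mapping.lookup f 0)"
    by (intro poly_mapping_eqI) (auto simp: mconst_def lookup_single when_def in_keys_iff subset_iff)
  then show ?thesis by blast
qed

text \<open>A new variable that is transcendental adds no equation: the coefficients of every member
  of \<open>J\<close> are already in \<open>J\<close>. An algebraic one adds its minimal polynomial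
  \<open>p\<close>, and \<open>h\<close> takes up two factors outside \<open>J\<close>: the leading
  coefficient, so that pseudo-division by \<open>p\<close> leaves a remainder whose coefficients are
  in \<open>J\<close> and are covered by induction, and the derivative of \<open>p\<close>, for
  separability.\<close>

lemma triangular_presentation:
  fixes J :: "('v, 'a::field_char_0) mpol set"
  assumes J: "primeideal J (mpol_ring N)" and vs: "set vs \<subseteq> N" "distinct vs"
  shows "\<exists>P h. h \<in> mpols (set vs) \<and> h \<notin> J \<and>
    (\<forall>v\<in>algebraic_vars J vs. P v \<in> J \<and> P v \<in> mpols (insert v (prevs vs v)) \<and> mp_deriv v (P v) dvd h) \<and>
    (\<forall>f\<in>J. f \<in> mpols (set vs) \<longrightarrow> in_sat h P (algebraic_vars J vs) f)"
  using vs
proof (induction vs rule: rev_induct)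
  case Nil
  have z: "f = 0" if f: "f \<in> J" "f \<in> mpols {}" for f
  proof -
    obtain c where c: "f = mconst c" using mpols_empty[OF f(2)] by blast
    have "c = 0"
    proof (rule ccontr)
      assume "c \<noteq> 0"
      have "mconst (inverse c) * f \<in> J"
        using f(1) ideal_mpolD(4)[OF primeideal_mpolD(1)[OF J]] by auto
      then show False
        using \<open>c \<noteq> 0\<close> primeideal_mpolD(2)[OF J] by (simp add: c flip: mconst_simps(4))
    qed
    with c show ?thesis by simp
  qed
  have "in_sat 1 P S f" if "f \<in> J" "f \<in> mpols {}" for P S f
    unfolding z[OF that] by (rule in_sat_0)
  then show ?case
    using primeideal_mpolD(2)[OF J]
    by (intro exI[of _ "\<lambda>_. 0"] exI[of _ 1]) (auto simp: algebraic_vars_def)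
next
  case (snoc v vs)
  then have v: "v \<in> N" "v \<notin> set vs" "set vs \<subseteq> N" by auto
  note id = ideal_mpolD[OF primeideal_mpolD(1)[OF J]] and pr = primeideal_mpolD[OF J]
  have "distinct vs" using snoc.prems by simp
  from snoc.IH[OF v(3) this] obtain P h where Ph: "h \<in> mpols (set vs) \<and> h \<notin> J \<and>
    (\<forall>v\<in>algebraic_vars J vs. P v \<in> J \<and> P v \<in> mpols (insert v (prevs vs v)) \<and> mp_deriv v (P v) dvd h) \<and>
    (\<forall>f\<in>J. f \<in> mpols (set vs) \<longrightarrow> in_sat h P (algebraic_vars J vs) f)"
    by (elim exE)
  have h: "h \<in> mpols (set vs)" "h \<notin> J" using Ph by auto
  have P: "P w \<in> J \<and> P w \<in> mpols (insert w (prevs vs w)) \<and> mp_deriv w (P w) dvd h"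
    if "w \<in> algebraic_vars J vs" for w
    using Ph that by simp
  have sat: "in_sat h P (algebraic_vars J vs) f" if "f \<in> J" "f \<in> mpols (set vs)" for f
    using Ph that by simp
  have old: "w \<in> set vs \<and> prevs (vs @ [v]) w = prevs vs w" if "w \<in> algebraic_vars J vs" for w
    using that by (auto simp: algebraic_vars_def)
  have fin: "finite (algebraic_vars J vs)" by (simp add: algebraic_vars_def)
  have mono: "mpols (set vs) \<subseteq> mpols (set (vs @ [v]))" by (rule mpols_mono) auto
  show ?case
  proof (cases "transc J (set vs) v")
    case True
    then have S: "algebraic_vars J (vs @ [v]) = algebraic_vars J vs"
      unfolding algebraic_vars_append1[OF v(2)] by simp
    have "in_sat h P (algebraic_vars J vs) f" if f: "f \<in> J" "f \<in> mpols (set (vs @ [v]))" for f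
    proof -
      obtain p where p: "coeffs_in (set vs) p" "f = poly p (mvar v)"
        using mpol_as_poly[of f v "set vs"] f(2) by auto
      with True f(1) have "\<forall>i. Polynomial.coeff p i \<in> J" by (auto simp: transc_def)
      with p show ?thesis
        by (auto simp: coeffs_in_def intro!: in_sat_poly sat)
    qed
    moreover have "P w \<in> J \<and> P w \<in> mpols (insert w (prevs (vs @ [v]) w)) \<and> mp_deriv w (P w) dvd h"
      if "w \<in> algebraic_vars J vs" for w
      using P[OF that] old[OF that] by simp
    ultimately show ?thesis unfolding S using h mono
      by (intro exI[of _ P] exI[of _ h] conjI ballI impI) (blast, blast, simp_all)
  next
    case False
    then have S: "algebraic_vars J (vs @ [v]) = insert v (algebraic_vars J vs)"
      unfolding algebraic_vars_append1[OF v(2)] by simp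
    obtain p where p: "coeffs_in (set vs) p" "poly p (mvar v) \<in> J" "Polynomial.lead_coeff p \<notin> J"
      "Polynomial.degree p > 0" "poly (formal_deriv p) (mvar v) \<notin> J"
      and small: "\<And>q. coeffs_in (set vs) q \<Longrightarrow> Polynomial.degree q < Polynomial.degree p \<Longrightarrow>
         poly q (mvar v) \<in> J \<Longrightarrow> (\<forall>i. Polynomial.coeff q i \<in> J)"
      using minimal_poly_mod_prime[OF J v(3,1) False] by metis
    define l where "l = Polynomial.lead_coeff p"
    define s where "s = poly (formal_deriv p) (mvar v)"
    define h' where "h' = h * l * s"
    define P' where "P' = P(v := poly p (mvar v))"
    have vsv: "mvar v \<in> mpols (set (vs @ [v]))" by (rule mpols_var) simp
    have l: "l \<in> mpols (set vs)" using p(1) by (simp add: l_def coeffs_in_def)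
    have s: "s \<in> mpols (set (vs @ [v]))"
      unfolding s_def using p(1) vsv
      by (intro mpols_poly coeffs_in_formal_deriv) (auto intro: coeffs_in_mono[of "set vs"])
    have toN: "mpols (set (vs @ [v])) \<subseteq> mpols N" using v by (intro mpols_mono) auto
    have h': "h' \<in> mpols (set (vs @ [v]))" "h' \<notin> J"
    proof -
      show "h' \<in> mpols (set (vs @ [v]))"
        unfolding h'_def using h(1) l s mono by (intro mpols_mult) auto
      have "h * l \<notin> J" using pr(3)[of h l] h l p(3) mono toN by (auto simp: l_def)
      then show "h' \<notin> J"
        unfolding h'_def using pr(3)[of "h * l" s] h(1) l s p(5) mono toN mpols_mult[of h "set vs" l]
        by (auto simp: s_def)
    qed
    have "h dvd h'" "l dvd h'" "s dvd h'" by (auto simp: h'_def)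
    have vS: "v \<notin> algebraic_vars J vs" using v by (auto simp: algebraic_vars_def)
    let ?S = "insert v (algebraic_vars J vs)"
    have sat': "in_sat h' P' ?S f" if "f \<in> J" "f \<in> mpols (set vs)" for f
      by (rule in_sat_superset[OF in_sat_dvd[OF sat[OF that] \<open>h dvd h'\<close>]])
        (use vS fin in \<open>auto simp: P'_def\<close>)
    have "in_sat h' P' ?S f" if f: "f \<in> J" "f \<in> mpols (set (vs @ [v]))" for f
    proof -
      obtain q where q: "coeffs_in (set vs) q" "f = poly q (mvar v)"
        using mpol_as_poly[of f v "set vs"] f(2) by auto
      obtain k a r where r: "coeffs_in (set vs) a" "coeffs_in (set vs) r"
        "Polynomial.degree r < Polynomial.degree p" "smult (l ^ k) q = a * p + r"
        using pseudo_division[OF p(1,4) q(1)] unfolding l_def by blast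
      have eq: "l ^ k * f = poly a (mvar v) * P' v + poly r (mvar v)"
        using arg_cong[OF r(4), of "\<lambda>p. poly p (mvar v)"] by (simp add: q P'_def)
      have "poly a (mvar v) \<in> mpols N"
        using r(1) v by (intro mpols_poly mpols_var) (auto intro: coeffs_in_mono[of "set vs"])
      then have "poly a (mvar v) * P' v \<in> J" using p(2) id(4) by (simp add: P'_def)
      moreover have "l ^ k * f \<in> J"
        using f(1) l mono toN by (intro id(4) mpols_power) auto
      ultimately have "poly r (mvar v) \<in> J"
        using eq id(7)[of "l ^ k * f" "poly a (mvar v) * P' v"] by simp
      from small[OF r(2,3) this] r(2) have "in_sat h' P' ?S (poly r (mvar v))"
        by (intro in_sat_poly sat') (auto simp: coeffs_in_def)
      then have "in_sat h' P' ?S (l ^ k * f)"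
        unfolding eq using fin by (intro in_sat_add in_sat_mult in_sat_base) auto
      then show ?thesis using \<open>l dvd h'\<close> by (rule in_sat_cancel)
    qed
    moreover have "P' w \<in> J \<and> P' w \<in> mpols (insert w (prevs (vs @ [v]) w)) \<and> mp_deriv w (P' w) dvd h'"
      if w: "w \<in> ?S" for w
    proof (cases "w = v")
      case True
      have "poly p (mvar v) \<in> mpols (insert v (set vs))"
        using p(1) by (intro mpols_poly mpols_var) (auto intro: coeffs_in_mono[of "set vs"])
      then show ?thesis
        using True p(2) v(2) \<open>s dvd h'\<close> mp_deriv_poly[OF p(1) v(2)] by (simp add: P'_def s_def)
    next
      case False
      then show ?thesis using w P[of w] old[of w] \<open>h dvd h'\<close> by (auto simp: P'_def intro: dvd_trans)
    qed
    ultimately show ?thesis unfolding S using h'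
      by (intro exI[of _ P'] exI[of _ h'] conjI ballI impI) simp_all
  qed
qed

text \<open>Of the list of variables only as much order is kept as makes the Jacobian of the
  \<open>P v\<close> triangular on \<open>S\<close>; its diagonal entries divide \<open>h\<close>
  and are thus nonzero wherever \<open>h\<close> is.\<close>

definition tri_pres :: "'v set \<Rightarrow> ('v, 'a::field) mpol set \<Rightarrow> ('v \<Rightarrow> nat) \<Rightarrow> 'v set
    \<Rightarrow> ('v \<Rightarrow> ('v, 'a) mpol) \<Rightarrow> ('v, 'a) mpol \<Rightarrow> bool" where
  "tri_pres N J ord S P h \<longleftrightarrow> S \<subseteq> N \<and> inj_on ord S \<and> h \<in> mpols N \<and> h \<notin> J \<and>
     (\<forall>v\<in>S. P v \<in> J \<and> mp_deriv v (P v) dvd h \<and> (\<forall>w\<in>S. ord v < ord w \<longrightarrow> mp_deriv w (P v) = 0)) \<and>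
     (\<forall>f\<in>J. in_sat h P S f)"

definition list_ord :: "'v list \<Rightarrow> 'v \<Rightarrow> nat" where
  "list_ord vs v = length (takeWhile (\<lambda>w. w \<noteq> v) vs)"

lemma list_ord_less: "w \<in> prevs vs v \<Longrightarrow> list_ord vs w < list_ord vs v"
  unfolding prevs_def list_ord_def by (induction vs) (auto split: if_splits)

lemma inj_on_list_ord: "inj_on (list_ord vs) (set vs)"
proof (induction vs)
  case (Cons a vs)
  then show ?case by (auto simp: list_ord_def inj_on_def)
qed simp

lemma tri_pres_list:
  fixes J :: "('v, 'a::field_char_0) mpol set"
  assumes J: "primeideal J (mpol_ring (set vs))" and vs: "distinct vs"
  obtains P h where "tri_pres (set vs) J (list_ord vs) (algebraic_vars J vs) P h"
    "\<And>v. v \<in> algebraic_vars J vs \<Longrightarrow> P v \<in> mpols (insert v (prevs vs v))"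
proof -
  obtain P h where h: "h \<in> mpols (set vs)" "h \<notin> J"
    and P: "\<And>v. v \<in> algebraic_vars J vs \<Longrightarrow> P v \<in> J \<and> P v \<in> mpols (insert v (prevs vs v)) \<and> mp_deriv v (P v) dvd h"
    and sat: "\<And>f. f \<in> J \<Longrightarrow> f \<in> mpols (set vs) \<Longrightarrow> in_sat h P (algebraic_vars J vs) f"
    using triangular_presentation[OF J order_refl vs] by blast
  have sub: "algebraic_vars J vs \<subseteq> set vs" by (auto simp: algebraic_vars_def)
  have "mp_deriv w (P v) = 0"
    if "v \<in> algebraic_vars J vs" "list_ord vs v < list_ord vs w" for v w
  proof (rule mp_deriv_outside)
    show "P v \<in> mpols (insert v (prevs vs v))" using P that by blast
    show "w \<notin> insert v (prevs vs v)" using that list_ord_less[of w vs v] by auto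
  qed
  then have "tri_pres (set vs) J (list_ord vs) (algebraic_vars J vs) P h"
    unfolding tri_pres_def using h P sat sub inj_on_subset[OF inj_on_list_ord sub]
      ideal_mpolD(1)[OF primeideal_mpolD(1)[OF J]] by blast
  then show ?thesis using that P by blast
qed

text \<open>Over points with \<open>h\<close> nonzero, the possibly infinite set \<open>J\<close> is
  replaced by the equations \<open>P v\<close>. For finite \<open>N\<close> these are finitely many,
  so that an existential formula can ask for such a point.\<close>

lemma tri_pres_zero:
  assumes t: "tri_pres N J ord S P h" and c: "type_hom c" and hx: "mp_eval c x h \<noteq> 0"
    and z: "\<And>v. v \<in> S \<Longrightarrow> mp_eval c x (P v) = (0 :: 'b::field)" and f: "f \<in> J"
  shows "mp_eval c x f = 0"
proof -
  obtain k q where "h ^ k * f = (\<Sum>v\<in>S. q v * P v)"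
    using t f by (auto simp: tri_pres_def in_sat_def)
  from arg_cong[OF this, of "mp_eval c x"] z have "mp_eval c x h ^ k * mp_eval c x f = 0"
    by (simp add: mp_eval_ring_simps[OF c] mp_eval_sum[OF c])
  then show ?thesis using hx by simp
qed

text \<open>Differentiate \<open>h ^ k * f = (\<Sum>v\<in>S. q v * P v)\<close> at a point of the
  variety. The terms in which \<open>h ^ k\<close> or \<open>q v\<close> is differentiated vanish
  there, so the gradient of \<open>f\<close> is a combination of those of the \<open>P v\<close>,
  and these form a triangular family.\<close>

lemma tri_pres_rank:
  fixes c :: "'a::field \<Rightarrow> 'b::field"
  assumes t: "tri_pres N J ord S P h" and N: "finite N" and c: "type_hom c"
    and x: "\<And>f. f \<in> J \<Longrightarrow> mp_eval c x f = 0" and hx: "mp_eval c x h \<noteq> 0"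
  shows "fun_vs.dim (grad c x ` J) = card S"
proof (rule fun_vs_dim_triangular[where ord = ord and g = "\<lambda>v. grad c x (P v)"])
  note ev = mp_eval_ring_simps[OF c] mp_eval_sum[OF c]
  have P: "P v \<in> J" if "v \<in> S" for v using t that by (auto simp: tri_pres_def)
  show "finite S" using t N finite_subset by (auto simp: tri_pres_def)
  show "inj_on ord S" using t by (simp add: tri_pres_def)
  show "grad c x (P v) v \<noteq> 0" if v: "v \<in> S" for v
  proof -
    have "mp_deriv v (P v) dvd h" using t v by (auto simp: tri_pres_def)
    then obtain q where "h = mp_deriv v (P v) * q" by (rule dvdE)
    with hx show ?thesis by (auto simp: grad_def ev)
  qed
  show "grad c x (P v) w = 0" if "v \<in> S" "w \<in> S" "ord v < ord w" for v w
    using t that by (auto simp: tri_pres_def grad_def ev)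
  show "(\<lambda>v. grad c x (P v)) ` S \<subseteq> grad c x ` J" using P by auto
  show "grad c x ` J \<subseteq> fun_vs.span ((\<lambda>v. grad c x (P v)) ` S)"
  proof safe
    fix f assume f: "f \<in> J"
    obtain k q where q: "h ^ k * f = (\<Sum>v\<in>S. q v * P v)"
      using t f by (auto simp: tri_pres_def in_sat_def)
    have "grad c x f w = (\<Sum>v\<in>S. (mp_eval c x (q v) / mp_eval c x h ^ k) * grad c x (P v) w)" for w
    proof -
      have "mp_eval c x (mp_deriv w (h ^ k * f)) = mp_eval c x (\<Sum>v\<in>S. mp_deriv w (q v * P v))"
        unfolding q by (simp add: mp_deriv_sum)
      then have "mp_eval c x h ^ k * grad c x f w = (\<Sum>v\<in>S. mp_eval c x (q v) * grad c x (P v) w)"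
        using x[OF f] x[OF P] by (simp add: mp_deriv_mult ev grad_def)
      then have "grad c x f w = (\<Sum>v\<in>S. mp_eval c x (q v) * grad c x (P v) w) / mp_eval c x h ^ k"
        using hx by (simp add: field_simps)
      then show ?thesis by (simp add: sum_divide_distrib)
    qed
    then have "grad c x f = (\<lambda>w. \<Sum>v\<in>S. (mp_eval c x (q v) / mp_eval c x h ^ k) * grad c x (P v) w)"
      by (rule ext)
    then show "grad c x f \<in> fun_vs.span ((\<lambda>v. grad c x (P v)) ` S)"
      using fun_vs_span_family[where S = S and a = "\<lambda>v. mp_eval c x (q v) / mp_eval c x h ^ k"
          and g = "\<lambda>v. grad c x (P v)"] by simp
  qed
qed

text \<open>Enlarging \<open>h\<close> shrinks the open set on which the presentation is used; this
  is how a further polynomial comes to be inverted.\<close>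

lemma tri_pres_multiple:
  assumes "tri_pres N J ord S P h" "h dvd h'" "h' \<in> mpols N" "h' \<notin> J"
  shows "tri_pres N J ord S P h'"
  using assms in_sat_dvd[of h P S _ h'] unfolding tri_pres_def by (meson dvd_trans)

section \<open>Generic points\<close>

text \<open>A universal domain: an algebraically closed extension of infinite transcendence degree.\<close>

type_synonym 'a univ_dom = "((nat, 'a) mpol fract) alg_closure"

definition to_univ :: "'a::field \<Rightarrow> 'a univ_dom" where
  "to_univ a = to_ac (Fract (mconst a) 1)"

definition univ_var :: "nat \<Rightarrow> 'a::field univ_dom" where
  "univ_var i = to_ac (Fract (mvar i) 1)"

lemma type_hom_to_univ [simp]: "type_hom to_univ"
  by (auto simp: ring_hom_def to_univ_def One_fract_def[symmetric] simp flip: to_ac_add to_ac_mult)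

lemma mp_eval_univ_var: "mp_eval to_univ univ_var f = to_ac (Fract f 1)"
proof -
  have "f \<in> mpols UNIV" by simp
  then show ?thesis
  proof (induction rule: mpol_induct)
    case (const c)
    show ?case unfolding mp_eval_const[OF type_hom_to_univ] by (simp add: to_univ_def)
  next
    case (var v)
    show ?case unfolding mp_eval_var[OF type_hom_to_univ] by (simp add: univ_var_def)
  qed (simp_all add: mp_eval_ring_simps flip: to_ac_add to_ac_mult)
qed

lemma mp_eval_univ_var_eq_0: "mp_eval to_univ univ_var f = 0 \<longleftrightarrow> f = 0"
  unfolding mp_eval_univ_var by (simp add: Zero_fract_def eq_fract)

lemma rename_rename:
  fixes f :: "('v, 'a::comm_ring_1) mpol"
  assumes "f \<in> mpols A" "inj_on r A"
  shows "mp_eval mconst (\<lambda>w. mvar (inv_into A r w)) (mp_eval mconst (\<lambda>v. mvar (r v)) f) = f"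
proof -
  have "mp_eval mconst (\<lambda>w. mvar (inv_into A r w)) (mp_eval mconst (\<lambda>v. mvar (r v)) f) =
      mp_eval mconst (\<lambda>v. mvar (inv_into A r (r v))) f"
    by (simp add: mp_eval_subst[OF type_hom_mconst] mp_eval_ring_simps)
  also have "\<dots> = mp_eval mconst mvar f"
    using assms by (intro mp_eval_cong[of _ _ A]) auto
  finally show ?thesis by (simp add: mp_eval_mconst_mvar)
qed

lemma rename_eq_0:
  fixes f :: "('v, 'a::comm_ring_1) mpol"
  assumes "f \<in> mpols A" "inj_on r A" "mp_eval mconst (\<lambda>v. mvar (r v)) f = 0"
  shows "f = 0"
  using rename_rename[OF assms(1,2)] by (simp add: assms(3) mp_eval_ring_simps)

text \<open>Sending \<open>v\<close> to the indeterminate of the univariate polynomial ring and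
  every other variable to itself as a constant gives \<open>p\<close> back.\<close>

lemma poly_mvar_eq_0:
  assumes "coeffs_in A p" "v \<notin> A" "poly p (mvar v) = 0"
  shows "p = (0 :: ('v, 'a::comm_ring_1) mpol poly)"
proof -
  define c where "c = (\<lambda>a::'a. [:mconst a :: ('v, 'a) mpol:])"
  define y where "y = (\<lambda>w. if w = v then [:0, 1:] else [:mvar w :: ('v, 'a) mpol:])"
  have c: "type_hom c" by (auto simp: ring_hom_def c_def one_pCons)
  have const: "mp_eval c y a = [:a:]" if "a \<in> mpols A" for a
    using that
  proof (induction rule: mpol_induct)
    case (var w)
    then have "y w = [:mvar w:]" using assms(2) by (auto simp: y_def)
    then show ?case by (simp add: mp_eval_var[OF c])
  qed (simp_all add: mp_eval_ring_simps[OF c], simp add: c_def)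
  have "mp_eval c y (poly p (mvar v)) = p" using assms(1)
  proof (induction p)
    case 0
    then show ?case by (simp add: mp_eval_ring_simps[OF c])
  next
    case (pCons a p)
    then show ?case by (simp add: mp_eval_ring_simps[OF c] const) (simp add: y_def)
  qed
  then show ?thesis using assms(3) by (simp add: mp_eval_ring_simps[OF c])
qed

lemma type_hom_poly:
  assumes "type_hom h"
  shows "h (poly p x) = poly (map_poly h p) (h x)"
  by (induction p) (use type_homD[OF assms] in \<open>auto simp: map_poly_pCons\<close>)

text \<open>Modulo \<open>J\<close> the quotient has smaller degree than \<open>p\<close>, but its
  actual degree is not controlled, since coefficients in \<open>J\<close> are invisible there. Let
  \<open>i0\<close> be the last index of a coefficient of \<open>a\<close> outside \<open>J\<close>.
  The coefficient of index \<open>i0 + degree g\<close> is 0 on the left, because this index exceeds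
  the degree of \<open>p\<close>, while on the right it is congruent to \<open>coeff a i0\<close>
  times the leading coefficient of \<open>g\<close>, which is not in the prime
  \<open>J\<close>.\<close>

lemma quotient_coeffs_in_prime:
  assumes J: "primeideal J (mpol_ring N)"
    and N: "coeffs_in N p" "coeffs_in N a" "coeffs_in N g" "m \<in> mpols N"
    and eq: "smult m p = a * g + r"
    and r: "\<And>i. Polynomial.coeff r i \<in> J" and l: "Polynomial.lead_coeff g \<notin> J"
    and deg: "Polynomial.degree g > 0" and i: "i \<ge> Polynomial.degree p"
  shows "Polynomial.coeff a i \<in> J"
proof (rule ccontr)
  assume ni: "Polynomial.coeff a i \<notin> J"
  note id = ideal_mpolD[OF primeideal_mpolD(1)[OF J]] and pr = primeideal_mpolD[OF J]
  let ?B = "{j. Polynomial.coeff a j \<notin> J}"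
  have fin: "finite ?B"
    by (rule finite_subset[of _ "{..Polynomial.degree a}"]) (use id(2) in \<open>auto intro: le_degree\<close>)
  define i0 where "i0 = Max ?B"
  have i0: "Polynomial.coeff a i0 \<notin> J" "i0 \<ge> i" "\<And>j. j > i0 \<Longrightarrow> Polynomial.coeff a j \<in> J"
    using Max_in[OF fin] Max_ge[OF fin] ni by (force simp: i0_def)+
  let ?n = "i0 + Polynomial.degree g"
  have "0 = Polynomial.coeff (smult m p) ?n"
    using i i0(2) deg by (simp add: coeff_eq_0)
  also have "\<dots> = (\<Sum>j\<le>?n. Polynomial.coeff a j * Polynomial.coeff g (?n - j)) + Polynomial.coeff r ?n"
    unfolding eq by (simp add: coeff_mult)
  also have "(\<Sum>j\<le>?n. Polynomial.coeff a j * Polynomial.coeff g (?n - j)) =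
      Polynomial.coeff a i0 * Polynomial.lead_coeff g +
      (\<Sum>j\<in>{..?n} - {i0}. Polynomial.coeff a j * Polynomial.coeff g (?n - j))"
    by (subst sum.remove[of _ i0]) auto
  finally have z: "0 = Polynomial.coeff a i0 * Polynomial.lead_coeff g +
      (\<Sum>j\<in>{..?n} - {i0}. Polynomial.coeff a j * Polynomial.coeff g (?n - j)) + Polynomial.coeff r ?n" .
  have e: "Polynomial.coeff a i0 * Polynomial.lead_coeff g =
      - ((\<Sum>j\<in>{..?n} - {i0}. Polynomial.coeff a j * Polynomial.coeff g (?n - j)) + Polynomial.coeff r ?n)"
    using z[symmetric] by (simp only: eq_neg_iff_add_eq_0 add.assoc)
  have sumJ: "(\<Sum>j\<in>A. Polynomial.coeff a j * Polynomial.coeff g (?n - j)) \<in> J"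
    if "finite A" "i0 \<notin> A" for A
    using that
  proof (induction A rule: finite_induct)
    case (insert j A)
    have "Polynomial.coeff a j * Polynomial.coeff g (?n - j) \<in> J"
    proof (cases "j < i0")
      case True
      then have "Polynomial.coeff g (?n - j) = 0" by (intro coeff_eq_0) auto
      then show ?thesis using id(2) by simp
    next
      case False
      then show ?thesis using i0(3)[of j] insert N(3) by (intro id(5)) (auto simp: coeffs_in_def)
    qed
    then show ?case using insert id(3) by simp
  qed (use id(2) in simp)
  have "Polynomial.coeff a i0 * Polynomial.lead_coeff g \<in> J"
    unfolding e by (rule id(6)[OF id(3)[OF sumJ r]]) auto
  then show False
    using pr(3)[of "Polynomial.coeff a i0" "Polynomial.lead_coeff g"] i0(1) l N by (auto simp: coeffs_in_def)
qed

text \<open>The new coordinate is any root of the minimal polynomial \<open>p\<close> of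
  \<open>v\<close>, its coefficients evaluated at \<open>b\<close>; pseudo-division shows that
  \<open>J\<close> vanishes there. The converse is obtained by comparison with the vanishing ideal
  \<open>S\<close> of the new tuple: the minimal polynomial \<open>g\<close> of \<open>v\<close>
  modulo \<open>S\<close> divides \<open>p\<close> up to a power of its leading coefficient and
  coefficients in \<open>J\<close>. If \<open>g\<close> had value outside \<open>J\<close>, the
  cofactor would have value in \<open>J\<close>, hence by minimality of \<open>p\<close> all its
  coefficients in \<open>J\<close>, and then the leading coefficient of \<open>p\<close> as
  well.\<close>

lemma generic_point_step:
  fixes J :: "('v, 'a::field_char_0) mpol set" and b :: "'v \<Rightarrow> 'f::alg_closed_field"
  assumes J: "primeideal J (mpol_ring N)" and A: "A \<subseteq> N" and v: "v \<in> N" "v \<notin> A"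
    and nt: "\<not> transc J A v" and c: "type_hom c"
    and b: "\<And>f. f \<in> mpols A \<Longrightarrow> f \<in> J \<longleftrightarrow> mp_eval c b f = 0"
  shows "\<exists>b'. \<forall>f\<in>mpols (insert v A). f \<in> J \<longleftrightarrow> mp_eval c b' f = 0"
proof -
  note id = ideal_mpolD[OF primeideal_mpolD(1)[OF J]] and pr = primeideal_mpolD[OF J]
  obtain p where p: "coeffs_in A p" "poly p (mvar v) \<in> J" "Polynomial.lead_coeff p \<notin> J"
      "Polynomial.degree p > 0" "poly (formal_deriv p) (mvar v) \<notin> J"
      and small: "\<And>q. coeffs_in A q \<Longrightarrow> Polynomial.degree q < Polynomial.degree p \<Longrightarrow>
         poly q (mvar v) \<in> J \<Longrightarrow> (\<forall>i. Polynomial.coeff q i \<in> J)"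
    using minimal_poly_mod_prime[OF J A v(1) nt] by metis
  have AN: "mpols A \<subseteq> mpols N" using A by (rule mpols_mono)
  have vA: "coeffs_in A q \<Longrightarrow> poly q (mvar v) \<in> mpols (insert v A)" for q
    by (intro mpols_poly mpols_var) (auto intro: coeffs_in_mono[of A])
  have vAN: "mpols (insert v A) \<subseteq> mpols N" using A v by (intro mpols_mono) auto
  have coefA: "coeffs_in A q \<Longrightarrow> Polynomial.coeff q i \<in> mpols A" for q i
    by (simp add: coeffs_in_def)
  let ?p = "map_poly (mp_eval c b) p"
  have "Polynomial.coeff ?p (Polynomial.degree p) \<noteq> 0"
    using p(3) b[OF coefA[OF p(1)]] by (simp add: coeff_map_poly mp_eval_ring_simps[OF c])
  then have "Polynomial.degree ?p > 0" using p(4) le_degree by fastforce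
  then obtain \<beta> where \<beta>: "poly ?p \<beta> = 0" using alg_closed_imp_poly_has_root by blast
  define b' where "b' = b(v := \<beta>)"
  have b'A: "mp_eval c b' f = mp_eval c b f" if "f \<in> mpols A" for f
    using that v by (intro mp_eval_cong[OF c]) (auto simp: b'_def)
  have ev0: "mp_eval c b' (poly q (mvar v)) = 0" if "coeffs_in A q" "\<And>i. Polynomial.coeff q i \<in> J" for q
  proof -
    have "map_poly (mp_eval c b') q = 0"
      using that b[OF coefA] b'A[OF coefA] by (intro poly_eqI) (simp add: coeff_map_poly mp_eval_ring_simps[OF c])
    then show ?thesis by (simp add: type_hom_poly[OF mp_eval_hom[OF c]])
  qed
  have "map_poly (mp_eval c b') p = ?p"
    using b'A[OF coefA[OF p(1)]] by (intro poly_eqI) (simp add: coeff_map_poly mp_eval_ring_simps[OF c])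
  then have pb: "mp_eval c b' (poly p (mvar v)) = 0"
    by (simp add: type_hom_poly[OF mp_eval_hom[OF c]] mp_eval_var[OF c]) (simp add: b'_def \<beta>)
  have dir1: "mp_eval c b' f = 0" if f: "f \<in> mpols (insert v A)" "f \<in> J" for f
  proof -
    obtain q where q: "coeffs_in A q" "f = poly q (mvar v)"
      using mpol_as_poly[OF f(1)] by metis
    obtain k a r where r: "coeffs_in A a" "coeffs_in A r" "Polynomial.degree r < Polynomial.degree p"
      "smult (Polynomial.lead_coeff p ^ k) q = a * p + r"
      using pseudo_division[OF p(1,4) q(1)] by blast
    have eq: "Polynomial.lead_coeff p ^ k * f = poly a (mvar v) * poly p (mvar v) + poly r (mvar v)"
      using arg_cong[OF r(4), of "\<lambda>p. poly p (mvar v)"] by (simp add: q)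
    have "poly a (mvar v) * poly p (mvar v) \<in> J"
      using p(2) vA[OF r(1)] vAN by (intro id(4)) auto
    moreover have "Polynomial.lead_coeff p ^ k * f \<in> J"
      using f(2) coefA[OF p(1)] AN by (intro id(4) mpols_power) auto
    ultimately have "poly r (mvar v) \<in> J"
      using eq id(7)[of "Polynomial.lead_coeff p ^ k * f" "poly a (mvar v) * poly p (mvar v)"] by simp
    from small[OF r(2,3) this] ev0[OF r(2)] have "mp_eval c b' (poly r (mvar v)) = 0" by blast
    then have "mp_eval c b' (Polynomial.lead_coeff p) ^ k * mp_eval c b' f = 0"
      using arg_cong[OF eq, of "mp_eval c b'"] pb by (simp add: mp_eval_ring_simps[OF c])
    moreover have "mp_eval c b' (Polynomial.lead_coeff p) \<noteq> 0"
      using b'A b p(3) coefA[OF p(1)] by auto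
    ultimately show ?thesis by simp
  qed
  \<comment> \<open>On \<open>K[A]\<close> the ideals \<open>S\<close> and \<open>J\<close> agree;
    it remains to see that \<open>S\<close> is not larger in the variable \<open>v\<close>.\<close>
  define S where "S = vanishing_ideal c (insert v A) b'"
  have S: "primeideal S (mpol_ring (insert v A))"
    unfolding S_def by (rule primeideal_vanishing_ideal[OF c])
  note idS = ideal_mpolD[OF primeideal_mpolD(1)[OF S]] and prS = primeideal_mpolD[OF S]
  have SA: "f \<in> S \<longleftrightarrow> f \<in> J" if "f \<in> mpols A" for f
    using that b b'A mpols_mono[of A "insert v A"] by (auto simp: S_def vanishing_ideal_def)
  have "\<not> transc S A v"
  proof
    assume "transc S A v"
    then have "Polynomial.lead_coeff p \<in> S"
      using p(1) pb vA[OF p(1)] by (auto simp: transc_def S_def vanishing_ideal_def)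
    then show False using SA coefA[OF p(1)] p(3) by blast
  qed
  then obtain g where g: "coeffs_in A g" "poly g (mvar v) \<in> S" "Polynomial.lead_coeff g \<notin> S"
      "Polynomial.degree g > 0"
      and smallS: "\<And>q. coeffs_in A q \<Longrightarrow> Polynomial.degree q < Polynomial.degree g \<Longrightarrow>
         poly q (mvar v) \<in> S \<Longrightarrow> (\<forall>i. Polynomial.coeff q i \<in> S)"
    using minimal_poly_mod_prime[OF S subset_insertI insertI1] by metis
  define l where "l = Polynomial.lead_coeff g"
  have l: "l \<in> mpols A" "l \<notin> J" using g SA coefA[OF g(1)] by (auto simp: l_def)
  have lk: "l ^ k \<in> mpols A" for k using l mpols_power by blast
  have red: "\<exists>k a r. coeffs_in A a \<and> coeffs_in A r \<and> (\<forall>i. Polynomial.coeff r i \<in> J) \<and>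
      smult (l ^ k) q = a * g + r" if q: "coeffs_in A q" "poly q (mvar v) \<in> S" for q
  proof -
    obtain k a r where r: "coeffs_in A a" "coeffs_in A r" "Polynomial.degree r < Polynomial.degree g"
      "smult (l ^ k) q = a * g + r"
      using pseudo_division[OF g(1,4) q(1)] unfolding l_def by blast
    have eq: "l ^ k * poly q (mvar v) = poly a (mvar v) * poly g (mvar v) + poly r (mvar v)"
      using arg_cong[OF r(4), of "\<lambda>p. poly p (mvar v)"] by simp
    have "poly a (mvar v) * poly g (mvar v) \<in> S"
      using g(2) vA[OF r(1)] by (intro idS(4)) auto
    moreover have "l ^ k * poly q (mvar v) \<in> S"
      using q(2) lk[of k] mpols_mono[of A "insert v A"] by (intro idS(4)) auto
    ultimately have "poly r (mvar v) \<in> S"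
      using eq idS(7)[of "l ^ k * poly q (mvar v)" "poly a (mvar v) * poly g (mvar v)"] by simp
    from smallS[OF r(2,3) this] have "\<forall>i. Polynomial.coeff r i \<in> J" using SA coefA[OF r(2)] by blast
    with r show ?thesis by blast
  qed
  have gJ: "poly g (mvar v) \<in> J"
  proof (rule ccontr)
    assume ng: "poly g (mvar v) \<notin> J"
    have "poly p (mvar v) \<in> S" using pb vA[OF p(1)] by (simp add: S_def vanishing_ideal_def)
    from red[OF p(1) this] obtain k a r where r: "coeffs_in A a" "coeffs_in A r" "\<And>i. Polynomial.coeff r i \<in> J"
      "smult (l ^ k) p = a * g + r" by blast
    have eq: "l ^ k * poly p (mvar v) = poly a (mvar v) * poly g (mvar v) + poly r (mvar v)"
      using arg_cong[OF r(4), of "\<lambda>p. poly p (mvar v)"] by simp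
    have "poly r (mvar v) \<in> J"
      using r(3) v by (intro ideal_poly_in[OF pr(1)] mpols_var) auto
    moreover have "l ^ k * poly p (mvar v) \<in> J"
      using p(2) lk[of k] AN by (intro id(4)) auto
    ultimately have "poly a (mvar v) * poly g (mvar v) \<in> J"
      using eq id(7)[of "l ^ k * poly p (mvar v)" "poly r (mvar v)"] by simp
    then have aJ: "poly a (mvar v) \<in> J"
      using ng pr(3) vA[OF r(1)] vA[OF g(1)] vAN by blast
    have cN: "coeffs_in A q \<Longrightarrow> coeffs_in N q" for q using coeffs_in_mono[OF A] .
    have high: "Polynomial.coeff a i \<in> J" if "i \<ge> Polynomial.degree p" for i
    proof (rule quotient_coeffs_in_prime[OF J, of p a g "l ^ k" r])
      show "Polynomial.lead_coeff g \<notin> J" using l(2) by (simp add: l_def)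
    qed (use cN p r g lk[of k] AN that in auto)
    \<comment> \<open>The coefficients of \<open>a\<close> from index \<open>degree p\<close> on are
      in \<open>J\<close> but need not be 0; cutting them off brings \<open>a\<close> below the
      degree to which minimality of \<open>p\<close> applies.\<close>
    let ?a = "poly_cutoff (Polynomial.degree p) a"
    have ca: "coeffs_in A ?a" using r(1) by (auto simp: coeffs_in_def coeff_poly_cutoff)
    have "poly (a - ?a) (mvar v) \<in> J"
      using high id(2) v by (intro ideal_poly_in[OF pr(1)] mpols_var) (auto simp: coeff_poly_cutoff)
    from id(7)[OF aJ this] have "poly ?a (mvar v) \<in> J" by simp
    moreover have "Polynomial.degree ?a < Polynomial.degree p"
    proof -
      have "Polynomial.degree ?a \<le> Polynomial.degree p - 1"
        by (rule degree_le) (use p(4) in \<open>auto simp: coeff_poly_cutoff\<close>)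
      with p(4) show ?thesis by linarith
    qed
    ultimately have low: "\<forall>i. Polynomial.coeff ?a i \<in> J" using small[OF ca] by blast
    have aJ': "Polynomial.coeff a i \<in> J" for i
      using high[of i] spec[OF low, of i] by (cases "i < Polynomial.degree p") (auto simp: coeff_poly_cutoff)
    have "Polynomial.coeff (a * g) i \<in> J" for i
    proof -
      have "finite B \<Longrightarrow> (\<Sum>j\<in>B. Polynomial.coeff a j * Polynomial.coeff g (i - j)) \<in> J" for B
        by (induction B rule: finite_induct)
          (use aJ' coefA[OF g(1)] AN id(2) in \<open>auto intro!: id(3) id(5)\<close>)
      then show ?thesis by (simp add: coeff_mult)
    qed
    then have "l ^ k * Polynomial.lead_coeff p \<in> J"
      using arg_cong[OF r(4), of "\<lambda>q. Polynomial.coeff q (Polynomial.degree p)"] r(3) id(3) by simp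
    then have "l ^ k \<in> J"
      using pr(3) lk[of k] coefA[OF p(1)] p(3) AN by blast
    then show False using pr(4) l AN by blast
  qed
  have "f \<in> J" if f: "f \<in> mpols (insert v A)" "mp_eval c b' f = 0" for f
  proof -
    obtain q where q: "coeffs_in A q" "f = poly q (mvar v)"
      using mpol_as_poly[OF f(1)] by metis
    have "poly q (mvar v) \<in> S" using f q by (simp add: S_def vanishing_ideal_def)
    from red[OF q(1) this] obtain k a r where r: "coeffs_in A a" "coeffs_in A r" "\<And>i. Polynomial.coeff r i \<in> J"
      "smult (l ^ k) q = a * g + r" by blast
    have eq: "l ^ k * f = poly a (mvar v) * poly g (mvar v) + poly r (mvar v)"
      using arg_cong[OF r(4), of "\<lambda>p. poly p (mvar v)"] by (simp add: q)
    have "poly r (mvar v) \<in> J"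
      using r(3) v by (intro ideal_poly_in[OF pr(1)] mpols_var) auto
    moreover have "poly a (mvar v) * poly g (mvar v) \<in> J"
      using gJ vA[OF r(1)] vAN by (intro id(4)) auto
    ultimately have "l ^ k * f \<in> J" unfolding eq by (rule id(3)[rotated])
    then have "l ^ k \<in> J \<or> f \<in> J" using pr(3) lk[of k] f(1) AN vAN by blast
    then show ?thesis using pr(4) l AN by blast
  qed
  with dir1 show ?thesis by blast
qed

text \<open>\<open>T\<close> has the greatest cardinality among the sets of variables without
  nonzero relation in \<open>J\<close>, so adding any further variable creates a relation.\<close>

lemma maximal_independent_vars:
  fixes J :: "('v, 'a::field_char_0) mpol set"
  assumes J: "primeideal J (mpol_ring N)" and N: "finite N"
  obtains T where "T \<subseteq> N" "\<And>f. f \<in> J \<Longrightarrow> f \<in> mpols T \<Longrightarrow> f = 0"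
    "\<And>v A. v \<in> N - T \<Longrightarrow> T \<subseteq> A \<Longrightarrow> \<not> transc J A v"
    "\<And>v A. v \<in> T \<Longrightarrow> A \<subseteq> T - {v} \<Longrightarrow> transc J A v"
proof -
  let ?Q = "\<lambda>T. T \<subseteq> N \<and> (\<forall>f\<in>J. f \<in> mpols T \<longrightarrow> f = 0)"
  have base: "f = 0" if f: "f \<in> J" "f \<in> mpols {}" for f
  proof -
    obtain c where c: "f = mconst c" using mpols_empty[OF f(2)] by blast
    have "c = 0"
    proof (rule ccontr)
      assume "c \<noteq> 0"
      have "mconst (inverse c) * f \<in> J"
        using f(1) ideal_mpolD(4)[OF primeideal_mpolD(1)[OF J]] by auto
      then show False
        using \<open>c \<noteq> 0\<close> primeideal_mpolD(2)[OF J] by (simp add: c flip: mconst_simps(4))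
    qed
    with c show ?thesis by simp
  qed
  have e: "?Q {}" using base by auto
  have "\<forall>T. ?Q T \<longrightarrow> card T < Suc (card N)" using card_mono[OF N] by (auto simp: less_Suc_eq_le)
  note bound = this
  define Q where "Q = ?Q"
  have "Q {}" "\<forall>T. Q T \<longrightarrow> card T < Suc (card N)" using e bound unfolding Q_def by blast+
  from ex_has_greatest_nat[of Q "{}" card, OF this]
  obtain T where QT: "Q T" "\<forall>T'. Q T' \<longrightarrow> card T' \<le> card T" by blast
  have T: "?Q T" using QT(1) by (simp add: Q_def)
  have max: "card T' \<le> card T" if "?Q T'" for T'
    using QT(2) that by (simp add: Q_def)
  have id: "0 \<in> J" using ideal_mpolD(2)[OF primeideal_mpolD(1)[OF J]] .
  show ?thesis
  proof (rule that[of T])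
    show "T \<subseteq> N" "\<And>f. f \<in> J \<Longrightarrow> f \<in> mpols T \<Longrightarrow> f = 0" using T by auto
    show "\<not> transc J A v" if v: "v \<in> N - T" "T \<subseteq> A" for v A
    proof
      assume tr: "transc J A v"
      have "finite T" using T N finite_subset by blast
      then have "card (insert v T) > card T" using v by simp
      then have "\<not> ?Q (insert v T)" using max[of "insert v T"] by linarith
      then obtain f where f: "f \<in> J" "f \<in> mpols (insert v T)" "f \<noteq> 0" using T v by auto
      then obtain p where p: "coeffs_in T p" "f = poly p (mvar v)" using mpol_as_poly by metis
      then have "\<forall>i. Polynomial.coeff p i \<in> J"
        using tr f(1) coeffs_in_mono[OF v(2)] by (auto simp: transc_def)
      then have "p = 0" using T p(1) by (intro poly_eqI) (auto simp: coeffs_in_def)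
      with p f(3) show False by simp
    qed
    show "transc J A v" if v: "v \<in> T" "A \<subseteq> T - {v}" for v A
      unfolding transc_def
    proof (intro allI impI)
      fix p i assume p: "coeffs_in A p \<and> poly p (mvar v) \<in> J"
      then have "poly p (mvar v) \<in> mpols T"
        using v by (intro mpols_poly mpols_var) (auto intro: coeffs_in_mono[of A])
      then have "poly p (mvar v) = 0" using T p by blast
      then have "p = 0" using p v by (intro poly_mvar_eq_0[of A p v]) auto
      then show "Polynomial.coeff p i \<in> J" using id by simp
    qed
  qed
qed

text \<open>The variables of \<open>T\<close> go to distinct indeterminates of the universal domain,
  of which there are infinitely many. Every other variable is algebraic over any set containing
  \<open>T\<close>, so its value is found in the algebraically closed field, one variable at a
  time.\<close>

theorem generic_point:
  fixes J :: "('v, 'a::field_char_0) mpol set"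
  assumes J: "primeideal J (mpol_ring N)" and N: "finite N"
  obtains b :: "'v \<Rightarrow> 'a univ_dom" where "J = vanishing_ideal to_univ N b"
proof -
  obtain T where T: "T \<subseteq> N" "\<And>f. f \<in> J \<Longrightarrow> f \<in> mpols T \<Longrightarrow> f = 0"
    "\<And>v A. v \<in> N - T \<Longrightarrow> T \<subseteq> A \<Longrightarrow> \<not> transc J A v"
    using maximal_independent_vars[OF assms] by metis
  have id: "0 \<in> J" using ideal_mpolD(2)[OF primeideal_mpolD(1)[OF J]] .
  have "\<exists>b :: 'v \<Rightarrow> 'a univ_dom. \<forall>f\<in>mpols (T \<union> B). f \<in> J \<longleftrightarrow> mp_eval to_univ b f = 0"
    if "finite B" "B \<subseteq> N - T" for B
    using that
  proof (induction B rule: finite_induct)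
    case empty
    have "finite T" using T N finite_subset by blast
    then obtain r :: "'v \<Rightarrow> nat" where r: "inj_on r T"
      using finite_imp_inj_to_nat_seg by metis
    have "f \<in> J \<longleftrightarrow> mp_eval to_univ (\<lambda>v. univ_var (r v)) f = 0" if f: "f \<in> mpols T" for f
    proof -
      have "mp_eval to_univ (\<lambda>v. univ_var (r v)) f =
          mp_eval to_univ univ_var (mp_eval mconst (\<lambda>v. mvar (r v)) f)"
        by (simp add: mp_eval_subst mp_eval_var)
      then have "mp_eval to_univ (\<lambda>v. univ_var (r v)) f = 0 \<longleftrightarrow> f = 0"
        using rename_eq_0[OF f r] by (auto simp: mp_eval_univ_var_eq_0 mp_eval_ring_simps)
      then show ?thesis using T(2)[OF _ f] id by auto
    qed
    then show ?case by auto
  next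
    case (insert v B)
    then obtain b :: "'v \<Rightarrow> 'a univ_dom"
      where b: "\<And>f. f \<in> mpols (T \<union> B) \<Longrightarrow> f \<in> J \<longleftrightarrow> mp_eval to_univ b f = 0"
      by auto
    have "\<exists>b' :: 'v \<Rightarrow> 'a univ_dom. \<forall>f\<in>mpols (insert v (T \<union> B)). f \<in> J \<longleftrightarrow> mp_eval to_univ b' f = 0"
      using insert T by (intro generic_point_step[OF J, of "T \<union> B" v to_univ b] b) auto
    then show ?case by simp
  qed
  from this[of "N - T"] N T(1) obtain b :: "'v \<Rightarrow> 'a univ_dom"
    where "\<And>f. f \<in> mpols N \<Longrightarrow> f \<in> J \<longleftrightarrow> mp_eval to_univ b f = 0"
    by (auto simp: Un_absorb1)
  then have "J = vanishing_ideal to_univ N b"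
    using ideal_mpolD(1)[OF primeideal_mpolD(1)[OF J]] by (auto simp: vanishing_ideal_def)
  then show ?thesis by (rule that)
qed

section \<open>Dimension\<close>

lemma vanishing_ideal_cong:
  "type_hom c \<Longrightarrow> (\<And>v. v \<in> N \<Longrightarrow> b v = b' v) \<Longrightarrow> vanishing_ideal c N b = vanishing_ideal c N b'"
  by (auto simp: vanishing_ideal_def cong: mp_eval_cong)

text \<open>A variable of an independent set satisfies no relation over other members of the set.
  Listing such a set first thus makes it part of the transcendence basis.\<close>

lemma algebraic_vars_avoid_independent:
  assumes "\<And>f. f \<in> J \<Longrightarrow> f \<in> mpols T \<Longrightarrow> f = 0" "0 \<in> J" "set ts = T" "distinct ts"
  shows "algebraic_vars J (ts @ rs) \<inter> T = {}"
proof -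
  have "transc J (prevs (ts @ rs) v) v" if v: "v \<in> T" for v
    unfolding transc_def
  proof (intro allI impI)
    fix p i assume p: "coeffs_in (prevs (ts @ rs) v) p \<and> poly p (mvar v) \<in> J"
    have pv: "prevs (ts @ rs) v = prevs ts v" using v assms(3) by simp
    have sub: "prevs ts v \<subseteq> T" "v \<notin> prevs ts v"
      using prevs_subset[of ts v] assms(3) by (auto simp: prevs_def dest: set_takeWhileD)
    have "poly p (mvar v) \<in> mpols T"
      using v p pv sub by (intro mpols_poly mpols_var) (auto intro: coeffs_in_mono)
    then have "poly p (mvar v) = 0" using p assms(1) by blast
    then have "p = 0" using p pv sub by (intro poly_mvar_eq_0[of "prevs ts v" p v]) auto
    then show "Polynomial.coeff p i \<in> J" using assms(2) by simp
  qed
  then show ?thesis by (auto simp: algebraic_vars_def)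
qed

text \<open>This takes the place of an exchange argument. The values of the \<open>g i\<close> are
  adjoined to a generic point as \<open>d\<close> new coordinates, which changes only the
  generators, so by invariance of the codimension the Jacobian rank grows from \<open>card S\<close>
  to \<open>d + card S\<close>. If the new coordinates are listed first, none of them is algebraic,
  hence the new rank is at most \<open>card N\<close>.\<close>

lemma independent_bound:
  fixes J :: "('v, 'a::field_char_0) mpol set"
  assumes t: "tri_pres N J ord S P h" and J: "primeideal J (mpol_ring N)" and N: "finite N"
    and g: "g ` {..<d} \<subseteq> mpols N" "alg_independent_mod J d g"
  shows "d + card S \<le> card N"
proof -
  obtain b :: "'v \<Rightarrow> 'a univ_dom" where gen: "J = vanishing_ideal to_univ N b"
    using generic_point[OF J N] .
  define N' where "N' = Inl ` N \<union> Inr ` {..<d}"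
  define b' where "b' = case_sum b (\<lambda>i. mp_eval to_univ b (g i))"
  define J' where "J' = vanishing_ideal to_univ N' b'"
  have N': "finite N'" "card N' = card N + d"
  proof -
    have "card N' = card (Inl ` N :: ('v + nat) set) + card (Inr ` {..<d} :: ('v + nat) set)"
      unfolding N'_def by (rule card_Un_disjoint) (use N in auto)
    then show "card N' = card N + d" by (simp add: card_image)
  qed (use N in \<open>simp add: N'_def\<close>)
  interpret i: interdefinable to_univ N N' b b' "case_sum mvar g" "\<lambda>v. mvar (Inl v)"
    by unfold_locales
      (use N N' g in \<open>auto simp: N'_def b'_def mp_eval_var intro!: mpols_var\<close>)
  define x where "x = restrict b N"
  define y where "y = (\<lambda>v\<in>N'. mp_eval to_univ x (case_sum mvar g v))"
  have ex: "mp_eval to_univ x f = mp_eval to_univ b f" if "f \<in> mpols N" for f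
    by (rule mp_eval_cong[OF type_hom_to_univ that]) (simp add: x_def)
  have x: "x \<in> points to_univ N J"
    using ex by (auto simp: points_def vanishing_ideal_def x_def gen)
  have hx: "h \<in> mpols N" "h \<notin> J" using t by (auto simp: tri_pres_def)
  have r1: "fun_vs.dim (grad to_univ x ` J) = card S"
    by (rule tri_pres_rank[OF t N]) (use ex hx gen in \<open>auto simp: vanishing_ideal_def\<close>)
  have yb: "y v = b' v" if "v \<in> N'" for v
    using that ex g(1) by (auto simp: y_def b'_def N'_def mp_eval_var x_def image_subset_iff)
  have J': "primeideal J' (mpol_ring N')" unfolding J'_def by (rule primeideal_vanishing_ideal) simp
  obtain ns where ns: "set ns = N" "distinct ns" using N finite_distinct_list by metis
  let ?ts = "map Inr [0..<d] :: ('v + nat) list"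
  let ?vs = "?ts @ map Inl ns"
  have vs: "set ?vs = N'" "distinct ?vs"
    using ns by (auto simp: N'_def distinct_map inj_on_def atLeast0LessThan)
  have "f = 0" if f: "f \<in> J'" "f \<in> mpols (Inr ` {..<d})" for f :: "('v + nat, 'a) mpol"
  proof -
    define i :: "'v + nat \<Rightarrow> nat" where "i = case_sum (\<lambda>_. 0) (\<lambda>i. i)"
    let ?F = "mp_eval mconst (\<lambda>v. mvar (i v)) f"
    have F: "?F \<in> mpols {..<d}"
      using f(2) by (rule mpols_subst) (auto simp: i_def intro: mpols_var)
    have "mp_eval to_univ b (mp_eval mconst g ?F) = mp_eval to_univ (\<lambda>v. mp_eval to_univ b (g (i v))) f"
      by (simp add: mp_eval_subst mp_eval_var)
    also have "\<dots> = mp_eval to_univ b' f"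
      by (rule mp_eval_cong[OF type_hom_to_univ f(2)]) (auto simp: b'_def i_def)
    also have "\<dots> = 0" using f(1) by (simp add: J'_def vanishing_ideal_def)
    finally have "mp_eval mconst g ?F \<in> J"
      using mpols_subst[OF F, of g N] g(1) by (auto simp: gen vanishing_ideal_def)
    then have "?F = 0" using g(2) F by (auto simp: alg_independent_mod_def)
    then show ?thesis
      by (rule rename_eq_0[OF f(2), rotated]) (auto simp: inj_on_def i_def)
  qed
  then have "algebraic_vars J' ?vs \<inter> Inr ` {..<d} = {}"
    using ideal_mpolD(2)[OF primeideal_mpolD(1)[OF J']]
    by (intro algebraic_vars_avoid_independent) (auto simp: distinct_map atLeast0LessThan)
  moreover have "algebraic_vars J' ?vs \<subseteq> N'" using vs(1) unfolding algebraic_vars_def by blast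
  ultimately have "algebraic_vars J' ?vs \<subseteq> Inl ` N" by (auto simp: N'_def)
  then have "card (algebraic_vars J' ?vs) \<le> card (Inl ` N :: ('v + nat) set)"
    using N by (intro card_mono) auto
  then have le: "card (algebraic_vars J' ?vs) \<le> card N" by (simp add: card_image)
  obtain P' h' where t': "tri_pres N' J' (list_ord ?vs) (algebraic_vars J' ?vs) P' h'"
    using tri_pres_list[of J' ?vs] J' vs by metis
  have ey: "mp_eval to_univ y f = mp_eval to_univ b' f" if "f \<in> mpols N'" for f
    by (rule mp_eval_cong[OF type_hom_to_univ that]) (rule yb)
  have "fun_vs.dim (grad to_univ y ` J') = card (algebraic_vars J' ?vs)"
  proof (rule tri_pres_rank[OF t' N'(1)])
    show "mp_eval to_univ y h' \<noteq> 0"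
      using t' ey[of h'] by (auto simp: tri_pres_def J'_def vanishing_ideal_def)
  qed (use ey in \<open>auto simp: J'_def vanishing_ideal_def\<close>)
  with i.codim_eq[OF type_hom_to_univ x[unfolded gen], folded y_def] r1 le N'(2) show ?thesis
    by (simp add: gen J'_def)
qed

text \<open>The rank at a generic point depends on \<open>J\<close> only, so all presentations have
  equally many equations. A list beginning with a maximal independent set \<open>T\<close> has
  exactly \<open>N - T\<close> as its algebraic variables; therefore
  \<open>card T + card S = card N\<close>. The variables of \<open>T\<close> show that
  \<open>card T\<close> is attained, and \<open>independent_bound\<close> that it is not exceeded;
  the bound also makes the maximum in \<open>variety_dim\<close> one over a finite set.\<close>

theorem tri_pres_variety_dim:
  fixes J :: "('v, 'a::field_char_0) mpol set"
  assumes t: "tri_pres N J ord S P h" and J: "primeideal J (mpol_ring N)" and N: "finite N"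
  shows "variety_dim N J + card S = card N"
proof -
  let ?D = "{d. \<exists>g. g ` {..<d} \<subseteq> mpols N \<and> alg_independent_mod J d g}"
  have cS: "card S \<le> card N" using t N card_mono by (auto simp: tri_pres_def)
  obtain b :: "'v \<Rightarrow> 'a univ_dom" where b: "J = vanishing_ideal to_univ N b"
    using generic_point[OF J N] .
  have rank: "fun_vs.dim (grad to_univ b ` J) = card S'" if "tri_pres N J ord' S' P' h'" for ord' S' P' h'
    by (rule tri_pres_rank[OF that N])
      (use that b in \<open>auto simp: tri_pres_def vanishing_ideal_def\<close>)
  obtain T where T: "T \<subseteq> N" "\<And>f. f \<in> J \<Longrightarrow> f \<in> mpols T \<Longrightarrow> f = 0"
    "\<And>v A. v \<in> N - T \<Longrightarrow> T \<subseteq> A \<Longrightarrow> \<not> transc J A v"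
    using maximal_independent_vars[OF J N] by metis
  have finT: "finite T" using T N finite_subset by blast
  obtain ts where ts: "set ts = T" "distinct ts" using finT finite_distinct_list by metis
  obtain rs where rs: "set rs = N - T" "distinct rs" using N finite_distinct_list by (metis finite_Diff)
  have vs: "set (ts @ rs) = N" "distinct (ts @ rs)" using ts rs T by auto
  have 0: "0 \<in> J" using ideal_mpolD(2)[OF primeideal_mpolD(1)[OF J]] .
  have "algebraic_vars J (ts @ rs) \<inter> T = {}"
    by (rule algebraic_vars_avoid_independent[OF T(2) 0 ts])
  moreover have "v \<in> algebraic_vars J (ts @ rs)" if v: "v \<in> N - T" for v
  proof -
    have "T \<subseteq> prevs (ts @ rs) v"
      using ts v by (auto simp: prevs_def takeWhile_append)
    then show ?thesis using T(3)[OF v] v vs(1) by (auto simp: algebraic_vars_def)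
  qed
  ultimately have av: "algebraic_vars J (ts @ rs) = N - T"
    using vs(1) by (auto simp: algebraic_vars_def)
  obtain P' h' where "tri_pres N J (list_ord (ts @ rs)) (N - T) P' h'"
    using tri_pres_list[of J "ts @ rs"] J vs av by metis
  then have "card S = card N - card T"
    using rank[OF t] rank[of _ "N - T"] finT T(1) by (simp add: card_Diff_subset)
  moreover have "card T \<le> card N" using T N card_mono by blast
  ultimately have cT: "card T + card S = card N" by simp
  have "card T \<in> ?D"
  proof -
    have lt: "length ts = card T" using ts distinct_card by fastforce
    let ?g = "\<lambda>i. mvar (ts ! i) :: ('v, 'a) mpol"
    have "?g ` {..<card T} \<subseteq> mpols N"
      using ts(1) lt T(1) by (auto intro!: mpols_var)
    moreover have "alg_independent_mod J (card T) ?g"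
      unfolding alg_independent_mod_def
    proof (intro ballI impI notI)
      fix F :: "(nat, 'a) mpol" assume F: "F \<in> mpols {..<card T}" "F \<noteq> 0" "mp_eval mconst ?g F \<in> J"
      have "mp_eval mconst ?g F \<in> mpols T"
        using F(1) by (rule mpols_subst) (use ts(1) lt in \<open>auto intro!: mpols_var\<close>)
      then have "mp_eval mconst ?g F = 0" using T(2) F(3) by blast
      then have "F = 0"
        by (rule rename_eq_0[OF F(1), rotated]) (use ts(2) lt in \<open>auto simp: inj_on_def nth_eq_iff_index_eq\<close>)
      with F(2) show False by simp
    qed
    ultimately show ?thesis by blast
  qed
  moreover have le: "d \<le> card T" if d: "d \<in> ?D" for d
  proof -
    obtain g where "g ` {..<d} \<subseteq> mpols N" "alg_independent_mod J d g" using d by blast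
    from independent_bound[OF t J N this] cT show ?thesis by linarith
  qed
  moreover have "finite ?D" by (rule finite_subset[of _ "{..card T}"]) (use le in auto)
  ultimately have "Max ?D = card T" by (intro Max_eqI)
  then show ?thesis using cT by (simp add: variety_dim_def)
qed

lemma tri_pres_smooth_at:
  fixes J :: "('v, 'a::field_char_0) mpol set" and c :: "'a \<Rightarrow> 'b::field"
  assumes "tri_pres N J ord S P h" "primeideal J (mpol_ring N)" "finite N" "type_hom c"
    and "\<And>f. f \<in> J \<Longrightarrow> mp_eval c x f = 0" "mp_eval c x h \<noteq> 0"
  shows "smooth_at c N J x"
  unfolding smooth_at_iff using tri_pres_rank[OF assms(1,3-6)] tri_pres_variety_dim[OF assms(1-3)] by simp

text \<open>The trick of Rabinowitsch: \<open>y\<close> is a coordinate for 1/h. Its equation has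
  derivative \<open>h\<close> in \<open>y\<close>, and \<open>y\<close> is put last in the order, so
  the system stays triangular with the same \<open>h\<close>. After multiplication by a power of
  \<open>h\<close> every occurrence of \<open>y\<close> can be eliminated, which reduces relations
  of the longer tuple to relations of \<open>b\<close> on \<open>N\<close>.\<close>

lemma tri_pres_localise:
  fixes b :: "'v \<Rightarrow> 'f::field"
  assumes c: "type_hom c" and N: "finite N" and y: "y \<notin> N"
    and t: "tri_pres N (vanishing_ideal c N b) ord S P h"
    and by_: "b y = inverse (mp_eval c b h)"
  shows "\<exists>ord'. tri_pres (insert y N) (vanishing_ideal c (insert y N) b) ord' (insert y S)
    (P(y := h * mvar y - 1)) h"
proof -
  note ev = mp_eval_ring_simps[OF c]
  have h: "h \<in> mpols N" "mp_eval c b h \<noteq> 0" using t by (auto simp: tri_pres_def vanishing_ideal_def)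
  have S: "S \<subseteq> N" "finite S" using t N finite_subset by (auto simp: tri_pres_def)
  have PN: "P v \<in> mpols N" "P v \<in> vanishing_ideal c N b" if "v \<in> S" for v
    using t that by (auto simp: tri_pres_def vanishing_ideal_def)
  have yS: "y \<notin> S" using y S by auto
  have mono: "mpols N \<subseteq> mpols (insert y N)" by (rule mpols_mono) auto
  define ord' where "ord' = ord(y := Suc (Max (ord ` insert y S)))"
  let ?P = "P(y := h * mvar y - 1)"
  have less: "ord' v < ord' y" if "v \<in> S" for v
    using that S yS by (auto simp: ord'_def less_Suc_eq_le)
  have inj: "inj_on ord' (insert y S)"
  proof -
    have "inj_on ord S" using t by (simp add: tri_pres_def)
    then have "inj_on ord' S" using yS by (auto simp: inj_on_def ord'_def)
    moreover have "ord' y \<notin> ord' ` (S - {y})" using less by force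
    ultimately show ?thesis by (simp add: inj_on_insert)
  qed
  have dy: "mp_deriv y (h * mvar y - 1) = h"
    using mp_deriv_outside[OF h(1) y] by (simp add: mp_deriv_minus mp_deriv_mult mp_deriv_var)
  have Py: "h * mvar y - 1 \<in> vanishing_ideal c (insert y N) b"
    using h by_ mono by (auto simp: vanishing_ideal_def ev intro!: mpols_minus mpols_mult mpols_var)
  have elim: "\<exists>k g q. g \<in> mpols N \<and> h ^ k * poly p (mvar y) = g + q * (h * mvar y - 1)"
    if "coeffs_in N p" for p
    using that
  proof (induction p)
    case 0
    then show ?case by (intro exI[of _ 0]) auto
  next
    case (pCons a p)
    then obtain k g q where g: "g \<in> mpols N" "h ^ k * poly p (mvar y) = g + q * (h * mvar y - 1)"
      by auto
    have "h ^ Suc k * poly (pCons a p) (mvar y) = h ^ Suc k * a + h * mvar y * (h ^ k * poly p (mvar y))"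
      by (simp add: algebra_simps)
    also have "\<dots> = (h ^ Suc k * a + g) + (g + h * mvar y * q) * (h * mvar y - 1)"
      unfolding g(2) by (simp add: algebra_simps)
    finally show ?case
      using g(1) pCons h(1) by (intro exI[of _ "Suc k"] exI[of _ "h ^ Suc k * a + g"] exI[of _ "g + h * mvar y * q"])
        (auto intro!: mpols_add mpols_mult mpols_power)
  qed
  have sat: "in_sat h ?P (insert y S) f" if f: "f \<in> vanishing_ideal c (insert y N) b" for f
  proof -
    obtain p where p: "coeffs_in N p" "f = poly p (mvar y)"
      using mpol_as_poly[of f y N] f by (auto simp: vanishing_ideal_def)
    obtain k g q where g: "g \<in> mpols N" "h ^ k * f = g + q * (h * mvar y - 1)"
      using elim[OF p(1)] p(2) by blast
    have "mp_eval c b g = 0"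
      using arg_cong[OF g(2), of "mp_eval c b"] f h by_ by (simp add: ev vanishing_ideal_def)
    with g(1) t have "in_sat h P S g" by (auto simp: tri_pres_def vanishing_ideal_def)
    then have "in_sat h ?P (insert y S) g"
      by (rule in_sat_superset) (use S yS in auto)
    moreover have "in_sat h ?P (insert y S) (?P y)" by (rule in_sat_base) (use S in auto)
    ultimately have "in_sat h ?P (insert y S) (h ^ k * f)"
      unfolding g(2) by (intro in_sat_add in_sat_mult) auto
    then show ?thesis by (rule in_sat_cancel) simp
  qed
  have PJ: "P v \<in> vanishing_ideal c (insert y N) b" if "v \<in> S" for v
    using PN[OF that] mono by (auto simp: vanishing_ideal_def)
  have tri: "mp_deriv w (P v) = 0" if "v \<in> S" "w \<in> insert y S" "ord' v < ord' w" for v w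
  proof (cases "w = y")
    case True
    then show ?thesis using mp_deriv_outside[OF PN(1)[OF that(1)] y] by simp
  next
    case False
    then show ?thesis using that t y S yS by (auto simp: tri_pres_def ord'_def split: if_splits)
  qed
  have "tri_pres (insert y N) (vanishing_ideal c (insert y N) b) ord' (insert y S) ?P h"
    unfolding tri_pres_def
  proof (intro conjI ballI impI)
    show "insert y S \<subseteq> insert y N" using S(1) by auto
    show "inj_on ord' (insert y S)" by (rule inj)
    show "h \<in> mpols (insert y N)" using h(1) mono by blast
    show "h \<notin> vanishing_ideal c (insert y N) b" using h(2) by (simp add: vanishing_ideal_def)
    fix v assume v: "v \<in> insert y S"
    show "?P v \<in> vanishing_ideal c (insert y N) b" using v PJ Py by auto
    show "mp_deriv v (?P v) dvd h" using v dy t by (auto simp: tri_pres_def)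
    fix w assume w: "w \<in> insert y S" "ord' v < ord' w"
    show "mp_deriv w (?P v) = 0"
    proof (cases "v = y")
      case True
      then show ?thesis using w less[of w] by auto
    next
      case False
      then show ?thesis using v w tri by simp
    qed
  qed (rule sat)
  then show ?thesis by blast
qed

section \<open>Nilpotents, units and Hensel's lemma\<close>

context cring
begin

definition nilpotent :: "'a \<Rightarrow> bool" where
  "nilpotent a \<longleftrightarrow> a \<in> carrier R \<and> (\<exists>n::nat. a [^] n = \<zero>)"

lemma prime_mem_of_pow:
  assumes P: "primeideal P R" and a: "a \<in> carrier R" and "a [^] (n::nat) \<in> P"
  shows "a \<in> P"
  using assms(3)
proof (induction n)
  case 0
  interpret P: primeideal P R by fact
  show ?case using 0 P.one_imp_carrier P.I_notcarr by simp
next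
  case (Suc n)
  interpret P: primeideal P R by fact
  show ?case using Suc a P.I_prime[of "a [^] n" a] by auto
qed

lemma nilpotent_in_prime: "nilpotent a \<Longrightarrow> primeideal P R \<Longrightarrow> a \<in> P"
proof -
  assume a: "nilpotent a" and P: "primeideal P R"
  interpret P: primeideal P R by fact
  obtain n :: nat where "a [^] n = \<zero>" "a \<in> carrier R" using a by (auto simp: nilpotent_def)
  then show "a \<in> P"
    using prime_mem_of_pow[OF P, of a n] additive_subgroup.zero_closed[OF P.is_additive_subgroup] by simp
qed

text \<open>The contrapositive of \<open>exists_prime_avoiding\<close> for the zero ideal. Testing
  nilpotency on primes gives sums of nilpotents without a binomial expansion.\<close>

lemma nilpotentI:
  assumes "a \<in> carrier R" "\<And>P. primeideal P R \<Longrightarrow> a \<in> P"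
  shows "nilpotent a"
proof (rule ccontr)
  assume "\<not> nilpotent a"
  then have "\<And>n::nat. a [^] n \<notin> {\<zero>}" using assms(1) by (auto simp: nilpotent_def)
  from exists_prime_avoiding[OF zeroideal assms(1) this] obtain P where "primeideal P R" "a \<notin> P" .
  with assms(2) show False by blast
qed

text \<open>A nonunit generates a proper ideal, and \<open>exists_prime_avoiding\<close> with 1 in
  place of \<open>f\<close> puts a prime above it.\<close>

lemma unitI:
  assumes "a \<in> carrier R" "\<And>P. primeideal P R \<Longrightarrow> a \<notin> P"
  shows "a \<in> Units R"
proof (rule ccontr)
  assume na: "a \<notin> Units R"
  have "\<one> [^] (n::nat) \<notin> PIdl a" for n
  proof
    assume "\<one> [^] n \<in> PIdl a"
    then obtain x where "x \<in> carrier R" "\<one> = x \<otimes> a" by (auto simp: cgenideal_def)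
    with na assms(1) show False unfolding Units_def by (auto simp: m_comm)
  qed
  from exists_prime_avoiding[OF cgenideal_ideal[OF assms(1)] one_closed this]
  obtain P where "primeideal P R" "PIdl a \<subseteq> P" .
  with cgenideal_self[OF assms(1)] assms(2) show False by blast
qed

lemma unit_not_in_prime:
  assumes "a \<in> Units R" "primeideal P R"
  shows "a \<notin> P"
proof
  interpret P: primeideal P R by fact
  assume "a \<in> P"
  then have "inv a \<otimes> a \<in> P" using assms by (intro P.I_l_closed) auto
  then show False using assms(1) P.one_imp_carrier P.I_notcarr by simp
qed

lemma unit_add_nilpotent:
  assumes "u \<in> Units R" "nilpotent e" "z \<in> carrier R"
  shows "u \<oplus> e \<otimes> z \<in> Units R"
proof (rule unitI)
  have c: "u \<in> carrier R" "e \<in> carrier R" using assms by (auto simp: nilpotent_def)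
  then show "u \<oplus> e \<otimes> z \<in> carrier R" using assms by auto
  fix P assume P: "primeideal P R"
  interpret P: primeideal P R by fact
  show "u \<oplus> e \<otimes> z \<notin> P"
  proof
    assume 1: "u \<oplus> e \<otimes> z \<in> P"
    have "e \<otimes> z \<in> P" using nilpotent_in_prime[OF assms(2) P] assms(3) by (rule P.I_r_closed)
    then have "\<ominus> (e \<otimes> z) \<in> P" by (rule P.a_inv_closed)
    with 1 have "(u \<oplus> e \<otimes> z) \<oplus> \<ominus> (e \<otimes> z) \<in> P" by (rule P.a_closed)
    then have "u \<in> P" using c assms(3) by (simp add: a_assoc r_neg)
    with unit_not_in_prime[OF assms(1) P] show False by blast
  qed
qed

text \<open>One Newton step: the linear term cancels the value \<open>F\<close>, and what remains is
  quadratic in the correction, hence divisible by \<open>e\<close> twice.\<close>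

lemma newton_correction:
  assumes "u \<in> Units R" "e \<in> carrier R" "w \<in> carrier R" "r \<in> carrier R" "F \<in> carrier R" "F = e \<otimes> w"
  shows "F \<oplus> \<ominus> (inv u \<otimes> F) \<otimes> u \<oplus> \<ominus> (inv u \<otimes> F) \<otimes> \<ominus> (inv u \<otimes> F) \<otimes> r =
    e \<otimes> e \<otimes> (inv u \<otimes> w \<otimes> (inv u \<otimes> w) \<otimes> r)"
proof -
  have u: "u \<in> carrier R" "inv u \<in> carrier R" using assms by auto
  have "\<ominus> (inv u \<otimes> F) \<otimes> u = \<ominus> F"
  proof -
    have "inv u \<otimes> F \<otimes> u = F \<otimes> (inv u \<otimes> u)" using u assms(5) by (simp add: m_comm[of "inv u" F] m_assoc)
    also have "\<dots> = F" using assms(1,5) by simp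
    finally show ?thesis using u assms(5) by (simp add: l_minus)
  qed
  moreover have "\<ominus> (inv u \<otimes> F) \<otimes> \<ominus> (inv u \<otimes> F) = (inv u \<otimes> F) \<otimes> (inv u \<otimes> F)"
    using u assms by (simp add: l_minus r_minus)
  moreover have "(inv u \<otimes> F) \<otimes> (inv u \<otimes> F) \<otimes> r = e \<otimes> e \<otimes> (inv u \<otimes> w \<otimes> (inv u \<otimes> w) \<otimes> r)"
    using u assms by (simp add: m_ac)
  ultimately show ?thesis using u assms by (simp add: r_neg)
qed

text \<open>Newton's method started at \<open>x\<close>. All corrections are multiples of the
  nilpotent value \<open>e\<close> of \<open>f\<close> at \<open>x\<close>, so the derivative
  changes by a multiple of \<open>e\<close> and remains a unit. After \<open>m\<close> steps the
  value of \<open>f\<close> is divisible by the power \<open>Suc m\<close> of \<open>e\<close>, and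
  some power of \<open>e\<close> is 0.\<close>

lemma hensel:
  fixes f :: "('v, 'k::comm_ring_1) mpol"
  assumes c: "c \<in> ring_hom ring_of_type_algebra R" and x: "x \<in> N \<rightarrow> carrier R"
    and v: "v \<in> N" and f: "f \<in> mpols N"
    and e: "nilpotent (mp_eval_in R c x f)" and u: "mp_eval_in R c x (mp_deriv v f) \<in> Units R"
  shows "\<exists>z\<in>carrier R. mp_eval_in R c (x(v := x v \<oplus> mp_eval_in R c x f \<otimes> z)) f = \<zero>"
proof -
  define e where "e = mp_eval_in R c x f"
  have ne: "nilpotent e" "e \<in> carrier R" using assms(5) by (auto simp: e_def nilpotent_def)
  have xv: "x v \<in> carrier R" using x v by auto
  have step: "\<exists>z\<in>carrier R. \<exists>w\<in>carrier R. mp_eval_in R c (x(v := x v \<oplus> e \<otimes> z)) f = e [^] Suc m \<otimes> w" for m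
  proof (induction m)
    case 0
    have "x(v := x v \<oplus> e \<otimes> \<zero>) = x" using xv ne by (simp add: fun_upd_idem_iff)
    then show ?case using ne by (intro bexI[of _ \<zero>] bexI[of _ \<one>]) (auto simp: e_def)
  next
    case (Suc m)
    then obtain z w where z: "z \<in> carrier R" "w \<in> carrier R"
      and eq: "mp_eval_in R c (x(v := x v \<oplus> e \<otimes> z)) f = e [^] Suc m \<otimes> w" by blast
    define y where "y = x(v := x v \<oplus> e \<otimes> z)"
    have y: "y \<in> N \<rightarrow> carrier R" using x xv ne z by (auto simp: y_def Pi_iff)
    have ez: "e \<otimes> z \<in> carrier R" using ne z by simp
    have f': "mp_deriv v f \<in> mpols N" using f by (rule mpols_deriv)
    interpret M: mp_evaluation R c x N by (rule mp_evaluationI[OF cring_axioms c x])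
    interpret Y: mp_evaluation R c y N by (rule mp_evaluationI[OF cring_axioms c y])
    obtain r where r: "r \<in> carrier R" "Y.ev (mp_deriv v f) = M.ev (mp_deriv v f) \<oplus> e \<otimes> z \<otimes> M.ev (mp_deriv v (mp_deriv v f)) \<oplus> e \<otimes> z \<otimes> (e \<otimes> z) \<otimes> r"
      using mp_taylor[OF cring_axioms c x ez v f'] unfolding y_def by blast
    define t where "t = z \<otimes> M.ev (mp_deriv v (mp_deriv v f)) \<oplus> z \<otimes> (e \<otimes> z) \<otimes> r"
    have cl: "M.ev (mp_deriv v (mp_deriv v f)) \<in> carrier R" "M.ev (mp_deriv v f) \<in> carrier R"
      using f' by (auto intro!: M.ev_closed mpols_deriv)
    have t: "t \<in> carrier R" using cl z ne r by (auto simp: t_def)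
    have "Y.ev (mp_deriv v f) = M.ev (mp_deriv v f) \<oplus> e \<otimes> t"
      unfolding r(2) t_def using cl z ne r(1) by (simp add: r_distr m_assoc a_assoc)
    then have uy: "Y.ev (mp_deriv v f) \<in> Units R"
      using unit_add_nilpotent[OF u ne(1) t] by simp
    define U where "U = Y.ev (mp_deriv v f)"
    define F where "F = Y.ev f"
    have U: "U \<in> Units R" "U \<in> carrier R" "inv U \<in> carrier R" using uy by (auto simp: U_def)
    have F: "F = e [^] Suc m \<otimes> w" "F \<in> carrier R" using eq ne z by (auto simp: F_def y_def)
    define d where "d = \<ominus> (inv U \<otimes> F)"
    have d: "d \<in> carrier R" using U F by (simp add: d_def)
    obtain r' where r': "r' \<in> carrier R" "mp_eval_in R c (y(v := y v \<oplus> d)) f = F \<oplus> d \<otimes> U \<oplus> d \<otimes> d \<otimes> r'"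
      using mp_taylor[OF cring_axioms c y d v f] unfolding F_def U_def by blast
    \<comment> \<open>Newton's method squares the power of \<open>e\<close>; of the gain only one
      factor is recorded and the others are moved into \<open>w'\<close>.\<close>
    define w' where "w' = e [^] m \<otimes> (inv U \<otimes> w \<otimes> (inv U \<otimes> w) \<otimes> r')"
    have w': "w' \<in> carrier R" using ne z U r' by (simp add: w'_def)
    have "mp_eval_in R c (y(v := y v \<oplus> d)) f = e [^] Suc m \<otimes> e [^] Suc m \<otimes> (inv U \<otimes> w \<otimes> (inv U \<otimes> w) \<otimes> r')"
      unfolding r'(2) unfolding d_def by (rule newton_correction) (use U F z ne r' in auto)
    also have "\<dots> = e [^] Suc (Suc m) \<otimes> w'"
      using ne z U r' by (simp add: w'_def m_ac)
    finally have 1: "mp_eval_in R c (y(v := y v \<oplus> d)) f = e [^] Suc (Suc m) \<otimes> w'" .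
    define z' where "z' = z \<oplus> \<ominus> (inv U \<otimes> (e [^] m \<otimes> w))"
    have z': "z' \<in> carrier R" using ne z U by (simp add: z'_def)
    have "d = e \<otimes> \<ominus> (inv U \<otimes> (e [^] m \<otimes> w))"
      unfolding d_def F using ne z U by (simp add: r_minus m_ac)
    then have "y v \<oplus> d = x v \<oplus> e \<otimes> z'"
      using xv ne z U by (simp add: y_def z'_def r_distr a_assoc)
    then have "y(v := y v \<oplus> d) = x(v := x v \<oplus> e \<otimes> z')" by (simp add: y_def)
    with 1 z' w' show ?case by metis
  qed
  obtain n :: nat where n: "e [^] n = \<zero>" using ne(1) by (auto simp: nilpotent_def)
  from step[of n] obtain z w where "z \<in> carrier R" "w \<in> carrier R"
    "mp_eval_in R c (x(v := x v \<oplus> e \<otimes> z)) f = e [^] Suc n \<otimes> w" by blast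
  with n ne show ?thesis by (auto simp: e_def)
qed

end

section \<open>Base change to \<open>\<D>\<close>\<close>

lemma finsum_mpol_ring:
  assumes "\<And>a. a \<in> A \<Longrightarrow> f a \<in> mpols N"
  shows "finsum (mpol_ring N :: ('v, 'a::comm_ring_1) mpol ring) f A = sum f A"
  using assms
proof (induction A rule: infinite_finite_induct)
  case (infinite A)
  then show ?case by (simp add: finsum_def finprod_def)
next
  case empty
  interpret cring "mpol_ring N :: ('v, 'a) mpol ring" by (rule cring_mpol_ring)
  show ?case by simp
next
  case (insert a A)
  interpret cring "mpol_ring N :: ('v, 'a) mpol ring" by (rule cring_mpol_ring)
  from insert show ?case by (subst finsum_insert) auto
qed

locale local_algebra =
  fixes \<D> :: "('k::field_char_0, 'd::comm_ring_1) based_algebra"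
  assumes fla: "finite_local_algebra \<D>"
begin

abbreviation "I\<^sub>\<D> \<equiv> {..len \<D>}"

sublocale vs: vector_space "smul \<D>"
  using fla by (simp add: finite_local_algebra_def)

lemma basis: "inj_on (eps \<D>) I\<^sub>\<D>" "vs.independent (eps \<D> ` I\<^sub>\<D>)" "vs.span (eps \<D> ` I\<^sub>\<D>) = UNIV"
  using fla by (auto simp: finite_local_algebra_def)

lemma smul_mult: "smul \<D> a (x * y) = smul \<D> a x * y" "smul \<D> a (x * y) = x * smul \<D> a y"
proof -
  have *: "smul \<D> a (x * y) = smul \<D> a x * y" for x y
    using fla by (simp add: finite_local_algebra_def)
  show "smul \<D> a (x * y) = smul \<D> a x * y" by (rule *)
  show "smul \<D> a (x * y) = x * smul \<D> a y" using *[of y x] by (simp add: mult.commute)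
qed

lemma coord_expand: "(\<Sum>m\<in>I\<^sub>\<D>. smul \<D> (coord \<D> x m) (eps \<D> m)) = x"
proof -
  have "(\<Sum>b\<in>eps \<D> ` I\<^sub>\<D>. smul \<D> (vs.representation (eps \<D> ` I\<^sub>\<D>) x b) b) = x"
    by (rule vs.sum_representation_eq) (use basis in auto)
  then show ?thesis by (simp add: sum.reindex[OF basis(1)] coord_def comp_def)
qed

lemma coord_add: "coord \<D> (x + y) m = coord \<D> x m + coord \<D> y m"
  unfolding coord_def using basis by (subst vs.representation_add) auto

lemma coord_smul: "coord \<D> (smul \<D> a x) m = a * coord \<D> x m"
  unfolding coord_def using basis by (subst vs.representation_scale) auto

lemma coord_0: "coord \<D> 0 m = 0"
  using coord_smul[of 0 0 m] by simp

lemma coord_sum: "coord \<D> (sum f A) m = (\<Sum>a\<in>A. coord \<D> (f a) m)"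
  by (induction A rule: infinite_finite_induct) (auto simp: coord_0 coord_add)

lemma coord_eps: "i \<in> I\<^sub>\<D> \<Longrightarrow> m \<in> I\<^sub>\<D> \<Longrightarrow> coord \<D> (eps \<D> i) m = (if m = i then 1 else 0)"
  unfolding coord_def using basis
  by (subst vs.representation_basis) (auto dest: inj_onD)

abbreviation struct_const :: "nat \<Rightarrow> nat \<Rightarrow> nat \<Rightarrow> 'k" where
  "struct_const i j m \<equiv> coord \<D> (eps \<D> i * eps \<D> j) m"

lemma coord_mult:
  "coord \<D> (x * y) m = (\<Sum>i\<in>I\<^sub>\<D>. \<Sum>j\<in>I\<^sub>\<D>. coord \<D> x i * coord \<D> y j * struct_const i j m)"
proof -
  have "x * y = (\<Sum>i\<in>I\<^sub>\<D>. smul \<D> (coord \<D> x i) (eps \<D> i)) * (\<Sum>j\<in>I\<^sub>\<D>. smul \<D> (coord \<D> y j) (eps \<D> j))"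
    by (simp only: coord_expand)
  also have "\<dots> = (\<Sum>i\<in>I\<^sub>\<D>. \<Sum>j\<in>I\<^sub>\<D>. smul \<D> (coord \<D> x i * coord \<D> y j) (eps \<D> i * eps \<D> j))"
    unfolding sum_product
    by (intro sum.cong refl) (simp add: smul_mult flip: vs.scale_scale, simp add: smul_mult(1)[symmetric] smul_mult(2)[symmetric] vs.scale_left_commute)
  finally show ?thesis by (simp add: coord_sum coord_smul)
qed

lemma resid_hom: "type_hom (resid \<D>)"
  and resid_smul: "resid \<D> (smul \<D> a x) = a * resid \<D> x"
  and resid_eps: "resid \<D> (eps \<D> 0) = 1" "j \<in> I\<^sub>\<D> \<Longrightarrow> j \<noteq> 0 \<Longrightarrow> resid \<D> (eps \<D> j) = 0"
  using fla by (auto simp: finite_local_algebra_def)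

lemma resid_eq_coord: "resid \<D> x = coord \<D> x 0"
proof -
  have "resid \<D> x = (\<Sum>m\<in>I\<^sub>\<D>. coord \<D> x m * resid \<D> (eps \<D> m))"
    using arg_cong[OF coord_expand[of x], of "resid \<D>"]
    by (simp add: type_hom_sum[OF resid_hom] resid_smul)
  also have "\<dots> = (\<Sum>m\<in>I\<^sub>\<D>. if m = 0 then coord \<D> x m else 0)"
    by (intro sum.cong) (auto simp: resid_eps)
  finally show ?thesis by simp
qed

lemma coord_one_0: "coord \<D> 1 0 = 1"
  using type_homD(2)[OF resid_hom] by (simp add: resid_eq_coord)

lemma struct_const_0:
  "i \<in> I\<^sub>\<D> \<Longrightarrow> j \<in> I\<^sub>\<D> \<Longrightarrow> struct_const i j 0 = (if i = 0 \<and> j = 0 then 1 else 0)"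
  unfolding resid_eq_coord[symmetric] type_homD(4)[OF resid_hom] using resid_eps by auto

text \<open>The unit law in coordinates. The element 1 may differ from the first basis vector, hence
  all of its coordinates occur.\<close>

lemma struct_const_one:
  assumes "j \<in> I\<^sub>\<D>" "m \<in> I\<^sub>\<D>"
  shows "(\<Sum>i\<in>I\<^sub>\<D>. coord \<D> 1 i * struct_const i j m) = (if j = m then 1 else 0)"
proof -
  have "(if j = m then 1 else 0) = coord \<D> (1 * eps \<D> j) m"
    using assms by (simp add: coord_eps)
  also have "\<dots> = (\<Sum>i\<in>I\<^sub>\<D>. \<Sum>q\<in>I\<^sub>\<D>. if q = j then coord \<D> 1 i * struct_const i q m else 0)"
    unfolding coord_mult[of 1 "eps \<D> j"] by (intro sum.cong refl) (use assms in \<open>auto simp: coord_eps\<close>)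
  also have "\<dots> = (\<Sum>i\<in>I\<^sub>\<D>. coord \<D> 1 i * struct_const i j m)"
    using assms by (simp only: sum.delta finite_atMost if_True)
  finally show ?thesis by simp
qed

lemma struct_const_assoc:
  assumes "i \<in> I\<^sub>\<D>" "j \<in> I\<^sub>\<D>" "q \<in> I\<^sub>\<D>"
  shows "(\<Sum>p\<in>I\<^sub>\<D>. struct_const i j p * struct_const p q m) = (\<Sum>p\<in>I\<^sub>\<D>. struct_const j q p * struct_const i p m)"
proof -
  have "coord \<D> ((eps \<D> i * eps \<D> j) * eps \<D> q) m =
      (\<Sum>p\<in>I\<^sub>\<D>. \<Sum>r\<in>I\<^sub>\<D>. if r = q then struct_const i j p * struct_const p r m else 0)"
    unfolding coord_mult[of "eps \<D> i * eps \<D> j" "eps \<D> q"] by (intro sum.cong refl) (use assms in \<open>auto simp: coord_eps\<close>)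
  also have "\<dots> = (\<Sum>p\<in>I\<^sub>\<D>. struct_const i j p * struct_const p q m)"
    using assms by (simp only: sum.delta finite_atMost if_True)
  finally have 1: "coord \<D> ((eps \<D> i * eps \<D> j) * eps \<D> q) m = \<dots>" .
  have "coord \<D> (eps \<D> i * (eps \<D> j * eps \<D> q)) m =
      (\<Sum>r\<in>I\<^sub>\<D>. if r = i then \<Sum>p\<in>I\<^sub>\<D>. struct_const j q p * struct_const r p m else 0)"
    unfolding coord_mult[of "eps \<D> i" "eps \<D> j * eps \<D> q"] by (intro sum.cong refl) (use assms in \<open>auto simp: coord_eps\<close>)
  also have "\<dots> = (\<Sum>p\<in>I\<^sub>\<D>. struct_const j q p * struct_const i p m)"
    using assms by (simp only: sum.delta finite_atMost if_True)
  finally show ?thesis using 1 by (simp add: mult.assoc)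
qed

lemma base_change_sel:
  "carrier (base_change \<D> R \<iota>) = I\<^sub>\<D> \<rightarrow>\<^sub>E carrier R"
  "u \<otimes>\<^bsub>base_change \<D> R \<iota>\<^esub> v = (\<lambda>m\<in>I\<^sub>\<D>. \<Oplus>\<^bsub>R\<^esub>i\<in>I\<^sub>\<D>. \<Oplus>\<^bsub>R\<^esub>j\<in>I\<^sub>\<D>. \<iota> (struct_const i j m) \<otimes>\<^bsub>R\<^esub> (u i \<otimes>\<^bsub>R\<^esub> v j))"
  "\<one>\<^bsub>base_change \<D> R \<iota>\<^esub> = (\<lambda>m\<in>I\<^sub>\<D>. \<iota> (coord \<D> 1 m))"
  "\<zero>\<^bsub>base_change \<D> R \<iota>\<^esub> = (\<lambda>m\<in>I\<^sub>\<D>. \<zero>\<^bsub>R\<^esub>)"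
  "u \<oplus>\<^bsub>base_change \<D> R \<iota>\<^esub> v = (\<lambda>m\<in>I\<^sub>\<D>. u m \<oplus>\<^bsub>R\<^esub> v m)"
  by (simp_all add: base_change_def)

definition bc_map :: "('r \<Rightarrow> 's) \<Rightarrow> (nat \<Rightarrow> 'r) \<Rightarrow> nat \<Rightarrow> 's" where
  "bc_map h u = (\<lambda>m\<in>I\<^sub>\<D>. h (u m))"

lemma bc_map_hom:
  assumes R: "cring R" and S: "cring S" and h: "h \<in> ring_hom R S"
    and \<iota>: "\<iota> \<in> ring_hom ring_of_type_algebra R" and \<iota>': "\<iota>' = h \<circ> \<iota>"
  shows "bc_map h \<in> ring_hom (base_change \<D> R \<iota>) (base_change \<D> S \<iota>')"
proof -
  interpret R: cring R by fact
  interpret S: cring S by fact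
  interpret h: ring_hom_cring R S h
    by (intro ring_hom_cring.intro ring_hom_cring_axioms.intro R S h)
  have \<iota>c: "\<iota> a \<in> carrier R" for a using \<iota> by (auto simp: ring_hom_def)
  show ?thesis
  proof (rule ring_hom_memI)
    fix u v assume u: "u \<in> carrier (base_change \<D> R \<iota>)" and v: "v \<in> carrier (base_change \<D> R \<iota>)"
    then have uc: "\<And>i. i \<in> I\<^sub>\<D> \<Longrightarrow> u i \<in> carrier R" and vc: "\<And>i. i \<in> I\<^sub>\<D> \<Longrightarrow> v i \<in> carrier R"
      by (auto simp: base_change_sel)
    show "bc_map h (u \<oplus>\<^bsub>base_change \<D> R \<iota>\<^esub> v) = bc_map h u \<oplus>\<^bsub>base_change \<D> S \<iota>'\<^esub> bc_map h v"
      using uc vc by (auto simp: bc_map_def base_change_sel restrict_def fun_eq_iff)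
    have "h (\<Oplus>\<^bsub>R\<^esub>i\<in>I\<^sub>\<D>. \<Oplus>\<^bsub>R\<^esub>j\<in>I\<^sub>\<D>. \<iota> (struct_const i j m) \<otimes>\<^bsub>R\<^esub> (u i \<otimes>\<^bsub>R\<^esub> v j)) =
       (\<Oplus>\<^bsub>S\<^esub>i\<in>I\<^sub>\<D>. \<Oplus>\<^bsub>S\<^esub>j\<in>I\<^sub>\<D>. \<iota>' (struct_const i j m) \<otimes>\<^bsub>S\<^esub> (h (u i) \<otimes>\<^bsub>S\<^esub> h (v j)))" for m
    proof -
      have "h (\<Oplus>\<^bsub>R\<^esub>i\<in>I\<^sub>\<D>. \<Oplus>\<^bsub>R\<^esub>j\<in>I\<^sub>\<D>. \<iota> (struct_const i j m) \<otimes>\<^bsub>R\<^esub> (u i \<otimes>\<^bsub>R\<^esub> v j)) =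
         (\<Oplus>\<^bsub>S\<^esub>i\<in>I\<^sub>\<D>. h (\<Oplus>\<^bsub>R\<^esub>j\<in>I\<^sub>\<D>. \<iota> (struct_const i j m) \<otimes>\<^bsub>R\<^esub> (u i \<otimes>\<^bsub>R\<^esub> v j)))"
        using uc vc \<iota>c by (subst h.hom_finsum) (auto simp: comp_def intro!: R.finsum_closed)
      also have "\<dots> = (\<Oplus>\<^bsub>S\<^esub>i\<in>I\<^sub>\<D>. \<Oplus>\<^bsub>S\<^esub>j\<in>I\<^sub>\<D>. \<iota>' (struct_const i j m) \<otimes>\<^bsub>S\<^esub> (h (u i) \<otimes>\<^bsub>S\<^esub> h (v j)))"
      proof (rule S.finsum_cong')
        show "(\<lambda>i. \<Oplus>\<^bsub>S\<^esub>j\<in>I\<^sub>\<D>. \<iota>' (struct_const i j m) \<otimes>\<^bsub>S\<^esub> (h (u i) \<otimes>\<^bsub>S\<^esub> h (v j))) \<in> I\<^sub>\<D> \<rightarrow> carrier S"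
          using uc vc \<iota>c by (auto simp: \<iota>' intro!: S.finsum_closed)
        fix i assume i: "i \<in> I\<^sub>\<D>"
        have "h (\<Oplus>\<^bsub>R\<^esub>j\<in>I\<^sub>\<D>. \<iota> (struct_const i j m) \<otimes>\<^bsub>R\<^esub> (u i \<otimes>\<^bsub>R\<^esub> v j)) =
            (\<Oplus>\<^bsub>S\<^esub>j\<in>I\<^sub>\<D>. h (\<iota> (struct_const i j m) \<otimes>\<^bsub>R\<^esub> (u i \<otimes>\<^bsub>R\<^esub> v j)))"
          using uc vc \<iota>c i by (subst h.hom_finsum) (auto simp: comp_def)
        also have "\<dots> = (\<Oplus>\<^bsub>S\<^esub>j\<in>I\<^sub>\<D>. \<iota>' (struct_const i j m) \<otimes>\<^bsub>S\<^esub> (h (u i) \<otimes>\<^bsub>S\<^esub> h (v j)))"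
          using uc vc \<iota>c i by (intro S.finsum_cong') (auto simp: \<iota>')
        finally show "h (\<Oplus>\<^bsub>R\<^esub>j\<in>I\<^sub>\<D>. \<iota> (struct_const i j m) \<otimes>\<^bsub>R\<^esub> (u i \<otimes>\<^bsub>R\<^esub> v j)) =
            (\<Oplus>\<^bsub>S\<^esub>j\<in>I\<^sub>\<D>. \<iota>' (struct_const i j m) \<otimes>\<^bsub>S\<^esub> (h (u i) \<otimes>\<^bsub>S\<^esub> h (v j)))" .
      qed simp
      finally show ?thesis .
    qed
    moreover have "(\<Oplus>\<^bsub>S\<^esub>i\<in>I\<^sub>\<D>. \<Oplus>\<^bsub>S\<^esub>j\<in>I\<^sub>\<D>. \<iota>' (struct_const i j m) \<otimes>\<^bsub>S\<^esub> (bc_map h u i \<otimes>\<^bsub>S\<^esub> bc_map h v j)) =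
       (\<Oplus>\<^bsub>S\<^esub>i\<in>I\<^sub>\<D>. \<Oplus>\<^bsub>S\<^esub>j\<in>I\<^sub>\<D>. \<iota>' (struct_const i j m) \<otimes>\<^bsub>S\<^esub> (h (u i) \<otimes>\<^bsub>S\<^esub> h (v j)))" for m
      using uc vc \<iota>c by (intro S.finsum_cong' refl) (auto simp: bc_map_def \<iota>' intro!: S.finsum_closed)
    ultimately show "bc_map h (u \<otimes>\<^bsub>base_change \<D> R \<iota>\<^esub> v) = bc_map h u \<otimes>\<^bsub>base_change \<D> S \<iota>'\<^esub> bc_map h v"
      by (simp add: base_change_sel) (simp add: bc_map_def restrict_def fun_eq_iff)
  next
    fix u assume "u \<in> carrier (base_change \<D> R \<iota>)"
    then show "bc_map h u \<in> carrier (base_change \<D> S \<iota>')"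
      by (auto simp: base_change_sel bc_map_def)
  next
    show "bc_map h \<one>\<^bsub>base_change \<D> R \<iota>\<^esub> = \<one>\<^bsub>base_change \<D> S \<iota>'\<^esub>"
      by (auto simp: base_change_sel bc_map_def \<iota>' restrict_def fun_eq_iff)
  qed
qed

end

section \<open>The ring axioms for base changes to the algebra\<close>

context local_algebra
begin

text \<open>Identities in \<open>R \<otimes> \<D>\<close> are checked for the polynomial ring over \<open>k\<close> and then specialised.\<close>

abbreviation generic_ring :: "(nat \<times> nat, 'k) mpol ring" where
  "generic_ring \<equiv> mpol_ring ({..<3} \<times> I\<^sub>\<D>)"

abbreviation generic_bc :: "(nat \<Rightarrow> (nat \<times> nat, 'k) mpol) ring" where
  "generic_bc \<equiv> base_change \<D> generic_ring mconst"

definition generic_elem :: "nat \<Rightarrow> nat \<Rightarrow> (nat \<times> nat, 'k) mpol" where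
  "generic_elem a = (\<lambda>i\<in>I\<^sub>\<D>. mvar (a, i))"

lemma generic_elem_closed: "a < 3 \<Longrightarrow> generic_elem a \<in> carrier generic_bc"
  by (auto simp: generic_elem_def base_change_sel intro!: mpols_var)

lemma generic_mult:
  assumes "u \<in> carrier generic_bc" "v \<in> carrier generic_bc"
  shows "u \<otimes>\<^bsub>generic_bc\<^esub> v = (\<lambda>m\<in>I\<^sub>\<D>. \<Sum>i\<in>I\<^sub>\<D>. \<Sum>j\<in>I\<^sub>\<D>. mconst (struct_const i j m) * (u i * v j))"
proof -
  have u: "u i \<in> mpols ({..<3} \<times> I\<^sub>\<D>)" and v: "v i \<in> mpols ({..<3} \<times> I\<^sub>\<D>)" if "i \<in> I\<^sub>\<D>" for i
    using assms that by (auto simp: base_change_sel PiE_iff)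
  have "(\<Oplus>\<^bsub>generic_ring\<^esub>i\<in>I\<^sub>\<D>. \<Oplus>\<^bsub>generic_ring\<^esub>j\<in>I\<^sub>\<D>. mconst (struct_const i j m) \<otimes>\<^bsub>generic_ring\<^esub> (u i \<otimes>\<^bsub>generic_ring\<^esub> v j)) =
      (\<Sum>i\<in>I\<^sub>\<D>. \<Sum>j\<in>I\<^sub>\<D>. mconst (struct_const i j m) * (u i * v j))" for m
  proof -
    have 1: "(\<Oplus>\<^bsub>generic_ring\<^esub>j\<in>I\<^sub>\<D>. mconst (struct_const i j m) \<otimes>\<^bsub>generic_ring\<^esub> (u i \<otimes>\<^bsub>generic_ring\<^esub> v j)) =
        (\<Sum>j\<in>I\<^sub>\<D>. mconst (struct_const i j m) * (u i * v j))" if "i \<in> I\<^sub>\<D>" for i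
      using u[OF that] v by (subst finsum_mpol_ring) (auto intro!: mpols_mult)
    interpret cring generic_ring by (rule cring_mpol_ring)
    have "(\<Oplus>\<^bsub>generic_ring\<^esub>i\<in>I\<^sub>\<D>. \<Oplus>\<^bsub>generic_ring\<^esub>j\<in>I\<^sub>\<D>. mconst (struct_const i j m) \<otimes>\<^bsub>generic_ring\<^esub> (u i \<otimes>\<^bsub>generic_ring\<^esub> v j)) =
       (\<Oplus>\<^bsub>generic_ring\<^esub>i\<in>I\<^sub>\<D>. \<Sum>j\<in>I\<^sub>\<D>. mconst (struct_const i j m) * (u i * v j))"
      using u v 1 by (intro finsum_cong') (auto intro!: mpols_sum mpols_mult)
    also have "\<dots> = (\<Sum>i\<in>I\<^sub>\<D>. \<Sum>j\<in>I\<^sub>\<D>. mconst (struct_const i j m) * (u i * v j))"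
      using u v by (subst finsum_mpol_ring) (auto intro!: mpols_sum mpols_mult)
    finally show ?thesis .
  qed
  then show ?thesis by (simp add: base_change_sel)
qed

lemma generic_multI:
  assumes "u \<in> carrier generic_bc" "v \<in> carrier generic_bc" "w \<in> extensional I\<^sub>\<D>"
    and uv: "\<And>i. i \<in> I\<^sub>\<D> \<Longrightarrow> u i = u' i" "\<And>i. i \<in> I\<^sub>\<D> \<Longrightarrow> v i = v' i"
    and eq: "\<And>m. m \<in> I\<^sub>\<D> \<Longrightarrow> (\<Sum>i\<in>I\<^sub>\<D>. \<Sum>j\<in>I\<^sub>\<D>. mconst (struct_const i j m) * (u' i * v' j)) = w m"
  shows "u \<otimes>\<^bsub>generic_bc\<^esub> v = w"
  unfolding generic_mult[OF assms(1,2)]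
proof (rule extensionalityI[OF restrict_extensional assms(3)])
  fix m assume m: "m \<in> I\<^sub>\<D>"
  have "(\<Sum>i\<in>I\<^sub>\<D>. \<Sum>j\<in>I\<^sub>\<D>. mconst (struct_const i j m) * (u i * v j)) =
      (\<Sum>i\<in>I\<^sub>\<D>. \<Sum>j\<in>I\<^sub>\<D>. mconst (struct_const i j m) * (u' i * v' j))"
    by (intro sum.cong refl) (simp only: uv)
  then show "(\<lambda>m\<in>I\<^sub>\<D>. \<Sum>i\<in>I\<^sub>\<D>. \<Sum>j\<in>I\<^sub>\<D>. mconst (struct_const i j m) * (u i * v j)) m = w m"
    using m eq[OF m] by simp
qed

lemma generic_elems_closed:
  "generic_elem 0 \<in> carrier generic_bc" "generic_elem 1 \<in> carrier generic_bc" "generic_elem 2 \<in> carrier generic_bc"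
  by (rule generic_elem_closed, simp)+

lemma generic_mult_closed:
  assumes "u \<in> carrier generic_bc" "v \<in> carrier generic_bc"
  shows "u \<otimes>\<^bsub>generic_bc\<^esub> v \<in> carrier generic_bc"
proof -
  have u: "u i \<in> mpols ({..<3} \<times> I\<^sub>\<D>)" and v: "v i \<in> mpols ({..<3} \<times> I\<^sub>\<D>)" if "i \<in> I\<^sub>\<D>" for i
    using assms that by (auto simp: base_change_sel PiE_iff)
  show ?thesis
    unfolding generic_mult[OF assms] using u v
    by (auto simp: base_change_sel intro!: mpols_sum mpols_mult)
qed

lemma mconst_sum: "mconst (sum f A) = (\<Sum>a\<in>A. mconst (f a) :: ('v, 'b::comm_ring_1) mpol)"
  by (rule type_hom_sum[OF type_hom_mconst])

lemma generic_assoc: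
  assumes u: "u \<in> carrier generic_bc" and v: "v \<in> carrier generic_bc" and w: "w \<in> carrier generic_bc"
  shows "(u \<otimes>\<^bsub>generic_bc\<^esub> v) \<otimes>\<^bsub>generic_bc\<^esub> w = u \<otimes>\<^bsub>generic_bc\<^esub> (v \<otimes>\<^bsub>generic_bc\<^esub> w)"
proof -
  let ?c = "\<lambda>i j m. mconst (struct_const i j m) :: (nat \<times> nat, 'k) mpol"
  have "(\<Sum>p\<in>I\<^sub>\<D>. \<Sum>q\<in>I\<^sub>\<D>. ?c p q m * ((\<Sum>i\<in>I\<^sub>\<D>. \<Sum>j\<in>I\<^sub>\<D>. ?c i j p * (u i * v j)) * w q)) =
      (\<Sum>i\<in>I\<^sub>\<D>. \<Sum>p\<in>I\<^sub>\<D>. ?c i p m * (u i * (\<Sum>j\<in>I\<^sub>\<D>. \<Sum>q\<in>I\<^sub>\<D>. ?c j q p * (v j * w q))))" for m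
  proof -
    have "(\<Sum>p\<in>I\<^sub>\<D>. \<Sum>q\<in>I\<^sub>\<D>. ?c p q m * ((\<Sum>i\<in>I\<^sub>\<D>. \<Sum>j\<in>I\<^sub>\<D>. ?c i j p * (u i * v j)) * w q)) =
        (\<Sum>p\<in>I\<^sub>\<D>. \<Sum>q\<in>I\<^sub>\<D>. \<Sum>i\<in>I\<^sub>\<D>. \<Sum>j\<in>I\<^sub>\<D>. ?c i j p * ?c p q m * (u i * v j * w q))"
      by (simp add: sum_distrib_left sum_distrib_right mult_ac)
    also have "\<dots> = (\<Sum>p\<in>I\<^sub>\<D>. \<Sum>i\<in>I\<^sub>\<D>. \<Sum>q\<in>I\<^sub>\<D>. \<Sum>j\<in>I\<^sub>\<D>. ?c i j p * ?c p q m * (u i * v j * w q))"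
      by (intro sum.cong refl sum.swap)
    also have "\<dots> = (\<Sum>p\<in>I\<^sub>\<D>. \<Sum>i\<in>I\<^sub>\<D>. \<Sum>j\<in>I\<^sub>\<D>. \<Sum>q\<in>I\<^sub>\<D>. ?c i j p * ?c p q m * (u i * v j * w q))"
      by (intro sum.cong refl sum.swap)
    also have "\<dots> = (\<Sum>i\<in>I\<^sub>\<D>. \<Sum>p\<in>I\<^sub>\<D>. \<Sum>j\<in>I\<^sub>\<D>. \<Sum>q\<in>I\<^sub>\<D>. ?c i j p * ?c p q m * (u i * v j * w q))"
      by (rule sum.swap)
    also have "\<dots> = (\<Sum>i\<in>I\<^sub>\<D>. \<Sum>j\<in>I\<^sub>\<D>. \<Sum>p\<in>I\<^sub>\<D>. \<Sum>q\<in>I\<^sub>\<D>. ?c i j p * ?c p q m * (u i * v j * w q))"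
      by (intro sum.cong refl sum.swap)
    also have "\<dots> = (\<Sum>i\<in>I\<^sub>\<D>. \<Sum>j\<in>I\<^sub>\<D>. \<Sum>q\<in>I\<^sub>\<D>. \<Sum>p\<in>I\<^sub>\<D>. ?c i j p * ?c p q m * (u i * v j * w q))"
      by (intro sum.cong refl sum.swap)
    also have "\<dots> = (\<Sum>i\<in>I\<^sub>\<D>. \<Sum>j\<in>I\<^sub>\<D>. \<Sum>q\<in>I\<^sub>\<D>. mconst (\<Sum>p\<in>I\<^sub>\<D>. struct_const i j p * struct_const p q m) * (u i * v j * w q))"
      by (simp add: mconst_sum sum_distrib_right)
    also have "\<dots> = (\<Sum>i\<in>I\<^sub>\<D>. \<Sum>j\<in>I\<^sub>\<D>. \<Sum>q\<in>I\<^sub>\<D>. mconst (\<Sum>p\<in>I\<^sub>\<D>. struct_const j q p * struct_const i p m) * (u i * v j * w q))"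
      by (intro sum.cong refl) (simp only: struct_const_assoc)
    also have "\<dots> = (\<Sum>i\<in>I\<^sub>\<D>. \<Sum>j\<in>I\<^sub>\<D>. \<Sum>q\<in>I\<^sub>\<D>. \<Sum>p\<in>I\<^sub>\<D>. ?c j q p * ?c i p m * (u i * v j * w q))"
      by (simp add: mconst_sum sum_distrib_right)
    also have "\<dots> = (\<Sum>i\<in>I\<^sub>\<D>. \<Sum>j\<in>I\<^sub>\<D>. \<Sum>p\<in>I\<^sub>\<D>. \<Sum>q\<in>I\<^sub>\<D>. ?c j q p * ?c i p m * (u i * v j * w q))"
      by (intro sum.cong refl sum.swap)
    also have "\<dots> = (\<Sum>i\<in>I\<^sub>\<D>. \<Sum>p\<in>I\<^sub>\<D>. \<Sum>j\<in>I\<^sub>\<D>. \<Sum>q\<in>I\<^sub>\<D>. ?c j q p * ?c i p m * (u i * v j * w q))"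
      by (intro sum.cong refl sum.swap)
    also have "\<dots> = (\<Sum>i\<in>I\<^sub>\<D>. \<Sum>p\<in>I\<^sub>\<D>. ?c i p m * (u i * (\<Sum>j\<in>I\<^sub>\<D>. \<Sum>q\<in>I\<^sub>\<D>. ?c j q p * (v j * w q))))"
      by (simp add: sum_distrib_left mult_ac)
    finally show ?thesis .
  qed
  then have "(\<lambda>m\<in>I\<^sub>\<D>. \<Sum>p\<in>I\<^sub>\<D>. \<Sum>q\<in>I\<^sub>\<D>. ?c p q m * ((u \<otimes>\<^bsub>generic_bc\<^esub> v) p * w q)) =
    (\<lambda>m\<in>I\<^sub>\<D>. \<Sum>i\<in>I\<^sub>\<D>. \<Sum>p\<in>I\<^sub>\<D>. ?c i p m * (u i * (v \<otimes>\<^bsub>generic_bc\<^esub> w) p))"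
    unfolding generic_mult[OF u v] generic_mult[OF v w]
    by (intro restrict_ext) simp
  then show ?thesis
    unfolding generic_mult[OF generic_mult_closed[OF u v] w] generic_mult[OF u generic_mult_closed[OF v w]] .
qed

text \<open>\<open>r \<otimes> d\<close>\<close>

definition pure :: "'r ring \<Rightarrow> ('k \<Rightarrow> 'r) \<Rightarrow> 'r \<Rightarrow> 'd \<Rightarrow> nat \<Rightarrow> 'r" where
  "pure R \<iota> r d = (\<lambda>m\<in>I\<^sub>\<D>. \<iota> (coord \<D> d m) \<otimes>\<^bsub>R\<^esub> r)"

lemma generic_pure_mult:
  assumes "r \<in> mpols ({..<3} \<times> I\<^sub>\<D>)" "s \<in> mpols ({..<3} \<times> I\<^sub>\<D>)"
  shows "pure generic_ring mconst r d \<otimes>\<^bsub>generic_bc\<^esub> pure generic_ring mconst s d' = pure generic_ring mconst (r * s) (d * d')"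
proof -
  have cl: "pure generic_ring mconst r d \<in> carrier generic_bc" "pure generic_ring mconst s d' \<in> carrier generic_bc"
    using assms by (auto simp: pure_def base_change_sel intro!: mpols_mult)
  have "(\<Sum>i\<in>I\<^sub>\<D>. \<Sum>j\<in>I\<^sub>\<D>. mconst (struct_const i j m) * (mconst (coord \<D> d i) * r * (mconst (coord \<D> d' j) * s))) =
     mconst (coord \<D> (d * d') m) * (r * s)" for m
    unfolding coord_mult[of d d'] by (simp add: mconst_sum sum_distrib_right sum_distrib_left mult_ac)
  then show ?thesis
    by (intro generic_multI[OF cl]) (auto simp: pure_def)
qed

context
  fixes R :: "'r ring" and \<iota> :: "'k \<Rightarrow> 'r"
  assumes R: "cring R" and \<iota>: "\<iota> \<in> ring_hom ring_of_type_algebra R"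
begin

interpretation R: cring R by (rule R)

abbreviation "RD \<equiv> base_change \<D> R \<iota>"

lemma iota_closed: "\<iota> a \<in> carrier R"
  using \<iota> by (auto simp: ring_hom_def)

text \<open>Any three elements of \<open>R \<otimes> \<D>\<close> are the images of the generic
  triple under one homomorphism, and each ring axiom involves at most three elements.\<close>

lemma specialise:
  assumes "u \<in> carrier RD" "v \<in> carrier RD" "w \<in> carrier RD"
  obtains E where "E \<in> ring_hom generic_ring R" "\<And>a. E (mconst a) = \<iota> a"
    "bc_map E \<in> ring_hom generic_bc RD"
    "bc_map E (generic_elem 0) = u" "bc_map E (generic_elem 1) = v" "bc_map E (generic_elem 2) = w"
    "\<And>i. i \<in> I\<^sub>\<D> \<Longrightarrow> E (mvar (0, i)) = u i" "\<And>i. i \<in> I\<^sub>\<D> \<Longrightarrow> E (mvar (1, i)) = v i"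
proof -
  define x where "x = (\<lambda>(a, i). if a = 0 then u i else if a = (1::nat) then v i else w (i::nat))"
  interpret mp_evaluation R \<iota> x "{..<3} \<times> I\<^sub>\<D>"
    using assms by (intro mp_evaluationI R \<iota>) (auto simp: x_def base_change_sel PiE_iff)
  have h: "bc_map ev \<in> ring_hom generic_bc RD"
    by (rule bc_map_hom[OF cring_mpol_ring R ev_hom mconst_hom]) (auto simp: fun_eq_iff)
  have b: "bc_map ev (generic_elem a) = (\<lambda>i\<in>I\<^sub>\<D>. x (a, i))" if "a < 3" for a
    using that by (auto simp: bc_map_def generic_elem_def restrict_def fun_eq_iff)
  have r: "(\<lambda>i\<in>I\<^sub>\<D>. z i) = z" if "z \<in> carrier RD" for z
    using that by (auto simp: base_change_sel PiE_iff extensional_restrict)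
  show ?thesis
  proof (rule that[of ev])
    show "bc_map ev (generic_elem 0) = u" "bc_map ev (generic_elem 1) = v" "bc_map ev (generic_elem 2) = w"
      using b[of 0] b[of 1] b[of 2] r assms by (auto simp: x_def)
    show "ev (mvar (0, i)) = u i" "ev (mvar (1, i)) = v i" if "i \<in> I\<^sub>\<D>" for i
      using that ev_var[of "(0, i)"] ev_var[of "(1, i)"] by (auto simp: x_def)
  qed (use ev_hom h in auto)
qed

lemma bc_mult_closed:
  assumes "u \<in> carrier RD" "v \<in> carrier RD"
  shows "u \<otimes>\<^bsub>RD\<^esub> v \<in> carrier RD"
  using assms iota_closed by (auto simp: base_change_sel PiE_iff intro!: R.finsum_closed)

lemma cring_base_change: "cring RD"
proof (rule cringI)
  show "abelian_group RD"
  proof (rule abelian_groupI)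
    fix u assume u: "u \<in> carrier RD"
    show "\<exists>v\<in>carrier RD. v \<oplus>\<^bsub>RD\<^esub> u = \<zero>\<^bsub>RD\<^esub>"
      using u by (intro bexI[of _ "\<lambda>m\<in>I\<^sub>\<D>. \<ominus>\<^bsub>R\<^esub> u m"])
        (auto simp: base_change_sel PiE_iff R.l_neg restrict_def fun_eq_iff extensional_def)
    show "\<zero>\<^bsub>RD\<^esub> \<oplus>\<^bsub>RD\<^esub> u = u"
      using u by (auto simp: base_change_sel PiE_iff restrict_def fun_eq_iff extensional_def)
  qed (auto simp: base_change_sel PiE_iff R.a_ac restrict_def fun_eq_iff extensional_def)
  show "Group.comm_monoid RD"
  proof (rule comm_monoidI)
    show "u \<otimes>\<^bsub>RD\<^esub> v \<in> carrier RD" if "u \<in> carrier RD" "v \<in> carrier RD" for u v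
      using that by (rule bc_mult_closed)
    show "\<one>\<^bsub>RD\<^esub> \<in> carrier RD" using iota_closed by (auto simp: base_change_sel)
    fix u assume u: "u \<in> carrier RD"
    {
      obtain E where E: "E \<in> ring_hom generic_ring R" "\<And>a. E (mconst a) = \<iota> a" "bc_map E \<in> ring_hom generic_bc RD"
        "bc_map E (generic_elem 0) = u"
        using specialise[OF u u u] by metis
      have cl: "\<one>\<^bsub>generic_bc\<^esub> \<in> carrier generic_bc" by (auto simp: base_change_sel)
      note g = generic_elems_closed(1)
      have "(\<Sum>i\<in>I\<^sub>\<D>. \<Sum>j\<in>I\<^sub>\<D>. mconst (struct_const i j m) * (mconst (coord \<D> 1 i) * mvar (0, j))) =
          (mvar (0, m) :: (nat \<times> nat, 'k) mpol)" if m: "m \<in> I\<^sub>\<D>" for m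
      proof -
        have "(\<Sum>i\<in>I\<^sub>\<D>. \<Sum>j\<in>I\<^sub>\<D>. mconst (struct_const i j m) * (mconst (coord \<D> 1 i) * mvar (0, j))) =
          (\<Sum>j\<in>I\<^sub>\<D>. mconst (\<Sum>i\<in>I\<^sub>\<D>. coord \<D> 1 i * struct_const i j m) * (mvar (0, j) :: (nat \<times> nat, 'k) mpol))"
          by (subst sum.swap) (simp add: mconst_sum sum_distrib_right sum_distrib_left mult_ac)
        also have "\<dots> = (\<Sum>j\<in>I\<^sub>\<D>. if j = m then mvar (0, j) else 0)"
          using m by (intro sum.cong refl) (simp add: struct_const_one)
        finally show ?thesis using m by simp
      qed
      then have "\<one>\<^bsub>generic_bc\<^esub> \<otimes>\<^bsub>generic_bc\<^esub> generic_elem 0 = generic_elem 0"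
        by (intro generic_multI[OF cl g]) (auto simp: base_change_sel generic_elem_def)
      then show "\<one>\<^bsub>RD\<^esub> \<otimes>\<^bsub>RD\<^esub> u = u"
        using ring_hom_mult[OF E(3) cl g] ring_hom_one[OF E(3)] E(4) by simp
    }
    fix v assume v: "v \<in> carrier RD"
    {
      obtain E where E: "bc_map E \<in> ring_hom generic_bc RD" "bc_map E (generic_elem 0) = u" "bc_map E (generic_elem 1) = v"
        using specialise[OF u v v] by metis
      note g = generic_elems_closed(1,2)
      have "generic_elem 0 \<otimes>\<^bsub>generic_bc\<^esub> generic_elem 1 = generic_elem 1 \<otimes>\<^bsub>generic_bc\<^esub> generic_elem 0"
        unfolding generic_mult[OF g] generic_mult[OF g(2,1)]
        by (intro restrict_ext, subst sum.swap) (simp add: mult_ac)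
      then show "u \<otimes>\<^bsub>RD\<^esub> v = v \<otimes>\<^bsub>RD\<^esub> u"
        using ring_hom_mult[OF E(1) g] ring_hom_mult[OF E(1) g(2,1)] E(2,3) by simp
    }
    fix w assume w: "w \<in> carrier RD"
    obtain E where E: "bc_map E \<in> ring_hom generic_bc RD" "bc_map E (generic_elem 0) = u" "bc_map E (generic_elem 1) = v"
        "bc_map E (generic_elem 2) = w"
      using specialise[OF u v w] by metis
    note g = generic_elems_closed
    show "(u \<otimes>\<^bsub>RD\<^esub> v) \<otimes>\<^bsub>RD\<^esub> w = u \<otimes>\<^bsub>RD\<^esub> (v \<otimes>\<^bsub>RD\<^esub> w)"
      using arg_cong[OF generic_assoc[OF g], of "bc_map E"]
      unfolding ring_hom_mult[OF E(1) generic_mult_closed[OF g(1,2)] g(3)]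
        ring_hom_mult[OF E(1) g(1) generic_mult_closed[OF g(2,3)]]
        ring_hom_mult[OF E(1) g(1,2)] ring_hom_mult[OF E(1) g(2,3)] E(2-4) .
  qed
  fix u v w assume uvw: "u \<in> carrier RD" "v \<in> carrier RD" "w \<in> carrier RD"
  obtain E where E: "bc_map E \<in> ring_hom generic_bc RD" "bc_map E (generic_elem 0) = u" "bc_map E (generic_elem 1) = v"
      "bc_map E (generic_elem 2) = w"
    using specialise[OF uvw] by metis
  note g = generic_elems_closed
  have cl: "generic_elem 0 \<oplus>\<^bsub>generic_bc\<^esub> generic_elem 1 \<in> carrier generic_bc"
    using g(1,2) by (auto simp: base_change_sel PiE_iff intro!: mpols_add)
  have "(generic_elem 0 \<oplus>\<^bsub>generic_bc\<^esub> generic_elem 1) \<otimes>\<^bsub>generic_bc\<^esub> generic_elem 2 =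
      generic_elem 0 \<otimes>\<^bsub>generic_bc\<^esub> generic_elem 2 \<oplus>\<^bsub>generic_bc\<^esub> generic_elem 1 \<otimes>\<^bsub>generic_bc\<^esub> generic_elem 2"
  proof (rule generic_multI[OF cl g(3)])
    let ?c = "\<lambda>i j m. mconst (struct_const i j m) :: (nat \<times> nat, 'k) mpol"
    show "generic_elem 0 \<otimes>\<^bsub>generic_bc\<^esub> generic_elem 2 \<oplus>\<^bsub>generic_bc\<^esub> generic_elem 1 \<otimes>\<^bsub>generic_bc\<^esub> generic_elem 2 \<in> extensional I\<^sub>\<D>"
      by (simp add: base_change_sel)
    fix i assume "i \<in> I\<^sub>\<D>"
    then show "(generic_elem 0 \<oplus>\<^bsub>generic_bc\<^esub> generic_elem 1) i = generic_elem 0 i + generic_elem 1 i"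
      by (simp add: base_change_sel)
  next
    fix m assume m: "m \<in> I\<^sub>\<D>"
    have "(generic_elem 0 \<otimes>\<^bsub>generic_bc\<^esub> generic_elem 2 \<oplus>\<^bsub>generic_bc\<^esub> generic_elem 1 \<otimes>\<^bsub>generic_bc\<^esub> generic_elem 2) m =
        (generic_elem 0 \<otimes>\<^bsub>generic_bc\<^esub> generic_elem 2) m + (generic_elem 1 \<otimes>\<^bsub>generic_bc\<^esub> generic_elem 2) m"
      using m by (simp add: base_change_sel(5))
    then show "(\<Sum>i\<in>I\<^sub>\<D>. \<Sum>j\<in>I\<^sub>\<D>. mconst (struct_const i j m) * ((generic_elem 0 i + generic_elem 1 i) * generic_elem 2 j)) =
        (generic_elem 0 \<otimes>\<^bsub>generic_bc\<^esub> generic_elem 2 \<oplus>\<^bsub>generic_bc\<^esub> generic_elem 1 \<otimes>\<^bsub>generic_bc\<^esub> generic_elem 2) m"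
      unfolding generic_mult[OF g(1,3)] generic_mult[OF g(2,3)] using m
      by (simp add: distrib_left distrib_right sum.distrib)
  qed (rule refl)
  from arg_cong[OF this, of "bc_map E"]
  show "(u \<oplus>\<^bsub>RD\<^esub> v) \<otimes>\<^bsub>RD\<^esub> w = u \<otimes>\<^bsub>RD\<^esub> w \<oplus>\<^bsub>RD\<^esub> v \<otimes>\<^bsub>RD\<^esub> w"
    unfolding ring_hom_mult[OF E(1) cl g(3)] ring_hom_add[OF E(1) g(1,2)]
      ring_hom_add[OF E(1) generic_mult_closed[OF g(1,3)] generic_mult_closed[OF g(2,3)]]
      ring_hom_mult[OF E(1) g(1,3)] ring_hom_mult[OF E(1) g(2,3)] E(2-4) .
qed

interpretation RD: cring RD by (rule cring_base_change)

lemma pure_closed: "r \<in> carrier R \<Longrightarrow> pure R \<iota> r d \<in> carrier RD"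
  using iota_closed by (auto simp: pure_def base_change_sel)

lemma pure_mult:
  assumes "r \<in> carrier R" "s \<in> carrier R"
  shows "pure R \<iota> r d \<otimes>\<^bsub>RD\<^esub> pure R \<iota> s d' = pure R \<iota> (r \<otimes>\<^bsub>R\<^esub> s) (d * d')"
proof -
  have c: "(\<lambda>i\<in>I\<^sub>\<D>. r) \<in> carrier RD" "(\<lambda>i\<in>I\<^sub>\<D>. s) \<in> carrier RD" using assms by (auto simp: base_change_sel)
  obtain E where E: "E \<in> ring_hom generic_ring R" "\<And>a. E (mconst a) = \<iota> a" "bc_map E \<in> ring_hom generic_bc RD"
    "\<And>i. i \<in> I\<^sub>\<D> \<Longrightarrow> E (mvar (0, i)) = (\<lambda>i\<in>I\<^sub>\<D>. r) i" "\<And>i. i \<in> I\<^sub>\<D> \<Longrightarrow> E (mvar (1, i)) = (\<lambda>i\<in>I\<^sub>\<D>. s) i"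
    by (rule specialise[OF c c(1)]) (rule that)
  let ?x = "mvar (0, 0) :: (nat \<times> nat, 'k) mpol" and ?y = "mvar (1, 0) :: (nat \<times> nat, 'k) mpol"
  have xy: "?x \<in> mpols ({..<3} \<times> I\<^sub>\<D>)" "?y \<in> mpols ({..<3} \<times> I\<^sub>\<D>)" by (auto intro!: mpols_var)
  have Exy: "E ?x = r" "E ?y = s" using E(4)[of 0] E(5)[of 0] by simp_all
  have p: "bc_map E (pure generic_ring mconst z d) = pure R \<iota> (E z) d" if "z \<in> mpols ({..<3} \<times> I\<^sub>\<D>)" for z d
    using that ring_hom_mult[OF E(1), of "mconst _" z] E(2)
    by (auto simp: bc_map_def pure_def restrict_def fun_eq_iff)
  have cl: "pure generic_ring mconst z d \<in> carrier generic_bc" if "z \<in> mpols ({..<3} \<times> I\<^sub>\<D>)" for z d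
    using that by (auto simp: pure_def base_change_sel intro!: mpols_mult)
  show ?thesis
    using arg_cong[OF generic_pure_mult[OF xy, of d d'], of "bc_map E"]
    unfolding ring_hom_mult[OF E(3) cl[OF xy(1)] cl[OF xy(2)]] p[OF xy(1)] p[OF xy(2)] p[OF mpols_mult[OF xy]] Exy
    using ring_hom_mult[OF E(1), of ?x ?y] xy by (simp add: Exy[simplified])
qed

lemma pure_one: "pure R \<iota> \<one>\<^bsub>R\<^esub> 1 = \<one>\<^bsub>RD\<^esub>"
  using iota_closed by (auto simp: pure_def base_change_sel restrict_def fun_eq_iff)

lemma pure_pow: "r \<in> carrier R \<Longrightarrow> pure R \<iota> r d [^]\<^bsub>RD\<^esub> (n::nat) = pure R \<iota> (r [^]\<^bsub>R\<^esub> n) (d ^ n)"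
proof (induction n)
  case (Suc n)
  then show ?case
    unfolding RD.nat_pow_Suc R.nat_pow_Suc power_Suc2 by (simp only: pure_mult R.nat_pow_closed)
qed (simp add: pure_one)

lemma iota_0: "\<iota> 0 = \<zero>\<^bsub>R\<^esub>"
  using ring_hom_zero_of_type[OF R.ring_axioms \<iota>] .

lemma iota_1: "\<iota> 1 = \<one>\<^bsub>R\<^esub>"
  using \<iota> by (auto simp: ring_hom_def)

lemma pure_0: "r \<in> carrier R \<Longrightarrow> pure R \<iota> r 0 = \<zero>\<^bsub>RD\<^esub>"
  by (auto simp: pure_def base_change_sel coord_0 iota_0)

text \<open>The projection to the component 0 is \<open>id \<otimes> \<pi>\<close>, since the
  residue map reads off the coordinate at the first basis vector.\<close>

lemma bc_0_hom: "(\<lambda>u. u 0) \<in> ring_hom RD R"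
proof (rule ring_hom_memI)
  fix u v assume uv: "u \<in> carrier RD" "v \<in> carrier RD"
  then show "u 0 \<in> carrier R" by (auto simp: base_change_sel PiE_iff)
  show "(u \<oplus>\<^bsub>RD\<^esub> v) 0 = u 0 \<oplus>\<^bsub>R\<^esub> v 0" by (simp add: base_change_sel)
  obtain E where E: "E \<in> ring_hom generic_ring R" "bc_map E \<in> ring_hom generic_bc RD"
    "bc_map E (generic_elem 0) = u" "bc_map E (generic_elem 1) = v"
    "\<And>i. i \<in> I\<^sub>\<D> \<Longrightarrow> E (mvar (0, i)) = u i" "\<And>i. i \<in> I\<^sub>\<D> \<Longrightarrow> E (mvar (1, i)) = v i"
    using specialise[OF uv uv(1)] by metis
  note g = generic_elems_closed(1,2)
  have "(\<Sum>i\<in>I\<^sub>\<D>. \<Sum>j\<in>I\<^sub>\<D>. mconst (struct_const i j 0) * (mvar (0, i) * mvar (1, j))) =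
      (\<Sum>i\<in>I\<^sub>\<D>. \<Sum>j\<in>I\<^sub>\<D>. if j = 0 then if i = 0 then mvar (0, i) * mvar (1, j) else 0 else (0 :: (nat \<times> nat, 'k) mpol))"
    by (intro sum.cong refl) (simp add: struct_const_0)
  also have "\<dots> = mvar (0, 0) * mvar (1, 0)" by simp
  finally have "(generic_elem 0 \<otimes>\<^bsub>generic_bc\<^esub> generic_elem 1) 0 = mvar (0, 0) * mvar (1, 0)"
    unfolding generic_mult[OF g] by (simp add: generic_elem_def cong: sum.cong_simp)
  then have "bc_map E (generic_elem 0 \<otimes>\<^bsub>generic_bc\<^esub> generic_elem 1) 0 = E (mvar (0, 0) * mvar (1, 0))"
    by (simp add: bc_map_def)
  also have "\<dots> = u 0 \<otimes>\<^bsub>R\<^esub> v 0"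
    using ring_hom_mult[OF E(1), of "mvar (0, 0)" "mvar (1, 0)"] E(5)[of 0] E(6)[of 0] by (simp add: mpols_var)
  finally show "(u \<otimes>\<^bsub>RD\<^esub> v) 0 = u 0 \<otimes>\<^bsub>R\<^esub> v 0"
    using ring_hom_mult[OF E(2) g] E(3,4) by simp
qed (auto simp: base_change_sel coord_one_0 iota_1)

text \<open>Both sides are additive in \<open>u\<close>, which is assembled one coordinate at a time
  from pure tensors, where \<open>pure_mult\<close> applies. This is what identifies multiplication
  by a constant of \<open>k\<close> with scaling of components.\<close>

lemma pure_1_mult:
  assumes r: "r \<in> carrier R" and u: "u \<in> carrier RD"
  shows "pure R \<iota> r 1 \<otimes>\<^bsub>RD\<^esub> u = (\<lambda>m\<in>I\<^sub>\<D>. r \<otimes>\<^bsub>R\<^esub> u m)"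
proof -
  define uA where "uA A = (\<lambda>m\<in>I\<^sub>\<D>. if m \<in> A then u m else \<zero>\<^bsub>R\<^esub>)" for A
  have um: "u m \<in> carrier R" if "m \<in> I\<^sub>\<D>" for m using u that by (auto simp: base_change_sel PiE_iff)
  have uAc: "uA A \<in> carrier RD" for A using um by (auto simp: uA_def base_change_sel)
  have ins: "uA (insert j A) = uA A \<oplus>\<^bsub>RD\<^esub> pure R \<iota> (u j) (eps \<D> j)" if "j \<in> I\<^sub>\<D>" "j \<notin> A" for j A
    using that um by (auto simp: uA_def pure_def base_change_sel restrict_def fun_eq_iff coord_eps iota_0 iota_1)
  have "pure R \<iota> r 1 \<otimes>\<^bsub>RD\<^esub> uA A = (\<lambda>m\<in>I\<^sub>\<D>. r \<otimes>\<^bsub>R\<^esub> uA A m)" if "finite A" "A \<subseteq> I\<^sub>\<D>" for A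
    using that
  proof (induction A rule: finite_induct)
    case empty
    have z: "uA {} = \<zero>\<^bsub>RD\<^esub>" by (auto simp: uA_def base_change_sel)
    have "\<zero>\<^bsub>RD\<^esub> = (\<lambda>m\<in>I\<^sub>\<D>. r \<otimes>\<^bsub>R\<^esub> \<zero>\<^bsub>RD\<^esub> m)"
      using r by (auto simp: base_change_sel restrict_def fun_eq_iff)
    then show ?case unfolding z RD.r_null[OF pure_closed[OF r]] .
  next
    case (insert j A)
    then have j: "j \<in> I\<^sub>\<D>" "j \<notin> A" by auto
    have "pure R \<iota> r 1 \<otimes>\<^bsub>RD\<^esub> uA (insert j A) =
       pure R \<iota> r 1 \<otimes>\<^bsub>RD\<^esub> uA A \<oplus>\<^bsub>RD\<^esub> pure R \<iota> (r \<otimes>\<^bsub>R\<^esub> u j) (eps \<D> j)"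
      unfolding ins[OF j] using uAc pure_closed[OF r] pure_closed[OF um[OF j(1)]] pure_mult[OF r um[OF j(1)], of 1]
      by (simp add: RD.r_distr)
    also have "\<dots> = (\<lambda>m\<in>I\<^sub>\<D>. r \<otimes>\<^bsub>R\<^esub> uA A m) \<oplus>\<^bsub>RD\<^esub> pure R \<iota> (r \<otimes>\<^bsub>R\<^esub> u j) (eps \<D> j)"
      using insert.IH insert.prems by (simp only: insert_subset)
    also have "\<dots> = (\<lambda>m\<in>I\<^sub>\<D>. r \<otimes>\<^bsub>R\<^esub> uA (insert j A) m)"
      using j r um by (auto simp: uA_def pure_def base_change_sel restrict_def fun_eq_iff coord_eps iota_0 iota_1)
    finally show ?case .
  qed
  from this[of I\<^sub>\<D>] show ?thesis
  proof -
    have "uA I\<^sub>\<D> = u" using u by (auto simp: uA_def base_change_sel PiE_iff restrict_def fun_eq_iff extensional_def)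
    with \<open>\<lbrakk>finite I\<^sub>\<D>; I\<^sub>\<D> \<subseteq> I\<^sub>\<D>\<rbrakk> \<Longrightarrow> pure R \<iota> r 1 \<otimes>\<^bsub>RD\<^esub> uA I\<^sub>\<D> = (\<lambda>m\<in>I\<^sub>\<D>. r \<otimes>\<^bsub>R\<^esub> uA I\<^sub>\<D> m)\<close>
    show ?thesis by simp
  qed
qed

end

end

section \<open>Nilpotents and units in base changes to a local algebra\<close>

context local_algebra
begin

text \<open>Here the locality of \<open>\<D>\<close> enters. The kernel of the residue map is a
  maximal ideal because the quotient is \<open>k\<close>; a proper ideal lies in some maximal ideal,
  and there is only one.\<close>

lemma proper_ideal_resid:
  assumes P: "ideal P (ring_of_type_algebra :: 'd ring)" and 1: "1 \<notin> P" and x: "x \<in> P"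
  shows "resid \<D> x = 0"
proof -
  let ?D = "ring_of_type_algebra :: 'd ring"
  interpret D: cring ?D by (rule cring_from_type_algebra)
  define M where "M = a_kernel ?D (ring_of_type_algebra :: 'k ring) (resid \<D>)"
  have M: "x \<in> M \<longleftrightarrow> resid \<D> x = 0" for x
    by (simp add: M_def a_kernel_def')
  have "ring_hom_ring ?D (ring_of_type_algebra :: 'k ring) (resid \<D>)"
    by (intro ring_hom_ringI2 ring_from_type_algebra resid_hom)
  then have idM: "ideal M ?D" unfolding M_def by (rule ring_hom_ring.kernel_is_ideal)
  have max: "maximalideal M ?D"
  proof (rule maximalidealI[OF idM])
    show "carrier ?D \<noteq> M"
      using M[of 1] type_homD(2)[OF resid_hom] by auto
    fix J assume J: "ideal J ?D" "M \<subseteq> J" "J \<subseteq> carrier ?D"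
    interpret J: ideal J ?D by fact
    show "J = M \<or> J = carrier ?D"
    proof (cases "J = M")
      case False
      then obtain y where y: "y \<in> J" "y \<notin> M" using J by blast
      let ?a = "resid \<D> y"
      have a: "?a \<noteq> 0" using y M by simp
      \<comment> \<open>Scaled to residue 1, \<open>y\<close> differs from 1 by an element of the
        kernel.\<close>
      have "1 - smul \<D> (inverse ?a) 1 * y \<in> M"
        using a by (simp add: M type_homD[OF resid_hom] resid_smul)
      then have "1 - smul \<D> (inverse ?a) 1 * y \<in> J" using J by blast
      moreover have "smul \<D> (inverse ?a) 1 * y \<in> J" using J.I_l_closed[OF y(1)] by simp
      ultimately have "1 - smul \<D> (inverse ?a) 1 * y + smul \<D> (inverse ?a) 1 * y \<in> J"
        using additive_subgroup.a_closed[OF J.is_additive_subgroup] by fastforce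
      then have "1 \<in> J" by simp
      then show ?thesis using J.one_imp_carrier by simp
    qed simp
  qed
  have "\<one>\<^bsub>?D\<^esub> [^]\<^bsub>?D\<^esub> (n::nat) \<notin> P" for n using 1 unfolding D.nat_pow_one by simp
  from D.exists_ideal_maximal_avoiding_powers[OF P D.one_closed this]
  obtain Q where Q: "ideal Q ?D" "P \<subseteq> Q" "\<And>n::nat. \<one>\<^bsub>?D\<^esub> [^]\<^bsub>?D\<^esub> n \<notin> Q"
    "\<And>Q'. ideal Q' ?D \<Longrightarrow> Q \<subset> Q' \<Longrightarrow> \<exists>n::nat. \<one>\<^bsub>?D\<^esub> [^]\<^bsub>?D\<^esub> n \<in> Q'"
    by metis
  note Q = Q(1,2) Q(3,4)[unfolded D.nat_pow_one]
  have "maximalideal Q ?D"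
  proof (rule maximalidealI[OF Q(1)])
    show "carrier ?D \<noteq> Q" using Q(3) by auto
    fix J assume J: "ideal J ?D" "Q \<subseteq> J" "J \<subseteq> carrier ?D"
    show "J = Q \<or> J = carrier ?D"
    proof (cases "J = Q")
      case False
      then have "\<one>\<^bsub>?D\<^esub> \<in> J" using Q(4)[of J] J by auto
      then show ?thesis using ideal.one_imp_carrier[OF J(1)] by blast
    qed simp
  qed
  moreover have "\<exists>!M. maximalideal M ?D" using fla by (simp add: finite_local_algebra_def)
  ultimately have "Q = M" using max by blast
  then show ?thesis using x Q(2) M by blast
qed

text \<open>Finite dimension gives a linear relation between the powers of \<open>x\<close>.
  Dividing it by its lowest power yields \<open>x ^ i0 * y = 0\<close>, where the residue of
  \<open>y\<close> is the lowest coefficient and hence nonzero. A prime contains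
  \<open>x ^ i0\<close> or \<open>y\<close>, but by locality not \<open>y\<close>; so
  \<open>x\<close> lies in every prime.\<close>

lemma nilpotent_of_resid_0:
  assumes x: "resid \<D> x = 0"
  shows "\<exists>n. x ^ n = 0"
proof -
  let ?D = "ring_of_type_algebra :: 'd ring"
  interpret D: cring ?D by (rule cring_from_type_algebra)
  \<comment> \<open>One more power than the dimension of \<open>\<D>\<close>, which is
    \<open>Suc (len \<D>)\<close>.\<close>
  let ?L = "{..Suc (len \<D>)}"
  define u where "u i = (\<lambda>m. if m \<in> I\<^sub>\<D> then coord \<D> (x ^ i) m else 0)" for i :: nat
  have "\<exists>a. (\<forall>m. (\<Sum>i\<in>?L. a i * u i m) = 0) \<and> \<not> (\<forall>i\<in>?L. a i = 0)"
  proof (rule ccontr)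
    assume "\<not> ?thesis"
    then have ind: "\<forall>i\<in>?L. a i = 0" if "\<And>m. (\<Sum>i\<in>?L. a i * u i m) = 0" for a using that by blast
    note fam = fun_vs_independent_family[where g = u and S = ?L, OF finite_atMost ind]
    let ?E = "(\<lambda>w v. if v = w then 1 else (0::'k)) ` I\<^sub>\<D>"
    have "u ` ?L \<subseteq> supported I\<^sub>\<D>" by (auto simp: u_def supported_def)
    then have "u ` ?L \<subseteq> fun_vs.span ?E" using supported_span(1)[of "I\<^sub>\<D>", where 'b='k] by simp
    then have "card (u ` ?L) \<le> card ?E"
      using fun_vs.independent_span_bound[of ?E "u ` ?L"] fam(2) by blast
    moreover have "card ?E = Suc (len \<D>)" using supported_span(3)[of "I\<^sub>\<D>", where 'b='k] by simp
    moreover have "card (u ` ?L) = Suc (Suc (len \<D>))" using card_image[OF fam(1)] by simp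
    ultimately show False by simp
  qed
  then obtain a where a: "\<And>m. (\<Sum>i\<in>?L. a i * u i m) = 0" "\<exists>i. i \<in> ?L \<and> a i \<noteq> 0" by blast
  define i0 where "i0 = (LEAST i. i \<in> ?L \<and> a i \<noteq> 0)"
  have i0: "i0 \<in> ?L" "a i0 \<noteq> 0" using LeastI_ex[OF a(2)] by (auto simp: i0_def)
  have min: "a i = 0" if "i < i0" for i
    using not_less_Least[of i "\<lambda>i. i \<in> ?L \<and> a i \<noteq> 0"] that i0(1) by (auto simp: i0_def)
  \<comment> \<open>The linear relation divided by the lowest power \<open>x ^ i0\<close> that
    occurs in it.\<close>
  define y where "y = (\<Sum>i\<in>?L. if i0 \<le> i then smul \<D> (a i) (x ^ (i - i0)) else 0)"
  have "(\<Sum>i\<in>?L. smul \<D> (a i) (x ^ i)) = 0"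
  proof -
    have "coord \<D> (\<Sum>i\<in>?L. smul \<D> (a i) (x ^ i)) m = 0" if "m \<in> I\<^sub>\<D>" for m
      using a(1)[of m] that by (simp add: coord_sum coord_smul u_def del: sum.atMost_Suc)
    then show ?thesis
      by (subst coord_expand[of "\<Sum>i\<in>?L. smul \<D> (a i) (x ^ i)", symmetric]) (simp del: sum.atMost_Suc)
  qed
  moreover have "x ^ i0 * y = (\<Sum>i\<in>?L. smul \<D> (a i) (x ^ i))"
    unfolding y_def sum_distrib_left
  proof (intro sum.cong refl)
    fix i show "x ^ i0 * (if i0 \<le> i then smul \<D> (a i) (x ^ (i - i0)) else 0) = smul \<D> (a i) (x ^ i)"
      using min[of i] by (cases "i0 \<le> i") (auto simp flip: smul_mult(2) power_add)
  qed
  ultimately have xy: "x ^ i0 * y = 0" by simp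
  have "resid \<D> y = (\<Sum>i\<in>?L. if i = i0 then a i else 0)"
    unfolding y_def type_hom_sum[OF resid_hom]
    by (intro sum.cong refl) (auto simp: type_homD[OF resid_hom] resid_smul x power_0_left)
  then have ry: "resid \<D> y \<noteq> 0" using i0 by simp
  have "D.nilpotent x"
  proof (rule D.nilpotentI)
    fix P assume P: "primeideal P ?D"
    interpret P: primeideal P ?D by fact
    have 0: "0 \<in> P" using additive_subgroup.zero_closed[OF P.is_additive_subgroup] by simp
    have 1: "1 \<notin> P" using P.I_notcarr P.one_imp_carrier by auto
    have "x ^ i0 \<in> P \<or> y \<in> P" using P.I_prime[of "x ^ i0" y] xy 0 by simp
    moreover have "y \<notin> P" using proper_ideal_resid[OF P.is_ideal 1] ry by blast
    ultimately show "x \<in> P" using D.prime_mem_of_pow[OF P, of x i0] by (simp add: pow_of_type)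
  qed simp
  then show ?thesis by (auto simp: D.nilpotent_def pow_of_type)
qed

context
  fixes R :: "'r ring" and \<iota> :: "'k \<Rightarrow> 'r"
  assumes R: "cring R" and \<iota>: "\<iota> \<in> ring_hom ring_of_type_algebra R"
begin

interpretation R: cring R by (rule R)
interpretation RD: cring "base_change \<D> R \<iota>" by (rule cring_base_change[OF R \<iota>])

text \<open>With component 0 equal to zero, \<open>u\<close> is a sum of pure tensors on basis
  elements of residue 0. These are nilpotent, so each pure tensor lies in every prime, and hence so
  does \<open>u\<close>.\<close>

lemma base_change_nilpotent:
  assumes u: "u \<in> carrier (base_change \<D> R \<iota>)" "u 0 = \<zero>\<^bsub>R\<^esub>"
  shows "RD.nilpotent u"
proof (rule RD.nilpotentI[OF u(1)])
  fix P assume P: "primeideal P (base_change \<D> R \<iota>)"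
  interpret P: primeideal P "base_change \<D> R \<iota>" by fact
  define uA where "uA A = (\<lambda>m\<in>I\<^sub>\<D>. if m \<in> A then u m else \<zero>\<^bsub>R\<^esub>)" for A
  have um: "u m \<in> carrier R" if "m \<in> I\<^sub>\<D>" for m using u that by (auto simp: base_change_sel PiE_iff)
  have ins: "uA (insert j A) = uA A \<oplus>\<^bsub>base_change \<D> R \<iota>\<^esub> pure R \<iota> (u j) (eps \<D> j)" if "j \<in> I\<^sub>\<D>" "j \<notin> A" for j A
    using that um
    by (auto simp: uA_def pure_def base_change_sel restrict_def fun_eq_iff coord_eps iota_0[OF R \<iota>] iota_1[OF R \<iota>])
  have z: "uA {} \<in> P"
    using additive_subgroup.zero_closed[OF P.is_additive_subgroup] by (auto simp: uA_def base_change_sel)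
  have pureP: "pure R \<iota> (u j) (eps \<D> j) \<in> P" if j: "j \<in> I\<^sub>\<D>" for j
  proof (cases "j = 0")
    case True
    then have "pure R \<iota> (u j) (eps \<D> j) = uA {}"
      using u(2) iota_closed[OF R \<iota>] by (auto simp: pure_def uA_def restrict_def fun_eq_iff)
    then show ?thesis using z by simp
  next
    case False
    then obtain n where "eps \<D> j ^ n = 0" using nilpotent_of_resid_0 resid_eps(2) j by blast
    then have "pure R \<iota> (u j) (eps \<D> j) [^]\<^bsub>base_change \<D> R \<iota>\<^esub> n = \<zero>\<^bsub>base_change \<D> R \<iota>\<^esub>"
      using um[OF j] by (simp add: pure_pow[OF R \<iota>] pure_0[OF R \<iota>])
    then have "RD.nilpotent (pure R \<iota> (u j) (eps \<D> j))"
      using pure_closed[OF R \<iota> um[OF j]] by (auto simp: RD.nilpotent_def)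
    then show ?thesis using P by (rule RD.nilpotent_in_prime)
  qed
  have "uA A \<in> P" if "finite A" "A \<subseteq> I\<^sub>\<D>" for A
    using that
  proof (induction A rule: finite_induct)
    case (insert j A)
    then show ?case
      using ins[of j A] pureP[of j] additive_subgroup.a_closed[OF P.is_additive_subgroup] by auto
  qed (use z in simp)
  from this[of "I\<^sub>\<D>"] have "uA I\<^sub>\<D> \<in> P" by simp
  moreover have "uA I\<^sub>\<D> = u"
    using u(1) by (auto simp: uA_def base_change_sel PiE_iff restrict_def fun_eq_iff extensional_def)
  ultimately show "u \<in> P" by simp
qed

text \<open>\<open>u\<close> differs from the invertible element \<open>u 0 \<otimes> 1\<close> by
  an element with component 0 equal to zero, which is nilpotent.\<close>

lemma base_change_unit:
  assumes u: "u \<in> carrier (base_change \<D> R \<iota>)" "u 0 \<in> Units R"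
  shows "u \<in> Units (base_change \<D> R \<iota>)"
proof -
  let ?T = "base_change \<D> R \<iota>"
  have u0: "u 0 \<in> carrier R" "inv\<^bsub>R\<^esub> u 0 \<in> carrier R" using u by auto
  define s where "s = pure R \<iota> (u 0) 1"
  have s: "s \<in> carrier ?T" "pure R \<iota> (inv\<^bsub>R\<^esub> u 0) 1 \<in> carrier ?T"
    unfolding s_def using u0 by (auto intro: pure_closed[OF R \<iota>])
  have "s \<otimes>\<^bsub>?T\<^esub> pure R \<iota> (inv\<^bsub>R\<^esub> u 0) 1 = \<one>\<^bsub>?T\<^esub>"
    unfolding s_def using u u0 by (simp add: pure_mult[OF R \<iota>] pure_one[OF R \<iota>])
  moreover from this have "pure R \<iota> (inv\<^bsub>R\<^esub> u 0) 1 \<otimes>\<^bsub>?T\<^esub> s = \<one>\<^bsub>?T\<^esub>"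
    using RD.m_comm[OF s] by simp
  ultimately have su: "s \<in> Units ?T" using s unfolding Units_def by blast
  define e where "e = u \<oplus>\<^bsub>?T\<^esub> \<ominus>\<^bsub>?T\<^esub> s"
  have e: "e \<in> carrier ?T" using u s by (simp add: e_def)
  have s0: "s 0 = u 0" using u0 by (simp add: s_def pure_def coord_one_0 iota_1[OF R \<iota>])
  have "s \<oplus>\<^bsub>?T\<^esub> e = u"
    unfolding e_def using RD.a_lcomm[of s u "\<ominus>\<^bsub>?T\<^esub> s"] u(1) s(1) RD.r_neg[OF s(1)] by simp
  then have "u = s \<oplus>\<^bsub>?T\<^esub> e" by (rule sym)
  then have "u 0 = u 0 \<oplus>\<^bsub>R\<^esub> e 0"
    using s0 by (metis (no_types, lifting) base_change_sel(5) atMost_iff restrict_apply' zero_le)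
  moreover have "e 0 \<in> carrier R" using e by (auto simp: base_change_sel PiE_iff)
  ultimately have "e 0 = \<zero>\<^bsub>R\<^esub>" using u0 by (metis R.add.l_cancel_one')
  then have "RD.nilpotent e" using base_change_nilpotent[OF e] by blast
  from RD.unit_add_nilpotent[OF su this RD.one_closed] show ?thesis
    using e \<open>u = s \<oplus>\<^bsub>?T\<^esub> e\<close> by simp
qed

end

end

section \<open>\<open>\<D>\<close>-fields and prolongations\<close>

locale D_base = local_algebra \<D> for \<D> :: "('k::field_char_0, 'd::comm_ring_1) based_algebra" +
  fixes \<iota> :: "'k \<Rightarrow> 'a::field_char_0" and \<Delta> :: "'a \<Rightarrow> nat \<Rightarrow> 'a"
  assumes D_field: "D_field \<D> ring_of_type_algebra \<iota> \<Delta>"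
begin

lemma iota_hom: "type_hom \<iota>"
  and Delta_hom: "\<Delta> \<in> ring_hom ring_of_type_algebra (base_change \<D> ring_of_type_algebra \<iota>)"
  and Delta_linear: "\<Delta> (\<iota> a * r) = (\<lambda>j\<in>I\<^sub>\<D>. \<iota> a * \<Delta> r j)"
  using D_field by (auto simp: D_field_def D_ring_def)

lemma resid_sum:
  fixes R :: "'r ring"
  assumes R: "cring R" and \<kappa>: "\<kappa> \<in> ring_hom ring_of_type_algebra R" and u: "\<And>j. j \<in> I\<^sub>\<D> \<Longrightarrow> u j \<in> carrier R"
  shows "(\<Oplus>\<^bsub>R\<^esub>j\<in>I\<^sub>\<D>. u j \<otimes>\<^bsub>R\<^esub> \<kappa> (resid \<D> (eps \<D> j))) = u 0"
proof -
  interpret R: cring R by fact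
  have "(\<Oplus>\<^bsub>R\<^esub>j\<in>I\<^sub>\<D>. u j \<otimes>\<^bsub>R\<^esub> \<kappa> (resid \<D> (eps \<D> j))) = (\<Oplus>\<^bsub>R\<^esub>j\<in>I\<^sub>\<D>. if 0 = j then u j else \<zero>\<^bsub>R\<^esub>)"
    using u resid_eps iota_0[OF R \<kappa>] iota_1[OF R \<kappa>] by (intro R.finsum_cong') auto
  also have "\<dots> = u 0" using u by (subst R.finsum_singleton) auto
  finally show ?thesis .
qed

lemma Delta_0: "\<Delta> r 0 = r"
proof -
  have "(\<Oplus>\<^bsub>ring_of_type_algebra\<^esub>j\<in>I\<^sub>\<D>. \<Delta> r j \<otimes>\<^bsub>ring_of_type_algebra\<^esub> \<iota> (resid \<D> (eps \<D> j))) = r"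
    using D_field by (auto simp: D_field_def D_ring_def)
  then show ?thesis
    using resid_sum[OF cring_from_type_algebra iota_hom, of "\<Delta> r"] by simp
qed

text \<open>The composite of \<open>\<partial>\<close> with \<open>c \<otimes> id\<close>.
  Evaluating \<open>f\<close> with this coefficient map amounts to evaluating
  \<open>f\<^sup>\<partial>\<close> in \<open>R \<otimes> \<D>\<close>.\<close>

definition kap :: "('a \<Rightarrow> 'r) \<Rightarrow> 'a \<Rightarrow> nat \<Rightarrow> 'r" where
  "kap c a = bc_map c (\<Delta> a)"

lemma kap_apply: "j \<in> I\<^sub>\<D> \<Longrightarrow> kap c a j = c (\<Delta> a j)"
  by (simp add: kap_def bc_map_def)

lemma kap_0: "kap c a 0 = c a"
  by (simp add: kap_apply Delta_0)

lemma comp_iota_hom: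
  "c \<in> ring_hom ring_of_type_algebra R \<Longrightarrow> c \<circ> \<iota> \<in> ring_hom ring_of_type_algebra R"
  using iota_hom by (auto simp: ring_hom_def)

lemma kap_hom:
  assumes R: "cring R" and c: "c \<in> ring_hom ring_of_type_algebra R"
  shows "kap c \<in> ring_hom ring_of_type_algebra (base_change \<D> R (c \<circ> \<iota>))"
proof -
  have "bc_map c \<in> ring_hom (base_change \<D> ring_of_type_algebra \<iota>) (base_change \<D> R (c \<circ> \<iota>))"
    by (rule bc_map_hom[OF cring_from_type_algebra R c iota_hom refl])
  with Delta_hom have "bc_map c \<circ> \<Delta> \<in> ring_hom ring_of_type_algebra (base_change \<D> R (c \<circ> \<iota>))"
    by (rule ring_hom_trans)
  then show ?thesis by (simp add: kap_def[abs_def] comp_def)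
qed

lemma bc_map_kap: "bc_map h (kap c a) = kap (h \<circ> c) a"
  by (auto simp: kap_def bc_map_def restrict_def fun_eq_iff)

lemma prol_poly_eq:
  "prol_poly \<D> \<iota> \<Delta> n f =
    mp_eval_in (base_change \<D> (mpol_ring (prol_vars \<D> n)) (mconst \<circ> \<iota>)) (kap mconst) (\<lambda>i. \<lambda>j\<in>I\<^sub>\<D>. mvar (j, i)) f"
  by (simp add: prol_poly_def mp_eval_in_def Let_def kap_def bc_map_def)

lemma prol_evaluation:
  "mp_evaluation (base_change \<D> (mpol_ring (prol_vars \<D> n)) (mconst \<circ> \<iota>)) (kap mconst) (\<lambda>i. \<lambda>j\<in>I\<^sub>\<D>. mvar (j, i)) {..<n}"
  by (intro mp_evaluationI cring_base_change kap_hom cring_mpol_ring comp_iota_hom mconst_hom)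
    (auto simp: base_change_sel prol_vars_def intro!: mpols_var split: if_splits)

lemma prol_poly_closed:
  assumes "f \<in> mpols {..<n}" "j \<in> I\<^sub>\<D>"
  shows "prol_poly \<D> \<iota> \<Delta> n f j \<in> mpols (prol_vars \<D> n)"
  using mp_evaluation.ev_closed[OF prol_evaluation assms(1)] assms(2)
  by (auto simp: prol_poly_eq base_change_sel PiE_iff)

text \<open>The universal property of the prolongation: its points in \<open>R\<close> are the
  points with coordinates in \<open>R \<otimes> \<D>\<close>. The generic evaluation that defines
  \<open>prol_poly\<close> is specialised along the homomorphism given by \<open>y\<close>.\<close>

lemma prol_poly_eval:
  assumes R: "cring R" and c: "c \<in> ring_hom ring_of_type_algebra R"
    and y: "y \<in> prol_vars \<D> n \<rightarrow> carrier R" and f: "f \<in> mpols {..<n}" and j: "j \<in> I\<^sub>\<D>"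
  shows "mp_eval_in R c y (prol_poly \<D> \<iota> \<Delta> n f j) =
    mp_eval_in (base_change \<D> R (c \<circ> \<iota>)) (kap c) (\<lambda>i. \<lambda>j\<in>I\<^sub>\<D>. y (j, i)) f j"
proof -
  let ?M = "base_change \<D> (mpol_ring (prol_vars \<D> n)) (mconst \<circ> \<iota>)" and ?T = "base_change \<D> R (c \<circ> \<iota>)"
  interpret E: mp_evaluation R c y "prol_vars \<D> n" by (rule mp_evaluationI[OF R c y])
  have h: "bc_map E.ev \<in> ring_hom ?M ?T"
    by (rule bc_map_hom[OF cring_mpol_ring R E.ev_hom comp_iota_hom[OF mconst_hom]]) (auto simp: fun_eq_iff)
  have T: "cring ?T" by (rule cring_base_change[OF R comp_iota_hom[OF c]])
  have k: "bc_map E.ev \<circ> kap mconst = kap c"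
    by (auto simp: fun_eq_iff kap_def bc_map_def restrict_def)
  have "bc_map E.ev (prol_poly \<D> \<iota> \<Delta> n f) = mp_eval_in ?T (kap c) (bc_map E.ev \<circ> (\<lambda>i. \<lambda>j\<in>I\<^sub>\<D>. mvar (j, i))) f"
    unfolding prol_poly_eq using mp_eval_in_compose_hom[OF prol_evaluation T h f] by (simp add: k)
  also have "\<dots> = mp_eval_in ?T (kap c) (\<lambda>i. \<lambda>j\<in>I\<^sub>\<D>. y (j, i)) f"
  proof (rule mp_eval_in_cong[OF _ f T _ kap_hom[OF R c]])
    show "(bc_map E.ev \<circ> (\<lambda>i. \<lambda>j\<in>I\<^sub>\<D>. mvar (j, i))) v = (\<lambda>j\<in>I\<^sub>\<D>. y (j, v))" if "v \<in> {..<n}" for v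
      using that by (auto simp: bc_map_def restrict_def fun_eq_iff prol_vars_def)
    show "bc_map E.ev \<circ> (\<lambda>i. \<lambda>j\<in>I\<^sub>\<D>. mvar (j, i)) \<in> {..<n} \<rightarrow> carrier ?T"
      using y by (auto simp: bc_map_def base_change_sel prol_vars_def Pi_iff)
  qed
  finally show ?thesis using j by (metis (no_types, lifting) bc_map_def restrict_apply')
qed

lemma prol_poly_0:
  assumes f: "f \<in> mpols {..<n}"
  shows "prol_poly \<D> \<iota> \<Delta> n f 0 = mp_eval mconst (\<lambda>i. mvar (0, i)) f"
proof -
  let ?M = "base_change \<D> (mpol_ring (prol_vars \<D> n)) (mconst \<circ> \<iota>)"
  have "prol_poly \<D> \<iota> \<Delta> n f 0 =
      mp_eval_in (mpol_ring (prol_vars \<D> n)) ((\<lambda>u. u 0) \<circ> kap mconst) ((\<lambda>u. u 0) \<circ> (\<lambda>i. \<lambda>j\<in>I\<^sub>\<D>. mvar (j, i))) f"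
    unfolding prol_poly_eq
    by (rule mp_eval_in_compose_hom[OF prol_evaluation cring_mpol_ring bc_0_hom[OF cring_mpol_ring comp_iota_hom[OF mconst_hom]] f])
  also have "(\<lambda>u. u 0) \<circ> kap mconst = (mconst :: 'a \<Rightarrow> (nat \<times> nat, 'a) mpol)"
    by (simp add: fun_eq_iff kap_0)
  also have "(\<lambda>u. u 0) \<circ> (\<lambda>i. \<lambda>j\<in>I\<^sub>\<D>. mvar (j, i)) = (\<lambda>i. mvar (0, i) :: (nat \<times> nat, 'a) mpol)"
    by (simp add: fun_eq_iff)
  also have "mp_eval_in (mpol_ring (prol_vars \<D> n)) mconst (\<lambda>i. mvar (0, i)) f = mp_eval mconst (\<lambda>i. mvar (0, i)) f"
    by (rule mp_eval_mpol_ring[OF f]) (auto simp: prol_vars_def intro!: mpols_var)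
  finally show ?thesis .
qed

lemma prol_ideal_subset_iff:
  assumes J: "ideal J (mpol_ring (prol_vars \<D> n))" and I: "I \<subseteq> mpols {..<n}"
  shows "prol_ideal \<D> \<iota> \<Delta> n I \<subseteq> J \<longleftrightarrow> (\<forall>f\<in>I. \<forall>j\<in>I\<^sub>\<D>. prol_poly \<D> \<iota> \<Delta> n f j \<in> J)"
proof -
  interpret cring "mpol_ring (prol_vars \<D> n) :: (nat \<times> nat, 'a) mpol ring" by (rule cring_mpol_ring)
  let ?G = "{prol_poly \<D> \<iota> \<Delta> n f j | f j. f \<in> I \<and> j \<in> I\<^sub>\<D>}"
  have "?G \<subseteq> carrier (mpol_ring (prol_vars \<D> n))" using I prol_poly_closed by auto
  from genideal_self[OF this] genideal_minimal[OF J, of ?G]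
  show ?thesis unfolding prol_ideal_def by blast
qed

lemma prol_ideal_subst_iff:
  assumes I: "ideal I (mpol_ring {..<n})" and s: "s ` prol_vars \<D> n \<subseteq> mpols {..<n}"
  shows "(\<forall>g\<in>prol_ideal \<D> \<iota> \<Delta> n I. mp_eval mconst s g \<in> I) \<longleftrightarrow>
    (\<forall>f\<in>I. \<forall>j\<in>I\<^sub>\<D>. mp_eval mconst s (prol_poly \<D> \<iota> \<Delta> n f j) \<in> I)"
proof -
  note id = ideal_mpolD[OF I]
  let ?J = "{g \<in> mpols (prol_vars \<D> n). mp_eval mconst s g \<in> I}"
  have "ideal ?J (mpol_ring (prol_vars \<D> n))"
  proof (rule ideal_mpolI)
    fix f p :: "(nat \<times> nat, 'a) mpol" assume fp: "f \<in> ?J" "p \<in> mpols (prol_vars \<D> n)"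
    then have "mp_eval mconst s p \<in> mpols {..<n}" using s by (intro mpols_subst[of p "prol_vars \<D> n"]) auto
    then show "p * f \<in> ?J" using fp id(4) by (auto simp: mp_eval_ring_simps intro: mpols_mult)
  qed (use id in \<open>auto simp: mp_eval_ring_simps intro: mpols_add\<close>)
  note iff = prol_ideal_subset_iff[OF this id(1)]
  have "prol_ideal \<D> \<iota> \<Delta> n I \<subseteq> mpols (prol_vars \<D> n)"
  proof -
    have "ideal (mpols (prol_vars \<D> n)) (mpol_ring (prol_vars \<D> n) :: (nat \<times> nat, 'a) mpol ring)"
      by (rule ideal_mpolI) (auto intro: mpols_add mpols_mult)
    then show ?thesis using prol_ideal_subset_iff[OF _ id(1)] id(1) prol_poly_closed by blast
  qed
  then show ?thesis using iff id(1) prol_poly_closed by blast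
qed

end

section \<open>Localisations of coordinate rings\<close>

text \<open>Witnesses of divisibility and of \<open>in_sat\<close> may involve arbitrary variables.
  Setting those outside \<open>N\<close> to 0 is a homomorphism that fixes \<open>K[N]\<close> and
  brings the witnesses there.\<close>

lemma restrict_vars:
  obtains \<rho> :: "('v, 'a::comm_ring_1) mpol \<Rightarrow> ('v, 'a) mpol" where
    "type_hom \<rho>" "\<And>f. f \<in> mpols N \<Longrightarrow> \<rho> f = f" "\<And>f. \<rho> f \<in> mpols N"
proof
  let ?x = "\<lambda>v. if v \<in> N then mvar v else (0 :: ('v, 'a) mpol)"
  show "type_hom (mp_eval mconst ?x)" by (rule mp_eval_hom) simp
  show "mp_eval mconst ?x f = f" if "f \<in> mpols N" for f
    using mp_eval_cong[of mconst f N ?x mvar] that by (simp add: mp_eval_mconst_mvar)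
  show "mp_eval mconst ?x f \<in> mpols N" for f
    by (rule mpols_subst[of f UNIV]) (auto intro: mpols_var)
qed

lemma dvd_mpols:
  fixes s h :: "('v, 'a::comm_ring_1) mpol"
  assumes "s dvd h" "s \<in> mpols N" "h \<in> mpols N"
  obtains q where "q \<in> mpols N" "h = s * q"
proof -
  obtain \<rho> :: "('v, 'a) mpol \<Rightarrow> ('v, 'a) mpol" where \<rho>: "type_hom \<rho>" "\<And>f. f \<in> mpols N \<Longrightarrow> \<rho> f = f" "\<And>f. \<rho> f \<in> mpols N"
    using restrict_vars by metis
  obtain q where "h = s * q" using assms(1) by (rule dvdE)
  then have "h = s * \<rho> q" using \<rho>(2)[OF assms(2)] \<rho>(2)[OF assms(3)] type_homD(4)[OF \<rho>(1)] by metis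
  then show ?thesis using that \<rho>(3) by blast
qed

lemma in_sat_mpols:
  fixes f h :: "('v, 'a::comm_ring_1) mpol"
  assumes "in_sat h P S f" "h \<in> mpols N" "f \<in> mpols N" "\<And>v. v \<in> S \<Longrightarrow> P v \<in> mpols N"
  obtains k q where "\<And>v. q v \<in> mpols N" "h ^ k * f = (\<Sum>v\<in>S. q v * P v)"
proof -
  obtain \<rho> :: "('v, 'a) mpol \<Rightarrow> ('v, 'a) mpol" where \<rho>: "type_hom \<rho>" "\<And>f. f \<in> mpols N \<Longrightarrow> \<rho> f = f" "\<And>f. \<rho> f \<in> mpols N"
    using restrict_vars by metis
  obtain k q where "h ^ k * f = (\<Sum>v\<in>S. q v * P v)" using assms(1) by (auto simp: in_sat_def)
  from arg_cong[OF this, of \<rho>] have "h ^ k * f = (\<Sum>v\<in>S. \<rho> (q v) * P v)"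
    using assms \<rho>(2) by (simp add: type_homD[OF \<rho>(1)] type_hom_sum[OF \<rho>(1)])
  then show ?thesis using that[of "\<lambda>v. \<rho> (q v)" k] \<rho>(3) by blast
qed

text \<open>The localisation of \<open>K[b]\<close> at the multiplicative set \<open>M\<close>, inside the field containing \<open>b\<close>.\<close>

locale localisation =
  fixes c :: "'a::field \<Rightarrow> 'f::field" and N :: "'v set" and b :: "'v \<Rightarrow> 'f" and M :: "('v, 'a) mpol set"
  assumes c: "type_hom c" and M: "M \<subseteq> mpols N" "1 \<in> M" "\<And>g h. g \<in> M \<Longrightarrow> h \<in> M \<Longrightarrow> g * h \<in> M"
    and M_nonzero: "\<And>g. g \<in> M \<Longrightarrow> mp_eval c b g \<noteq> 0"
begin

abbreviation "evb \<equiv> mp_eval c b"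

lemmas ev = mp_eval_ring_simps[OF c]

definition Loc :: "'f ring" where
  "Loc = \<lparr>carrier = {evb f / evb g | f g. f \<in> mpols N \<and> g \<in> M},
     monoid.mult = (*), one = 1, ring.zero = 0, add = (+)\<rparr>"

lemma Loc_sel [simp]:
  "carrier Loc = {evb f / evb g | f g. f \<in> mpols N \<and> g \<in> M}"
  "x \<otimes>\<^bsub>Loc\<^esub> y = x * y" "x \<oplus>\<^bsub>Loc\<^esub> y = x + y" "\<one>\<^bsub>Loc\<^esub> = 1" "\<zero>\<^bsub>Loc\<^esub> = 0"
  by (simp_all add: Loc_def)

lemma in_LocI: "f \<in> mpols N \<Longrightarrow> g \<in> M \<Longrightarrow> evb f / evb g \<in> carrier Loc"
  by auto

lemma eval_in_Loc: "f \<in> mpols N \<Longrightarrow> evb f \<in> carrier Loc"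
  using in_LocI[OF _ M(2), of f] by (simp add: ev)

lemma inverse_in_Loc: "g \<in> M \<Longrightarrow> inverse (evb g) \<in> carrier Loc"
  using in_LocI[of 1 g] by (simp add: ev divide_inverse)

lemma Loc_mult: "x \<in> carrier Loc \<Longrightarrow> y \<in> carrier Loc \<Longrightarrow> x * y \<in> carrier Loc"
proof -
  assume "x \<in> carrier Loc" "y \<in> carrier Loc"
  then obtain f g f' g' where "x = evb f / evb g" "y = evb f' / evb g'"
    and m: "f \<in> mpols N" "g \<in> M" "f' \<in> mpols N" "g' \<in> M" by auto
  then have "x * y = evb (f * f') / evb (g * g')" by (simp add: ev)
  then show ?thesis using in_LocI[OF mpols_mult[OF m(1,3)] M(3)[OF m(2,4)]] by simp
qed

lemma Loc_add: "x \<in> carrier Loc \<Longrightarrow> y \<in> carrier Loc \<Longrightarrow> x + y \<in> carrier Loc"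
proof -
  assume "x \<in> carrier Loc" "y \<in> carrier Loc"
  then obtain f g f' g' where xy: "x = evb f / evb g" "y = evb f' / evb g'"
    and m: "f \<in> mpols N" "g \<in> M" "f' \<in> mpols N" "g' \<in> M" by auto
  have "x + y = evb (f * g' + f' * g) / evb (g * g')"
    unfolding xy using M_nonzero[OF m(2)] M_nonzero[OF m(4)] by (simp add: ev field_simps)
  then show ?thesis
    using in_LocI[of "f * g' + f' * g" "g * g'"] m M by (auto intro!: mpols_add mpols_mult)
qed

lemma cring_Loc: "cring Loc"
proof (rule cringI)
  show "abelian_group Loc"
  proof (rule abelian_groupI)
    fix x assume x: "x \<in> carrier Loc"
    have "- 1 \<in> carrier Loc" using eval_in_Loc[of "- 1"] by (simp add: ev mpols_uminus)
    from Loc_mult[OF this x] have "- x \<in> carrier Loc" by (simp del: Loc_sel(1))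
    then show "\<exists>y\<in>carrier Loc. y \<oplus>\<^bsub>Loc\<^esub> x = \<zero>\<^bsub>Loc\<^esub>" by (intro bexI[of _ "- x"]) (auto simp del: Loc_sel(1))
  next
    show "\<zero>\<^bsub>Loc\<^esub> \<in> carrier Loc" using eval_in_Loc[of 0] by (simp add: ev del: Loc_sel(1))
  qed (auto simp: Loc_add algebra_simps simp del: Loc_sel(1))
  show "Group.comm_monoid Loc"
  proof (rule comm_monoidI)
    show "\<one>\<^bsub>Loc\<^esub> \<in> carrier Loc" using eval_in_Loc[of 1] by (simp add: ev del: Loc_sel(1))
  qed (auto simp: Loc_mult algebra_simps simp del: Loc_sel(1))
qed (auto simp: algebra_simps simp del: Loc_sel(1))

lemma c_hom_Loc: "c \<in> ring_hom ring_of_type_algebra Loc"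
proof (rule ring_hom_memI)
  show "c x \<in> carrier Loc" for x using eval_in_Loc[of "mconst x"] by (simp add: ev del: Loc_sel(1))
qed (auto simp: type_homD[OF c] simp del: Loc_sel(1))

lemma eval_in_LocR:
  assumes f: "f \<in> mpols N'" and x: "x \<in> N' \<rightarrow> carrier Loc"
  shows "mp_eval_in Loc c x f = mp_eval c x f"
proof -
  interpret L: mp_evaluation Loc c x N' by (rule mp_evaluationI[OF cring_Loc c_hom_Loc x])
  show ?thesis
    using f by (induction rule: mpol_induct) (simp_all add: ev L.ev_add L.ev_mult del: Loc_sel(1))
qed

lemma unit_Loc:
  assumes "f \<in> mpols N" "g \<in> M" "f dvd g"
  shows "evb f \<in> Units Loc"
proof -
  obtain q where q: "q \<in> mpols N" "g = f * q" using dvd_mpols[OF assms(3,1)] assms(2) M(1) by blast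
  have "evb f * (evb q / evb g) = 1"
    using M_nonzero[OF assms(2)] unfolding q(2) by (simp add: ev)
  then have "evb f \<otimes>\<^bsub>Loc\<^esub> (evb q / evb g) = \<one>\<^bsub>Loc\<^esub>" "(evb q / evb g) \<otimes>\<^bsub>Loc\<^esub> evb f = \<one>\<^bsub>Loc\<^esub>"
    by (simp_all only: Loc_sel mult.commute)
  then show ?thesis
    using eval_in_Loc[OF assms(1)] in_LocI[OF q(1) assms(2)] unfolding Units_def by blast
qed

text \<open>The universal property of the localisation. As \<open>K[b]\<close> is not formed as a
  quotient, the homomorphism is prescribed on polynomials and is required to kill the relations of
  \<open>b\<close>.\<close>

lemma extend_hom:
  fixes T :: "'t ring"
  assumes T: "cring T" and E: "E \<in> ring_hom (mpol_ring N) T"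
    and kill: "\<And>f. f \<in> mpols N \<Longrightarrow> evb f = 0 \<Longrightarrow> E f = \<zero>\<^bsub>T\<^esub>"
    and unit: "\<And>g. g \<in> M \<Longrightarrow> E g \<in> Units T"
  obtains \<delta> where "\<delta> \<in> ring_hom Loc T" "\<And>f. f \<in> mpols N \<Longrightarrow> \<delta> (evb f) = E f"
    "\<And>f g. f \<in> mpols N \<Longrightarrow> g \<in> M \<Longrightarrow> \<delta> (evb f / evb g) = E f \<otimes>\<^bsub>T\<^esub> inv\<^bsub>T\<^esub> E g"
proof -
  interpret T: cring T by fact
  have Ec: "E f \<in> carrier T" if "f \<in> mpols N" for f using E that by (auto simp: ring_hom_def)
  have Ea: "E (f + g) = E f \<oplus>\<^bsub>T\<^esub> E g" and Em: "E (f * g) = E f \<otimes>\<^bsub>T\<^esub> E g"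
    if "f \<in> mpols N" "g \<in> mpols N" for f g using E that by (auto simp: ring_hom_def)
  have E1: "E 1 = \<one>\<^bsub>T\<^esub>" using E by (auto simp: ring_hom_def)
  have cross: "E f \<otimes>\<^bsub>T\<^esub> inv\<^bsub>T\<^esub> E g = E f' \<otimes>\<^bsub>T\<^esub> inv\<^bsub>T\<^esub> E g'"
    if m: "f \<in> mpols N" "g \<in> M" "f' \<in> mpols N" "g' \<in> M" and eq: "evb f / evb g = evb f' / evb g'" for f g f' g'
  proof -
    have gN: "g \<in> mpols N" "g' \<in> mpols N" using m M by auto
    have "evb f * evb g' = evb f' * evb g"
      using eq M_nonzero[OF m(2)] M_nonzero[OF m(4)] by (simp add: field_simps)
    then have "E (f * g' - f' * g) = \<zero>\<^bsub>T\<^esub>"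
      using m gN by (intro kill) (auto simp: ev intro!: mpols_minus mpols_mult)
    moreover have "E (f * g') = E (f' * g) \<oplus>\<^bsub>T\<^esub> E (f * g' - f' * g)"
      using m gN Ea[of "f' * g" "f * g' - f' * g"] by (auto intro!: mpols_minus mpols_mult)
    ultimately have x: "E f \<otimes>\<^bsub>T\<^esub> E g' = E f' \<otimes>\<^bsub>T\<^esub> E g"
      using m gN Ec by (simp add: Em)
    have u: "E g \<in> Units T" "E g' \<in> Units T" using unit m by auto
    have "E f \<otimes>\<^bsub>T\<^esub> inv\<^bsub>T\<^esub> E g = (E f \<otimes>\<^bsub>T\<^esub> E g') \<otimes>\<^bsub>T\<^esub> (inv\<^bsub>T\<^esub> E g \<otimes>\<^bsub>T\<^esub> inv\<^bsub>T\<^esub> E g')"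
    proof -
      have "(E f \<otimes>\<^bsub>T\<^esub> E g') \<otimes>\<^bsub>T\<^esub> (inv\<^bsub>T\<^esub> E g \<otimes>\<^bsub>T\<^esub> inv\<^bsub>T\<^esub> E g') = E f \<otimes>\<^bsub>T\<^esub> inv\<^bsub>T\<^esub> E g \<otimes>\<^bsub>T\<^esub> (E g' \<otimes>\<^bsub>T\<^esub> inv\<^bsub>T\<^esub> E g')"
        using m gN Ec u by (simp add: T.m_ac del: T.Units_r_inv T.Units_l_inv)
      then show ?thesis using m gN Ec u by simp
    qed
    also have "\<dots> = E f' \<otimes>\<^bsub>T\<^esub> inv\<^bsub>T\<^esub> E g' \<otimes>\<^bsub>T\<^esub> (E g \<otimes>\<^bsub>T\<^esub> inv\<^bsub>T\<^esub> E g)"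
      unfolding x using m gN Ec u by (simp add: T.m_ac del: T.Units_r_inv T.Units_l_inv)
    also have "\<dots> = E f' \<otimes>\<^bsub>T\<^esub> inv\<^bsub>T\<^esub> E g'" using m gN Ec u by simp
    finally show ?thesis .
  qed
  \<comment> \<open>The value is read off some representation as a fraction; by \<open>cross\<close>
    all representations give the same.\<close>
  define \<delta> where "\<delta> x = (SOME t. \<exists>f\<in>mpols N. \<exists>g\<in>M. x = evb f / evb g \<and> t = E f \<otimes>\<^bsub>T\<^esub> inv\<^bsub>T\<^esub> E g)" for x
  have \<delta>: "\<delta> (evb f / evb g) = E f \<otimes>\<^bsub>T\<^esub> inv\<^bsub>T\<^esub> E g" if "f \<in> mpols N" "g \<in> M" for f g
  proof -
    have "\<exists>t. \<exists>f'\<in>mpols N. \<exists>g'\<in>M. evb f / evb g = evb f' / evb g' \<and> t = E f' \<otimes>\<^bsub>T\<^esub> inv\<^bsub>T\<^esub> E g'"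
      using that by blast
    from someI_ex[OF this] obtain f' g' where "f' \<in> mpols N" "g' \<in> M" "evb f / evb g = evb f' / evb g'"
      "\<delta> (evb f / evb g) = E f' \<otimes>\<^bsub>T\<^esub> inv\<^bsub>T\<^esub> E g'" unfolding \<delta>_def by blast
    then show ?thesis using cross[OF that] by metis
  qed
  have \<delta>1: "\<delta> (evb f) = E f" if "f \<in> mpols N" for f
    using \<delta>[OF that M(2)] Ec[OF that] by (simp add: ev E1)
  have "\<delta> \<in> ring_hom Loc T"
  proof (rule ring_hom_memI)
    show "\<delta> \<one>\<^bsub>Loc\<^esub> = \<one>\<^bsub>T\<^esub>" using \<delta>1[of 1] by (simp add: ev E1)
    fix x assume "x \<in> carrier Loc"
    then obtain f g where fg: "x = evb f / evb g" "f \<in> mpols N" "g \<in> M" by auto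
    then have uf: "E g \<in> Units T" "g \<in> mpols N" using unit M by auto
    show "\<delta> x \<in> carrier T" using fg uf Ec \<delta> by auto
    fix y assume "y \<in> carrier Loc"
    then obtain f' g' where fg': "y = evb f' / evb g'" "f' \<in> mpols N" "g' \<in> M" by auto
    then have uf': "E g' \<in> Units T" "g' \<in> mpols N" using unit M by auto
    have gg: "g * g' \<in> M" using fg fg' M by auto
    have inv: "inv\<^bsub>T\<^esub> E (g * g') = inv\<^bsub>T\<^esub> E g \<otimes>\<^bsub>T\<^esub> inv\<^bsub>T\<^esub> E g'"
    proof -
      have c: "E g \<in> carrier T" "E g' \<in> carrier T" "inv\<^bsub>T\<^esub> E g \<in> carrier T" "inv\<^bsub>T\<^esub> E g' \<in> carrier T" using uf uf' by auto
      have "(E g \<otimes>\<^bsub>T\<^esub> E g') \<otimes>\<^bsub>T\<^esub> (inv\<^bsub>T\<^esub> E g \<otimes>\<^bsub>T\<^esub> inv\<^bsub>T\<^esub> E g') =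
          (E g \<otimes>\<^bsub>T\<^esub> inv\<^bsub>T\<^esub> E g) \<otimes>\<^bsub>T\<^esub> (E g' \<otimes>\<^bsub>T\<^esub> inv\<^bsub>T\<^esub> E g')"
        using c by (simp add: T.m_ac)
      then have "(E g \<otimes>\<^bsub>T\<^esub> E g') \<otimes>\<^bsub>T\<^esub> (inv\<^bsub>T\<^esub> E g \<otimes>\<^bsub>T\<^esub> inv\<^bsub>T\<^esub> E g') = \<one>\<^bsub>T\<^esub>"
        using uf uf' by simp
      from T.comm_inv_char[OF _ _ this] show ?thesis using c uf uf' by (simp add: Em)
    qed
    have "x * y = evb (f * f') / evb (g * g')" by (simp add: fg fg' ev)
    then have "\<delta> (x * y) = E (f * f') \<otimes>\<^bsub>T\<^esub> inv\<^bsub>T\<^esub> E (g * g')"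
      using \<delta> gg fg fg' mpols_mult by metis
    also have "\<dots> = \<delta> x \<otimes>\<^bsub>T\<^esub> \<delta> y"
      unfolding inv using fg fg' uf uf' Ec by (simp add: Em \<delta> T.m_ac)
    finally show "\<delta> (x \<otimes>\<^bsub>Loc\<^esub> y) = \<delta> x \<otimes>\<^bsub>T\<^esub> \<delta> y" by simp
    have "x + y = evb (f * g' + f' * g) / evb (g * g')"
      using M_nonzero[OF fg(3)] M_nonzero[OF fg'(3)] by (simp add: fg fg' ev field_simps)
    then have "\<delta> (x + y) = E (f * g' + f' * g) \<otimes>\<^bsub>T\<^esub> inv\<^bsub>T\<^esub> E (g * g')"
      using \<delta>[OF _ gg, of "f * g' + f' * g"] fg fg' uf uf' by (simp add: mpols_add mpols_mult)
    also have "\<dots> = E f \<otimes>\<^bsub>T\<^esub> inv\<^bsub>T\<^esub> E g \<otimes>\<^bsub>T\<^esub> (E g' \<otimes>\<^bsub>T\<^esub> inv\<^bsub>T\<^esub> E g') \<oplus>\<^bsub>T\<^esub> E f' \<otimes>\<^bsub>T\<^esub> inv\<^bsub>T\<^esub> E g' \<otimes>\<^bsub>T\<^esub> (E g \<otimes>\<^bsub>T\<^esub> inv\<^bsub>T\<^esub> E g)"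
      unfolding inv using fg fg' uf uf' Ec T.Units_inv_closed
      by (simp add: Em Ea mpols_mult T.l_distr T.r_distr T.m_ac del: T.Units_r_inv T.Units_l_inv)
    also have "\<dots> = \<delta> x \<oplus>\<^bsub>T\<^esub> \<delta> y"
      using fg fg' uf uf' Ec by (simp add: \<delta>)
    finally show "\<delta> (x \<oplus>\<^bsub>Loc\<^esub> y) = \<delta> x \<oplus>\<^bsub>T\<^esub> \<delta> y" by simp
  qed
  then show ?thesis using that \<delta>1 \<delta> by blast
qed

end

section \<open>From D-varieties to \<open>UC\<^sub>\<D>\<close>\<close>

lemma localisation_powers:
  fixes c :: "'a::field \<Rightarrow> 'f::field"
  assumes c: "type_hom c" and h: "h \<in> mpols N" "mp_eval c b h \<noteq> 0"
  shows "localisation c N b (range ((^) h))"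
proof
  show "1 \<in> range ((^) h)" by (rule range_eqI[of _ _ 0]) simp
  show "g * g' \<in> range ((^) h)" if g: "g \<in> range ((^) h)" "g' \<in> range ((^) h)" for g g'
  proof -
    obtain i j where "g = h ^ i" "g' = h ^ j" using g by auto
    then show ?thesis by (intro range_eqI[of _ _ "i + j"]) (simp add: power_add)
  qed
qed (use c h mpols_power in \<open>auto simp: mp_eval_ring_simps[OF c]\<close>)

context D_base
begin

lemma eval_component_0:
  fixes b :: "'v \<Rightarrow> 'f::field"
  assumes R: "cring R" and c: "c \<in> ring_hom ring_of_type_algebra R" and Y: "Y \<in> N \<rightarrow> carrier (base_change \<D> R (c \<circ> \<iota>))"
    and f: "f \<in> mpols N"
  shows "mp_eval_in (base_change \<D> R (c \<circ> \<iota>)) (kap c) Y f 0 = mp_eval_in R c (\<lambda>v. Y v 0) f"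
proof -
  have "(\<lambda>u. u 0) (mp_eval_in (base_change \<D> R (c \<circ> \<iota>)) (kap c) Y f) =
      mp_eval_in R ((\<lambda>u. u 0) \<circ> kap c) ((\<lambda>u. u 0) \<circ> Y) f"
    by (rule mp_eval_in_compose_hom[OF mp_evaluationI[OF cring_base_change[OF R comp_iota_hom[OF c]] kap_hom[OF R c] Y] R
          bc_0_hom[OF R comp_iota_hom[OF c]] f])
  moreover have "(\<lambda>u. u 0) \<circ> kap c = c" by (simp add: fun_eq_iff kap_0)
  ultimately show ?thesis by (simp add: comp_def)
qed

text \<open>An explicit form of formal smoothness. The coordinates from \<open>n\<close> on are
  lifted one after the other. At an algebraic coordinate the value of \<open>P p\<close> has
  component 0 equal to zero and is nilpotent, and its derivative is a unit because it divides
  \<open>h\<close>, so Hensel's lemma applies; the correction is a multiple of that value and leaves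
  component 0 unchanged. All relations are then respected, since a power of \<open>h\<close> times
  any relation is a combination of the \<open>P v\<close>, and \<open>h\<close> is sent to a
  unit.\<close>

lemma lift_D_structure:
  fixes b :: "nat \<Rightarrow> 'f::field" and c :: "'a \<Rightarrow> 'f"
  assumes c: "type_hom c"
    and t: "tri_pres {..<m} (vanishing_ideal c {..<m} b) ord S P h"
    and Pv: "\<And>v. v \<in> S \<Longrightarrow> P v \<in> mpols {..v}"
    and n: "n \<le> m"
  defines "Lc \<equiv> localisation.Loc c {..<m} b (range ((^) h))"
  defines "LD \<equiv> base_change \<D> Lc (c \<circ> \<iota>)"
  assumes Y0: "\<And>i. i < n \<Longrightarrow> Y0 i \<in> carrier LD" "\<And>i. i < n \<Longrightarrow> Y0 i 0 = b i"
    and kill0: "\<And>f. f \<in> mpols {..<n} \<Longrightarrow> mp_eval c b f = 0 \<Longrightarrow> mp_eval_in LD (kap c) Y0 f = \<zero>\<^bsub>LD\<^esub>"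
  shows "\<exists>\<delta>. \<delta> \<in> ring_hom Lc LD \<and> (\<forall>a. \<delta> (c a) = kap c a) \<and> (\<forall>i<n. \<delta> (b i) = Y0 i) \<and>
      (\<forall>x\<in>carrier Lc. \<delta> x 0 = x)"
proof -
  have S: "S \<subseteq> {..<m}" and h: "h \<in> mpols {..<m}" "mp_eval c b h \<noteq> 0"
    and PJ: "\<And>v. v \<in> S \<Longrightarrow> P v \<in> mpols {..<m} \<and> mp_eval c b (P v) = 0 \<and> mp_deriv v (P v) dvd h"
    and sat: "\<And>f. f \<in> mpols {..<m} \<Longrightarrow> mp_eval c b f = 0 \<Longrightarrow> in_sat h P S f"
    using t by (auto simp: tri_pres_def vanishing_ideal_def)
  have loc: "localisation c {..<m} b (range ((^) h))" by (rule localisation_powers[OF c h])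
  interpret L: localisation c "{..<m}" b "range ((^) h)" by (rule loc)
  have Lc: "Lc = L.Loc" by (simp add: Lc_def)
  have cL: "cring Lc" and chL: "c \<in> ring_hom ring_of_type_algebra Lc"
    unfolding Lc by (rule L.cring_Loc L.c_hom_Loc)+
  have cT: "cring LD" unfolding LD_def by (rule cring_base_change[OF cL comp_iota_hom[OF chL]])
  interpret LD: cring LD by (rule cT)
  have kh: "kap c \<in> ring_hom ring_of_type_algebra LD" unfolding LD_def by (rule kap_hom[OF cL chL])
  have h0: "(\<lambda>u. u 0) \<in> ring_hom LD Lc" unfolding LD_def by (rule bc_0_hom[OF cL comp_iota_hom[OF chL]])
  have bL: "b v \<in> carrier Lc" if "v < m" for v
    unfolding Lc using L.eval_in_Loc[of "mvar v"] that by (simp add: L.ev mpols_var del: L.Loc_sel)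
  have comp0: "mp_eval_in LD (kap c) Y f 0 = mp_eval c b f"
    if Y: "Y \<in> N \<rightarrow> carrier LD" "\<forall>v\<in>N. Y v 0 = b v" and N: "N \<subseteq> {..<m}" and f: "f \<in> mpols N" for Y N f
  proof -
    have "mp_eval_in LD (kap c) Y f 0 = mp_eval_in Lc c (\<lambda>v. Y v 0) f"
      unfolding LD_def by (rule eval_component_0[OF cL chL _ f]) (use Y in \<open>simp add: LD_def\<close>)
    also have "\<dots> = mp_eval c (\<lambda>v. Y v 0) f"
      unfolding Lc by (rule L.eval_in_LocR[OF f]) (use Y N bL in \<open>auto simp: Lc simp del: L.Loc_sel\<close>)
    also have "\<dots> = mp_eval c b f" by (rule mp_eval_cong[OF c f]) (use Y in auto)
    finally show ?thesis .
  qed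
  have unit: "u \<in> Units LD" if "u \<in> carrier LD" "u 0 \<in> Units Lc" for u
    using base_change_unit[OF cL comp_iota_hom[OF chL]] that by (simp add: LD_def)
  have nil: "LD.nilpotent u" if "u \<in> carrier LD" "u 0 = 0" for u
    using base_change_nilpotent[OF cL comp_iota_hom[OF chL], of u] that
    by (simp add: LD_def Lc del: L.Loc_sel(1))
  have build: "\<exists>Y. Y \<in> {..<p} \<rightarrow> carrier LD \<and> (\<forall>v<p. Y v 0 = b v) \<and> (\<forall>i<n. Y i = Y0 i) \<and>
      (\<forall>v\<in>S. v < p \<longrightarrow> mp_eval_in LD (kap c) Y (P v) = \<zero>\<^bsub>LD\<^esub>)" if "n \<le> p" "p \<le> m" for p
    using that
  proof (induction p rule: dec_induct)
    case base
    \<comment> \<open>An equation \<open>P v\<close> with \<open>v < n\<close> involves only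
      coordinates whose lifts are prescribed, so \<open>kill0\<close> covers it.\<close>
    have "mp_eval_in LD (kap c) Y0 (P v) = \<zero>\<^bsub>LD\<^esub>" if "v \<in> S" "v < n" for v
    proof (rule kill0)
      show "P v \<in> mpols {..<n}" by (rule subsetD[OF mpols_mono Pv[OF that(1)]]) (use that(2) in auto)
    qed (use PJ that in auto)
    then show ?case using Y0 by (intro exI[of _ Y0]) auto
  next
    case (step p)
    then obtain Y where Y: "Y \<in> {..<p} \<rightarrow> carrier LD" "\<And>v. v < p \<Longrightarrow> Y v 0 = b v" "\<And>i. i < n \<Longrightarrow> Y i = Y0 i"
      "\<And>v. v \<in> S \<Longrightarrow> v < p \<Longrightarrow> mp_eval_in LD (kap c) Y (P v) = \<zero>\<^bsub>LD\<^esub>" by auto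
    have pm: "p < m" using step by simp
    have keep: "\<exists>Y. Y \<in> {..<Suc p} \<rightarrow> carrier LD \<and> (\<forall>v<Suc p. Y v 0 = b v) \<and> (\<forall>i<n. Y i = Y0 i) \<and>
        (\<forall>v\<in>S. v < Suc p \<longrightarrow> mp_eval_in LD (kap c) Y (P v) = \<zero>\<^bsub>LD\<^esub>)"
      if y: "y \<in> carrier LD" "y 0 = b p" "p \<in> S \<Longrightarrow> mp_eval_in LD (kap c) (Y(p := y)) (P p) = \<zero>\<^bsub>LD\<^esub>" for y
    proof (intro exI[of _ "Y(p := y)"] conjI allI ballI impI)
      show "Y(p := y) \<in> {..<Suc p} \<rightarrow> carrier LD" using Y(1) y(1) by (auto simp: less_Suc_eq Pi_iff)
      show "(Y(p := y)) v 0 = b v" if "v < Suc p" for v using that Y(2) y(2) by (auto simp: less_Suc_eq)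
      show "(Y(p := y)) i = Y0 i" if "i < n" for i using that Y(3) step.hyps by auto
      show "mp_eval_in LD (kap c) (Y(p := y)) (P v) = \<zero>\<^bsub>LD\<^esub>" if v: "v \<in> S" "v < Suc p" for v
      proof (cases "v = p")
        case False
        then have vp: "v < p" using v by simp
        have "mp_eval_in LD (kap c) (Y(p := y)) (P v) = mp_eval_in LD (kap c) Y (P v)"
          by (rule mp_eval_in_cong[OF _ Pv[OF v(1)] cT _ kh]) (use vp Y(1) in \<open>auto simp: Pi_iff\<close>)
        then show ?thesis using Y(4)[OF v(1) vp] by simp
      qed (use y(3) v in simp)
    qed
    \<comment> \<open>Any lift of \<open>b p\<close> serves at a transcendental coordinate; at an
      algebraic one this is the starting value for Newton's method.\<close>
    define y where "y = pure Lc (c \<circ> \<iota>) (b p) 1"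
    have y: "y \<in> carrier LD" "y 0 = b p"
    proof -
      show "y \<in> carrier LD" unfolding y_def LD_def by (rule pure_closed[OF cL comp_iota_hom[OF chL] bL[OF pm]])
      show "y 0 = b p"
        using iota_1[OF cL comp_iota_hom[OF chL]] by (simp add: y_def pure_def coord_one_0 Lc del: L.Loc_sel(1))
    qed
    show ?case
    proof (cases "p \<in> S")
      case False
      then show ?thesis using keep[OF y] by blast
    next
      case True
      define x where "x = Y(p := y)"
      have x: "x \<in> {..p} \<rightarrow> carrier LD" "\<forall>v\<in>{..p}. x v 0 = b v"
        using Y(1,2) y by (auto simp: x_def Pi_iff le_less)
      have Nm: "{..p} \<subseteq> {..<m}" using pm by auto
      have f: "P p \<in> mpols {..p}" "mp_deriv p (P p) \<in> mpols {..p}" using Pv[OF True] mpols_deriv by auto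
      interpret E: mp_evaluation LD "kap c" x "{..p}" by (rule mp_evaluationI[OF cT kh x(1)])
      have "LD.nilpotent (E.ev (P p))"
        by (rule nil) (use E.ev_closed[OF f(1)] comp0[OF x Nm f(1)] PJ[OF True] in auto)
      moreover have "E.ev (mp_deriv p (P p)) \<in> Units LD"
      proof (rule unit)
        have "mp_eval c b (mp_deriv p (P p)) \<in> Units Lc"
          unfolding Lc
        proof (rule L.unit_Loc[of _ h])
          show "mp_deriv p (P p) \<in> mpols {..<m}" using f(2) mpols_mono[OF Nm] by blast
          show "h \<in> range ((^) h)" by (rule range_eqI[of _ _ 1]) simp
        qed (use PJ[OF True] in simp)
        then show "E.ev (mp_deriv p (P p)) 0 \<in> Units Lc" using comp0[OF x Nm f(2)] by simp
      qed (rule E.ev_closed[OF f(2)])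
      ultimately obtain z where z: "z \<in> carrier LD"
        "mp_eval_in LD (kap c) (x(p := x p \<oplus>\<^bsub>LD\<^esub> E.ev (P p) \<otimes>\<^bsub>LD\<^esub> z)) (P p) = \<zero>\<^bsub>LD\<^esub>"
        using LD.hensel[OF kh x(1) _ f(1), of p] by auto
      let ?y = "y \<oplus>\<^bsub>LD\<^esub> E.ev (P p) \<otimes>\<^bsub>LD\<^esub> z"
      have e: "E.ev (P p) \<in> carrier LD" "E.ev (P p) 0 = 0"
        using E.ev_closed[OF f(1)] comp0[OF x Nm f(1)] PJ[OF True] by auto
      have "?y 0 = y 0 \<oplus>\<^bsub>Lc\<^esub> (E.ev (P p) 0 \<otimes>\<^bsub>Lc\<^esub> z 0)"
        using ring_hom_add[OF h0, of y "E.ev (P p) \<otimes>\<^bsub>LD\<^esub> z"] ring_hom_mult[OF h0 e(1) z(1)] y(1) e(1) z(1) by simp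
      then have "?y 0 = b p" using y(2) e(2) by (simp add: Lc del: L.Loc_sel(1))
      moreover have "mp_eval_in LD (kap c) (Y(p := ?y)) (P p) = \<zero>\<^bsub>LD\<^esub>" using z(2) by (simp add: x_def)
      ultimately show ?thesis using keep[of ?y] y(1) e(1) z(1) by simp
    qed
  qed
  from build[OF n order_refl] obtain Y where "Y \<in> {..<m} \<rightarrow> carrier LD \<and> (\<forall>v<m. Y v 0 = b v) \<and> (\<forall>i<n. Y i = Y0 i) \<and>
      (\<forall>v\<in>S. v < m \<longrightarrow> mp_eval_in LD (kap c) Y (P v) = \<zero>\<^bsub>LD\<^esub>)" by (elim exE)
  then have Y: "Y \<in> {..<m} \<rightarrow> carrier LD" "\<And>v. v \<in> {..<m} \<Longrightarrow> Y v 0 = b v"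
    "\<And>i. i < n \<Longrightarrow> Y i = Y0 i" "\<And>v. v \<in> S \<Longrightarrow> mp_eval_in LD (kap c) Y (P v) = \<zero>\<^bsub>LD\<^esub>"
    using S by auto
  interpret E: mp_evaluation LD "kap c" Y "{..<m}" by (rule mp_evaluationI[OF cT kh Y(1)])
  have "\<forall>v\<in>{..<m}. Y v 0 = b v" using Y(2) by blast
  note E0 = comp0[OF Y(1) this order_refl]
  have uM: "E.ev g \<in> Units LD" if g: "g \<in> range ((^) h)" for g
  proof (rule unit)
    have gN: "g \<in> mpols {..<m}" using g h(1) mpols_power by auto
    show "E.ev g \<in> carrier LD" by (rule E.ev_closed[OF gN])
    show "E.ev g 0 \<in> Units Lc" unfolding E0[OF gN] Lc by (rule L.unit_Loc[OF gN g dvd_refl])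
  qed
  have kill: "E.ev f = \<zero>\<^bsub>LD\<^esub>" if f: "f \<in> mpols {..<m}" "mp_eval c b f = 0" for f
  proof -
    have PN: "P v \<in> mpols {..<m}" if "v \<in> S" for v using PJ[OF that] by blast
    obtain k q where q: "\<And>v. q v \<in> mpols {..<m}" "h ^ k * f = (\<Sum>v\<in>S. q v * P v)"
      by (rule in_sat_mpols[OF sat[OF f] h(1) f(1)], erule PN, rule that)
    have "E.ev (\<Sum>v\<in>A. q v * P v) = \<zero>\<^bsub>LD\<^esub>" if "finite A" "A \<subseteq> S" for A
      using that
    proof (induction A rule: finite_induct)
      case (insert v A)
      then have "E.ev (q v * P v) = \<zero>\<^bsub>LD\<^esub>" using q(1) PJ[of v] Y(4)[of v] E.ev_closed[OF q(1)] by (simp add: E.ev_mult)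
      with insert q(1) PJ show ?case
        by (subst sum.insert, simp, simp, subst E.ev_add) (auto intro!: mpols_mult mpols_sum)
    qed simp
    moreover have "finite S" by (rule finite_subset[OF S finite_lessThan])
    ultimately have "E.ev (h ^ k * f) = \<zero>\<^bsub>LD\<^esub>" unfolding q(2) by simp
    moreover have hk: "h ^ k \<in> mpols {..<m}" "E.ev (h ^ k) \<in> Units LD" using h(1) mpols_power uM by auto
    ultimately have "E.ev (h ^ k) \<otimes>\<^bsub>LD\<^esub> E.ev f = E.ev (h ^ k) \<otimes>\<^bsub>LD\<^esub> \<zero>\<^bsub>LD\<^esub>"
      using f(1) by (simp add: E.ev_mult LD.Units_closed)
    then show ?thesis using LD.Units_l_cancel[OF hk(2) E.ev_closed[OF f(1)] LD.zero_closed] by simp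
  qed
  obtain \<delta> where \<delta>: "\<delta> \<in> ring_hom L.Loc LD" "\<And>f. f \<in> mpols {..<m} \<Longrightarrow> \<delta> (L.evb f) = E.ev f"
    "\<And>f g. f \<in> mpols {..<m} \<Longrightarrow> g \<in> range ((^) h) \<Longrightarrow> \<delta> (L.evb f / L.evb g) = E.ev f \<otimes>\<^bsub>LD\<^esub> inv\<^bsub>LD\<^esub> E.ev g"
  proof (rule L.extend_hom[OF cT E.ev_hom])
    show "E.ev f = \<zero>\<^bsub>LD\<^esub>" if "f \<in> mpols {..<m}" "L.evb f = 0" for f by (rule kill[OF that])
    show "E.ev g \<in> Units LD" if "g \<in> range ((^) h)" for g by (rule uM[OF that])
  qed (rule that)
  show "\<exists>\<delta>. \<delta> \<in> ring_hom Lc LD \<and> (\<forall>a. \<delta> (c a) = kap c a) \<and> (\<forall>i<n. \<delta> (b i) = Y0 i) \<and>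
      (\<forall>x\<in>carrier Lc. \<delta> x 0 = x)"
  proof (intro exI[of _ \<delta>] conjI allI impI ballI)
    show "\<delta> \<in> ring_hom Lc LD" using \<delta>(1) by (simp add: Lc)
    show "\<delta> (c a) = kap c a" for a using \<delta>(2)[of "mconst a"] by (simp add: L.ev)
    show "\<delta> (b i) = Y0 i" if "i < n" for i
      using \<delta>(2)[of "mvar i"] that n Y(3)[OF that] by (simp add: L.ev mpols_var)
    fix x assume "x \<in> carrier Lc"
    then obtain f g where fg: "f \<in> mpols {..<m}" "g \<in> range ((^) h)" "x = L.evb f / L.evb g"
      by (auto simp: Lc)
    have gN: "g \<in> mpols {..<m}" using fg(2) h(1) mpols_power by auto
    have u: "E.ev g \<in> Units LD" by (rule uM[OF fg(2)])
    have "(inv\<^bsub>LD\<^esub> E.ev g \<otimes>\<^bsub>LD\<^esub> E.ev g) 0 = (inv\<^bsub>LD\<^esub> E.ev g) 0 * L.evb g"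
      using ring_hom_mult[OF h0, of "inv\<^bsub>LD\<^esub> E.ev g" "E.ev g"] u E0[OF gN] by (simp add: Lc LD.Units_closed del: L.Loc_sel(1))
    moreover have "\<one>\<^bsub>LD\<^esub> 0 = 1" using ring_hom_one[OF h0] by (simp add: Lc del: L.Loc_sel(1))
    ultimately have "(inv\<^bsub>LD\<^esub> E.ev g) 0 * L.evb g = 1" using u by simp
    then have "(inv\<^bsub>LD\<^esub> E.ev g) 0 = inverse (L.evb g)"
      using L.M_nonzero[OF fg(2)] by (simp add: field_simps)
    moreover have "\<delta> x 0 = L.evb f * (inv\<^bsub>LD\<^esub> E.ev g) 0"
      unfolding fg(3) \<delta>(3)[OF fg(1,2)]
      using ring_hom_mult[OF h0, of "E.ev f" "inv\<^bsub>LD\<^esub> E.ev g"] u E0[OF fg(1)] E.ev_closed[OF fg(1)]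
      by (simp add: Lc del: L.Loc_sel(1))
    ultimately show "\<delta> x 0 = x" by (simp add: fg(3) divide_inverse)
  qed
qed

section \<open>Numbering the coordinates of the prolongation\<close>

lemma prevs_upt: "v < m \<Longrightarrow> insert v (prevs [0..<m] v) = {..v}"
proof -
  assume v: "v < m"
  have "[0..<m] = [0..<v] @ v # [Suc v..<m]" using v upt_add_eq_append[of 0 v "m - v"] upt_conv_Cons[of v m] by simp
  then have "prevs [0..<m] v = set [0..<v]"
    unfolding prevs_def by (simp add: takeWhile_append)
  then show ?thesis by auto
qed

text \<open>The variable \<open>x\<^sup>j\<^sub>i\<close> gets number \<open>j n + i\<close>, so that the variables \<open>x\<^sup>0\<^sub>i\<close> come first.\<close>

definition prol_code :: "nat \<Rightarrow> nat \<times> nat \<Rightarrow> nat" where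
  "prol_code n = (\<lambda>(j, i). j * n + i)"

definition prol_decode :: "nat \<Rightarrow> nat \<Rightarrow> nat \<times> nat" where
  "prol_decode n q = (q div n, q mod n)"

lemma prol_code:
  assumes "v \<in> prol_vars \<D> n"
  shows "prol_code n v < Suc (len \<D>) * n" "prol_decode n (prol_code n v) = v"
proof -
  obtain j i where v: "v = (j, i)" "j \<le> len \<D>" "i < n" using assms by (auto simp: prol_vars_def)
  have "j * n + i < j * n + n" using v by simp
  also have "\<dots> \<le> Suc (len \<D>) * n" using v by (metis Suc_le_mono mult_Suc add.commute mult_le_mono1)
  finally show "prol_code n v < Suc (len \<D>) * n" by (simp add: prol_code_def v)
  show "prol_decode n (prol_code n v) = v" using v by (simp add: prol_code_def prol_decode_def)
qed

lemma prol_decode: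
  assumes "q < Suc (len \<D>) * n"
  shows "prol_decode n q \<in> prol_vars \<D> n" "prol_code n (prol_decode n q) = q"
proof -
  have "n > 0" using assms by (cases n) auto
  then have "q div n \<le> len \<D>" using assms by (metis less_mult_imp_div_less less_Suc_eq_le)
  then show "prol_decode n q \<in> prol_vars \<D> n" using \<open>n > 0\<close> by (simp add: prol_decode_def prol_vars_def)
  show "prol_code n (prol_decode n q) = q" by (simp add: prol_code_def prol_decode_def)
qed

lemma finite_prol_vars: "finite (prol_vars \<D> n)"
  by (simp add: prol_vars_def)

end

lemma irreducible_varietyD:
  assumes "irreducible_variety N (I :: ('v, 'a::field) mpol set)"
  shows "finite N" "primeideal I (mpol_ring N)" "affine_variety N I" "I \<subseteq> mpols N"
  using assms irreducible_variety_iff_prime[of N I] ideal_mpolD(1)[OF primeideal_mpolD(1), of I N]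
  by (auto simp: irreducible_variety_def)

lemma irreducible_vanishing_ideal:
  "finite N \<Longrightarrow> type_hom c \<Longrightarrow> irreducible_variety N (vanishing_ideal c N b)"
  by (simp add: irreducible_variety_iff_prime primeideal_vanishing_ideal)

lemma large_fieldD:
  assumes "large_field TYPE('a::field)" "irreducible_variety {..<n} (I :: (nat, 'a) mpol set)"
    "has_smooth_rational_point {..<n} I" "f \<in> mpols {..<n}" "f \<notin> I"
  obtains x where "x \<in> rational_points {..<n} I" "mp_eval id x f \<noteq> 0"
proof -
  have "zariski_dense_in {..<n} I (point_ideal {..<n} ` rational_points {..<n} I)"
    using assms(1-3) by (auto simp: large_field_def)
  then show ?thesis
    using rational_points_dense_iff[OF irreducible_varietyD(2)[OF assms(2)] order_refl] assms(4,5) that by blast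
qed

context D_base
begin

text \<open>A dense image means that the map from \<open>K[X]\<close> to \<open>K[Y]\<close> is
  injective. The other direction is the component 0 of the equations of the prolongation.\<close>

lemma dominant_prolongation:
  assumes I: "irreducible_variety {..<n} I" and J: "irreducible_variety (prol_vars \<D> n) J"
    and sub: "prol_ideal \<D> \<iota> \<Delta> n I \<subseteq> J"
    and dom: "zariski_dense_in {..<n} I (prol_proj n ` topspace (zariski (prol_vars \<D> n) J))"
    and f: "f \<in> mpols {..<n}"
  shows "f \<in> I \<longleftrightarrow> mp_eval mconst (\<lambda>i. mvar (0, i)) f \<in> J"
proof
  assume fI: "f \<in> I"
  have "prol_poly \<D> \<iota> \<Delta> n f 0 \<in> J"
    using sub prol_ideal_subset_iff[OF primeideal_mpolD(1)[OF irreducible_varietyD(2)[OF J]] irreducible_varietyD(4)[OF I]] fI by auto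
  then show "mp_eval mconst (\<lambda>i. mvar (0, i)) f \<in> J" using prol_poly_0[OF f] by simp
next
  assume fJ: "mp_eval mconst (\<lambda>i. mvar (0, i)) f \<in> J"
  show "f \<in> I"
  proof (rule ccontr)
    assume "f \<notin> I"
    with dom f obtain p where p: "p \<in> topspace (zariski (prol_vars \<D> n) J)" "f \<notin> prol_proj n p"
      unfolding zariski_dense_in_iff[OF irreducible_varietyD(2)[OF I]] by blast
    then have "mp_eval mconst (\<lambda>i. mvar (0, i)) f \<notin> p" "J \<subseteq> p"
      using f by (auto simp: prol_proj_def topspace_zariski)
    with fJ show False by blast
  qed
qed

lemma zero_base_changeI:
  "u \<in> carrier (base_change \<D> R \<kappa>) \<Longrightarrow> (\<And>j. j \<in> I\<^sub>\<D> \<Longrightarrow> u j = \<zero>\<^bsub>R\<^esub>) \<Longrightarrow> u = \<zero>\<^bsub>base_change \<D> R \<kappa>\<^esub>"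
  by (auto simp: base_change_sel PiE_iff extensional_def restrict_def fun_eq_iff)

text \<open>A \<open>\<D>\<close>-structure on the ring generated by \<open>b\<close> is the same as a section of the prolongation
  of the locus of \<open>b\<close>.\<close>

lemma D_variety_of_hom:
  fixes c :: "'a \<Rightarrow> 'f::field" and b :: "nat \<Rightarrow> 'f" and R :: "'f ring"
  assumes c: "type_hom c" and R: "cring R" and cR: "c \<in> ring_hom ring_of_type_algebra R"
    and bR: "\<And>i. i < m \<Longrightarrow> b i \<in> carrier R"
    and evR: "\<And>N x f. f \<in> mpols N \<Longrightarrow> x \<in> N \<rightarrow> carrier R \<Longrightarrow> mp_eval_in R c x f = mp_eval c x (f :: (nat, 'a) mpol)"
    and evR': "\<And>N x f. f \<in> mpols N \<Longrightarrow> x \<in> N \<rightarrow> carrier R \<Longrightarrow> mp_eval_in R c x f = mp_eval c x (f :: (nat \<times> nat, 'a) mpol)"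
    and zR: "\<zero>\<^bsub>R\<^esub> = 0"
    and \<delta>: "\<delta> \<in> ring_hom R (base_change \<D> R (c \<circ> \<iota>))" "\<And>a. \<delta> (c a) = kap c a"
    and s: "\<And>j i. (j, i) \<in> prol_vars \<D> m \<Longrightarrow> s (j, i) \<in> mpols {..<m} \<and> mp_eval c b (s (j, i)) = \<delta> (b i) j"
    and s0: "\<And>i. i < m \<Longrightarrow> s (0, i) = mvar i"
  shows "irreducible_D_variety \<D> \<iota> \<Delta> m (vanishing_ideal c {..<m} b) s"
proof -
  let ?I = "vanishing_ideal c {..<m} b" and ?T = "base_change \<D> R (c \<circ> \<iota>)"
  have irr: "irreducible_variety {..<m} ?I" by (rule irreducible_vanishing_ideal[OF finite_lessThan c])
  note id = primeideal_mpolD(1)[OF irreducible_varietyD(2)[OF irr]]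
  have T: "cring ?T" by (rule cring_base_change[OF R comp_iota_hom[OF cR]])
  have \<delta>c: "\<delta> x j \<in> carrier R" if "x \<in> carrier R" "j \<in> I\<^sub>\<D>" for x j
    using \<delta>(1) that by (auto simp: ring_hom_def base_change_sel PiE_iff Pi_iff)
  have s_img: "s ` prol_vars \<D> m \<subseteq> mpols {..<m}" using s by auto
  have "mp_eval mconst s (prol_poly \<D> \<iota> \<Delta> m f j) \<in> ?I" if f: "f \<in> ?I" and j: "j \<in> I\<^sub>\<D>" for f j
  proof -
    have fN: "f \<in> mpols {..<m}" and f0: "mp_eval c b f = 0" using f by (auto simp: vanishing_ideal_def)
    let ?y = "\<lambda>(j, i). \<delta> (b i) j"
    have yR: "?y \<in> prol_vars \<D> m \<rightarrow> carrier R" using \<delta>c bR by (auto simp: prol_vars_def)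
    note cl = prol_poly_closed[OF fN j]
    have "mp_eval c b (mp_eval mconst s (prol_poly \<D> \<iota> \<Delta> m f j)) = mp_eval c ?y (prol_poly \<D> \<iota> \<Delta> m f j)"
      unfolding mp_eval_subst[OF c] by (rule mp_eval_cong[OF c cl]) (use s in auto)
    also have "\<dots> = mp_eval_in R c ?y (prol_poly \<D> \<iota> \<Delta> m f j)" by (rule evR'[OF cl yR, symmetric])
    also have "\<dots> = mp_eval_in ?T (kap c) (\<lambda>i. \<lambda>j\<in>I\<^sub>\<D>. ?y (j, i)) f j"
      by (rule prol_poly_eval[OF R cR yR fN j])
    also have "mp_eval_in ?T (kap c) (\<lambda>i. \<lambda>j\<in>I\<^sub>\<D>. ?y (j, i)) f = mp_eval_in ?T (\<delta> \<circ> c) (\<delta> \<circ> b) f"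
    proof -
      have "\<delta> \<circ> c = kap c" using \<delta>(2) by (simp add: fun_eq_iff)
      moreover have "mp_eval_in ?T (kap c) (\<lambda>i. \<lambda>j\<in>I\<^sub>\<D>. ?y (j, i)) f = mp_eval_in ?T (kap c) (\<delta> \<circ> b) f"
      proof (rule mp_eval_in_cong[OF _ fN T _ kap_hom[OF R cR]])
        fix i assume "i \<in> {..<m}"
        then have "\<delta> (b i) \<in> carrier ?T" using \<delta>(1) bR by (auto simp: ring_hom_def)
        then show "(\<lambda>j\<in>I\<^sub>\<D>. ?y (j, i)) = (\<delta> \<circ> b) i"
          by (auto simp: base_change_sel PiE_iff restrict_def fun_eq_iff extensional_def)
      next
        show "(\<lambda>i. \<lambda>j\<in>I\<^sub>\<D>. ?y (j, i)) \<in> {..<m} \<rightarrow> carrier ?T"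
          using \<delta>c bR by (auto simp: base_change_sel)
      qed
      ultimately show ?thesis by simp
    qed
    also have "\<dots> = \<delta> (mp_eval_in R c b f)"
      by (rule mp_eval_in_compose_hom[OF mp_evaluationI[OF R cR] T \<delta>(1) fN, symmetric]) (use bR in auto)
    also have "mp_eval_in R c b f = \<zero>\<^bsub>R\<^esub>" using evR[OF fN, of b] bR f0 zR by auto
    also have "\<delta> \<zero>\<^bsub>R\<^esub> = \<zero>\<^bsub>?T\<^esub>"
      by (rule Ring.ring_hom_zero[OF \<delta>(1) cring.axioms(1)[OF R] cring.axioms(1)[OF T]])
    also have "\<zero>\<^bsub>?T\<^esub> j = 0" using j zR by (simp add: base_change_sel)
    finally show ?thesis
      using mpols_subst[OF cl, of s "{..<m}"] s_img by (auto simp: vanishing_ideal_def)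
  qed
  then have "\<forall>g\<in>prol_ideal \<D> \<iota> \<Delta> m ?I. mp_eval mconst s g \<in> ?I"
    using prol_ideal_subst_iff[OF id s_img] by blast
  moreover have "\<forall>i<m. s (0, i) - mvar i \<in> ?I" using s0 ideal_mpolD(2)[OF id] by simp
  ultimately show ?thesis
    using irr s_img irreducible_varietyD(3)[OF irr] by (simp add: irreducible_D_variety_def affine_D_variety_def)
qed

theorem UC_of_smooth_D_varieties:
  assumes large: "large_field TYPE('a)"
    and sharp: "\<And>n I s. irreducible_D_variety \<D> \<iota> \<Delta> n I s \<Longrightarrow> smooth_variety {..<n} I \<Longrightarrow>
      rational_points {..<n} I \<noteq> {} \<Longrightarrow> sharp_points \<D> \<Delta> n I s \<noteq> {}"
  shows "UC \<D> \<iota> \<Delta>"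
  unfolding UC_def
proof (intro conjI allI impI D_field)
  fix n I J U
  assume "irreducible_variety {..<n} I \<and> irreducible_variety (prol_vars \<D> n) J \<and>
    prol_ideal \<D> \<iota> \<Delta> n I \<subseteq> J \<and>
    zariski_dense_in {..<n} I (prol_proj n ` topspace (zariski (prol_vars \<D> n) J)) \<and>
    has_smooth_rational_point (prol_vars \<D> n) J"
  then have I: "irreducible_variety {..<n} I" and J: "irreducible_variety (prol_vars \<D> n) J"
    and sub: "prol_ideal \<D> \<iota> \<Delta> n I \<subseteq> J"
    and dom: "zariski_dense_in {..<n} I (prol_proj n ` topspace (zariski (prol_vars \<D> n) J))"
    and smooth: "has_smooth_rational_point (prol_vars \<D> n) J" by auto
  assume U: "openin (zariski (prol_vars \<D> n) J) U \<and> U \<noteq> {}"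
  let ?V = "prol_vars \<D> n" and ?c = "to_univ :: 'a \<Rightarrow> 'a univ_dom"
  note c = type_hom_to_univ[where 'a = 'a]
  from U obtain Q where Q: "Q \<subseteq> mpols ?V" "U = {p. primeideal p (mpol_ring ?V) \<and> J \<subseteq> p \<and> \<not> Q \<subseteq> p}"
    unfolding openin_zariski by (elim conjE exE)
  \<comment> \<open>It suffices to find \<open>\<nabla>(a)\<close> in the basic open set where
    \<open>t\<close> does not vanish.\<close>
  with U obtain t where t: "t \<in> Q" "t \<notin> J" by blast
  then have tV: "t \<in> mpols ?V" using Q by blast
  obtain b :: "nat \<times> nat \<Rightarrow> 'a univ_dom" where b: "J = vanishing_ideal ?c ?V b"
    using generic_point[OF irreducible_varietyD(2,1)[OF J]] .
  \<comment> \<open>The number of coordinates of the prolongation. They are renumbered by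
    \<open>prol_code\<close> because largeness and D-varieties refer to variables that form an
    initial segment of the naturals.\<close>
  define m where "m = Suc (len \<D>) * n"
  have nm: "n \<le> m" by (simp add: m_def)
  define b0 where "b0 = (\<lambda>q. b (prol_decode n q))"
  have b0_code: "b0 (prol_code n v) = b v" if "v \<in> ?V" for v
    using prol_code(2)[OF that] by (simp add: b0_def)
  have code_0: "prol_code n (0, i) = i" for i by (simp add: prol_code_def)
  interpret ren: interdefinable ?c ?V "{..<m}" b b0 "\<lambda>q. mvar (prol_decode n q)" "\<lambda>v. mvar (prol_code n v)"
  proof
    show "finite ?V" by (rule finite_prol_vars)
    show "mvar (prol_decode n q) \<in> mpols ?V" if "q \<in> {..<m}" for q
      using prol_decode(1) that by (intro mpols_var) (simp add: m_def)
    show "mvar (prol_code n v) \<in> mpols {..<m}" if "v \<in> ?V" for v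
      using prol_code(1)[OF that] by (intro mpols_var) (simp add: m_def)
  qed (use b0_code in \<open>simp_all add: mp_eval_var b0_def\<close>)
  define J0 where "J0 = vanishing_ideal ?c {..<m} b0"
  have J0: "irreducible_variety {..<m} J0" unfolding J0_def by (rule irreducible_vanishing_ideal) simp_all
  have smooth0: "has_smooth_rational_point {..<m} J0"
    unfolding J0_def by (rule ren.has_smooth_rational_point_image) (use smooth in \<open>simp add: b\<close>)
  define S where "S = algebraic_vars J0 [0..<m]"
  have set_m: "set [0..<m] = {..<m}" by auto
  obtain P h0 where tri0: "tri_pres {..<m} J0 (list_ord [0..<m]) S P h0"
    and Pv0: "\<And>v. v \<in> S \<Longrightarrow> P v \<in> mpols (insert v (prevs [0..<m] v))"
    using tri_pres_list[of J0 "[0..<m]"] irreducible_varietyD(2)[OF J0] unfolding S_def set_m by auto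
  have Pv: "P v \<in> mpols {..v}" if "v \<in> S" for v
    using Pv0[OF that] prevs_upt[of v m] that by (auto simp: S_def algebraic_vars_def)
  define t0 where "t0 = mp_eval mconst (\<lambda>v. mvar (prol_code n v)) t"
  interpret ren': interdefinable ?c "{..<m}" ?V b0 b "\<lambda>v. mvar (prol_code n v)" "\<lambda>q. mvar (prol_decode n q)"
    by (rule ren.swap)
  have t0: "t0 \<in> mpols {..<m}" "t0 \<notin> J0"
  proof -
    show "t0 \<in> mpols {..<m}" unfolding t0_def by (rule mpols_subst[OF tV]) (rule ren.\<psi>)
    have "mp_eval ?c b0 t0 = mp_eval ?c b t" unfolding t0_def by (rule ren'.eval_\<phi>[OF tV])
    then show "t0 \<notin> J0" using t tV by (simp add: b J0_def vanishing_ideal_def)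
  qed
  \<comment> \<open>With \<open>t0\<close> inverted as well, every point of the variety built below
    lies over the given open set.\<close>
  define h where "h = h0 * t0"
  have h0: "h0 \<in> mpols {..<m}" "h0 \<notin> J0" using tri0 by (auto simp: tri_pres_def)
  have h: "h \<in> mpols {..<m}" "h \<notin> J0"
    unfolding h_def using h0 t0 primeideal_mpolD(3)[OF irreducible_varietyD(2)[OF J0]] by (auto intro: mpols_mult)
  have tri: "tri_pres {..<m} (vanishing_ideal ?c {..<m} b0) (list_ord [0..<m]) S P h"
    using tri_pres_multiple[OF tri0 _ h] by (simp add: h_def J0_def)
  have loc: "localisation ?c {..<m} b0 (range ((^) h))"
    by (rule localisation_powers[OF c h(1)]) (use h in \<open>simp add: J0_def vanishing_ideal_def\<close>)
  interpret L: localisation ?c "{..<m}" b0 "range ((^) h)" by (rule loc)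
  let ?LD = "base_change \<D> L.Loc (?c \<circ> \<iota>)"
  have b0L: "b0 q \<in> carrier L.Loc" if "q < m" for q
    using L.eval_in_Loc[of "mvar q"] that by (simp add: L.ev mpols_var del: L.Loc_sel)
  have codeL: "b0 (prol_code n (j, i)) \<in> carrier L.Loc" if "j \<in> I\<^sub>\<D>" "i < n" for j i
    by (rule b0L) (use prol_code(1)[of "(j, i)" n] that in \<open>simp add: m_def prol_vars_def\<close>)
  \<comment> \<open>The generic point of Y read as a lift: component \<open>j\<close> of
    \<open>\<delta> (x\<^sub>i)\<close> is to be the coordinate \<open>x\<^sup>j\<^sub>i\<close> of
    this point.\<close>
  define Y0 where "Y0 i = (\<lambda>j\<in>I\<^sub>\<D>. b0 (prol_code n (j, i)))" for i
  have Y0: "Y0 i \<in> carrier ?LD" "Y0 i 0 = b0 i" if "i < n" for i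
    using codeL that by (auto simp: Y0_def base_change_sel code_0 simp del: L.Loc_sel)
  have eval_low: "mp_eval ?c b (mp_eval mconst (\<lambda>i. mvar (0, i)) f) = mp_eval ?c b0 f" if "f \<in> mpols {..<n}" for f
    unfolding mp_eval_subst[OF c] mp_eval_var[OF c]
    by (rule mp_eval_cong[OF c that]) (use b0_code[of "(0, _)"] in \<open>auto simp: prol_vars_def code_0\<close>)
  have I_iff: "f \<in> I \<longleftrightarrow> mp_eval ?c b0 f = 0" if f: "f \<in> mpols {..<n}" for f
  proof -
    have "mp_eval mconst (\<lambda>i. mvar (0, i)) f \<in> mpols ?V"
      by (rule mpols_subst[OF f]) (auto simp: prol_vars_def intro!: mpols_var)
    then show ?thesis
      using dominant_prolongation[OF I J sub dom f] eval_low[OF f] by (simp add: b vanishing_ideal_def)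
  qed
  \<comment> \<open>The components of \<open>f\<close> at \<open>Y0\<close> are the values of its
    prolongation polynomials at the generic point of Y, and those polynomials are in
    \<open>J\<close> because Y lies in the prolongation of X.\<close>
  have kill0: "mp_eval_in ?LD (kap ?c) Y0 f = \<zero>\<^bsub>?LD\<^esub>" if f: "f \<in> mpols {..<n}" "mp_eval ?c b0 f = 0" for f
  proof (rule zero_base_changeI)
    have LDc: "cring ?LD" by (rule cring_base_change[OF L.cring_Loc comp_iota_hom[OF L.c_hom_Loc]])
    have kh: "kap ?c \<in> ring_hom ring_of_type_algebra ?LD" by (rule kap_hom[OF L.cring_Loc L.c_hom_Loc])
    have Y0c: "Y0 \<in> {..<n} \<rightarrow> carrier ?LD" using Y0 by auto
    interpret E: mp_evaluation ?LD "kap ?c" Y0 "{..<n}" by (rule mp_evaluationI[OF LDc kh Y0c])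
    show "E.ev f \<in> carrier ?LD" by (rule E.ev_closed[OF f(1)])
    fix j assume j: "j \<in> I\<^sub>\<D>"
    have fI: "f \<in> I" using I_iff f by simp
    have pJ: "prol_poly \<D> \<iota> \<Delta> n f j \<in> J"
      using sub prol_ideal_subset_iff[OF primeideal_mpolD(1)[OF irreducible_varietyD(2)[OF J]] irreducible_varietyD(4)[OF I]] fI j by auto
    have bV: "b \<in> ?V \<rightarrow> carrier L.Loc"
      using codeL b0_code by (auto simp: prol_vars_def simp del: L.Loc_sel)
    have "E.ev f = mp_eval_in ?LD (kap ?c) (\<lambda>i. \<lambda>j\<in>I\<^sub>\<D>. b (j, i)) f"
      by (rule mp_eval_in_cong[OF _ f(1) LDc Y0c kh])
        (use b0_code in \<open>auto simp: Y0_def restrict_def fun_eq_iff prol_vars_def\<close>)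
    then have "E.ev f j = mp_eval_in L.Loc ?c b (prol_poly \<D> \<iota> \<Delta> n f j)"
      using prol_poly_eval[OF L.cring_Loc L.c_hom_Loc bV f(1) j] by simp
    also have "\<dots> = mp_eval ?c b (prol_poly \<D> \<iota> \<Delta> n f j)" by (rule L.eval_in_LocR[OF prol_poly_closed[OF f(1) j] bV])
    also have "\<dots> = 0" using pJ by (simp add: b vanishing_ideal_def)
    finally show "E.ev f j = \<zero>\<^bsub>L.Loc\<^esub>" by simp
  qed
  obtain \<delta> where \<delta>: "\<delta> \<in> ring_hom L.Loc ?LD" "\<And>a. \<delta> (?c a) = kap ?c a" "\<And>i. i < n \<Longrightarrow> \<delta> (b0 i) = Y0 i"
    "\<And>x. x \<in> carrier L.Loc \<Longrightarrow> \<delta> x 0 = x"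
    using lift_D_structure[OF c tri Pv nm Y0 kill0] by blast
  \<comment> \<open>The additional coordinate \<open>m\<close> has the value 1/h, which makes the
    localisation the coordinate ring of an affine variety.\<close>
  define b' where "b' = b0(m := inverse (mp_eval ?c b0 h))"
  define I' where "I' = vanishing_ideal ?c {..<Suc m} b'"
  have b'_low: "mp_eval ?c b' f = mp_eval ?c b0 f" if "f \<in> mpols {..<m}" for f
    by (rule mp_eval_cong[OF c that]) (simp add: b'_def)
  have J0': "vanishing_ideal ?c {..<m} b' = vanishing_ideal ?c {..<m} b0"
    by (rule vanishing_ideal_cong[OF c]) (simp add: b'_def)
  have hb: "mp_eval ?c b0 h \<noteq> 0" using h by (simp add: J0_def vanishing_ideal_def)
  obtain ord' where tri': "tri_pres {..<Suc m} I' ord' (insert m S) (P(m := h * mvar m - 1)) h"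
    using tri_pres_localise[OF c, of "{..<m}" m b' "list_ord [0..<m]" S P h] tri J0' b'_low[OF h(1)]
    by (auto simp: I'_def lessThan_Suc b'_def)
  have irr': "irreducible_variety {..<Suc m} I'" unfolding I'_def by (rule irreducible_vanishing_ideal) simp_all
  have mono: "mpols {..<m} \<subseteq> mpols {..<Suc m}" by (rule mpols_mono) auto
  have Pm: "h * mvar m - 1 \<in> I'"
    using tri' by (auto simp: tri_pres_def)
  have hx: "mp_eval d x h * x m = 1" if "type_hom d" "\<And>f. f \<in> I' \<Longrightarrow> mp_eval d x f = 0" for d :: "'a \<Rightarrow> 'e::field" and x
    using that(2)[OF Pm] by (simp add: mp_eval_ring_simps[OF that(1)])
  have "smooth_variety {..<Suc m} I'"
    unfolding smooth_variety_def
  proof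
    fix x assume x: "x \<in> points to_ac {..<Suc m} I'"
    then have x0: "\<And>f. f \<in> I' \<Longrightarrow> mp_eval to_ac x f = 0" by (auto simp: points_def)
    show "smooth_at to_ac {..<Suc m} I' x"
      by (rule tri_pres_smooth_at[OF tri' irreducible_varietyD(2)[OF irr'] _ _ x0])
        (use hx[OF type_hom_to_ac x0] in auto)
  qed
  \<comment> \<open>Largeness turns the smooth rational point of Y into a rational point with
    \<open>h\<close> nonzero, at which the coordinate \<open>m\<close> can be filled in.\<close>
  moreover have "rational_points {..<Suc m} I' \<noteq> {}"
  proof -
    obtain x where x: "x \<in> rational_points {..<m} J0" "mp_eval id x h \<noteq> 0"
      using large_fieldD[OF large J0 smooth0 h] .
    define x' where "x' = (\<lambda>q\<in>{..<Suc m}. if q < m then x q else inverse (mp_eval id x h))"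
    have low: "mp_eval id x' f = mp_eval id x f" if "f \<in> mpols {..<m}" for f
      by (rule mp_eval_cong[OF type_hom_id(1) that]) (simp add: x'_def)
    have "mp_eval id x' f = 0" if "f \<in> I'" for f
    proof (rule tri_pres_zero[OF tri' _ _ _ that])
      show "mp_eval id x' h \<noteq> 0" using x(2) low[OF h(1)] by simp
      fix v assume "v \<in> insert m S"
      then consider "v = m" | "v \<in> S" "v \<noteq> m" by blast
      then show "mp_eval id x' ((P(m := h * mvar m - 1)) v) = 0"
      proof cases
        case 1
        then show ?thesis using low[OF h(1)] x(2) by (simp add: mp_eval_ring_simps x'_def)
      next
        case 2
        then have "P v \<in> J0" using tri0 by (auto simp: tri_pres_def)
        then show ?thesis
          using 2 x(1) low[of "P v"] irreducible_varietyD(4)[OF J0] by (auto simp: rational_points_def points_def)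
      qed
    qed simp
    then have "x' \<in> rational_points {..<Suc m} I'" by (auto simp: rational_points_def points_def x'_def)
    then show ?thesis by blast
  qed
  moreover
  have gen: "\<exists>f\<in>mpols {..<Suc m}. mp_eval ?c b' f = r" if r: "r \<in> carrier L.Loc" for r
  proof -
    obtain f k where f: "f \<in> mpols {..<m}" "r = mp_eval ?c b0 f / mp_eval ?c b0 (h ^ k)" using r by auto
    have "mp_eval ?c b' (f * mvar m ^ k) = r"
      using b'_low[OF f(1)] by (simp add: mp_eval_ring_simps f(2) b'_def power_inverse divide_inverse)
    moreover have "f * mvar m ^ k \<in> mpols {..<Suc m}"
      using f(1) mono by (intro mpols_mult mpols_power mpols_var) auto
    ultimately show ?thesis by blast
  qed
  have b'L: "b' i \<in> carrier L.Loc" if "i < Suc m" for i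
  proof (cases "i = m")
    case True
    have "h \<in> range ((^) h)" by (rule range_eqI[of _ _ 1]) simp
    then show ?thesis using L.inverse_in_Loc[of h] True by (simp add: b'_def del: L.Loc_sel)
  next
    case False
    then show ?thesis using b0L[of i] that by (simp add: b'_def del: L.Loc_sel)
  qed
  have \<delta>L: "\<delta> r j \<in> carrier L.Loc" if "r \<in> carrier L.Loc" "j \<in> I\<^sub>\<D>" for r j
    using \<delta>(1) that unfolding ring_hom_def base_change_sel(1) by (auto simp: PiE_iff Pi_iff simp del: L.Loc_sel)
  \<comment> \<open>Each component of \<open>\<delta>\<close> is represented by a polynomial in the
    coordinates. At \<open>j = 0\<close> the variable itself is taken, so that the section property
    holds on the nose.\<close>
  have "\<exists>f\<in>mpols {..<Suc m}. mp_eval ?c b' f = \<delta> (b' i) j \<and> (j = 0 \<longrightarrow> f = mvar i)"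
    if "j \<in> I\<^sub>\<D>" "i < Suc m" for j i
  proof (cases "j = 0")
    case True
    then show ?thesis using \<delta>(4)[OF b'L[OF that(2)]] that
      by (intro bexI[of _ "mvar i"]) (auto simp: mp_eval_var intro: mpols_var)
  next
    case False
    then show ?thesis using gen[OF \<delta>L[OF b'L[OF that(2)] that(1)]] by auto
  qed
  then have "\<forall>v\<in>prol_vars \<D> (Suc m). \<exists>f. f \<in> mpols {..<Suc m} \<and> mp_eval ?c b' f = \<delta> (b' (snd v)) (fst v) \<and> (fst v = 0 \<longrightarrow> f = mvar (snd v))"
    by (auto simp: prol_vars_def)
  from bchoice[OF this] obtain s where s: "\<And>j i. (j, i) \<in> prol_vars \<D> (Suc m) \<Longrightarrow>
      s (j, i) \<in> mpols {..<Suc m} \<and> mp_eval ?c b' (s (j, i)) = \<delta> (b' i) j \<and> (j = 0 \<longrightarrow> s (j, i) = mvar i)"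
    by fastforce
  have Dvar: "irreducible_D_variety \<D> \<iota> \<Delta> (Suc m) I' s"
    unfolding I'_def
  proof (rule D_variety_of_hom[OF c L.cring_Loc L.c_hom_Loc b'L _ _ _ \<delta>(1,2)])
    show "s (0, i) = mvar i" if "i < Suc m" for i using s[of 0 i] that by (auto simp: prol_vars_def)
  qed (use s L.eval_in_LocR in \<open>auto simp del: L.Loc_sel(1)\<close>)
  ultimately obtain a' where a': "a' \<in> sharp_points \<D> \<Delta> (Suc m) I' s" using sharp by blast
  then have aI': "a' \<in> rational_points {..<Suc m} I'"
    and nab: "nabla \<D> \<Delta> (Suc m) a' = (\<lambda>v\<in>prol_vars \<D> (Suc m). mp_eval id a' (s v))"
    by (auto simp: sharp_points_def)
  have a0: "mp_eval id a' f = 0" if "f \<in> I'" for f using aI' that by (auto simp: rational_points_def points_def)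
  define a where "a = restrict a' {..<n}"
  have aI: "a \<in> rational_points {..<n} I"
  proof -
    have "mp_eval id a f = 0" if f: "f \<in> I" for f
    proof -
      have fN: "f \<in> mpols {..<n}" using f irreducible_varietyD(4)[OF I] by blast
      have "f \<in> mpols {..<m}" using fN mpols_mono[of "{..<n}" "{..<m}"] nm by auto
      then have "f \<in> I'" using I_iff[OF fN] f b'_low mono by (auto simp: I'_def vanishing_ideal_def)
      then have "mp_eval id a' f = 0" by (rule a0)
      moreover have "mp_eval id a f = mp_eval id a' f"
        by (rule mp_eval_cong[OF type_hom_id(1) fN]) (simp add: a_def)
      ultimately show ?thesis by simp
    qed
    then show ?thesis by (auto simp: rational_points_def points_def a_def)
  qed
  \<comment> \<open>By the choice of \<open>Y0\<close>, \<open>s (j, i)\<close> and the coordinate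
    with the number of \<open>(j, i)\<close> agree at the generic point, so they agree at
    \<open>a'\<close>. Sharpness then identifies that coordinate of \<open>a'\<close> with
    \<open>\<partial>\<^sub>j\<close> of its coordinate \<open>i\<close>.\<close>
  have nabla_a: "nabla \<D> \<Delta> n a v = a' (prol_code n v)" if v: "v \<in> ?V" for v
  proof -
    obtain j i where ji: "v = (j, i)" "j \<in> I\<^sub>\<D>" "i < n" using v by (auto simp: prol_vars_def)
    show ?thesis
    proof (cases "j = 0")
      case True
      then show ?thesis using ji v by (simp add: nabla_def a_def code_0)
    next
      case False
      have iV: "(j, i) \<in> prol_vars \<D> (Suc m)" using ji nm by (auto simp: prol_vars_def)
      have cm: "prol_code n v < m" using prol_code(1)[OF v] by (simp add: m_def)
      have "mp_eval ?c b' (s (j, i)) = b0 (prol_code n v)"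
        using s[OF iV] \<delta>(3)[OF ji(3)] ji nm by (simp add: b'_def Y0_def)
      then have "s (j, i) - mvar (prol_code n v) \<in> I'"
        using s[OF iV] cm by (auto simp: I'_def vanishing_ideal_def mp_eval_ring_simps b'_def intro!: mpols_minus mpols_var)
      from a0[OF this] have "mp_eval id a' (s (j, i)) = a' (prol_code n v)"
        by (simp add: mp_eval_ring_simps)
      moreover have "nabla \<D> \<Delta> (Suc m) a' (j, i) = \<Delta> (a' i) j" using iV False by (simp add: nabla_def)
      ultimately have "\<Delta> (a' i) j = a' (prol_code n v)" using nab iV by simp
      then show ?thesis using False ji v by (simp add: nabla_def a_def)
    qed
  qed
  have ev_nabla: "mp_eval id (nabla \<D> \<Delta> n a) g = mp_eval id a' (mp_eval mconst (\<lambda>v. mvar (prol_code n v)) g)"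
    if "g \<in> mpols ?V" for g
    unfolding mp_eval_subst[OF type_hom_id(1)] mp_eval_var[OF type_hom_id(1)]
    by (rule mp_eval_cong[OF type_hom_id(1) that]) (rule nabla_a)
  have "point_ideal ?V (nabla \<D> \<Delta> n a) \<in> U"
  proof -
    have "J \<subseteq> point_ideal ?V (nabla \<D> \<Delta> n a)"
    proof
      fix g assume g: "g \<in> J"
      have gV: "g \<in> mpols ?V" using g irreducible_varietyD(4)[OF J] by blast
      have "mp_eval mconst (\<lambda>v. mvar (prol_code n v)) g \<in> J0"
        unfolding J0_def by (rule ren'.pullback_in) (use g in \<open>simp add: b\<close>)
      then have "mp_eval mconst (\<lambda>v. mvar (prol_code n v)) g \<in> I'"
        using b'_low mono by (auto simp: J0_def I'_def vanishing_ideal_def)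
      then show "g \<in> point_ideal ?V (nabla \<D> \<Delta> n a)" using ev_nabla[OF gV] a0 gV by (simp add: point_ideal_def)
    qed
    moreover have "t \<notin> point_ideal ?V (nabla \<D> \<Delta> n a)"
    proof -
      have "mp_eval id a' h \<noteq> 0" using hx[OF type_hom_id(1) a0] by auto
      then have "mp_eval id a' t0 \<noteq> 0" by (auto simp: h_def mp_eval_ring_simps)
      then show ?thesis using ev_nabla[OF tV] by (simp add: point_ideal_def t0_def)
    qed
    moreover have "primeideal (point_ideal ?V (nabla \<D> \<Delta> n a)) (mpol_ring ?V)"
      unfolding point_ideal_eq by (rule primeideal_vanishing_ideal) simp
    ultimately show ?thesis using t(1) unfolding Q(2) by blast
  qed
  then show "\<exists>a\<in>rational_points {..<n} I. point_ideal ?V (nabla \<D> \<Delta> n a) \<in> U" using aI by blast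
qed

end

section \<open>Sharp points from \<open>UC\<^sub>\<D>\<close>\<close>

text \<open>In a relation over the larger field choose a nonzero coefficient and a
  \<open>K\<close>-linear functional with value 1 on it, namely a coordinate with respect to a basis
  containing it. Applied to all coefficients, it produces a nontrivial relation over
  \<open>K\<close>.\<close>

lemma fun_vs_independent_extend_scalars:
  fixes c :: "'a::field \<Rightarrow> 'b::field" and B :: "('v \<Rightarrow> 'a) set"
  assumes c: "type_hom c" and B: "finite B" "fun_vs.independent B"
  shows "inj_on (\<lambda>u. c \<circ> u) B" "fun_vs.independent ((\<lambda>u. c \<circ> u) ` B)"
proof -
  interpret K: vector_space "\<lambda>a x. c a * x"
    by unfold_locales (auto simp: type_homD[OF c] algebra_simps)
  have ind: "\<forall>u\<in>B. a u = 0" if a: "\<And>v. (\<Sum>u\<in>B. a u * (c \<circ> u) v) = 0" for a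
  proof (rule ccontr)
    assume "\<not> (\<forall>u\<in>B. a u = 0)"
    then obtain u0 where u0: "u0 \<in> B" "a u0 \<noteq> 0" by blast
    have "K.independent {a u0}" using u0(2) by (simp add: K.dependent_single)
    note eb = K.extend_basis_superset[OF this] K.independent_extend_basis[OF this] K.span_extend_basis[OF this]
    define W where "W = K.extend_basis {a u0}"
    have W: "{a u0} \<subseteq> W" "K.independent W" "UNIV \<subseteq> K.span W"
      using eb by (simp_all add: W_def)
    define \<xi> where "\<xi> x = K.representation W x (a u0)" for x
    have span: "x \<in> K.span W" for x using W(3) by blast
    have \<xi>_add: "\<xi> (x + y) = \<xi> x + \<xi> y" for x y
      using K.representation_add[OF W(2) span span] by (simp add: \<xi>_def)
    have \<xi>_scale: "\<xi> (c k * x) = k * \<xi> x" for k x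
      using K.representation_scale[OF W(2) span] by (simp add: \<xi>_def)
    have \<xi>_0: "\<xi> 0 = 0" using \<xi>_scale[of 0 0] by simp
    have \<xi>_sum: "\<xi> (\<Sum>u\<in>A. f u) = (\<Sum>u\<in>A. \<xi> (f u))" for A :: "('v \<Rightarrow> 'a) set" and f
      by (induction A rule: infinite_finite_induct) (auto simp: \<xi>_0 \<xi>_add)
    have "\<xi> (a u0) = 1"
      using K.representation_basis[OF W(2), of "a u0"] W(1) by (simp add: \<xi>_def)
    have "(\<Sum>u\<in>B. \<xi> (a u) * u v) = 0" for v
    proof -
      have "(\<Sum>u\<in>B. \<xi> (a u) * u v) = \<xi> (\<Sum>u\<in>B. a u * (c \<circ> u) v)"
        unfolding \<xi>_sum by (intro sum.cong refl) (simp add: \<xi>_scale[symmetric] mult.commute)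
      then show ?thesis using a[of v] \<xi>_0 by simp
    qed
    then have "(\<Sum>u\<in>B. (\<lambda>v. \<xi> (a u) * u v)) = 0" by (simp add: fun_eq_iff sum_fun_apply)
    then have "fun_vs.dependent B"
      unfolding fun_vs.dependent_finite[OF B(1)] using u0(1) \<open>\<xi> (a u0) = 1\<close>
      by (intro exI[of _ "\<lambda>u. \<xi> (a u)"] conjI bexI[of _ u0]) auto
    with B(2) show False by simp
  qed
  show "inj_on (\<lambda>u. c \<circ> u) B"
    by (rule fun_vs_independent_family(1)[OF B(1)]) (erule ind)
  show "fun_vs.independent ((\<lambda>u. c \<circ> u) ` B)"
    by (rule fun_vs_independent_family(2)[OF B(1)]) (erule ind)
qed

text \<open>The rank of a matrix over \<open>K\<close> is the same over an extension, and the
  dimension refers to \<open>K\<close> on both sides. This connects \<open>smooth_variety\<close>,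
  which tests points over the algebraic closure, with smoothness at rational points.\<close>

lemma smooth_at_extend_scalars:
  fixes I :: "('v, 'a::field) mpol set" and c :: "'a \<Rightarrow> 'b::field"
  assumes c: "type_hom c" and N: "finite N" and I: "I \<subseteq> mpols N"
  shows "smooth_at c N I (c \<circ> x) \<longleftrightarrow> smooth_at id N I x"
proof -
  have g: "grad c (c \<circ> x) f = c \<circ> grad id x f" for f
    using mp_eval_compose[OF type_hom_id(1) c, of x] by (simp add: grad_def fun_eq_iff)
  obtain B where B: "B \<subseteq> grad id x ` I" "fun_vs.independent B" "grad id x ` I \<subseteq> fun_vs.span B"
    "card B = fun_vs.dim (grad id x ` I)"
    using fun_vs.basis_exists[of "grad id x ` I"] by metis
  have "B \<subseteq> supported N" using B(1) I grad_supported[OF type_hom_id(1)] by fastforce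
  then have "B \<subseteq> fun_vs.span ((\<lambda>w v. if v = w then 1 else (0::'a)) ` N)" using supported_span(1)[OF N] by blast
  then have finB: "finite B"
    using fun_vs.independent_span_bound[OF finite_imageI[OF N] B(2)] by blast
  note ext = fun_vs_independent_extend_scalars[OF c finB B(2)]
  have "fun_vs.dim (grad c (c \<circ> x) ` I) = card B"
  proof (rule fun_vs.dim_unique[of "(\<lambda>u. c \<circ> u) ` B"])
    show "(\<lambda>u. c \<circ> u) ` B \<subseteq> grad c (c \<circ> x) ` I" using B(1) by (auto simp: g)
    show "card ((\<lambda>u. c \<circ> u) ` B) = card B" by (rule card_image[OF ext(1)])
    show "grad c (c \<circ> x) ` I \<subseteq> fun_vs.span ((\<lambda>u. c \<circ> u) ` B)"
    proof safe
      fix f assume "f \<in> I"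
      then have "grad id x f \<in> fun_vs.span B" using B(3) by blast
      then obtain a where "grad id x f = (\<Sum>u\<in>B. (\<lambda>v. a u * u v))"
        unfolding fun_vs.span_finite[OF finB] by auto
      then have "grad c (c \<circ> x) f = (\<lambda>v. \<Sum>u\<in>B. c (a u) * (c \<circ> u) v)"
        by (simp add: g fun_eq_iff sum_fun_apply type_hom_sum[OF c] type_homD[OF c])
      then show "grad c (c \<circ> x) f \<in> fun_vs.span ((\<lambda>u. c \<circ> u) ` B)"
        using fun_vs_span_family[where S = B and a = "\<lambda>u. c (a u)" and g = "\<lambda>u. c \<circ> u"] by simp
    qed
  qed (rule ext(2))
  then show ?thesis unfolding smooth_at_iff using B(4) by simp
qed

lemma smooth_variety_rational_point:
  fixes I :: "('v, 'a::field) mpol set"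
  assumes N: "finite N" and I: "I \<subseteq> mpols N" and sm: "smooth_variety N I" and x: "x \<in> rational_points N I"
  shows "has_smooth_rational_point N I"
proof -
  define y where "y = restrict (to_ac \<circ> x) N"
  have ev: "mp_eval to_ac y f = mp_eval to_ac (to_ac \<circ> x) f" if "f \<in> mpols N" for f
    by (rule mp_eval_cong[OF type_hom_to_ac that]) (simp add: y_def)
  have "mp_eval to_ac (to_ac \<circ> x) f = to_ac (mp_eval id x f)" for f
    using mp_eval_compose[OF type_hom_id(1) type_hom_to_ac, of x f] by (simp add: comp_def)
  then have "y \<in> points to_ac N I"
    using x I ev by (auto simp: points_def rational_points_def y_def)
  then have "smooth_at to_ac N I y" using sm by (auto simp: smooth_variety_def)
  moreover have "grad to_ac y f = grad to_ac (to_ac \<circ> x) f" if "f \<in> I" for f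
    using ev mpols_deriv[of f N] that I by (auto simp: grad_def fun_eq_iff)
  ultimately have "smooth_at to_ac N I (to_ac \<circ> x)"
    unfolding smooth_at_iff by (simp cong: image_cong)
  then have "smooth_at id N I x" using smooth_at_extend_scalars[OF type_hom_to_ac N I] by blast
  with x show ?thesis by (auto simp: has_smooth_rational_point_def)
qed

context D_base
begin

lemma UC_point:
  assumes UC: "UC \<D> \<iota> \<Delta>" and I: "irreducible_variety {..<n} I" and J: "irreducible_variety (prol_vars \<D> n) J"
    and sub: "prol_ideal \<D> \<iota> \<Delta> n I \<subseteq> J"
    and dom: "zariski_dense_in {..<n} I (prol_proj n ` topspace (zariski (prol_vars \<D> n) J))"
    and sm: "has_smooth_rational_point (prol_vars \<D> n) J"
    and q: "q \<in> mpols (prol_vars \<D> n)" "q \<notin> J"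
  obtains a where "a \<in> rational_points {..<n} I" "J \<subseteq> point_ideal (prol_vars \<D> n) (nabla \<D> \<Delta> n a)"
    "q \<notin> point_ideal (prol_vars \<D> n) (nabla \<D> \<Delta> n a)"
proof -
  let ?V = "prol_vars \<D> n"
  define U where "U = {p. primeideal p (mpol_ring ?V) \<and> J \<subseteq> p \<and> \<not> {q} \<subseteq> p}"
  have opn: "openin (zariski ?V J) U"
    unfolding openin_zariski U_def using q(1) by (intro exI[of _ "{q}"] conjI) auto
  have "J \<in> U" using irreducible_varietyD(2)[OF J] q(2) by (simp add: U_def)
  then have ne: "U \<noteq> {}" by blast
  note UC' = conjunct2[OF UC[unfolded UC_def], rule_format, of n I J U]
  have "\<exists>a\<in>rational_points {..<n} I. point_ideal ?V (nabla \<D> \<Delta> n a) \<in> U"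
    by (rule UC') (intro conjI I J sub dom sm opn ne)+
  then obtain a where "a \<in> rational_points {..<n} I" "point_ideal ?V (nabla \<D> \<Delta> n a) \<in> U" by blast
  then show ?thesis using that by (simp add: U_def)
qed

theorem sharp_points_dense_of_UC:
  assumes UC: "UC \<D> \<iota> \<Delta>" and V: "irreducible_D_variety \<D> \<iota> \<Delta> n I s"
    and smooth: "has_smooth_rational_point {..<n} I"
  shows "zariski_dense_in {..<n} I (point_ideal {..<n} ` sharp_points \<D> \<Delta> n I s)"
proof -
  have I: "irreducible_variety {..<n} I" and s: "s ` prol_vars \<D> n \<subseteq> mpols {..<n}"
    and sI: "\<And>g. g \<in> prol_ideal \<D> \<iota> \<Delta> n I \<Longrightarrow> mp_eval mconst s g \<in> I"
    and s0: "\<And>i. i < n \<Longrightarrow> s (0, i) - mvar i \<in> I"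
    using V by (auto simp: irreducible_D_variety_def affine_D_variety_def)
  let ?V = "prol_vars \<D> n" and ?c = "to_univ :: 'a \<Rightarrow> 'a univ_dom"
  note c = type_hom_to_univ[where 'a = 'a]
  obtain b :: "nat \<Rightarrow> 'a univ_dom" where b: "I = vanishing_ideal ?c {..<n} b"
    using generic_point[OF irreducible_varietyD(2,1)[OF I]] .
  \<comment> \<open>A generic point of the graph of \<open>s\<close>. It generates the same ring as
    \<open>b\<close>, its coordinates with \<open>j = 0\<close> being those of \<open>b\<close>; the
    smooth rational point of V is therefore transported to the graph.\<close>
  define b' where "b' = (\<lambda>v. mp_eval ?c b (s v))"
  define J where "J = vanishing_ideal ?c ?V b'"
  have J: "irreducible_variety ?V J" unfolding J_def by (rule irreducible_vanishing_ideal[OF finite_prol_vars c])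
  have b0: "b' (0, i) = b i" if "i < n" for i
    using s0[OF that] by (simp add: b vanishing_ideal_def mp_eval_ring_simps b'_def)
  interpret g: interdefinable ?c "{..<n}" ?V b b' s "\<lambda>i. mvar (0, i)"
    by unfold_locales
      (use s b0 finite_prol_vars in \<open>auto simp: b'_def mp_eval_var prol_vars_def intro!: mpols_var\<close>)
  have evJ: "mp_eval ?c b (mp_eval mconst s g) = mp_eval ?c b' g" for g
    unfolding mp_eval_subst[OF c] b'_def ..
  have "prol_poly \<D> \<iota> \<Delta> n f j \<in> J" if "f \<in> I" "j \<in> I\<^sub>\<D>" for f j
  proof -
    have fN: "f \<in> mpols {..<n}" using that irreducible_varietyD(4)[OF I] by blast
    have "prol_poly \<D> \<iota> \<Delta> n f j \<in> prol_ideal \<D> \<iota> \<Delta> n I"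
    proof -
      interpret cring "mpol_ring ?V :: (nat \<times> nat, 'a) mpol ring" by (rule cring_mpol_ring)
      have "{prol_poly \<D> \<iota> \<Delta> n f j | f j. f \<in> I \<and> j \<in> I\<^sub>\<D>} \<subseteq> carrier (mpol_ring ?V)"
        using irreducible_varietyD(4)[OF I] prol_poly_closed by auto
      from genideal_self[OF this] show ?thesis unfolding prol_ideal_def using that by blast
    qed
    from sI[OF this] have "mp_eval ?c b' (prol_poly \<D> \<iota> \<Delta> n f j) = 0"
      by (simp add: b vanishing_ideal_def evJ)
    then show ?thesis using prol_poly_closed[OF fN that(2)] by (simp add: J_def vanishing_ideal_def)
  qed
  then have sub: "prol_ideal \<D> \<iota> \<Delta> n I \<subseteq> J"
    using prol_ideal_subset_iff[OF primeideal_mpolD(1)[OF irreducible_varietyD(2)[OF J]] irreducible_varietyD(4)[OF I]] by blast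
  have low: "mp_eval ?c b' (mp_eval mconst (\<lambda>i. mvar (0, i)) f) = mp_eval ?c b f" if "f \<in> mpols {..<n}" for f
    unfolding mp_eval_subst[OF c] mp_eval_var[OF c] by (rule mp_eval_cong[OF c that]) (use b0 in auto)
  have lowV: "mp_eval mconst (\<lambda>i. mvar (0, i)) f \<in> mpols ?V" if "f \<in> mpols {..<n}" for f :: "(nat, 'a) mpol"
    by (rule mpols_subst[OF that]) (auto simp: prol_vars_def intro!: mpols_var)
  have "prol_proj n J = I"
    using low lowV irreducible_varietyD(4)[OF I] by (auto simp: prol_proj_def J_def b vanishing_ideal_def)
  moreover have "J \<in> topspace (zariski ?V J)" using irreducible_varietyD(2)[OF J] by (simp add: topspace_zariski)
  ultimately have "I \<in> prol_proj n ` topspace (zariski ?V J)" by blast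
  then have dom: "zariski_dense_in {..<n} I (prol_proj n ` topspace (zariski ?V J))"
    unfolding zariski_dense_in_iff[OF irreducible_varietyD(2)[OF I]] using irreducible_varietyD(2)[OF I] by blast
  have smJ: "has_smooth_rational_point ?V J"
    unfolding J_def by (rule g.has_smooth_rational_point_image) (use smooth in \<open>simp add: b\<close>)
  have "sharp_points \<D> \<Delta> n I s \<subseteq> rational_points {..<n} I" by (auto simp: sharp_points_def)
  moreover have "\<exists>a\<in>sharp_points \<D> \<Delta> n I s. mp_eval id a f \<noteq> 0" if f: "f \<in> mpols {..<n}" "f \<notin> I" for f
  proof -
    let ?f = "mp_eval mconst (\<lambda>i. mvar (0, i)) f"
    have "?f \<notin> J" using f low[OF f(1)] by (simp add: J_def b vanishing_ideal_def)
    then obtain a where a: "a \<in> rational_points {..<n} I" "J \<subseteq> point_ideal ?V (nabla \<D> \<Delta> n a)"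
      "?f \<notin> point_ideal ?V (nabla \<D> \<Delta> n a)"
      by (rule UC_point[OF UC I J sub dom smJ lowV[OF f(1)]])
    have na0: "nabla \<D> \<Delta> n a (0, i) = a i" if "i < n" for i using that by (simp add: nabla_def prol_vars_def)
    have lowa: "mp_eval id (nabla \<D> \<Delta> n a) (mp_eval mconst (\<lambda>i. mvar (0, i)) q) = mp_eval id a q" if "q \<in> mpols {..<n}" for q
      unfolding mp_eval_subst[OF type_hom_id(1)] mp_eval_var[OF type_hom_id(1)]
      by (rule mp_eval_cong[OF type_hom_id(1) that]) (use na0 in auto)
    have "mp_eval id a f \<noteq> 0" using a(3) lowV[OF f(1)] lowa[OF f(1)] by (simp add: point_ideal_def)
    moreover have nv: "nabla \<D> \<Delta> n a v = mp_eval id a (s v)" if v: "v \<in> ?V" for v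
    proof -
      have sv: "s v \<in> mpols {..<n}" using s v by blast
      \<comment> \<open>On the graph every coordinate is the corresponding component of
        \<open>s\<close> in the coordinates with \<open>j = 0\<close>; at \<open>\<nabla>(a)\<close>
        this equation is the sharpness of \<open>a\<close>.\<close>
      let ?g = "mvar v - mp_eval mconst (\<lambda>i. mvar (0, i)) (s v)"
      have "?g \<in> J"
        using v lowV[OF sv] low[OF sv]
        by (auto simp: J_def vanishing_ideal_def mp_eval_ring_simps b'_def intro!: mpols_minus mpols_var)
      then have "mp_eval id (nabla \<D> \<Delta> n a) ?g = 0" using a(2) by (auto simp: point_ideal_def)
      then show ?thesis using lowa[OF sv] by (simp add: mp_eval_ring_simps)
    qed
    have "nabla \<D> \<Delta> n a = (\<lambda>v\<in>?V. mp_eval id a (s v))"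
    proof (rule ext)
      fix v
      show "nabla \<D> \<Delta> n a v = (\<lambda>v\<in>?V. mp_eval id a (s v)) v"
      proof (cases "v \<in> ?V")
        case True
        then show ?thesis using nv[OF True] by simp
      qed (simp add: nabla_def)
    qed
    ultimately show ?thesis using a(1) by (auto simp: sharp_points_def)
  qed
  ultimately show ?thesis
    using rational_points_dense_iff[OF irreducible_varietyD(2)[OF I]] by blast
qed

lemma dense_nonempty:
  assumes "irreducible_variety {..<n} (I :: (nat, 'a) mpol set)" "zariski_dense_in {..<n} I (point_ideal {..<n} ` A)"
  shows "A \<noteq> {}"
  using assms(2) primeideal_mpolD(2)[OF irreducible_varietyD(2)[OF assms(1)]] mpols_1[of "{..<n}", where 'a = 'a]
  unfolding zariski_dense_in_iff[OF irreducible_varietyD(2)[OF assms(1)]] by blast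

end

section \<open>Polynomials as terms\<close>

text \<open>\<open>term_rep n cs t f\<close>: the term \<open>t\<close> represents the polynomial \<open>f\<close>, the variable with number
  \<open>n + i\<close> being the parameter \<open>cs ! i\<close>.\<close>

inductive term_rep :: "nat \<Rightarrow> 'a::comm_ring_1 list \<Rightarrow> ('k, 'o) rterm \<Rightarrow> (nat, 'a) mpol \<Rightarrow> bool"
  for n cs where
  var: "v < n \<Longrightarrow> term_rep n cs (TVar v) (mvar v)"
| param: "i < length cs \<Longrightarrow> term_rep n cs (TVar (n + i)) (mconst (cs ! i))"
| zero: "term_rep n cs TZero 0"
| one: "term_rep n cs TOne 1"
| plus: "term_rep n cs s f \<Longrightarrow> term_rep n cs t g \<Longrightarrow> term_rep n cs (TPlus s t) (f + g)"
| times: "term_rep n cs s f \<Longrightarrow> term_rep n cs t g \<Longrightarrow> term_rep n cs (TTimes s t) (f * g)"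

lemma term_rep_mpols: "term_rep n cs t f \<Longrightarrow> f \<in> mpols {..<n}"
  by (induction rule: term_rep.induct) (auto intro: mpols_var mpols_add mpols_mult)

lemma term_rep_sets: "term_rep n cs t f \<Longrightarrow> set1_rterm t = {} \<and> set2_rterm t = {}"
  by (induction rule: term_rep.induct) auto

lemma term_rep_val:
  fixes e :: "'a::comm_ring_1 \<Rightarrow> 'r" and R :: "'r ring"
  assumes "term_rep n cs t f" and R: "cring R" and e: "e \<in> ring_hom ring_of_type_algebra R"
    and \<sigma>: "\<And>v. \<sigma> v \<in> carrier R" "\<And>i. i < length cs \<Longrightarrow> \<sigma> (n + i) = e (cs ! i)"
  shows "term_val R \<kappa> F \<sigma> t = mp_eval_in R e \<sigma> f"
  using assms(1)
proof (induction rule: term_rep.induct)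
  case (plus s f t g)
  interpret mp_evaluation R e \<sigma> "{..<n}" by (rule mp_evaluationI[OF R e]) (use \<sigma> in auto)
  from plus show ?case by (simp add: ev_add term_rep_mpols)
next
  case (times s f t g)
  interpret mp_evaluation R e \<sigma> "{..<n}" by (rule mp_evaluationI[OF R e]) (use \<sigma> in auto)
  from times show ?case by (simp add: ev_mult term_rep_mpols)
next
  case (var v)
  interpret mp_evaluation R e \<sigma> "{..<n}" by (rule mp_evaluationI[OF R e]) (use \<sigma> in auto)
  from var show ?case by simp
next
  case (param i)
  interpret mp_evaluation R e \<sigma> "{..<n}" by (rule mp_evaluationI[OF R e]) (use \<sigma> in auto)
  from param show ?case using \<sigma>(2) by simp
next
  case zero
  interpret mp_evaluation R e \<sigma> "{..<n}" by (rule mp_evaluationI[OF R e]) (use \<sigma> in auto)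
  show ?case by simp
next
  case one
  interpret mp_evaluation R e \<sigma> "{..<n}" by (rule mp_evaluationI[OF R e]) (use \<sigma> in auto)
  show ?case by simp
qed

lemma term_rep_exists:
  fixes f :: "(nat, 'a::comm_ring_1) mpol"
  assumes f: "f \<in> mpols {..<n}" and cs: "\<And>m. m \<in> Poly_Mapping.keys f \<Longrightarrow> Poly_Mapping.lookup f m \<in> set cs"
  shows "\<exists>t :: ('k, 'o) rterm. term_rep n cs t f"
proof -
  let ?r = "\<lambda>g. \<exists>t :: ('k, 'o) rterm. term_rep n cs t g"
  have sum: "?r (\<Sum>a\<in>A. g a)" if "finite A" "\<And>a. a \<in> A \<Longrightarrow> ?r (g a)" for g :: "(nat \<Rightarrow>\<^sub>0 nat) \<Rightarrow> (nat, 'a) mpol" and A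
    using that by (induction A rule: finite_induct) (auto intro: term_rep.zero, metis term_rep.plus)
  have prod: "?r (\<Prod>a\<in>A. g a)" if "finite A" "\<And>a. a \<in> A \<Longrightarrow> ?r (g a)" for g :: "nat \<Rightarrow> (nat, 'a) mpol" and A
    using that by (induction A rule: finite_induct) (auto intro: term_rep.one, metis term_rep.times)
  have pow: "?r (mvar v ^ k)" if "v < n" for v k
    by (induction k) (auto intro: term_rep.one, metis term_rep.times term_rep.var that)
  have "?r (Poly_Mapping.single m (Poly_Mapping.lookup f m))" if m: "m \<in> Poly_Mapping.keys f" for m
  proof -
    have "?r (mconst (Poly_Mapping.lookup f m))"
      using cs[OF m] by (metis in_set_conv_nth term_rep.param)
    moreover have "Poly_Mapping.keys m \<subseteq> {..<n}" using f m by (auto simp: mpols_def)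
    then have "?r (\<Prod>v\<in>Poly_Mapping.keys m. mvar v ^ Poly_Mapping.lookup m v)"
      by (intro prod) (auto intro!: pow)
    ultimately show ?thesis unfolding single_eq_prod by (metis term_rep.times)
  qed
  then have "?r (\<Sum>m\<in>Poly_Mapping.keys f. Poly_Mapping.single m (Poly_Mapping.lookup f m))"
    by (intro sum) auto
  then show ?thesis using poly_mapping_sum_singles[of f] by simp
qed

primrec qconj :: "('k, 'o) qf_formula list \<Rightarrow> ('k, 'o) qf_formula" where
  "qconj [] = QEq TZero TZero"
| "qconj (\<phi> # \<phi>s) = QAnd \<phi> (qconj \<phi>s)"

lemma qf_sat_qconj: "qf_sat R \<iota> F \<rho> (qconj \<phi>s) \<longleftrightarrow> (\<forall>\<phi>\<in>set \<phi>s. qf_sat R \<iota> F \<rho> \<phi>)"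
  by (induction \<phi>s) auto

lemma qconj_sets:
  "qf_consts (qconj \<phi>s) = (\<Union>\<phi>\<in>set \<phi>s. qf_consts \<phi>)" "qf_ops (qconj \<phi>s) = (\<Union>\<phi>\<in>set \<phi>s. qf_ops \<phi>)"
  by (induction \<phi>s) auto

text \<open>A finite system of polynomial equations, one inequation and prescriptions for operators
  on the unknowns is a single existential formula whose parameters are the coefficients. With
  \<open>W\<close> empty it belongs to the language of rings, so that one statement serves both
  notions of existential closedness.\<close>

lemma ex_closed_solve:
  fixes e :: "'a::field \<Rightarrow> 'r" and L :: "'r ring" and A :: "'k set" and Q :: "'o set" and n :: nat
  assumes ec: "ex_closed A Q ring_of_type_algebra \<kappa> F L \<kappa>' G e"
    and L: "cring L" and e: "e \<in> ring_hom ring_of_type_algebra L"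
    and P: "finite P" "P \<subseteq> mpols {..<n}" and h: "h \<in> mpols {..<n}"
    and W: "finite W" "\<And>j i. (j, i) \<in> W \<Longrightarrow> i < n \<and> j \<in> Q \<and> g (j, i) \<in> mpols {..<n}"
    and y: "\<And>i. i < n \<Longrightarrow> y i \<in> carrier L"
    and yP: "\<And>f. f \<in> P \<Longrightarrow> mp_eval_in L e y f = \<zero>\<^bsub>L\<^esub>" and yh: "mp_eval_in L e y h \<noteq> \<zero>\<^bsub>L\<^esub>"
    and yW: "\<And>j i. (j, i) \<in> W \<Longrightarrow> G j (y i) = mp_eval_in L e y (g (j, i))"
  shows "\<exists>x. (\<forall>f\<in>P. mp_eval id x f = 0) \<and> mp_eval id x h \<noteq> 0 \<and>
    (\<forall>(j, i)\<in>W. F j (x i) = mp_eval id x (g (j, i)))"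
proof -
  interpret L: cring L by fact
  let ?all = "insert h (P \<union> g ` W)"
  have fin: "finite (\<Union>f\<in>?all. Poly_Mapping.lookup f ` Poly_Mapping.keys f)" using P W by auto
  obtain cs where cs: "set cs = (\<Union>f\<in>?all. Poly_Mapping.lookup f ` Poly_Mapping.keys f)"
    by (rule exE[OF finite_list[OF fin]]) (rule that)
  have allN: "f \<in> mpols {..<n}" if "f \<in> ?all" for f using that P h W(2) by fastforce
  have ex: "\<exists>t :: ('k, 'o) rterm. term_rep n cs t f" if "f \<in> ?all" for f
    by (rule term_rep_exists[OF allN[OF that]]) (use cs that in blast)
  then have "\<forall>f\<in>?all. \<exists>t :: ('k, 'o) rterm. term_rep n cs t f" by (rule ballI)
  from bchoice[OF this] obtain tm :: "(nat, 'a) mpol \<Rightarrow> ('k, 'o) rterm" where "\<forall>f\<in>?all. term_rep n cs (tm f) f" ..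
  then have tm: "\<And>f. f \<in> ?all \<Longrightarrow> term_rep n cs (tm f) f" by (rule bspec)
  obtain Ps where Ps: "set Ps = P" using P(1) finite_list by blast
  obtain Ws where Ws: "set Ws = W" using W(1) finite_list by blast
  define \<phi> where "\<phi> = qconj (QNot (QEq (tm h) TZero) # map (\<lambda>f. QEq (tm f) TZero) Ps @
      map (\<lambda>(j, i). QEq (TOp j (TVar i)) (tm (g (j, i)))) Ws)"
  \<comment> \<open>Numbers below \<open>n\<close> are the unknowns, the next
    \<open>length cs\<close> carry the coefficients, and 0 fills the rest.\<close>
  define \<rho> where "\<rho> v = (if v < n then 0 else if v < n + length cs then cs ! (v - n) else 0)" for v
  define \<sigma> where "\<sigma> v = (if v < n then y v else e (\<rho> v))" for v
  have eL: "e a \<in> carrier L" for a using e by (auto simp: ring_hom_def)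
  have \<sigma>L: "\<sigma> v \<in> carrier L" for v using y eL by (auto simp: \<sigma>_def)
  have val: "term_val L \<kappa>' G \<sigma> (tm f) = mp_eval_in L e y f" if f: "f \<in> ?all" for f
  proof -
    have "term_val L \<kappa>' G \<sigma> (tm f) = mp_eval_in L e \<sigma> f"
      by (rule term_rep_val[OF tm[OF f] L e \<sigma>L]) (simp add: \<sigma>_def \<rho>_def)
    also have "\<dots> = mp_eval_in L e y f"
      by (rule mp_eval_in_cong[OF _ allN[OF f] L _ e]) (use y eL in \<open>auto simp: \<sigma>_def\<close>)
    finally show ?thesis .
  qed
  have sets: "set1_rterm (tm f) = {}" "set2_rterm (tm f) = {}" if "f \<in> ?all" for f
    using term_rep_sets[OF tm[OF that]] by auto
  have "qf_sat L \<kappa>' G \<sigma> \<phi>"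
    unfolding \<phi>_def qf_sat_qconj using yh yP yW W(2) Ps Ws val by (auto simp: \<sigma>_def)
  moreover have "qf_consts \<phi> \<subseteq> A" "qf_ops \<phi> \<subseteq> Q"
    unfolding \<phi>_def qconj_sets using sets W(2) Ps Ws by auto
  moreover have "range \<sigma> \<subseteq> carrier L" using \<sigma>L by blast
  moreover have "\<forall>v. v \<notin> {..<n} \<longrightarrow> \<sigma> v = e (\<rho> v)" by (simp add: \<sigma>_def)
  ultimately have "\<exists>\<tau>. range \<tau> \<subseteq> carrier (ring_of_type_algebra :: 'a ring) \<and> (\<forall>v. v \<notin> {..<n} \<longrightarrow> \<tau> v = \<rho> v) \<and>
      qf_sat ring_of_type_algebra \<kappa> F \<tau> \<phi>"
    using ec[unfolded ex_closed_def, rule_format, of \<phi> "{..<n}" \<rho>] by auto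
  then obtain \<tau> where \<tau>: "\<And>v. v \<notin> {..<n} \<Longrightarrow> \<tau> v = \<rho> v" "qf_sat ring_of_type_algebra \<kappa> F \<tau> \<phi>" by blast
  have val': "term_val ring_of_type_algebra \<kappa> F \<tau> (tm f) = mp_eval id \<tau> f" if f: "f \<in> ?all" for f
    unfolding mp_eval_eq_in
    by (rule term_rep_val[OF tm[OF f] cring_from_type_algebra type_hom_id(1)]) (use \<tau>(1) in \<open>auto simp: \<rho>_def\<close>)
  show ?thesis
    using \<tau>(2) unfolding \<phi>_def qf_sat_qconj
    by (intro exI[of _ \<tau>]) (use Ps Ws val' in \<open>auto simp: ball_Un\<close>)
qed

lemma ex_closed_field_solve:
  fixes e :: "'a::field \<Rightarrow> 'r" and L :: "'r ring" and n :: nat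
  assumes ec: "ex_closed_field ring_of_type_algebra L e"
    and L: "cring L" and e: "e \<in> ring_hom ring_of_type_algebra L"
    and P: "finite P" "P \<subseteq> mpols {..<n}" and h: "h \<in> mpols {..<n}"
    and y: "\<And>i. i < n \<Longrightarrow> y i \<in> carrier L"
    and yP: "\<And>f. f \<in> P \<Longrightarrow> mp_eval_in L e y f = \<zero>\<^bsub>L\<^esub>" and yh: "mp_eval_in L e y h \<noteq> \<zero>\<^bsub>L\<^esub>"
  obtains x where "\<And>f. f \<in> P \<Longrightarrow> mp_eval id x f = 0" "mp_eval id x h \<noteq> 0"
  using ex_closed_solve[OF ec[unfolded ex_closed_field_def] L e P h, of "{}" _ y] y yP yh by auto

section \<open>Existential closedness from \<open>UC\<^sub>\<D>\<close>\<close>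

lemma minus_of_type: "x \<ominus>\<^bsub>ring_of_type_algebra\<^esub> y = (x - y :: 'a::comm_ring_1)"
proof -
  interpret R: cring "ring_of_type_algebra :: 'a ring" by (rule cring_from_type_algebra)
  have "\<ominus>\<^bsub>ring_of_type_algebra\<^esub> y = - y" by (rule R.minus_equality) auto
  then show ?thesis by (simp add: a_minus_def)
qed

text \<open>The counterpart of \<open>primeideal_vanishing_ideal\<close> for a field given by a
  carrier, such as the extension in which a formula is assumed to hold.\<close>

lemma primeideal_kernel_eval:
  fixes L :: "'r ring" and e :: "'a::comm_ring_1 \<Rightarrow> 'r"
  assumes L: "field L" and e: "e \<in> ring_hom ring_of_type_algebra L" and y: "y \<in> N \<rightarrow> carrier L"
  shows "primeideal {f \<in> mpols N. mp_eval_in L e y f = \<zero>\<^bsub>L\<^esub>} (mpol_ring N)"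
proof -
  interpret L: field L by fact
  interpret mp_evaluation L e y N by (rule mp_evaluationI[OF L.is_cring e y])
  show ?thesis
  proof (rule primeideal_mpolI)
    show "ideal {f \<in> mpols N. ev f = \<zero>\<^bsub>L\<^esub>} (mpol_ring N)"
      by (rule ideal_mpolI) (auto simp: ev_add ev_mult ev_closed mpols_add mpols_mult)
  next
    fix f g assume "f \<in> mpols N" "g \<in> mpols N" "f * g \<in> {f \<in> mpols N. ev f = \<zero>\<^bsub>L\<^esub>}"
    then show "f \<in> {f \<in> mpols N. ev f = \<zero>\<^bsub>L\<^esub>} \<or> g \<in> {f \<in> mpols N. ev f = \<zero>\<^bsub>L\<^esub>}"
      using L.integral[of "ev f" "ev g"] by (auto simp: ev_mult ev_closed)
  qed auto
qed

primrec subterms :: "('k, 'o) rterm \<Rightarrow> ('k, 'o) rterm set" where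
  "subterms (TVar v) = {TVar v}"
| "subterms TZero = {TZero}"
| "subterms TOne = {TOne}"
| "subterms (TConst a) = {TConst a}"
| "subterms (TPlus s t) = insert (TPlus s t) (subterms s \<union> subterms t)"
| "subterms (TMinus s t) = insert (TMinus s t) (subterms s \<union> subterms t)"
| "subterms (TTimes s t) = insert (TTimes s t) (subterms s \<union> subterms t)"
| "subterms (TOp f t) = insert (TOp f t) (subterms t)"

primrec qf_subterms :: "('k, 'o) qf_formula \<Rightarrow> ('k, 'o) rterm set" where
  "qf_subterms (QEq s t) = subterms s \<union> subterms t"
| "qf_subterms (QNot \<phi>) = qf_subterms \<phi>"
| "qf_subterms (QAnd \<phi> \<psi>) = qf_subterms \<phi> \<union> qf_subterms \<psi>"

lemma finite_subterms: "finite (subterms t)"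
  by (induction t) auto

lemma finite_qf_subterms: "finite (qf_subterms \<phi>)"
  by (induction \<phi>) (auto simp: finite_subterms)

lemma subterms_refl: "t \<in> subterms t"
  by (cases t) auto

lemma subterms_trans: "s \<in> subterms t \<Longrightarrow> subterms s \<subseteq> subterms t"
  by (induction t) auto

lemma qf_subterms_trans: "s \<in> qf_subterms \<phi> \<Longrightarrow> subterms s \<subseteq> qf_subterms \<phi>"
  by (induction \<phi>) (auto dest: subterms_trans)

lemma subterms_ops: "s \<in> subterms t \<Longrightarrow> set2_rterm s \<subseteq> set2_rterm t"
  by (induction t) auto

lemma qf_subterms_ops: "s \<in> qf_subterms \<phi> \<Longrightarrow> set2_rterm s \<subseteq> qf_ops \<phi>"
  by (induction \<phi>) (auto dest: subterms_ops)

lemma term_val_closed: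
  assumes "cring R" "\<And>v. \<sigma> v \<in> carrier R" "\<And>a. \<kappa> a \<in> carrier R"
    "\<And>j x. j \<in> set2_rterm t \<Longrightarrow> x \<in> carrier R \<Longrightarrow> F j x \<in> carrier R"
  shows "term_val R \<kappa> F \<sigma> t \<in> carrier R"
proof -
  interpret cring R by fact
  show ?thesis using assms(4) by (induction t) (auto simp: assms(2,3))
qed

context D_base
begin

text \<open>Taking the values of all subterms as coordinates flattens the formula: ring operations
  become polynomial relations between coordinates, and an operator applied to a subterm becomes an
  equation between a coordinate of the tuple and one of its image under \<open>\<nabla>\<close>.
  Nested operators are thus handled by a single prolongation.\<close>

theorem ex_closed_of_UC:
  fixes L :: "'r ring"
  assumes UC: "UC \<D> \<iota> \<Delta>" and ext: "D_field_extension \<D> ring_of_type_algebra \<iota> \<Delta> L \<delta> e"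
    and ecf: "ex_closed_field ring_of_type_algebra L e"
  shows "ex_closed_D_field \<D> ring_of_type_algebra \<iota> \<Delta> L \<delta> e"
  unfolding ex_closed_D_field_def ex_closed_def
proof (intro allI impI)
  fix \<phi> :: "('k, nat) qf_formula" and V \<rho>
  assume "qf_consts \<phi> \<subseteq> UNIV \<and> qf_ops \<phi> \<subseteq> {1..len \<D>} \<and> finite V \<and> range \<rho> \<subseteq> carrier (ring_of_type_algebra :: 'a ring) \<and>
    (\<exists>\<sigma>. range \<sigma> \<subseteq> carrier L \<and> (\<forall>v. v \<notin> V \<longrightarrow> \<sigma> v = e (\<rho> v)) \<and> qf_sat L (e \<circ> \<iota>) (\<lambda>j r. \<delta> r j) \<sigma> \<phi>)"
  then obtain \<sigma> where ops: "qf_ops \<phi> \<subseteq> {1..len \<D>}" and \<sigma>: "\<And>v. \<sigma> v \<in> carrier L"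
    "\<And>v. v \<notin> V \<Longrightarrow> \<sigma> v = e (\<rho> v)" "qf_sat L (e \<circ> \<iota>) (\<lambda>j r. \<delta> r j) \<sigma> \<phi>" by blast
  have L: "field L" and e: "e \<in> ring_hom ring_of_type_algebra L"
    and \<delta>: "\<delta> \<in> ring_hom L (base_change \<D> L (e \<circ> \<iota>))"
    and \<delta>e: "\<And>r j. j \<in> I\<^sub>\<D> \<Longrightarrow> \<delta> (e r) j = e (\<Delta> r j)"
    and res: "\<And>r. r \<in> carrier L \<Longrightarrow> (\<Oplus>\<^bsub>L\<^esub>j\<in>I\<^sub>\<D>. \<delta> r j \<otimes>\<^bsub>L\<^esub> (e \<circ> \<iota>) (resid \<D> (eps \<D> j))) = r"
    using ext by (auto simp: D_field_extension_def D_field_def D_ring_def)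
  interpret L: field L by fact
  let ?T = "base_change \<D> L (e \<circ> \<iota>)"
  have T: "cring ?T" by (rule cring_base_change[OF L.is_cring comp_iota_hom[OF e]])
  have \<delta>T: "\<delta> r \<in> carrier ?T" if "r \<in> carrier L" for r using \<delta> that by (auto simp: ring_hom_def)
  have \<delta>c: "\<delta> r j \<in> carrier L" if "r \<in> carrier L" "j \<in> I\<^sub>\<D>" for r j
    using \<delta>T[OF that(1)] that(2) by (auto simp: base_change_sel PiE_iff)
  have \<delta>0: "\<delta> r 0 = r" if "r \<in> carrier L" for r
    using res[OF that] resid_sum[OF L.is_cring comp_iota_hom[OF e], of "\<delta> r"] \<delta>c[OF that] by simp
  have \<delta>_kap: "\<delta> (e r) = kap e r" for r
  proof -
    have "e r \<in> carrier L" using e by (auto simp: ring_hom_def)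
    from \<delta>T[OF this] show ?thesis
      using \<delta>e by (auto simp: base_change_sel PiE_iff kap_def bc_map_def restrict_def fun_eq_iff extensional_def)
  qed
  have "\<exists>ts. set ts = qf_subterms \<phi> \<and> distinct ts" by (rule finite_distinct_list[OF finite_qf_subterms])
  then obtain ts where ts: "set ts = qf_subterms \<phi>" "distinct ts" by (elim exE conjE)
  define n where "n = length ts"
  define val where "val t = term_val L (e \<circ> \<iota>) (\<lambda>j r. \<delta> r j) \<sigma> t" for t
  have val_closed: "val t \<in> carrier L" if "t \<in> qf_subterms \<phi>" for t
    unfolding val_def
  proof (rule term_val_closed[where \<sigma> = \<sigma>, OF L.is_cring \<sigma>(1)])
    show "(e \<circ> \<iota>) k \<in> carrier L" for k using e by (auto simp: ring_hom_def)
    fix j x assume "j \<in> set2_rterm t" "x \<in> carrier L"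
    then show "\<delta> x j \<in> carrier L" using \<delta>c[of x j] qf_subterms_ops[OF that] ops by auto
  qed
  define a where "a i = val (ts ! i)" for i
  have aL: "a i \<in> carrier L" if "i < n" for i
    unfolding a_def by (rule val_closed) (use that in \<open>simp add: n_def flip: ts(1)\<close>)
  define ix where "ix t = (SOME i. i < n \<and> ts ! i = t)" for t
  have ix: "ix t < n \<and> ts ! ix t = t" if "t \<in> set ts" for t
  proof -
    have "\<exists>i. i < n \<and> ts ! i = t" using that by (auto simp: in_set_conv_nth n_def)
    from someI_ex[OF this] show ?thesis by (simp add: ix_def)
  qed
  let ?V = "prol_vars \<D> n"
  define y where "y = (\<lambda>(j, i). \<delta> (a i) j)"
  have yL: "y \<in> ?V \<rightarrow> carrier L" using \<delta>c aL by (auto simp: y_def prol_vars_def)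
  have aL': "a \<in> {..<n} \<rightarrow> carrier L" using aL by auto
  define I where "I = {f \<in> mpols {..<n}. mp_eval_in L e a f = \<zero>\<^bsub>L\<^esub>}"
  define J where "J = {f \<in> mpols ?V. mp_eval_in L e y f = \<zero>\<^bsub>L\<^esub>}"
  have I: "irreducible_variety {..<n} I" and J: "irreducible_variety ?V J"
    unfolding irreducible_variety_iff_prime I_def J_def
    using primeideal_kernel_eval[OF L e aL'] primeideal_kernel_eval[OF L e yL] finite_prol_vars by auto
  interpret A: mp_evaluation L e a "{..<n}" by (rule mp_evaluationI[OF L.is_cring e aL'])
  interpret Y: mp_evaluation L e y ?V by (rule mp_evaluationI[OF L.is_cring e yL])
  have low: "Y.ev (mp_eval mconst (\<lambda>i. mvar (0, i)) f) = A.ev f" if "f \<in> mpols {..<n}" for f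
    using that
  proof (induction rule: mpol_induct)
    case (var v)
    then have v: "v < n" "(0, v) \<in> ?V" by (auto simp: prol_vars_def)
    have "Y.ev (mvar (0, v)) = y (0, v)" by (rule Y.ev_var[OF v(2)])
    also have "\<dots> = a v" using \<delta>0[OF aL[OF v(1)]] by (simp add: y_def)
    finally show ?case using var by (simp add: mp_eval_ring_simps)
  next
    case (add f g)
    then show ?case
      by (simp add: mp_eval_ring_simps A.ev_add, subst Y.ev_add)
        (auto intro!: mpols_subst[of _ "{..<n}"] mpols_var simp: prol_vars_def)
  next
    case (mult f g)
    then show ?case
      by (simp add: mp_eval_ring_simps A.ev_mult, subst Y.ev_mult)
        (auto intro!: mpols_subst[of _ "{..<n}"] mpols_var simp: prol_vars_def)
  qed (simp add: mp_eval_ring_simps)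
  have lowV: "mp_eval mconst (\<lambda>i. mvar (0, i)) f \<in> mpols ?V" if "f \<in> mpols {..<n}" for f :: "(nat, 'a) mpol"
    by (rule mpols_subst[OF that]) (auto simp: prol_vars_def intro!: mpols_var)
  have "prol_poly \<D> \<iota> \<Delta> n f j \<in> J" if f: "f \<in> I" and j: "j \<in> I\<^sub>\<D>" for f j
  proof -
    have fN: "f \<in> mpols {..<n}" "A.ev f = \<zero>\<^bsub>L\<^esub>" using f by (auto simp: I_def)
    have "Y.ev (prol_poly \<D> \<iota> \<Delta> n f j) = mp_eval_in ?T (kap e) (\<lambda>i. \<lambda>j\<in>I\<^sub>\<D>. y (j, i)) f j"
      by (rule prol_poly_eval[OF L.is_cring e yL fN(1) j])
    also have "mp_eval_in ?T (kap e) (\<lambda>i. \<lambda>j\<in>I\<^sub>\<D>. y (j, i)) f = mp_eval_in ?T (kap e) (\<delta> \<circ> a) f"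
    proof (rule mp_eval_in_cong[OF _ fN(1) T _ kap_hom[OF L.is_cring e]])
      fix i assume "i \<in> {..<n}"
      then show "(\<lambda>j\<in>I\<^sub>\<D>. y (j, i)) = (\<delta> \<circ> a) i"
        using \<delta>T[OF aL] by (auto simp: y_def base_change_sel PiE_iff restrict_def fun_eq_iff extensional_def)
    next
      show "(\<lambda>i. \<lambda>j\<in>I\<^sub>\<D>. y (j, i)) \<in> {..<n} \<rightarrow> carrier ?T" using \<delta>c aL by (auto simp: base_change_sel y_def)
    qed
    also have "kap e = \<delta> \<circ> e" by (simp add: fun_eq_iff \<delta>_kap)
    also have "mp_eval_in ?T (\<delta> \<circ> e) (\<delta> \<circ> a) f = \<delta> (A.ev f)"
      by (rule mp_eval_in_compose_hom[OF A.mp_evaluation_axioms T \<delta> fN(1), symmetric])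
    also have "\<delta> (A.ev f) = \<zero>\<^bsub>?T\<^esub>"
      unfolding fN(2) by (rule Ring.ring_hom_zero[OF \<delta> L.ring_axioms cring.axioms(1)[OF T]])
    also have "\<zero>\<^bsub>?T\<^esub> j = \<zero>\<^bsub>L\<^esub>" using j by (simp add: base_change_sel)
    finally show ?thesis using prol_poly_closed[OF fN(1) j] by (simp add: J_def)
  qed
  then have sub: "prol_ideal \<D> \<iota> \<Delta> n I \<subseteq> J"
    using prol_ideal_subset_iff[OF primeideal_mpolD(1)[OF irreducible_varietyD(2)[OF J]] irreducible_varietyD(4)[OF I]] by blast
  have "prol_proj n J = I"
    using low lowV by (auto simp: prol_proj_def J_def I_def)
  moreover have "J \<in> topspace (zariski ?V J)" using irreducible_varietyD(2)[OF J] by (simp add: topspace_zariski)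
  ultimately have "I \<in> prol_proj n ` topspace (zariski ?V J)" by blast
  then have dom: "zariski_dense_in {..<n} I (prol_proj n ` topspace (zariski ?V J))"
    unfolding zariski_dense_in_iff[OF irreducible_varietyD(2)[OF I]] using irreducible_varietyD(2)[OF I] by blast
  \<comment> \<open>The point \<open>y\<close> over \<open>L\<close> satisfies the finitely many
    conditions of a triangular presentation of \<open>J\<close>. Existential closedness as a field
    supplies a point over \<open>K\<close> satisfying them, and such a point is smooth.\<close>
  have smooth: "has_smooth_rational_point ?V J"
  proof -
    have "\<exists>vs. set vs = ?V \<and> distinct vs" by (rule finite_distinct_list[OF finite_prol_vars])
    then obtain vs where vs: "set vs = ?V" "distinct vs" by (elim exE conjE)
    have "primeideal J (mpol_ring (set vs))" using irreducible_varietyD(2)[OF J] by (simp add: vs(1))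
    then obtain P h where "tri_pres (set vs) J (list_ord vs) (algebraic_vars J vs) P h"
      by (rule tri_pres_list[OF _ vs(2)]) (rule that)
    then have tri: "tri_pres ?V J (list_ord vs) (algebraic_vars J vs) P h" unfolding vs(1) .
    let ?S = "algebraic_vars J vs"
    define m where "m = Suc (len \<D>) * n"
    let ?ren = "mp_eval mconst (\<lambda>v. mvar (prol_code n v)) :: (nat \<times> nat, 'a) mpol \<Rightarrow> (nat, 'a) mpol"
    define z where "z q = y (prol_decode n q)" for q
    have zL: "z q \<in> carrier L" if "q < m" for q
      using prol_decode(1)[of q n] that yL by (auto simp: z_def m_def)
    have renN: "?ren f \<in> mpols {..<m}" if "f \<in> mpols ?V" for f
      by (rule mpols_subst[OF that]) (use prol_code(1) in \<open>auto simp: m_def intro!: mpols_var\<close>)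
    have ren_ev: "mp_eval_in L e z (?ren f) = Y.ev f" if f: "f \<in> mpols ?V" for f
    proof -
      interpret Z: mp_evaluation L e z "{..<m}" by (rule mp_evaluationI[OF L.is_cring e]) (use zL in auto)
      show ?thesis using f
      proof (induction rule: mpol_induct)
        case (var v)
        have "mp_eval_in L e z (mvar (prol_code n v)) = z (prol_code n v)"
          by (rule Z.ev_var) (use prol_code(1)[OF var] in \<open>simp add: m_def\<close>)
        also have "\<dots> = y v" using prol_code(2)[OF var] by (simp add: z_def)
        finally show ?case using var by (simp add: mp_eval_ring_simps)
      next
        case (add f g)
        then show ?case by (simp add: mp_eval_ring_simps Y.ev_add Z.ev_add renN)
      next
        case (mult f g)
        then show ?case by (simp add: mp_eval_ring_simps Y.ev_mult Z.ev_mult renN)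
      qed (simp add: mp_eval_ring_simps)
    qed
    have PJ: "P v \<in> mpols ?V" "Y.ev (P v) = \<zero>\<^bsub>L\<^esub>" if "v \<in> ?S" for v
      using tri that by (auto simp: tri_pres_def J_def)
    have hJ: "h \<in> mpols ?V" "Y.ev h \<noteq> \<zero>\<^bsub>L\<^esub>" using tri by (auto simp: tri_pres_def J_def)
    have finS: "finite ?S" by (simp add: algebraic_vars_def)
    obtain x where x: "\<And>f. f \<in> ?ren ` P ` ?S \<Longrightarrow> mp_eval id x f = 0" "mp_eval id x (?ren h) \<noteq> 0"
      by (rule ex_closed_field_solve[OF ecf L.is_cring e, of "?ren ` P ` ?S" m "?ren h" z])
        (use PJ hJ finS renN ren_ev zL in auto)
    define x' where "x' = (\<lambda>v\<in>?V. x (prol_code n v))"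
    have ev': "mp_eval id x' f = mp_eval id x (?ren f)" if "f \<in> mpols ?V" for f
      unfolding mp_eval_subst[OF type_hom_id(1)] mp_eval_var[OF type_hom_id(1)]
      by (rule mp_eval_cong[OF type_hom_id(1) that]) (simp add: x'_def)
    have x'h: "mp_eval id x' h \<noteq> 0" using x(2) ev'[OF hJ(1)] by simp
    have x'J: "mp_eval id x' f = 0" if "f \<in> J" for f
      by (rule tri_pres_zero[OF tri type_hom_id(1) x'h _ that]) (use x(1) ev' PJ in auto)
    then have "x' \<in> rational_points ?V J" by (auto simp: rational_points_def points_def x'_def)
    moreover have "smooth_at id ?V J x'"
      by (rule tri_pres_smooth_at[OF tri irreducible_varietyD(2,1)[OF J] type_hom_id(1) x'J x'h])
    ultimately show ?thesis by (auto simp: has_smooth_rational_point_def)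
  qed
  have Yv: "Y.ev (mvar (j, i)) = \<delta> (a i) j" if "(j, i) \<in> ?V" for j i
    by (rule trans[OF Y.ev_var[OF that]]) (simp add: y_def)
  \<comment> \<open>Pairs of subterms with different values. The product \<open>q\<close> of the
    corresponding differences is not in the prime \<open>J\<close>; requiring it to be nonzero at
    \<open>\<nabla>(a')\<close> preserves inequations, hence negated formulas.\<close>
  define D where "D = {(i, k). i < n \<and> k < n \<and> a i \<noteq> a k}"
  have finD: "finite D" by (rule finite_subset[of _ "{..<n} \<times> {..<n}"]) (auto simp: D_def)
  define q where "q = (\<Prod>(i, k)\<in>D. mvar (0, i) - mvar (0, k) :: (nat \<times> nat, 'a) mpol)"
  note prJ = primeideal_mpolD[OF irreducible_varietyD(2)[OF J]] and idJ = ideal_mpolD[OF primeideal_mpolD(1)[OF irreducible_varietyD(2)[OF J]]]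
  have dV: "(mvar (0, i) - mvar (0, k) :: (nat \<times> nat, 'a) mpol) \<in> mpols ?V" if "i < n" "k < n" for i k
    by (intro mpols_minus mpols_var) (use that in \<open>auto simp: prol_vars_def\<close>)
  have nD: "mvar (0, i) - mvar (0, k) \<notin> J" if "(i, k) \<in> D" for i k
  proof
    assume d: "mvar (0, i) - mvar (0, k) \<in> J"
    have ik: "i < n" "k < n" "a i \<noteq> a k" using that by (auto simp: D_def)
    have vV: "mvar (0, i) \<in> mpols ?V" "mvar (0, k) \<in> mpols ?V" "(0, i) \<in> ?V" "(0, k) \<in> ?V"
      using ik by (auto simp: prol_vars_def intro!: mpols_var)
    have "Y.ev (mvar (0, i)) = Y.ev (mvar (0, i) - mvar (0, k)) \<oplus>\<^bsub>L\<^esub> Y.ev (mvar (0, k))"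
      using Y.ev_add[OF dV[OF ik(1,2)] vV(2)] by simp
    also have "\<dots> = Y.ev (mvar (0, k))" using d Y.ev_closed[OF vV(2)] by (simp add: J_def)
    finally show False
      using ik(3) \<delta>0[OF aL[OF ik(1)]] \<delta>0[OF aL[OF ik(2)]] unfolding Yv[OF vV(3)] Yv[OF vV(4)] by simp
  qed
  have "(\<Prod>(i, k)\<in>D'. mvar (0, i) - mvar (0, k)) \<notin> J \<and> (\<Prod>(i, k)\<in>D'. mvar (0, i) - mvar (0, k) :: (nat \<times> nat, 'a) mpol) \<in> mpols ?V"
    if "D' \<subseteq> D" for D'
  proof -
    have "finite D'" using that finD finite_subset by blast
    then show ?thesis using that
    proof (induction D' rule: finite_induct)
      case (insert d D')
      obtain i k where d: "d = (i, k)" "i < n" "k < n" using insert by (auto simp: D_def)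
      show ?case
        using insert d dV[OF d(2,3)] prJ(3)[OF dV[OF d(2,3)]] nD[of i k]
        by (auto intro!: mpols_mult)
    qed (use prJ(2) in simp)
  qed
  from this[of D] have q: "q \<notin> J" "q \<in> mpols ?V" by (auto simp: q_def)
  obtain a' where a': "a' \<in> rational_points {..<n} I" "J \<subseteq> point_ideal ?V (nabla \<D> \<Delta> n a')"
    "q \<notin> point_ideal ?V (nabla \<D> \<Delta> n a')"
    by (rule UC_point[OF UC I J sub dom smooth q(2,1)])
  \<comment> \<open>Equations between values of subterms pass to \<open>a'\<close> because
    \<open>a'\<close> lies on the locus of \<open>a\<close>. Equations involving an operator pass in
    the same way in \<open>specJ\<close>, because \<open>\<nabla>(a')\<close> lies on the locus of
    \<open>y\<close>.\<close>
  have specI: "mp_eval id a' f = mp_eval id a' g" if fg: "f \<in> mpols {..<n}" "g \<in> mpols {..<n}" "A.ev f = A.ev g" for f g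
  proof -
    have m: "f - g \<in> mpols {..<n}" using fg by (auto intro: mpols_minus)
    have "A.ev (f - g) \<oplus>\<^bsub>L\<^esub> A.ev g = A.ev g" using A.ev_add[OF m fg(2)] fg(3) by simp
    then have "A.ev (f - g) = \<zero>\<^bsub>L\<^esub>" using A.ev_closed[OF m] A.ev_closed[OF fg(2)]
      by (metis L.add.r_cancel_one)
    then have "f - g \<in> I" using m by (simp add: I_def)
    then have "mp_eval id a' (f - g) = 0" using a'(1) by (auto simp: rational_points_def points_def)
    then show ?thesis by (simp add: mp_eval_ring_simps)
  qed
  have inj: "a i = a k" if ik: "i < n" "k < n" "a' i = a' k" for i k
  proof (rule ccontr)
    assume "a i \<noteq> a k"
    then have D: "(i, k) \<in> D" using ik by (simp add: D_def)
    have "mp_eval id (nabla \<D> \<Delta> n a') q =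
        (\<Prod>(i, k)\<in>D. mp_eval id (nabla \<D> \<Delta> n a') (mvar (0, i) - mvar (0, k)))"
      unfolding q_def mp_eval_prod[OF type_hom_id(1)] by (simp add: case_prod_unfold)
    also have "\<dots> = 0"
      using D ik finD by (intro prod_zero) (auto intro!: bexI[of _ "(i, k)"] simp: mp_eval_ring_simps nabla_def prol_vars_def)
    finally show False using a'(3) q(2) by (simp add: point_ideal_def)
  qed
  have specJ: "\<Delta> (a' k) j = a' i" if ik: "i < n" "k < n" "j \<in> {1..len \<D>}" "a i = \<delta> (a k) j" for i k j
  proof -
    have V: "(0, i) \<in> ?V" "(j, k) \<in> ?V" using ik by (auto simp: prol_vars_def)
    have m: "(mvar (0, i) - mvar (j, k) :: (nat \<times> nat, 'a) mpol) \<in> mpols ?V"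
      by (intro mpols_minus mpols_var V)
    have "Y.ev (mvar (0, i) - mvar (j, k)) \<oplus>\<^bsub>L\<^esub> Y.ev (mvar (j, k)) = Y.ev (mvar (0, i))"
      using Y.ev_add[OF m mpols_var[OF V(2)]] by simp
    also have "\<dots> = Y.ev (mvar (j, k))"
      unfolding Yv[OF V(1)] Yv[OF V(2)] using \<delta>0[OF aL[OF ik(1)]] ik(4) by simp
    finally have "Y.ev (mvar (0, i) - mvar (j, k)) = \<zero>\<^bsub>L\<^esub>"
      using Y.ev_closed[OF m] Y.ev_closed[OF mpols_var[OF V(2)]] by (metis L.add.r_cancel_one)
    then have "mvar (0, i) - mvar (j, k) \<in> J" using m by (simp add: J_def)
    then have "mp_eval id (nabla \<D> \<Delta> n a') (mvar (0, i) - mvar (j, k)) = 0" using a'(2) by (auto simp: point_ideal_def)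
    then show ?thesis using V ik by (simp add: mp_eval_ring_simps nabla_def)
  qed
  \<comment> \<open>Quantified variables that do not occur in the formula receive the default value
    0; parameters keep their values.\<close>
  define \<tau> where "\<tau> v = (if v \<in> V then if TVar v \<in> set ts then a' (ix (TVar v)) else 0 else \<rho> v)" for v
  let ?K = "ring_of_type_algebra :: 'a ring"
  have a_ix: "a (ix t) = val t" if "t \<in> set ts" for t using ix[OF that] by (simp add: a_def)
  have mv: "mvar (ix t) \<in> (mpols {..<n} :: (nat, 'a) mpol set)" if "t \<in> set ts" for t
    using ix[OF that] by (intro mpols_var) simp
  have A_ix: "A.ev (mvar (ix t)) = val t" if "t \<in> set ts" for t
    using ix[OF that] a_ix[OF that] by simp
  have valK: "term_val ?K \<iota> (\<lambda>j r. \<Delta> r j) \<tau> t = a' (ix t)" if "t \<in> set ts" for t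
    using that
  proof (induction t)
    case (TVar v)
    show ?case
    proof (cases "v \<in> V")
      case False
      then have "A.ev (mvar (ix (TVar v))) = A.ev (mconst (\<rho> v))" using A_ix[OF TVar] \<sigma>(2) by (simp add: val_def)
      from specI[OF mv[OF TVar] mpols_const this] False show ?thesis by (simp add: \<tau>_def mp_eval_ring_simps)
    qed (use TVar in \<open>simp add: \<tau>_def\<close>)
  next
    case TZero
    have "A.ev (mvar (ix TZero)) = A.ev 0" using A_ix[OF TZero] by (simp add: val_def)
    from specI[OF mv[OF TZero] mpols_0 this] show ?case by (simp add: mp_eval_ring_simps)
  next
    case TOne
    have "A.ev (mvar (ix TOne)) = A.ev 1" using A_ix[OF TOne] by (simp add: val_def)
    from specI[OF mv[OF TOne] mpols_1 this] show ?case by (simp add: mp_eval_ring_simps)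
  next
    case (TConst k)
    have "A.ev (mvar (ix (TConst k))) = A.ev (mconst (\<iota> k))" using A_ix[OF TConst] by (simp add: val_def)
    from specI[OF mv[OF TConst] mpols_const this] show ?case by (simp add: mp_eval_ring_simps)
  next
    case (TPlus s t)
    have st: "s \<in> set ts" "t \<in> set ts"
      using qf_subterms_trans[of "TPlus s t" \<phi>] TPlus.prems ts(1) subterms_refl[of s] subterms_refl[of t] by auto
    have "A.ev (mvar (ix (TPlus s t))) = A.ev (mvar (ix s) + mvar (ix t))"
      using A_ix[OF TPlus.prems] A_ix[OF st(1)] A_ix[OF st(2)] A.ev_add[OF mv[OF st(1)] mv[OF st(2)]] by (simp add: val_def)
    from specI[OF mv[OF TPlus.prems] mpols_add[OF mv[OF st(1)] mv[OF st(2)]] this] TPlus.IH st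
    show ?case by (simp add: mp_eval_ring_simps)
  next
    case (TMinus s t)
    have st: "s \<in> set ts" "t \<in> set ts"
      using qf_subterms_trans[of "TMinus s t" \<phi>] TMinus.prems ts(1) subterms_refl[of s] subterms_refl[of t] by auto
    have cl: "val s \<in> carrier L" "val t \<in> carrier L" using val_closed st ts(1) by auto
    have "val (TMinus s t) \<oplus>\<^bsub>L\<^esub> val t = val s" using cl by (simp add: val_def L.minus_eq L.a_assoc L.l_neg)
    then have "A.ev (mvar (ix (TMinus s t)) + mvar (ix t)) = A.ev (mvar (ix s))"
      using A_ix[OF TMinus.prems] A_ix[OF st(1)] A_ix[OF st(2)] A.ev_add[OF mv[OF TMinus.prems] mv[OF st(2)]] by simp
    from specI[OF mpols_add[OF mv[OF TMinus.prems] mv[OF st(2)]] mv[OF st(1)] this] TMinus.IH st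
    show ?case by (simp add: mp_eval_ring_simps minus_of_type algebra_simps)
  next
    case (TTimes s t)
    have st: "s \<in> set ts" "t \<in> set ts"
      using qf_subterms_trans[of "TTimes s t" \<phi>] TTimes.prems ts(1) subterms_refl[of s] subterms_refl[of t] by auto
    have "A.ev (mvar (ix (TTimes s t))) = A.ev (mvar (ix s) * mvar (ix t))"
      using A_ix[OF TTimes.prems] A_ix[OF st(1)] A_ix[OF st(2)] A.ev_mult[OF mv[OF st(1)] mv[OF st(2)]] by (simp add: val_def)
    from specI[OF mv[OF TTimes.prems] mpols_mult[OF mv[OF st(1)] mv[OF st(2)]] this] TTimes.IH st
    show ?case by (simp add: mp_eval_ring_simps)
  next
    case (TOp j t)
    have st: "t \<in> set ts"
      using qf_subterms_trans[of "TOp j t" \<phi>] TOp.prems ts(1) subterms_refl[of t] by auto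
    have j: "j \<in> {1..len \<D>}" using qf_subterms_ops[of "TOp j t" \<phi>] TOp.prems ts(1) ops by auto
    have "\<Delta> (a' (ix t)) j = a' (ix (TOp j t))"
      by (rule specJ) (use ix TOp.prems st j a_ix[OF TOp.prems] a_ix[OF st] in \<open>auto simp: val_def\<close>)
    then show ?case using TOp.IH st by simp
  qed
  have eq_iff: "val s = val t \<longleftrightarrow> term_val ?K \<iota> (\<lambda>j r. \<Delta> r j) \<tau> s = term_val ?K \<iota> (\<lambda>j r. \<Delta> r j) \<tau> t"
    if st: "s \<in> set ts" "t \<in> set ts" for s t
  proof
    assume "val s = val t"
    then have "A.ev (mvar (ix s)) = A.ev (mvar (ix t))" using A_ix st by simp
    from specI[OF mv[OF st(1)] mv[OF st(2)] this] show "term_val ?K \<iota> (\<lambda>j r. \<Delta> r j) \<tau> s = term_val ?K \<iota> (\<lambda>j r. \<Delta> r j) \<tau> t"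
      using valK st by (simp add: mp_eval_ring_simps)
  next
    assume "term_val ?K \<iota> (\<lambda>j r. \<Delta> r j) \<tau> s = term_val ?K \<iota> (\<lambda>j r. \<Delta> r j) \<tau> t"
    then have "a (ix s) = a (ix t)" using valK st ix by (intro inj) auto
    then show "val s = val t" using a_ix st by simp
  qed
  have "qf_sat ?K \<iota> (\<lambda>j r. \<Delta> r j) \<tau> \<psi> \<longleftrightarrow> qf_sat L (e \<circ> \<iota>) (\<lambda>j r. \<delta> r j) \<sigma> \<psi>" if "qf_subterms \<psi> \<subseteq> set ts" for \<psi>
    using that
  proof (induction \<psi>)
    case (QEq s t)
    then have "s \<in> set ts" "t \<in> set ts" using subterms_refl[of s] subterms_refl[of t] by auto
    from eq_iff[OF this] show ?case by (auto simp: val_def comp_def)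
  qed auto
  then have "qf_sat ?K \<iota> (\<lambda>j r. \<Delta> r j) \<tau> \<phi>" using \<sigma>(3) ts(1) by simp
  then show "\<exists>\<tau>. range \<tau> \<subseteq> carrier ?K \<and> (\<forall>v. v \<notin> V \<longrightarrow> \<tau> v = \<rho> v) \<and> qf_sat ?K \<iota> (\<lambda>j r. \<Delta> r j) \<tau> \<phi>"
    by (intro exI[of _ \<tau>]) (auto simp: \<tau>_def)
qed

end

section \<open>The function field of a D-variety\<close>

lemma pairing:
  obtains p :: "'a::field_char_0 \<times> 'a \<Rightarrow> 'a" where "inj p"
proof -
  have "\<exists>p :: 'a \<times> 'a \<Rightarrow> 'a. bij_betw p (UNIV \<times> UNIV) UNIV"
    unfolding card_of_ordIso by (rule card_of_Times_same_infinite[OF infinite_UNIV_char_0])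
  then obtain p :: "'a \<times> 'a \<Rightarrow> 'a" where "bij_betw p (UNIV \<times> UNIV) UNIV" by blast
  then have "inj p" by (auto dest: bij_betw_imp_inj_on)
  then show ?thesis by (rule that)
qed

primrec list_code :: "('a \<times> 'a \<Rightarrow> 'a) \<Rightarrow> 'a list \<Rightarrow> 'a::zero" where
  "list_code p [] = 0"
| "list_code p (x # xs) = p (x, list_code p xs)"

lemma list_code_inject:
  "length xs = length ys \<Longrightarrow> inj p \<Longrightarrow> list_code p xs = list_code p ys \<Longrightarrow> xs = ys"
  by (induction xs ys rule: list_induct2) (auto dest: injD)

text \<open>An infinite field is equinumerous with its square, so finite lists over it, and with
  them polynomials in finitely many variables, can be coded by its elements. Exponents and lengths
  are coded by natural numbers, which embed in characteristic 0.\<close>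

lemma mpols_code:
  obtains cd :: "(nat, 'a::field_char_0) mpol \<Rightarrow> 'a" where "inj_on cd (mpols {..<n})"
proof -
  obtain p :: "'a \<times> 'a \<Rightarrow> 'a" where p: "inj p" by (rule pairing)
  define mc where "mc m = list_code p (map (\<lambda>v. of_nat (Poly_Mapping.lookup m v)) [0..<n])" for m :: "nat \<Rightarrow>\<^sub>0 nat"
  have mc: "m = m'" if m: "mc m = mc m'" "Poly_Mapping.keys m \<subseteq> {..<n}" "Poly_Mapping.keys m' \<subseteq> {..<n}" for m m'
  proof (rule poly_mapping_eqI)
    fix v
    have "map (\<lambda>v. of_nat (Poly_Mapping.lookup m v)) [0..<n] = map (\<lambda>v. of_nat (Poly_Mapping.lookup m' v) :: 'a) [0..<n]"
      by (rule list_code_inject[OF _ p]) (use m(1) in \<open>simp_all add: mc_def\<close>)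
    then have "Poly_Mapping.lookup m v = Poly_Mapping.lookup m' v" if "v < n" using that by simp
    moreover have "Poly_Mapping.lookup m v = 0 \<and> Poly_Mapping.lookup m' v = 0" if "\<not> v < n"
      using that m(2,3) by (auto simp: in_keys_iff subset_iff)
    ultimately show "Poly_Mapping.lookup m v = Poly_Mapping.lookup m' v" by metis
  qed
  define ls :: "(nat, 'a) mpol \<Rightarrow> (nat \<Rightarrow>\<^sub>0 nat) list" where "ls f = (SOME ks. set ks = Poly_Mapping.keys f)" for f
  have ls: "set (ls f) = Poly_Mapping.keys f" for f
    unfolding ls_def by (rule someI_ex) (rule finite_list, simp)
  \<comment> \<open>Each entry carries its monomial together with its coefficient, so the list
    determines the polynomial whatever order of the monomials \<open>ls\<close> has chosen.\<close>
  define F where "F f = map (\<lambda>m. p (mc m, Poly_Mapping.lookup f m)) (ls f)" for f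
  \<comment> \<open>The length is recorded separately because \<open>list_code\<close> is injective
    only on lists of equal length: 0, the code of the empty list, may also be a value of
    \<open>p\<close>.\<close>
  define cd where "cd f = p (of_nat (length (F f)), list_code p (F f))" for f
  have sub: "Poly_Mapping.lookup f m = Poly_Mapping.lookup g m"
    if fg: "F f = F g" "f \<in> mpols {..<n}" "g \<in> mpols {..<n}" and m: "m \<in> Poly_Mapping.keys f" for f g m
  proof -
    have "p (mc m, Poly_Mapping.lookup f m) \<in> set (F g)" unfolding fg(1)[symmetric] using m ls by (auto simp: F_def)
    then obtain m' where m': "m' \<in> Poly_Mapping.keys g" "p (mc m, Poly_Mapping.lookup f m) = p (mc m', Poly_Mapping.lookup g m')"
      using ls by (auto simp: F_def)
    from injD[OF p m'(2)] have eq: "mc m = mc m'" "Poly_Mapping.lookup f m = Poly_Mapping.lookup g m'" by auto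
    have "m = m'" by (rule mc[OF eq(1)]) (use fg m m'(1) in \<open>auto simp: mpols_def\<close>)
    then show ?thesis using eq(2) by simp
  qed
  have "inj_on cd (mpols {..<n})"
  proof (rule inj_onI)
    fix f g assume fg: "f \<in> mpols {..<n}" "g \<in> mpols {..<n}" "cd f = cd g"
    from injD[OF p fg(3)[unfolded cd_def]]
    have "length (F f) = length (F g)" "list_code p (F f) = list_code p (F g)" by auto
    then have FF: "F f = F g" using list_code_inject p by blast
    show "f = g"
    proof (rule poly_mapping_eqI)
      fix m
      show "Poly_Mapping.lookup f m = Poly_Mapping.lookup g m"
      proof (cases "m \<in> Poly_Mapping.keys f \<or> m \<in> Poly_Mapping.keys g")
        case True
        then show ?thesis using sub[OF FF fg(1,2), of m] sub[OF FF[symmetric] fg(2,1), of m] by auto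
      qed (simp add: in_keys_iff)
    qed
  qed
  then show ?thesis by (rule that)
qed

text \<open>A fraction is coded by the codes of a chosen numerator and denominator. The function
  field of a variety is thereby no larger than the base field.\<close>

lemma Loc_code:
  fixes c :: "'a::field_char_0 \<Rightarrow> 'f::field" and b :: "nat \<Rightarrow> 'f"
  assumes "localisation c {..<n} b M"
  obtains enc :: "'f \<Rightarrow> 'a" where "inj_on enc (carrier (localisation.Loc c {..<n} b M))"
proof -
  interpret L: localisation c "{..<n}" b M by fact
  obtain p :: "'a \<times> 'a \<Rightarrow> 'a" where p: "inj p" by (rule pairing)
  obtain cd :: "(nat, 'a) mpol \<Rightarrow> 'a" where cd: "inj_on cd (mpols {..<n})" by (rule mpols_code)
  have "\<forall>x\<in>carrier L.Loc. \<exists>fg. fst fg \<in> mpols {..<n} \<and> snd fg \<in> mpols {..<n} \<and> x = L.evb (fst fg) / L.evb (snd fg)"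
  proof
    fix x assume "x \<in> carrier L.Loc"
    then obtain f g where "f \<in> mpols {..<n}" "g \<in> M" "x = L.evb f / L.evb g" by auto
    then show "\<exists>fg. fst fg \<in> mpols {..<n} \<and> snd fg \<in> mpols {..<n} \<and> x = L.evb (fst fg) / L.evb (snd fg)"
      using L.M(1) by (intro exI[of _ "(f, g)"]) auto
  qed
  from bchoice[OF this] obtain r where "\<forall>x\<in>carrier L.Loc.
      fst (r x) \<in> mpols {..<n} \<and> snd (r x) \<in> mpols {..<n} \<and> x = L.evb (fst (r x)) / L.evb (snd (r x))" ..
  then have r: "\<And>x. x \<in> carrier L.Loc \<Longrightarrow>
      fst (r x) \<in> mpols {..<n} \<and> snd (r x) \<in> mpols {..<n} \<and> x = L.evb (fst (r x)) / L.evb (snd (r x))" by (rule bspec)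
  have "inj_on (\<lambda>x. p (cd (fst (r x)), cd (snd (r x)))) (carrier L.Loc)"
  proof (rule inj_onI)
    fix x y assume x: "x \<in> carrier L.Loc" and y: "y \<in> carrier L.Loc"
      and eq: "p (cd (fst (r x)), cd (snd (r x))) = p (cd (fst (r y)), cd (snd (r y)))"
    from injD[OF p eq] have "cd (fst (r x)) = cd (fst (r y))" "cd (snd (r x)) = cd (snd (r y))" by auto
    then have "fst (r x) = fst (r y)" "snd (r x) = snd (r y)" using inj_onD[OF cd] r[OF x] r[OF y] by blast+
    then show "x = y" using r[OF x] r[OF y] by simp
  qed
  then show ?thesis by (rule that)
qed

section \<open>Specialising quantifier-free formulas from a generic point\<close>

lemma term_val_hom:
  fixes R :: "'r ring" and S :: "'s ring"
  assumes R: "cring R" and S: "cring S" and h: "h \<in> ring_hom R S" and \<sigma>: "\<And>v. \<sigma> v \<in> carrier R"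
    and t: "set1_rterm t = {}" "set2_rterm t = {}"
  shows "term_val R \<kappa> F \<sigma> t \<in> carrier R \<and> term_val S \<kappa>' G (h \<circ> \<sigma>) t = h (term_val R \<kappa> F \<sigma> t)"
proof -
  interpret R: cring R by fact
  interpret S: cring S by fact
  interpret h: ring_hom_cring R S h
    by (intro ring_hom_cring.intro ring_hom_cring_axioms.intro R S h)
  show ?thesis using t by (induction t) (auto simp: \<sigma> a_minus_def)
qed

lemma qf_sat_hom:
  fixes R :: "'r ring" and S :: "'s ring"
  assumes R: "cring R" and S: "cring S" and h: "h \<in> ring_hom R S" and inj: "inj_on h (carrier R)"
    and \<sigma>: "\<And>v. \<sigma> v \<in> carrier R" and \<phi>: "qf_consts \<phi> = {}" "qf_ops \<phi> = {}"
  shows "qf_sat S \<kappa>' G (h \<circ> \<sigma>) \<phi> \<longleftrightarrow> qf_sat R \<kappa> F \<sigma> \<phi>"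
  using \<phi>
proof (induction \<phi>)
  case (QEq s t)
  then have "set1_rterm s = {}" "set2_rterm s = {}" "set1_rterm t = {}" "set2_rterm t = {}" by auto
  with term_val_hom[where \<sigma> = \<sigma> and t = s and \<kappa> = \<kappa> and F = F and \<kappa>' = \<kappa>' and G = G, OF R S h \<sigma>] term_val_hom[where \<sigma> = \<sigma> and t = t and \<kappa> = \<kappa> and F = F and \<kappa>' = \<kappa>' and G = G, OF R S h \<sigma>]
  show ?case by (auto simp: inj_on_eq_iff[OF inj] comp_def)
qed auto

text \<open>The fraction is never reduced, so its denominator is a product of denominators of
  variables. Where that product is nonzero, all intermediate denominators are nonzero too, and
  evaluating the term commutes with evaluating numerator and denominator.\<close>

primrec term_frac ::
    "(nat \<Rightarrow> ('v, 'a::comm_ring_1) mpol \<times> ('v, 'a) mpol) \<Rightarrow> ('k, 'o) rterm \<Rightarrow> ('v, 'a) mpol \<times> ('v, 'a) mpol" where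
  "term_frac r (TVar v) = r v"
| "term_frac r TZero = (0, 1)"
| "term_frac r TOne = (1, 1)"
| "term_frac r (TConst a) = (0, 1)"
| "term_frac r (TPlus s t) = (fst (term_frac r s) * snd (term_frac r t) + fst (term_frac r t) * snd (term_frac r s),
     snd (term_frac r s) * snd (term_frac r t))"
| "term_frac r (TMinus s t) = (fst (term_frac r s) * snd (term_frac r t) - fst (term_frac r t) * snd (term_frac r s),
     snd (term_frac r s) * snd (term_frac r t))"
| "term_frac r (TTimes s t) = (fst (term_frac r s) * fst (term_frac r t), snd (term_frac r s) * snd (term_frac r t))"
| "term_frac r (TOp f t) = term_frac r t"

lemma term_frac_val:
  fixes c :: "'a::field \<Rightarrow> 'b::field"
  assumes c: "type_hom c" and t: "set1_rterm t = {}" "set2_rterm t = {}"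
    and d: "mp_eval c x (snd (term_frac r t)) \<noteq> 0"
  shows "term_val ring_of_type_algebra \<kappa> F (\<lambda>v. mp_eval c x (fst (r v)) / mp_eval c x (snd (r v))) t =
    mp_eval c x (fst (term_frac r t)) / mp_eval c x (snd (term_frac r t))"
  using t d by (induction t) (auto simp: mp_eval_ring_simps[OF c] minus_of_type add_frac_eq diff_frac_eq)

lemma term_frac_mpols:
  fixes c :: "'a::field \<Rightarrow> 'b::field"
  assumes c: "type_hom c"
    and r: "\<And>v. fst (r v) \<in> mpols N \<and> snd (r v) \<in> mpols N \<and> mp_eval c b (snd (r v)) \<noteq> 0"
  shows "fst (term_frac r t) \<in> mpols N \<and> snd (term_frac r t) \<in> mpols N \<and> mp_eval c b (snd (term_frac r t)) \<noteq> 0"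
  by (induction t) (use r in \<open>auto simp: mp_eval_ring_simps[OF c] intro: mpols_add mpols_mult mpols_minus\<close>)

text \<open>An equation between fractions says that the cross difference \<open>D\<close> vanishes.
  If \<open>D\<close> vanishes at the generic point, it vanishes on the whole variety; otherwise
  \<open>D\<close> is made a factor of \<open>h\<close>. In both cases truth at \<open>x\<close> is
  equivalent to truth at the generic point, and because this is an equivalence it passes through
  negations.\<close>

lemma qf_specialise:
  fixes c :: "'a::field \<Rightarrow> 'b::field" and r :: "nat \<Rightarrow> ('v, 'a) mpol \<times> ('v, 'a) mpol"
  assumes c: "type_hom c"
    and r: "\<And>v. fst (r v) \<in> mpols N \<and> snd (r v) \<in> mpols N \<and> mp_eval c b (snd (r v)) \<noteq> 0"
    and \<phi>: "qf_consts \<phi> = {}" "qf_ops \<phi> = {}"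
  shows "\<exists>h. h \<in> mpols N \<and> mp_eval c b h \<noteq> 0 \<and>
    (\<forall>x. (\<forall>f\<in>vanishing_ideal c N b. mp_eval id x f = 0) \<and> mp_eval id x h \<noteq> 0 \<longrightarrow>
      (qf_sat ring_of_type_algebra \<kappa> F (\<lambda>v. mp_eval id x (fst (r v)) / mp_eval id x (snd (r v))) \<phi> \<longleftrightarrow>
       qf_sat ring_of_type_algebra \<kappa>' F' (\<lambda>v. mp_eval c b (fst (r v)) / mp_eval c b (snd (r v))) \<phi>))"
proof -
  define Q where "Q h \<phi> \<longleftrightarrow> h \<in> mpols N \<and> mp_eval c b h \<noteq> 0 \<and>
    (\<forall>x. (\<forall>f\<in>vanishing_ideal c N b. mp_eval id x f = 0) \<and> mp_eval id x h \<noteq> 0 \<longrightarrow>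
      (qf_sat ring_of_type_algebra \<kappa> F (\<lambda>v. mp_eval id x (fst (r v)) / mp_eval id x (snd (r v))) \<phi> \<longleftrightarrow>
       qf_sat ring_of_type_algebra \<kappa>' F' (\<lambda>v. mp_eval c b (fst (r v)) / mp_eval c b (snd (r v))) \<phi>))" for h \<phi>
  have "\<exists>h. Q h \<phi>"
    using \<phi>
  proof (induction \<phi>)
  case (QEq s t)
  then have st: "set1_rterm s = {}" "set2_rterm s = {}" "set1_rterm t = {}" "set2_rterm t = {}" by auto
  obtain f g where fg: "term_frac r s = (f, g)" by (cases "term_frac r s")
  obtain f' g' where fg': "term_frac r t = (f', g')" by (cases "term_frac r t")
  have m: "f \<in> mpols N" "g \<in> mpols N" "f' \<in> mpols N" "g' \<in> mpols N" and nz: "mp_eval c b g \<noteq> 0" "mp_eval c b g' \<noteq> 0"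
    using term_frac_mpols[where r = r and t = s, OF c r] term_frac_mpols[where r = r and t = t, OF c r] fg fg' by auto
  define D where "D = f * g' - f' * g"
  have D: "D \<in> mpols N" using m by (auto simp: D_def intro: mpols_mult mpols_minus)
  have valc: "qf_sat ring_of_type_algebra \<kappa>' F' (\<lambda>v. mp_eval c b (fst (r v)) / mp_eval c b (snd (r v))) (QEq s t) \<longleftrightarrow> mp_eval c b D = 0"
    using term_frac_val[OF c st(1,2), where x = b and r = r and \<kappa> = \<kappa>' and F = F'] term_frac_val[OF c st(3,4), where x = b and r = r and \<kappa> = \<kappa>' and F = F'] nz fg fg'
    by (simp add: D_def mp_eval_ring_simps[OF c] frac_eq_eq)
  have vali: "qf_sat ring_of_type_algebra \<kappa> F (\<lambda>v. mp_eval id x (fst (r v)) / mp_eval id x (snd (r v))) (QEq s t) \<longleftrightarrow> mp_eval id x D = 0"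
    if "mp_eval id x g \<noteq> 0" "mp_eval id x g' \<noteq> 0" for x
    using term_frac_val[OF type_hom_id(1) st(1,2), where x = x and r = r and \<kappa> = \<kappa> and F = F] term_frac_val[OF type_hom_id(1) st(3,4), where x = x and r = r and \<kappa> = \<kappa> and F = F] that fg fg'
    by (simp add: D_def mp_eval_ring_simps frac_eq_eq)
  show ?case
  proof (cases "mp_eval c b D = 0")
    case True
    then have DI: "D \<in> vanishing_ideal c N b" using D by (simp add: vanishing_ideal_def)
    have "Q (g * g') (QEq s t)"
      unfolding Q_def valc
    proof (intro conjI allI impI)
      show "g * g' \<in> mpols N" by (rule mpols_mult[OF m(2,4)])
      show "mp_eval c b (g * g') \<noteq> 0" using nz by (simp add: mp_eval_ring_simps[OF c])
      fix x assume x: "(\<forall>f\<in>vanishing_ideal c N b. mp_eval id x f = 0) \<and> mp_eval id x (g * g') \<noteq> 0"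
      then have "mp_eval id x D = 0" using DI by blast
      with x vali[of x] True
      show "qf_sat ring_of_type_algebra \<kappa> F (\<lambda>v. mp_eval id x (fst (r v)) / mp_eval id x (snd (r v))) (QEq s t) \<longleftrightarrow> mp_eval c b D = 0"
        by (simp add: mp_eval_ring_simps del: qf_sat.simps)
    qed
    then show ?thesis ..
  next
    case False
    have "Q (g * g' * D) (QEq s t)"
      unfolding Q_def valc
    proof (intro conjI allI impI)
      show "g * g' * D \<in> mpols N" by (rule mpols_mult[OF mpols_mult[OF m(2,4)] D])
      show "mp_eval c b (g * g' * D) \<noteq> 0" using nz False by (simp add: mp_eval_ring_simps[OF c])
      fix x assume x: "(\<forall>f\<in>vanishing_ideal c N b. mp_eval id x f = 0) \<and> mp_eval id x (g * g' * D) \<noteq> 0"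
      with vali[of x] False
      show "qf_sat ring_of_type_algebra \<kappa> F (\<lambda>v. mp_eval id x (fst (r v)) / mp_eval id x (snd (r v))) (QEq s t) \<longleftrightarrow> mp_eval c b D = 0"
        by (simp add: mp_eval_ring_simps del: qf_sat.simps)
    qed
    then show ?thesis ..
  qed
next
  case (QNot \<phi>)
  then obtain h where "Q h \<phi>" by auto
  then have "Q h (QNot \<phi>)" unfolding Q_def qf_sat.simps by simp
  then show ?case ..
next
  case (QAnd \<phi> \<psi>)
  then obtain h h' where h: "Q h \<phi>" and h': "Q h' \<psi>" by auto
  note h = h[unfolded Q_def] and h' = h'[unfolded Q_def]
  have "Q (h * h') (QAnd \<phi> \<psi>)"
    unfolding Q_def
  proof (intro conjI allI impI)
    show "h * h' \<in> mpols N" by (rule mpols_mult[OF conjunct1[OF h] conjunct1[OF h']])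
    show "mp_eval c b (h * h') \<noteq> 0" using h h' by (simp add: mp_eval_ring_simps[OF c])
    fix x assume x: "(\<forall>f\<in>vanishing_ideal c N b. mp_eval id x f = 0) \<and> mp_eval id x (h * h') \<noteq> 0"
    then have x': "(\<forall>f\<in>vanishing_ideal c N b. mp_eval id x f = 0) \<and> mp_eval id x h \<noteq> 0"
      "(\<forall>f\<in>vanishing_ideal c N b. mp_eval id x f = 0) \<and> mp_eval id x h' \<noteq> 0" by (auto simp: mp_eval_ring_simps)
    show "qf_sat ring_of_type_algebra \<kappa> F (\<lambda>v. mp_eval id x (fst (r v)) / mp_eval id x (snd (r v))) (QAnd \<phi> \<psi>) \<longleftrightarrow>
       qf_sat ring_of_type_algebra \<kappa>' F' (\<lambda>v. mp_eval c b (fst (r v)) / mp_eval c b (snd (r v))) (QAnd \<phi> \<psi>)"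
      unfolding qf_sat.simps
        mp[OF spec[OF conjunct2[OF conjunct2[OF h]]] x'(1)] mp[OF spec[OF conjunct2[OF conjunct2[OF h']]] x'(2)] ..
  qed
  then show ?case ..
  qed
  then show ?thesis unfolding Q_def .
qed

text \<open>An open subset of the variety parametrises solutions of the formula.\<close>

lemma ex_closed_function_field:
  fixes c :: "'a::field \<Rightarrow> 'f::field" and b :: "nat \<Rightarrow> 'f" and S :: "'s ring"
  assumes large: "large_field TYPE('a)" and c: "type_hom c"
    and I: "irreducible_variety {..<n} (vanishing_ideal c {..<n} b)"
    and sm: "has_smooth_rational_point {..<n} (vanishing_ideal c {..<n} b)"
    and S: "cring S" and dec: "dec \<in> ring_hom S ring_of_type_algebra" "inj_on dec (carrier S)"
    and frac: "\<And>x. x \<in> carrier S \<Longrightarrow>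
      \<exists>f g. f \<in> mpols {..<n} \<and> g \<in> mpols {..<n} \<and> mp_eval c b g \<noteq> 0 \<and> dec x = mp_eval c b f / mp_eval c b g"
    and e: "\<And>a. dec (e a) = c a"
  shows "ex_closed_field ring_of_type_algebra S e"
  unfolding ex_closed_field_def ex_closed_def
proof (intro allI impI)
  fix \<phi> :: "(unit, unit) qf_formula" and V and \<rho> :: "nat \<Rightarrow> 'a"
  let ?K = "ring_of_type_algebra :: 'a ring"
  assume "qf_consts \<phi> \<subseteq> {} \<and> qf_ops \<phi> \<subseteq> {} \<and> finite V \<and> range \<rho> \<subseteq> carrier ?K \<and>
    (\<exists>\<sigma>. range \<sigma> \<subseteq> carrier S \<and> (\<forall>v. v \<notin> V \<longrightarrow> \<sigma> v = e (\<rho> v)) \<and> qf_sat S (\<lambda>_. \<zero>\<^bsub>S\<^esub>) (\<lambda>_ r. r) \<sigma> \<phi>)"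
  then obtain \<sigma> where \<phi>: "qf_consts \<phi> = {}" "qf_ops \<phi> = {}" and \<sigma>: "\<And>v. \<sigma> v \<in> carrier S"
    "\<And>v. v \<notin> V \<Longrightarrow> \<sigma> v = e (\<rho> v)" "qf_sat S (\<lambda>_. \<zero>\<^bsub>S\<^esub>) (\<lambda>_ r. r) \<sigma> \<phi>" by blast
  \<comment> \<open>Parameters are represented by constants with denominator 1, so that
    specialisation keeps their values.\<close>
  have ex: "\<exists>q. fst q \<in> mpols {..<n} \<and> snd q \<in> mpols {..<n} \<and> mp_eval c b (snd q) \<noteq> 0 \<and>
      dec (\<sigma> v) = mp_eval c b (fst q) / mp_eval c b (snd q) \<and> (v \<notin> V \<longrightarrow> q = (mconst (\<rho> v), 1))" for v
  proof (cases "v \<in> V")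
    case True
    obtain f g where "f \<in> mpols {..<n}" "g \<in> mpols {..<n}" "mp_eval c b g \<noteq> 0" "dec (\<sigma> v) = mp_eval c b f / mp_eval c b g"
      using frac[OF \<sigma>(1)] by blast
    then show ?thesis using True by (intro exI[of _ "(f, g)"]) simp
  next
    case False
    then show ?thesis using \<sigma>(2)[of v]
      by (intro exI[of _ "(mconst (\<rho> v), 1)"]) (simp add: e mp_eval_ring_simps[OF c])
  qed
  from choice[OF allI[OF ex]] obtain r where r0: "\<forall>v. fst (r v) \<in> mpols {..<n} \<and> snd (r v) \<in> mpols {..<n} \<and> mp_eval c b (snd (r v)) \<noteq> 0 \<and>
      dec (\<sigma> v) = mp_eval c b (fst (r v)) / mp_eval c b (snd (r v)) \<and> (v \<notin> V \<longrightarrow> r v = (mconst (\<rho> v), 1))" ..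
  have r: "fst (r v) \<in> mpols {..<n} \<and> snd (r v) \<in> mpols {..<n} \<and> mp_eval c b (snd (r v)) \<noteq> 0"
    "dec (\<sigma> v) = mp_eval c b (fst (r v)) / mp_eval c b (snd (r v))" "v \<notin> V \<Longrightarrow> r v = (mconst (\<rho> v), 1)" for v
    using spec[OF r0, of v] by simp_all
  have d\<sigma>: "dec \<circ> \<sigma> = (\<lambda>v. mp_eval c b (fst (r v)) / mp_eval c b (snd (r v)))" by (simp add: fun_eq_iff r(2))
  have "qf_sat ring_of_type_algebra (\<lambda>_. 0) (\<lambda>_ r. r) (dec \<circ> \<sigma>) \<phi>"
    by (rule iffD2[OF qf_sat_hom[where \<sigma> = \<sigma>, OF S cring_from_type_algebra dec \<sigma>(1) \<phi>] \<sigma>(3)])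
  then have sat: "qf_sat ring_of_type_algebra (\<lambda>_. 0) (\<lambda>_ r. r) (\<lambda>v. mp_eval c b (fst (r v)) / mp_eval c b (snd (r v))) \<phi>"
    unfolding d\<sigma> .
  have "\<exists>h. h \<in> mpols {..<n} \<and> mp_eval c b h \<noteq> 0 \<and>
    (\<forall>x. (\<forall>f\<in>vanishing_ideal c {..<n} b. mp_eval id x f = 0) \<and> mp_eval id x h \<noteq> 0 \<longrightarrow>
      (qf_sat ?K (\<lambda>_. \<zero>\<^bsub>?K\<^esub>) (\<lambda>_ r. r) (\<lambda>v. mp_eval id x (fst (r v)) / mp_eval id x (snd (r v))) \<phi> \<longleftrightarrow>
       qf_sat ring_of_type_algebra (\<lambda>_. 0) (\<lambda>_ r. r) (\<lambda>v. mp_eval c b (fst (r v)) / mp_eval c b (snd (r v))) \<phi>))"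
    by (rule qf_specialise[where r = r, OF c r(1) \<phi>])
  then obtain h where h: "h \<in> mpols {..<n}" "mp_eval c b h \<noteq> 0" and
    eq: "\<forall>x. (\<forall>f\<in>vanishing_ideal c {..<n} b. mp_eval id x f = 0) \<and> mp_eval id x h \<noteq> 0 \<longrightarrow>
      (qf_sat ?K (\<lambda>_. \<zero>\<^bsub>?K\<^esub>) (\<lambda>_ r. r) (\<lambda>v. mp_eval id x (fst (r v)) / mp_eval id x (snd (r v))) \<phi> \<longleftrightarrow>
       qf_sat ring_of_type_algebra (\<lambda>_. 0) (\<lambda>_ r. r) (\<lambda>v. mp_eval c b (fst (r v)) / mp_eval c b (snd (r v))) \<phi>)"
    by (elim exE conjE)
  have "h \<notin> vanishing_ideal c {..<n} b" using h(2) by (simp add: vanishing_ideal_def)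
  then obtain x where x: "x \<in> rational_points {..<n} (vanishing_ideal c {..<n} b)" "mp_eval id x h \<noteq> 0"
    by (rule large_fieldD[OF large I sm h(1)])
  have "\<forall>f\<in>vanishing_ideal c {..<n} b. mp_eval id x f = 0" using x(1) by (auto simp: rational_points_def points_def)
  from iffD2[OF mp[OF spec[OF eq] conjI[OF this x(2)]] sat]
  have "qf_sat ?K (\<lambda>_. \<zero>\<^bsub>?K\<^esub>) (\<lambda>_ r. r) (\<lambda>v. mp_eval id x (fst (r v)) / mp_eval id x (snd (r v))) \<phi>" .
  then show "\<exists>\<tau>. range \<tau> \<subseteq> carrier ?K \<and> (\<forall>v. v \<notin> V \<longrightarrow> \<tau> v = \<rho> v) \<and> qf_sat ?K (\<lambda>_. \<zero>\<^bsub>?K\<^esub>) (\<lambda>_ r. r) \<tau> \<phi>"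
    by (intro exI[of _ "\<lambda>v. mp_eval id x (fst (r v)) / mp_eval id x (snd (r v))"])
      (simp add: r(3) mp_eval_ring_simps)
qed

section \<open>The operators on the function field of a D-variety\<close>

context D_base
begin

text \<open>By linearity over \<open>k\<close> and \<open>\<partial> 1 = 1\<close> the elements of
  \<open>k\<close> are constants of the structure.\<close>

lemma kap_iota:
  fixes S :: "'s ring"
  assumes S: "cring S" and e: "e \<in> ring_hom ring_of_type_algebra S"
  shows "kap e (\<iota> a) = pure S (e \<circ> \<iota>) (e (\<iota> a)) 1"
proof -
  interpret S: cring S by fact
  have ec: "e x \<in> carrier S" for x using e by (auto simp: ring_hom_def)
  have em: "e (x * y) = e x \<otimes>\<^bsub>S\<^esub> e y" for x y using ring_hom_mult[OF e, of x y] by simp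
  have "\<Delta> 1 = (\<lambda>m\<in>I\<^sub>\<D>. \<iota> (coord \<D> 1 m))"
    using ring_hom_one[OF Delta_hom] by (simp add: base_change_sel)
  then have "\<Delta> (\<iota> a) = (\<lambda>m\<in>I\<^sub>\<D>. \<iota> a * (\<lambda>m\<in>I\<^sub>\<D>. \<iota> (coord \<D> 1 m)) m)"
    using Delta_linear[of a 1] by simp
  then have "e (\<Delta> (\<iota> a) m) = e (\<iota> (coord \<D> 1 m)) \<otimes>\<^bsub>S\<^esub> e (\<iota> a)" if "m \<in> I\<^sub>\<D>" for m
    using that em[of "\<iota> a" "\<iota> (coord \<D> 1 m)"] S.m_comm[OF ec ec] by simp
  then show ?thesis by (auto simp: kap_def bc_map_def pure_def restrict_def fun_eq_iff)
qed

text \<open>Linearity over \<open>k\<close> comes from multiplicativity: \<open>\<delta>\<close>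
  sends an element of \<open>k\<close> to a pure tensor with 1, and multiplication by such a tensor
  scales all components.\<close>

lemma D_field_extensionI:
  fixes S :: "'s ring"
  assumes S: "field S" and e: "e \<in> ring_hom ring_of_type_algebra S"
    and \<delta>: "\<delta> \<in> ring_hom S (base_change \<D> S (e \<circ> \<iota>))" and \<delta>e: "\<And>a. \<delta> (e a) = kap e a"
    and \<delta>0: "\<And>x. x \<in> carrier S \<Longrightarrow> \<delta> x 0 = x"
  shows "D_field_extension \<D> ring_of_type_algebra \<iota> \<Delta> S \<delta> e"
proof -
  interpret S: field S by fact
  note he = comp_iota_hom[OF e]
  have ec: "e x \<in> carrier S" for x using e by (auto simp: ring_hom_def)
  have \<delta>c: "\<delta> x \<in> carrier (base_change \<D> S (e \<circ> \<iota>))" if "x \<in> carrier S" for x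
    using \<delta> that by (auto simp: ring_hom_def)
  have "D_ring \<D> S (e \<circ> \<iota>) \<delta>"
    unfolding D_ring_def
  proof (intro conjI allI ballI)
    show "cring S" by (rule S.is_cring)
    show "e \<circ> \<iota> \<in> ring_hom ring_of_type_algebra S" by (rule he)
    show "\<delta> \<in> ring_hom S (base_change \<D> S (e \<circ> \<iota>))" by (rule \<delta>)
    fix r assume r: "r \<in> carrier S"
    show "(\<Oplus>\<^bsub>S\<^esub>j\<in>I\<^sub>\<D>. \<delta> r j \<otimes>\<^bsub>S\<^esub> (e \<circ> \<iota>) (resid \<D> (eps \<D> j))) = r"
      using resid_sum[OF S.is_cring he, of "\<delta> r"] \<delta>c[OF r] \<delta>0[OF r] by (auto simp: base_change_sel PiE_iff)
    fix a
    have "\<delta> (e (\<iota> a) \<otimes>\<^bsub>S\<^esub> r) = pure S (e \<circ> \<iota>) (e (\<iota> a)) 1 \<otimes>\<^bsub>base_change \<D> S (e \<circ> \<iota>)\<^esub> \<delta> r"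
      unfolding ring_hom_mult[OF \<delta> ec r] \<delta>e kap_iota[OF S.is_cring e] ..
    also have "\<dots> = (\<lambda>j\<in>I\<^sub>\<D>. e (\<iota> a) \<otimes>\<^bsub>S\<^esub> \<delta> r j)"
      by (rule pure_1_mult[OF S.is_cring he ec \<delta>c[OF r]])
    finally show "\<delta> ((e \<circ> \<iota>) a \<otimes>\<^bsub>S\<^esub> r) = (\<lambda>j\<in>I\<^sub>\<D>. (e \<circ> \<iota>) a \<otimes>\<^bsub>S\<^esub> \<delta> r j)" by simp
  qed
  then show ?thesis
    unfolding D_field_extension_def D_field_def[of \<D> S] using S D_field e \<delta>e kap_apply by auto
qed

theorem sharp_point_of_ex_closed:
  fixes I :: "(nat, 'a) mpol set"
  assumes large: "large_field TYPE('a)"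
    and ec: "\<And>(L :: ('a + 'l) ring) \<delta> e. D_field_extension \<D> ring_of_type_algebra \<iota> \<Delta> L \<delta> e \<Longrightarrow>
      ex_closed_field ring_of_type_algebra L e \<Longrightarrow> ex_closed_D_field \<D> ring_of_type_algebra \<iota> \<Delta> L \<delta> e"
    and V: "irreducible_D_variety \<D> \<iota> \<Delta> n I s" and sm: "has_smooth_rational_point {..<n} I"
  shows "sharp_points \<D> \<Delta> n I s \<noteq> {}"
proof -
  let ?N = "{..<n}"
  have I: "irreducible_variety ?N I" and aff: "affine_D_variety \<D> \<iota> \<Delta> n I s"
    using V by (auto simp: irreducible_D_variety_def)
  note pI = irreducible_varietyD(2)[OF I]
  note iI = primeideal_mpolD(1)[OF pI]
  have sm': "s ` prol_vars \<D> n \<subseteq> mpols ?N" and sP: "\<And>g. g \<in> prol_ideal \<D> \<iota> \<Delta> n I \<Longrightarrow> mp_eval mconst s g \<in> I"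
    and s0: "\<And>i. i < n \<Longrightarrow> s (0, i) - mvar i \<in> I"
    using aff by (auto simp: affine_D_variety_def)
  have s: "s (j, i) \<in> mpols ?N" if "j \<in> I\<^sub>\<D>" "i < n" for j i
    using sm' that by (auto simp: prol_vars_def)
  have sP': "mp_eval mconst s (prol_poly \<D> \<iota> \<Delta> n f j) \<in> I" if "f \<in> I" "j \<in> I\<^sub>\<D>" for f j
  proof -
    have "\<forall>g\<in>prol_ideal \<D> \<iota> \<Delta> n I. mp_eval mconst s g \<in> I" using sP by (rule ballI)
    from iffD1[OF prol_ideal_subst_iff[OF iI sm'] this] that show ?thesis by simp
  qed
  obtain b0 :: "nat \<Rightarrow> 'a univ_dom" where b0: "I = vanishing_ideal to_univ ?N b0"
    by (rule generic_point[OF pI finite_lessThan])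
  define c where "c = (to_univ :: 'a \<Rightarrow> 'a univ_dom)"
  define b where "b = b0"
  have c: "type_hom c" by (simp add: c_def)
  have b: "I = vanishing_ideal c ?N b" by (simp add: b0 c_def b_def)
  have Iiff: "f \<in> I \<longleftrightarrow> mp_eval c b f = 0" if "f \<in> mpols ?N" for f
    using that by (simp add: b vanishing_ideal_def)
  \<comment> \<open>Everything nonzero at the generic point is inverted, so that the localisation is
    the function field of V.\<close>
  define M where "M = {g \<in> mpols ?N. mp_eval c b g \<noteq> 0}"
  have loc: "localisation c ?N b M"
    by unfold_locales (auto simp: M_def c mpols_mult mp_eval_ring_simps[OF c])
  interpret L: localisation c ?N b M by (rule loc)
  define Lc where "Lc = L.Loc"
  have ops: "x \<otimes>\<^bsub>Lc\<^esub> y = x * y" "x \<oplus>\<^bsub>Lc\<^esub> y = x + y" "\<one>\<^bsub>Lc\<^esub> = 1" "\<zero>\<^bsub>Lc\<^esub> = 0" for x y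
    by (simp_all add: Lc_def)
  have cL: "cring Lc" and chL: "c \<in> ring_hom ring_of_type_algebra Lc"
    unfolding Lc_def by (rule L.cring_Loc L.c_hom_Loc)+
  have evL: "L.evb f \<in> carrier Lc" if "f \<in> mpols ?N" for f
    unfolding Lc_def by (rule L.eval_in_Loc[OF that])
  have evLR: "mp_eval_in Lc c x f = mp_eval c x f" if "f \<in> mpols N'" "x \<in> N' \<rightarrow> carrier Lc" for f x and N' :: "'v set"
    using that unfolding Lc_def by (rule L.eval_in_LocR)
  have fracL: "\<exists>f g. f \<in> mpols ?N \<and> g \<in> M \<and> x = L.evb f / L.evb g" if "x \<in> carrier Lc" for x
    using that by (auto simp: Lc_def)
  have bL: "b v \<in> carrier Lc" if "v < n" for v
    using evL[of "mvar v"] that by (simp add: L.ev mpols_var)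
  have unitL: "L.evb g \<in> Units Lc" if "g \<in> M" for g
    unfolding Lc_def by (rule L.unit_Loc[OF _ that dvd_refl]) (use that in \<open>simp add: M_def\<close>)
  interpret Lc: cring Lc by (rule cL)
  have fL: "field Lc"
  proof (rule Lc.cring_fieldI)
    show "Units Lc = carrier Lc - {\<zero>\<^bsub>Lc\<^esub>}"
    proof (intro equalityI subsetI)
      fix x assume x: "x \<in> Units Lc"
      then have "inv\<^bsub>Lc\<^esub> x * x = 1" using Lc.Units_l_inv[OF x] by (simp add: ops)
      then show "x \<in> carrier Lc - {\<zero>\<^bsub>Lc\<^esub>}" using Lc.Units_closed[OF x] by (auto simp: ops)
    next
      fix x assume x: "x \<in> carrier Lc - {\<zero>\<^bsub>Lc\<^esub>}"
      then obtain f g where fg: "f \<in> mpols ?N" "g \<in> M" "x = L.evb f / L.evb g" using fracL by blast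
      then have f: "f \<in> M" using x by (auto simp: M_def ops)
      have "inverse (L.evb g) \<in> Units Lc"
      proof -
        have "inverse (L.evb g) \<in> carrier Lc" unfolding Lc_def by (rule L.inverse_in_Loc[OF fg(2)])
        moreover have "L.evb g \<in> carrier Lc" using unitL[OF fg(2)] by (rule Lc.Units_closed)
        moreover have "L.evb g \<otimes>\<^bsub>Lc\<^esub> inverse (L.evb g) = \<one>\<^bsub>Lc\<^esub>" "inverse (L.evb g) \<otimes>\<^bsub>Lc\<^esub> L.evb g = \<one>\<^bsub>Lc\<^esub>"
          using L.M_nonzero[OF fg(2)] by (simp_all add: ops)
        ultimately show ?thesis unfolding Units_def by blast
      qed
      from Lc.Units_m_closed[OF unitL[OF f] this] show "x \<in> Units Lc" by (simp add: fg(3) ops divide_inverse)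
    qed
  qed
  define LD where "LD = base_change \<D> Lc (c \<circ> \<iota>)"
  note hc = comp_iota_hom[OF chL]
  have cT: "cring LD" unfolding LD_def by (rule cring_base_change[OF cL hc])
  have kh: "kap c \<in> ring_hom ring_of_type_algebra LD" unfolding LD_def by (rule kap_hom[OF cL chL])
  have h0: "(\<lambda>u. u 0) \<in> ring_hom LD Lc" unfolding LD_def by (rule bc_0_hom[OF cL hc])
  interpret LD: cring LD by (rule cT)
  define w where "w v = L.evb (s v)" for v
  have w: "w \<in> prol_vars \<D> n \<rightarrow> carrier Lc" using evL sm' by (auto simp: w_def)
  \<comment> \<open>The section read as a lift of the generic point to
    \<open>K(V) \<otimes> \<D>\<close>. It respects the relations of V because \<open>s\<close> maps
    V into its prolongation, and it sends nonzero denominators to units because their component 0 is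
    a nonzero element of a field.\<close>
  define Y where "Y i = (\<lambda>j\<in>I\<^sub>\<D>. w (j, i))" for i
  have Y: "Y \<in> ?N \<rightarrow> carrier LD" using w by (auto simp: Y_def LD_def base_change_sel prol_vars_def split: if_splits)
  have Y0: "Y i 0 = b i" if i: "i < n" for i
  proof -
    have "L.evb (s (0, i) - mvar i) = 0"
      using s0[OF i] Iiff irreducible_varietyD(4)[OF I] by blast
    then show ?thesis by (simp add: Y_def w_def L.ev)
  qed
  interpret E: mp_evaluation LD "kap c" Y ?N by (rule mp_evaluationI[OF cT kh Y])
  have E0: "E.ev f 0 = L.evb f" if f: "f \<in> mpols ?N" for f
  proof -
    have "E.ev f 0 = mp_eval_in Lc c (\<lambda>v. Y v 0) f"
      unfolding LD_def by (rule eval_component_0[OF cL chL _ f]) (use Y in \<open>simp add: LD_def\<close>)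
    also have "\<dots> = mp_eval c (\<lambda>v. Y v 0) f" by (rule evLR[OF f]) (use Y0 bL in auto)
    also have "\<dots> = L.evb f" by (rule mp_eval_cong[OF c f]) (use Y0 in auto)
    finally show ?thesis .
  qed
  have kill: "E.ev f = \<zero>\<^bsub>LD\<^esub>" if f: "f \<in> mpols ?N" "L.evb f = 0" for f
  proof -
    have fI: "f \<in> I" using Iiff f by blast
    have "E.ev f j = 0" if j: "j \<in> I\<^sub>\<D>" for j
    proof -
      have "E.ev f j = mp_eval_in Lc c w (prol_poly \<D> \<iota> \<Delta> n f j)"
        unfolding Y_def LD_def by (rule prol_poly_eval[OF cL chL w f(1) j, symmetric])
      also have "\<dots> = mp_eval c w (prol_poly \<D> \<iota> \<Delta> n f j)"
        by (rule evLR[OF prol_poly_closed[OF f(1) j] w])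
      also have "\<dots> = L.evb (mp_eval mconst s (prol_poly \<D> \<iota> \<Delta> n f j))"
        unfolding mp_eval_subst[OF c] w_def[abs_def] ..
      also have "\<dots> = 0" using sP'[OF fI j] Iiff irreducible_varietyD(4)[OF I] by blast
      finally show ?thesis .
    qed
    moreover have "E.ev f \<in> extensional I\<^sub>\<D>" using E.ev_closed[OF f(1)] by (auto simp: LD_def base_change_sel PiE_iff)
    ultimately show ?thesis
      by (auto simp: LD_def base_change_sel ops restrict_def fun_eq_iff extensional_def)
  qed
  have uM: "E.ev g \<in> Units LD" if g: "g \<in> M" for g
  proof -
    have gN: "g \<in> mpols ?N" using g by (simp add: M_def)
    have "E.ev g \<in> carrier LD" "E.ev g 0 \<in> Units Lc" using E.ev_closed[OF gN] E0[OF gN] unitL[OF g] by auto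
    then show ?thesis unfolding LD_def by (rule base_change_unit[OF cL hc])
  qed
  obtain \<delta> where \<delta>: "\<delta> \<in> ring_hom Lc LD" "\<And>f. f \<in> mpols ?N \<Longrightarrow> \<delta> (L.evb f) = E.ev f"
    unfolding Lc_def
  proof (rule L.extend_hom[OF cT E.ev_hom])
    show "E.ev f = \<zero>\<^bsub>LD\<^esub>" if "f \<in> mpols ?N" "L.evb f = 0" for f by (rule kill[OF that])
    show "E.ev g \<in> Units LD" if "g \<in> M" for g by (rule uM[OF that])
  qed (rule that[unfolded Lc_def])
  have \<delta>c: "\<delta> (c a) = kap c a" for a using \<delta>(2)[of "mconst a"] by (simp add: L.ev)
  have \<delta>b: "\<delta> (b i) = Y i" if "i < n" for i using \<delta>(2)[of "mvar i"] that by (simp add: L.ev mpols_var)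
  have \<delta>0: "\<delta> x 0 = x" if x: "x \<in> carrier Lc" for x
  proof -
    obtain f g where fg: "f \<in> mpols ?N" "g \<in> M" "x = L.evb f / L.evb g" using fracL[OF x] by blast
    have gN: "g \<in> mpols ?N" using fg(2) by (simp add: M_def)
    have "(\<delta> x \<otimes>\<^bsub>LD\<^esub> \<delta> (L.evb g)) 0 = \<delta> (x \<otimes>\<^bsub>Lc\<^esub> L.evb g) 0"
      using ring_hom_mult[OF \<delta>(1) x evL[OF gN]] by simp
    also have "x \<otimes>\<^bsub>Lc\<^esub> L.evb g = L.evb f" using fg L.M_nonzero[OF fg(2)] by (simp add: ops)
    also have "\<delta> (L.evb f) 0 = L.evb f" using \<delta>(2)[OF fg(1)] E0[OF fg(1)] by simp
    finally have 1: "(\<delta> x \<otimes>\<^bsub>LD\<^esub> \<delta> (L.evb g)) 0 = L.evb f" .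
    have "\<delta> x \<in> carrier LD" "\<delta> (L.evb g) \<in> carrier LD"
      using \<delta>(1) x evL[OF gN] by (auto simp: ring_hom_def)
    from ring_hom_mult[OF h0 this] 1 have "\<delta> x 0 * L.evb g = L.evb f"
      using \<delta>(2)[OF gN] E0[OF gN] by (simp add: ops)
    then show ?thesis using L.M_nonzero[OF fg(2)] by (simp add: fg(3) field_simps)
  qed
  obtain enc0 :: "'a univ_dom \<Rightarrow> 'a" where enc0: "inj_on enc0 (carrier Lc)"
    unfolding Lc_def by (rule Loc_code[OF loc])
  \<comment> \<open>A copy of the function field inside the left summand of \<open>'a + 'l\<close>,
    the type of the extensions to which the hypothesis applies.\<close>
  define enc where "enc x = (Inl (enc0 x) :: 'a + 'l)" for x
  have enc: "inj_on enc (carrier Lc)" using enc0 by (auto simp: enc_def inj_on_def)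
  define S where "S = image_ring enc Lc"
  define dec where "dec = inv_into (carrier Lc) enc"
  have S: "field S" unfolding S_def by (rule field.inj_imp_image_ring_is_field[OF fL enc])
  interpret S: field S by (rule S)
  have iso: "enc \<in> ring_iso Lc S" unfolding S_def by (rule inj_imp_image_ring_iso[OF enc])
  have ench: "enc \<in> ring_hom Lc S" using iso by (simp add: ring_iso_def)
  have dech: "dec \<in> ring_hom S Lc"
    using ring_iso_set_sym[OF Lc.ring_axioms iso] by (simp add: ring_iso_def dec_def)
  have carS: "carrier S = enc ` carrier Lc" by (simp add: S_def image_ring_carrier)
  have de: "dec (enc x) = x" if "x \<in> carrier Lc" for x
    unfolding dec_def using inv_into_f_f[OF enc that] .
  have ed: "enc (dec x) = x" if "x \<in> carrier S" for x
    unfolding dec_def using f_inv_into_f[of x enc "carrier Lc"] that by (simp add: carS)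
  have decc: "dec x \<in> carrier Lc" if "x \<in> carrier S" for x
    using dech that by (auto simp: ring_hom_def)
  define e where "e = enc \<circ> c"
  have e: "e \<in> ring_hom ring_of_type_algebra S" unfolding e_def by (rule ring_hom_trans[OF chL ench])
  define \<delta>' where "\<delta>' x = bc_map enc (\<delta> (dec x))" for x
  have "D_field_extension \<D> ring_of_type_algebra \<iota> \<Delta> S \<delta>' e"
  proof (rule D_field_extensionI[OF S e])
    have "bc_map enc \<in> ring_hom LD (base_change \<D> S (e \<circ> \<iota>))"
      unfolding LD_def by (rule bc_map_hom[OF cL S.is_cring ench hc]) (simp add: e_def comp_assoc)
    from ring_hom_trans[OF ring_hom_trans[OF dech \<delta>(1)] this]
    show "\<delta>' \<in> ring_hom S (base_change \<D> S (e \<circ> \<iota>))" by (simp add: comp_def \<delta>'_def[abs_def])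
    have "c a \<in> carrier Lc" for a using chL by (auto simp: ring_hom_def)
    then show "\<delta>' (e a) = kap e a" for a by (simp add: \<delta>'_def e_def de \<delta>c bc_map_kap)
    show "\<delta>' x 0 = x" if "x \<in> carrier S" for x
      using \<delta>0[OF decc[OF that]] ed[OF that] by (simp add: \<delta>'_def bc_map_def)
  qed
  moreover have "ex_closed_field ring_of_type_algebra S e"
  proof (rule ex_closed_function_field[OF large c I[unfolded b] sm[unfolded b] S.is_cring, of dec])
    show "dec \<in> ring_hom S ring_of_type_algebra"
      using dech by (auto simp: ring_hom_def ops)
    show "inj_on dec (carrier S)" unfolding dec_def carS by (rule inj_on_inv_into) simp
    show "\<exists>f g. f \<in> mpols ?N \<and> g \<in> mpols ?N \<and> mp_eval c b g \<noteq> 0 \<and> dec x = mp_eval c b f / mp_eval c b g"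
      if "x \<in> carrier S" for x
      using fracL[OF decc[OF that]] by (auto simp: M_def)
    show "dec (e a) = c a" for a using chL by (simp add: e_def de ring_hom_def Pi_iff)
  qed
  ultimately have ecD: "ex_closed_D_field \<D> ring_of_type_algebra \<iota> \<Delta> S \<delta>' e" by (rule ec)
  have "\<exists>vs. set vs = ?N \<and> distinct vs" by (rule finite_distinct_list[OF finite_lessThan])
  then obtain vs where vs: "set vs = ?N" "distinct vs" by (elim exE conjE)
  have "primeideal I (mpol_ring (set vs))" using pI by (simp add: vs(1))
  then obtain P h where "tri_pres (set vs) I (list_ord vs) (algebraic_vars I vs) P h"
    by (rule tri_pres_list[OF _ vs(2)]) (rule that)
  then have tri: "tri_pres ?N I (list_ord vs) (algebraic_vars I vs) P h" unfolding vs(1) .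
  let ?S = "algebraic_vars I vs"
  have finS: "finite ?S" by (simp add: algebraic_vars_def)
  have PI: "P v \<in> mpols ?N" "L.evb (P v) = 0" if "v \<in> ?S" for v
  proof -
    have "P v \<in> I" using tri that by (auto simp: tri_pres_def)
    then show "P v \<in> mpols ?N" "L.evb (P v) = 0" using irreducible_varietyD(4)[OF I] Iiff[of "P v"] by auto
  qed
  have hI: "h \<in> mpols ?N" "L.evb h \<noteq> 0" using tri Iiff by (auto simp: tri_pres_def)
  define y where "y = enc \<circ> b"
  have ev_y: "mp_eval_in S e y f = enc (L.evb f)" if f: "f \<in> mpols ?N" for f
  proof -
    have bN: "b \<in> ?N \<rightarrow> carrier Lc" using bL by auto
    show ?thesis
      unfolding e_def y_def mp_eval_in_compose_hom[OF mp_evaluationI[OF cL chL bN] S.is_cring ench f, symmetric]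
        evLR[OF f bN] ..
  qed
  have enc_0: "enc x = \<zero>\<^bsub>S\<^esub> \<longleftrightarrow> x = 0" if "x \<in> carrier Lc" for x
    using inj_on_eq_iff[OF enc that Lc.zero_closed] by (simp add: S_def image_ring_zero ops)
  \<comment> \<open>Membership in V is expressed by the finitely many \<open>P v\<close> together
    with \<open>h\<close> nonzero, and sharpness by the equations for the operators. The generic
    point satisfies all of them in the function field.\<close>
  have "\<exists>x. (\<forall>f\<in>P ` ?S. mp_eval id x f = 0) \<and> mp_eval id x h \<noteq> 0 \<and>
      (\<forall>(j, i)\<in>{1..len \<D>} \<times> ?N. \<Delta> (x i) j = mp_eval id x (s (j, i)))"
  proof (rule ex_closed_solve[OF ecD[unfolded ex_closed_D_field_def] S.is_cring e, of "P ` ?S" n h "{1..len \<D>} \<times> ?N" s y])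
    show "y i \<in> carrier S" if "i < n" for i using bL[OF that] by (simp add: y_def carS)
    show "mp_eval_in S e y f = \<zero>\<^bsub>S\<^esub>" if "f \<in> P ` ?S" for f
    proof -
      from that obtain v where v: "v \<in> ?S" "f = P v" by blast
      have "enc 0 = \<zero>\<^bsub>S\<^esub>" unfolding S_def image_ring_zero by (simp add: ops)
      then show ?thesis using ev_y[OF PI(1)[OF v(1)]] PI(2)[OF v(1)] v(2) by simp
    qed
    show "mp_eval_in S e y h \<noteq> \<zero>\<^bsub>S\<^esub>" using ev_y[OF hI(1)] enc_0[OF evL[OF hI(1)]] hI(2) by simp
    show "\<delta>' (y i) j = mp_eval_in S e y (s (j, i))" if ji: "(j, i) \<in> {1..len \<D>} \<times> ?N" for j i
    proof -
      have j: "j \<in> I\<^sub>\<D>" "i < n" using ji by auto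
      show ?thesis
        unfolding ev_y[OF s[OF j]] using j by (simp add: \<delta>'_def y_def de bL \<delta>b bc_map_def Y_def w_def)
    qed
  qed (use finS PI hI s in auto)
  then obtain x where "(\<forall>f\<in>P ` ?S. mp_eval id x f = 0) \<and> mp_eval id x h \<noteq> 0 \<and>
      (\<forall>(j, i)\<in>{1..len \<D>} \<times> ?N. \<Delta> (x i) j = mp_eval id x (s (j, i)))" by (elim exE)
  then have x: "\<And>v. v \<in> ?S \<Longrightarrow> mp_eval id x (P v) = 0" "mp_eval id x h \<noteq> 0"
    "\<And>j i. j \<in> {1..len \<D>} \<Longrightarrow> i < n \<Longrightarrow> \<Delta> (x i) j = mp_eval id x (s (j, i))" by auto
  define a where "a = restrict x ?N"
  have ax: "mp_eval id a f = mp_eval id x f" if "f \<in> mpols ?N" for f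
    by (rule mp_eval_cong[OF type_hom_id(1) that]) (simp add: a_def)
  have aI: "mp_eval id a f = 0" if "f \<in> I" for f
    using ax[of f] tri_pres_zero[OF tri type_hom_id(1) x(2,1) that] irreducible_varietyD(4)[OF I] that by auto
  then have "a \<in> rational_points ?N I" by (auto simp: rational_points_def points_def a_def)
  moreover have "nabla \<D> \<Delta> n a = (\<lambda>v\<in>prol_vars \<D> n. mp_eval id a (s v))"
  proof -
    have "(if j = 0 then a i else \<Delta> (a i) j) = mp_eval id a (s (j, i))" if ji: "j \<in> I\<^sub>\<D>" "i < n" for j i
    proof (cases "j = 0")
      case True
      then show ?thesis using aI[OF s0[OF ji(2)]] by (simp add: mp_eval_ring_simps)
    next
      case False
      then show ?thesis using ax[OF s[OF ji]] x(3)[of j i] ji by (simp add: a_def)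
    qed
    then show ?thesis by (auto simp: nabla_def prol_vars_def restrict_def fun_eq_iff)
  qed
  ultimately have "a \<in> sharp_points \<D> \<Delta> n I s" by (simp add: sharp_points_def)
  then show ?thesis by blast
qed

end

text \<open>The extensions in the fifth statement live on the type \<open>'a + 'l\<close> with
  \<open>'l\<close> arbitrary. Its left summand already has room for all function fields over
  \<open>K\<close>, while the derivation of existential closedness from \<open>UC\<close> works for
  extensions on any type; hence the equivalence for every choice of \<open>'l\<close>.\<close>

theorem theorem4p6:
  fixes \<D> :: "('k::field_char_0, 'd::comm_ring_1) based_algebra"
    and \<iota> :: "'k \<Rightarrow> 'a::field_char_0"
    and \<Delta> :: "'a \<Rightarrow> nat \<Rightarrow> 'a"
  assumes "finite_local_algebra \<D>"
    and "D_field \<D> ring_of_type_algebra \<iota> \<Delta>"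
    and "large_field TYPE('a)"
  shows "(UC \<D> \<iota> \<Delta> \<longleftrightarrow>
           (\<forall>n I s. irreducible_D_variety \<D> \<iota> \<Delta> n I s \<and> has_smooth_rational_point {..<n} I \<longrightarrow>
              zariski_dense_in {..<n} I (point_ideal {..<n} ` sharp_points \<D> \<Delta> n I s))) \<and>
         (UC \<D> \<iota> \<Delta> \<longleftrightarrow>
           (\<forall>n I s. irreducible_D_variety \<D> \<iota> \<Delta> n I s \<and> has_smooth_rational_point {..<n} I \<longrightarrow>
              sharp_points \<D> \<Delta> n I s \<noteq> {})) \<and>
         (UC \<D> \<iota> \<Delta> \<longleftrightarrow>
           (\<forall>n I s. irreducible_D_variety \<D> \<iota> \<Delta> n I s \<and> smooth_variety {..<n} I \<and>
              rational_points {..<n} I \<noteq> {} \<longrightarrow>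
              sharp_points \<D> \<Delta> n I s \<noteq> {})) \<and>
         (UC \<D> \<iota> \<Delta> \<longleftrightarrow>
           (\<forall>(L :: ('a + 'l) ring) \<delta> e.
              D_field_extension \<D> ring_of_type_algebra \<iota> \<Delta> L \<delta> e \<and>
              ex_closed_field ring_of_type_algebra L e \<longrightarrow>
              ex_closed_D_field \<D> ring_of_type_algebra \<iota> \<Delta> L \<delta> e))"
proof -
  interpret D_base \<D> \<iota> \<Delta>
    by unfold_locales (rule assms(1), rule assms(2))
  show ?thesis (is "(?U = ?A) \<and> (?U = ?B) \<and> (?U = ?C) \<and> (?U = ?E)")
  proof -
    have UA: ?A if ?U
      using sharp_points_dense_of_UC[OF that] by (intro allI impI) (elim conjE)
    have AB: ?B if A: ?A
    proof (intro allI impI)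
      fix n I s
      assume V: "irreducible_D_variety \<D> \<iota> \<Delta> n I s \<and> has_smooth_rational_point {..<n} I"
      then have I: "irreducible_variety {..<n} I" by (simp add: irreducible_D_variety_def)
      show "sharp_points \<D> \<Delta> n I s \<noteq> {}"
        by (rule dense_nonempty[OF I A[rule_format, OF V]])
    qed
    have BC: ?C if B: ?B
    proof (intro allI impI)
      fix n I s
      assume V: "irreducible_D_variety \<D> \<iota> \<Delta> n I s \<and> smooth_variety {..<n} I \<and> rational_points {..<n} I \<noteq> {}"
      then obtain x where "x \<in> rational_points {..<n} I" by blast
      moreover have "irreducible_variety {..<n} I" using V by (simp add: irreducible_D_variety_def)
      ultimately have "has_smooth_rational_point {..<n} I"
        using V irreducible_varietyD(4) by (intro smooth_variety_rational_point[of _ _ x]) auto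
      with V show "sharp_points \<D> \<Delta> n I s \<noteq> {}" by (intro B[rule_format]) simp
    qed
    have CU: ?U if C: ?C
      by (rule UC_of_smooth_D_varieties[OF assms(3)]) (rule C[rule_format], simp)
    have UE: ?E if U: ?U
      using ex_closed_of_UC[OF U] by (intro allI impI) (elim conjE)
    have EB: ?B if E: ?E
    proof (intro allI impI)
      fix n I s
      assume V: "irreducible_D_variety \<D> \<iota> \<Delta> n I s \<and> has_smooth_rational_point {..<n} I"
      show "sharp_points \<D> \<Delta> n I s \<noteq> {}"
        by (rule sharp_point_of_ex_closed[OF assms(3) E[rule_format, OF conjI]]) (use V in simp_all)
    qed
    \<comment> \<open>\<open>UA\<close>, \<open>AB\<close>, \<open>BC\<close> and \<open>CU\<close>
      form a cycle, and the last statement is attached to it by \<open>UE\<close> and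
      \<open>EB\<close>.\<close>
    show ?thesis using UA AB BC CU UE EB by argo
  qed
qed

end
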